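(* Let $\mathscr{A}$ be a Curtis–Tits amalgam with property (D) of type $\Gamma_\omega(\mathsf{k})$. Then $\mathscr{A}$ has a non-trivial universal completion if and only if $\sim_{\mathscr{A}}$ refines $\sim_0$.
   Context: Let $\mathsf{k}$ be a field with at least $4$ elements and $\Gamma=(I,E)$ a connected simply-laced diagram without triangles, i.e. a finite connected simple graph with $I\subset\mathbb{N}$, $n=|I|\ge 3$, and no circuits of length $3$. Curtis–Tits amalgams. A Curtis–Tits amalgam with diagram $\Gamma$ over $\mathsf{k}$ is a collection $\mathscr{A}=\{\mathbf{A}_i,\mathbf{A}_{i,j},\mathbf{a}_{i,j}\mid i\ne j\in I\}$ of groups (with $\mathbf{A}_{i,j}=\mathbf{A}_{j,i}$) and injective homomorphisms $\mathbf{a}_{i,j}\colon\mathbf{A}_i\to\mathbf{A}_{i,j}$ such that: (1) $\mathbf{A}_i=\mathrm{SL}_2(\mathsf{k})$; (2) if $\{i,j\}\in E$, then $\mathbf{A}_{i,j}\cong\mathrm{SL}_3(\mathsf{k})=\mathrm{SL}(V)$ and the images $S_1,S_2$ of $\mathbf{A}_i,\mathbf{A}_j$ form a standard pair: there are decompositions $V=U_m\oplus V_m$ ($m=1,2$), $\dim U_m=1$, $\dim V_m=2$, such that $S_m$ centralizes $U_m$ and preserves $V_m$, acting on it as $\mathrm{SL}(V_m)$, and $U_1\subset V_2$, $U_2\subset V_1$; (3) if $\{i,j\}\notin E$, then $\mathbf{A}_{i,j}=\mathbf{A}_i\circ\mathbf{A}_j$ is $\mathbf{A}_i\times\mathbf{A}_j$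 or $(\mathbf{A}_i\times\mathbf{A}_j)/\langle(z,z)\rangle$, where $\langle z\rangle=Z(\mathrm{SL}_2(\mathsf{k}))$, with natural maps $\mathbf{a}_{i,j}$. Property (D): writing $\mathbf{D}_i^j=N_{\mathbf{A}_{i,j}}(\mathbf{a}_{j,i}(\mathbf{A}_j))\cap\mathbf{a}_{i,j}(\mathbf{A}_i)$ for $\{i,j\}\in E$, there are subgroups $\mathbf{D}_i\le\mathbf{A}_i$ with $\mathbf{a}_{i,j}(\mathbf{D}_i)=\mathbf{D}_i^j$ for all edges $\{i,j\}$. A completion of $\mathscr{A}$ is a group $A$ with homomorphisms $\alpha_i\colon\mathbf{A}_i\to A$, $\alpha_{i,j}\colon\mathbf{A}_{i,j}\to A$ whose images generate $A$ and with $\alpha_{i,j}\circ\mathbf{a}_{i,j}=\alpha_i$; it is universal if every completion factors uniquely through it; it is non-trivial if $A\neq 1$. A homomorphism of amalgams is a family of group homomorphisms compatible with the connecting maps. Type $\Gamma_\omega(\mathsf{k})$. Fix $0\in I$ and a spanning tree $T$ of $\Gamma$ rooted at $0$ such that in each edge of $T$ the vertex nearest to $0$ has the smaller label. The group $\mathrm{Aut}(\mathsf{k})\times\langle\tau\rangle$ ($\tau$ of order $2$) acts on $\mathrm{SL}_2(\mathsf{k})$: $\mathrm{Aut}(\mathsf{k})$ entrywise and $\tau$ by transpose-inverse. Let $\omega\colon\pi_1(\Gamma,0)\to\langle\tau\rangle\times\mathrm{Aut}(\mathsf{k})$ be a homomorphism; equivalently a set map $\omega\colon E\setminus E(T)\to\langle\tau\rangle\times\mathrm{Aut}(\mathsf{k})$,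 where $e=\{i,j\}$, $i<j$, is sent to the value on the unique minimal loop of $T\cup\{e\}$, traversing $e$ from $i$ to $j$. The standard amalgam $\mathscr{G}_\omega(\mathsf{k})=\{\mathbf{G}_i,\mathbf{G}_{i,j},\mathbf{g}_{i,j}\}$ has $\mathbf{G}_i=\mathrm{SL}_2(\mathsf{k})$; $\mathbf{G}_{i,j}=\mathrm{SL}_3(\mathsf{k})$ if $\{i,j\}\in E$, and $\mathbf{G}_i\times\mathbf{G}_j$ with natural inclusions otherwise; for $\{i,j\}\in E$, $i<j$: $\mathbf{g}_{i,j}(A)=\begin{pmatrix}A&0\\0&1\end{pmatrix}$, $\mathbf{g}_{j,i}(A)=\begin{pmatrix}1&0\\0&A^{\omega_{j,i}}\end{pmatrix}$, where $\omega_{j,i}=\omega(\{i,j\})$ if $\{i,j\}\in E\setminus E(T)$ and $\omega_{j,i}=1$ if $\{i,j\}\in E(T)$. A Curtis–Tits amalgam is of type $\Gamma_\omega(\mathsf{k})$ if it is a (surjective) homomorphic image of $\mathscr{G}_\omega(\mathsf{k})$. Relations. For distinct $i,j\in I$: $i\sim_0 j$ iff $i,j$ are not adjacent but have a common neighbor in $\Gamma$, and the set of neighbors of $i$ equals the set of neighbors of $j$; this gives an equivalence relation $\sim_0$. $\sim_{\mathscr{A}}$ is the equivalence relation on $I$ generated by the pairs of distinct $(i,j)$ such that $\mathbf{A}_{i,j}\cong(\mathrm{SL}_2(\mathsf{k})\times\mathrm{SL}_2(\mathsf{k}))/\langle(z,z)\rangle$ with $z\neq1$ (so if $\mathrm{char}\,\mathsf{k}=2$,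 it is equality). A relation $\sim$ refines $\sim'$ if $i\sim j$ implies $i\sim' j$. *)

theory Defs
  imports
    "HOL-Analysis.Determinants"
    "HOL-Algebra.Weak_Morphisms"
    "HOL-Algebra.Group_Action"
    "HOL-Algebra.Elementary_Groups"
begin

definition finite_simple_graph :: "nat set \<Rightarrow> nat set set \<Rightarrow> bool" where
  "finite_simple_graph I E \<longleftrightarrow> finite I \<and> (\<forall>e\<in>E. \<exists>i\<in>I. \<exists>j\<in>I. i \<noteq> j \<and> e = {i, j})"

definition adj :: "nat set set \<Rightarrow> (nat \<times> nat) set" where
  "adj E = {(i, j). {i, j} \<in> E}"

definition connected_graph :: "nat set \<Rightarrow> nat set set \<Rightarrow> bool" where
  "connected_graph I E \<longleftrightarrow> (\<forall>i\<in>I. \<forall>j\<in>I. (i, j) \<in> (adj E)\<^sup>*)"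

definition is_circuit :: "nat set set \<Rightarrow> nat list \<Rightarrow> bool" where
  "is_circuit E vs \<longleftrightarrow> 3 \<le> length vs \<and> distinct vs \<and>
     (\<forall>k<length vs. {vs ! k, vs ! (Suc k mod length vs)} \<in> E)"

definition triangle_free :: "nat set set \<Rightarrow> bool" where
  "triangle_free E \<longleftrightarrow> \<not> (\<exists>vs. is_circuit E vs \<and> length vs = 3)"

definition spanning_tree :: "nat set \<Rightarrow> nat set set \<Rightarrow> nat set set \<Rightarrow> bool" where
  "spanning_tree I E T \<longleftrightarrow> T \<subseteq> E \<and> connected_graph I T \<and> \<not> (\<exists>vs. is_circuit T vs)"

definition graph_dist :: "nat set set \<Rightarrow> nat \<Rightarrow> nat \<Rightarrow> nat" where
  "graph_dist T i j = (LEAST n. (i, j) \<in> adj T ^^ n)"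

definition labels_increase_from :: "nat \<Rightarrow> nat set set \<Rightarrow> bool" where
  "labels_increase_from r T \<longleftrightarrow>
     (\<forall>i j. {i, j} \<in> T \<and> graph_dist T r i < graph_dist T r j \<longrightarrow> i < j)"

definition neighbors :: "nat set set \<Rightarrow> nat \<Rightarrow> nat set" where
  "neighbors E i = {j. {i, j} \<in> E}"

definition SL :: "('k::field^'n^'n) monoid" where
  "SL = \<lparr>carrier = {A. det A = 1}, mult = (**), one = mat 1\<rparr>"

abbreviation SL2 :: "('k::field^2^2) monoid" where "SL2 \<equiv> SL"
abbreviation SL3 :: "('k::field^3^3) monoid" where "SL3 \<equiv> SL"

lemma SL_group: "group (SL :: ('k::field^'n^'n) monoid)"
proof (rule groupI)
  fix A :: "'k^'n^'n" assume "A \<in> carrier SL"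
  then have A: "det A = 1" by (simp add: SL_def)
  then obtain B where B: "B ** A = mat 1"
    by (metis invertible_det_nz invertible_def zero_neq_one)
  then have "det B = 1" using A by (metis det_I det_mul mult.right_neutral)
  with B show "\<exists>B\<in>carrier SL. B \<otimes>\<^bsub>SL\<^esub> A = \<one>\<^bsub>SL\<^esub>" by (auto simp: SL_def)
qed (auto simp: SL_def det_mul matrix_mul_assoc)

text \<open>For a two-dimensional subspace \<open>W\<close>: the determinant-one automorphisms of \<open>W\<close>, with the
  determinant read off in coordinates \<open>\<theta>\<close>; the choice of \<open>\<theta>\<close> is immaterial. Maps on \<open>W\<close> are
  represented by their extensional restrictions.\<close>

definition SL_on :: "('k::field^3) set \<Rightarrow> ('k^3 \<Rightarrow> 'k^3) set" where
  "SL_on W = {restrict (\<lambda>v. \<theta> (A *v inv_into UNIV \<theta> v)) W | (\<theta> :: 'k^2 \<Rightarrow> 'k^3) A.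
     Vector_Spaces.linear (*s) (*s) \<theta> \<and> inj \<theta> \<and> range \<theta> = W \<and> det A = 1}"

definition acts_as_SL2_on :: "('k::field^3^3) set \<Rightarrow> ('k^3) set \<Rightarrow> ('k^3) set \<Rightarrow> bool" where
  "acts_as_SL2_on S U W \<longleftrightarrow>
     vec.subspace U \<and> vec.subspace W \<and> vec.dim U = 1 \<and> vec.dim W = 2 \<and>
     U \<inter> W = {0} \<and> {u + w | u w. u \<in> U \<and> w \<in> W} = UNIV \<and>
     (\<forall>s\<in>S. \<forall>u\<in>U. s *v u = u) \<and>
     (\<forall>s\<in>S. \<forall>w\<in>W. s *v w \<in> W) \<and>
     (\<lambda>s. restrict ((*v) s) W) ` S = SL_on W"

definition standard_pair :: "('k::field^3^3) set \<Rightarrow> ('k^3^3) set \<Rightarrow> bool" where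
  "standard_pair S1 S2 \<longleftrightarrow>
     (\<exists>U1 W1 U2 W2. acts_as_SL2_on S1 U1 W1 \<and> acts_as_SL2_on S2 U2 W2 \<and> U1 \<subseteq> W2 \<and> U2 \<subseteq> W1)"

text \<open>The generator \<open>z\<close> of the centre of \<open>SL\<^sub>2\<close>; it is \<open>1\<close> in characteristic 2.\<close>

definition sl2_z :: "'k::field^2^2" where
  "sl2_z = mat (- 1)"

lemma generate_sl2_z:
  "generate SL2 {sl2_z :: 'k::field^2^2} =
     {z \<in> carrier SL2. \<forall>x\<in>carrier SL2. z \<otimes>\<^bsub>SL2\<^esub> x = x \<otimes>\<^bsub>SL2\<^esub> z}"
proof -
  interpret group "SL2 :: ('k^2^2) monoid" by (rule SL_group)
  let ?Z = "{z \<in> carrier (SL2 :: ('k^2^2) monoid). \<forall>x\<in>carrier SL2. z \<otimes>\<^bsub>SL2\<^esub> x = x \<otimes>\<^bsub>SL2\<^esub> z}"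
  have z: "sl2_z \<in> carrier (SL2 :: ('k^2^2) monoid)"
    by (simp add: SL_def sl2_z_def det_2 mat_def)
  have zz: "(sl2_z :: 'k^2^2) ** sl2_z = mat 1"
    by (simp add: sl2_z_def mat_def matrix_matrix_mult_def vec_eq_iff forall_2 sum_2)
  then have zinv: "inv\<^bsub>SL2\<^esub> sl2_z = (sl2_z :: 'k^2^2)"
    using z by (intro inv_equality) (auto simp: SL_def)
  have zcomm: "(sl2_z :: 'k^2^2) ** x = x ** sl2_z" for x
    by (simp add: sl2_z_def mat_def matrix_matrix_mult_def vec_eq_iff forall_2 sum_2)
  have gen: "x \<in> generate SL2 {sl2_z} \<Longrightarrow> x = mat 1 \<or> x = (sl2_z :: 'k^2^2)" for x
  proof (induction rule: generate.induct)
    case (inv h) then show ?case using zinv by auto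
  qed (auto simp: SL_def zz)
  show ?thesis
  proof
    show "generate SL2 {sl2_z} \<subseteq> ?Z"
      using gen z zcomm by (fastforce simp: SL_def)
    show "?Z \<subseteq> generate SL2 {sl2_z}"
    proof
      fix c assume "c \<in> ?Z"
      then have dc: "det c = 1" and comm: "\<And>x. det x = 1 \<Longrightarrow> c ** x = x ** c"
        by (auto simp: SL_def)
      let ?u = "vector [vector [1, 1], vector [0, 1]] :: 'k^2^2"
      let ?l = "vector [vector [1, 0], vector [1, 1]] :: 'k^2^2"
      have "c ** ?u = ?u ** c" "c ** ?l = ?l ** c"
        by (auto intro!: comm simp: det_2)
      then have *: "c$1$2 = 0" "c$2$1 = 0" "c$1$1 = c$2$2"
        by (auto simp: matrix_matrix_mult_def vec_eq_iff forall_2 sum_2)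
      then have "c$1$1 * c$1$1 = 1" using dc by (simp add: det_2)
      then have "c$1$1 = 1 \<or> c$1$1 = -1" by (simp add: square_eq_1_iff)
      then have "c = mat 1 \<or> c = sl2_z"
        using * by (auto simp: sl2_z_def mat_def vec_eq_iff forall_2)
      then show "c \<in> generate SL2 {sl2_z}"
        using generate.one[of SL2 "{sl2_z}"] generate.incl[of sl2_z "{sl2_z}" SL2] by (auto simp: SL_def)
    qed
  qed
qed

definition diag_centre :: "(('k::field^2^2) \<times> ('k^2^2)) set" where
  "diag_centre = generate (SL2 \<times>\<times> SL2) {(sl2_z, sl2_z)}"

text \<open>The connecting map \<open>conn A i j\<close> goes from \<open>vgrp A i\<close> to \<open>egrp A i j\<close>; the values of \<open>egrp\<close> and
  \<open>conn\<close> are irrelevant unless \<open>i\<close> and \<open>j\<close> are distinct elements of the index set.\<close>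

record ('a, 'b) amalgam =
  vgrp :: "nat \<Rightarrow> 'a monoid"
  egrp :: "nat \<Rightarrow> nat \<Rightarrow> 'b monoid"
  conn :: "nat \<Rightarrow> nat \<Rightarrow> 'a \<Rightarrow> 'b"

definition is_amalgam :: "nat set \<Rightarrow> ('a, 'b) amalgam \<Rightarrow> bool" where
  "is_amalgam I A \<longleftrightarrow>
     (\<forall>i\<in>I. group (vgrp A i)) \<and>
     (\<forall>i\<in>I. \<forall>j\<in>I. i \<noteq> j \<longrightarrow>
        group (egrp A i j) \<and> egrp A i j = egrp A j i \<and>
        conn A i j \<in> hom (vgrp A i) (egrp A i j) \<and>
        inj_on (conn A i j) (carrier (vgrp A i)))"

definition amalgam_hom ::
  "nat set \<Rightarrow> ('a, 'b) amalgam \<Rightarrow> ('c, 'd) amalgam \<Rightarrow>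
     (nat \<Rightarrow> 'a \<Rightarrow> 'c) \<Rightarrow> (nat \<Rightarrow> nat \<Rightarrow> 'b \<Rightarrow> 'd) \<Rightarrow> bool" where
  "amalgam_hom I A B \<phi> \<psi> \<longleftrightarrow>
     (\<forall>i\<in>I. \<phi> i \<in> hom (vgrp A i) (vgrp B i)) \<and>
     (\<forall>i\<in>I. \<forall>j\<in>I. i \<noteq> j \<longrightarrow>
        \<psi> i j \<in> hom (egrp A i j) (egrp B i j) \<and>
        (\<forall>x\<in>carrier (egrp A i j). \<psi> i j x = \<psi> j i x) \<and>
        (\<forall>x\<in>carrier (vgrp A i). \<psi> i j (conn A i j x) = conn B i j (\<phi> i x)))"

definition amalgam_epi ::
  "nat set \<Rightarrow> ('a, 'b) amalgam \<Rightarrow> ('c, 'd) amalgam \<Rightarrow>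
     (nat \<Rightarrow> 'a \<Rightarrow> 'c) \<Rightarrow> (nat \<Rightarrow> nat \<Rightarrow> 'b \<Rightarrow> 'd) \<Rightarrow> bool" where
  "amalgam_epi I A B \<phi> \<psi> \<longleftrightarrow> amalgam_hom I A B \<phi> \<psi> \<and>
     (\<forall>i\<in>I. \<phi> i ` carrier (vgrp A i) = carrier (vgrp B i)) \<and>
     (\<forall>i\<in>I. \<forall>j\<in>I. i \<noteq> j \<longrightarrow> \<psi> i j ` carrier (egrp A i j) = carrier (egrp B i j))"

definition is_completion ::
  "nat set \<Rightarrow> ('a, 'b) amalgam \<Rightarrow> 'c monoid \<Rightarrow>
     (nat \<Rightarrow> 'a \<Rightarrow> 'c) \<Rightarrow> (nat \<Rightarrow> nat \<Rightarrow> 'b \<Rightarrow> 'c) \<Rightarrow> bool" where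
  "is_completion I A C \<alpha> \<beta> \<longleftrightarrow>
     group C \<and>
     (\<forall>i\<in>I. \<alpha> i \<in> hom (vgrp A i) C) \<and>
     (\<forall>i\<in>I. \<forall>j\<in>I. i \<noteq> j \<longrightarrow>
        \<beta> i j \<in> hom (egrp A i j) C \<and>
        (\<forall>x\<in>carrier (egrp A i j). \<beta> i j x = \<beta> j i x) \<and>
        (\<forall>x\<in>carrier (vgrp A i). \<beta> i j (conn A i j x) = \<alpha> i x)) \<and>
     generate C ((\<Union>i\<in>I. \<alpha> i ` carrier (vgrp A i)) \<union>
                 (\<Union>i\<in>I. \<Union>j\<in>I - {i}. \<beta> i j ` carrier (egrp A i j))) = carrier C"

text \<open>Homomorphisms are compared only on the carrier, hence the extensionality requirement.\<close>

definition completion_hom ::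
  "nat set \<Rightarrow> ('a, 'b) amalgam \<Rightarrow>
     'c monoid \<Rightarrow> (nat \<Rightarrow> 'a \<Rightarrow> 'c) \<Rightarrow> (nat \<Rightarrow> nat \<Rightarrow> 'b \<Rightarrow> 'c) \<Rightarrow>
     'd monoid \<Rightarrow> (nat \<Rightarrow> 'a \<Rightarrow> 'd) \<Rightarrow> (nat \<Rightarrow> nat \<Rightarrow> 'b \<Rightarrow> 'd) \<Rightarrow> ('c \<Rightarrow> 'd) \<Rightarrow> bool" where
  "completion_hom I A C \<alpha> \<beta> D \<gamma> \<delta> h \<longleftrightarrow>
     h \<in> hom C D \<and> h \<in> extensional (carrier C) \<and>
     (\<forall>i\<in>I. \<forall>x\<in>carrier (vgrp A i). h (\<alpha> i x) = \<gamma> i x) \<and>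
     (\<forall>i\<in>I. \<forall>j\<in>I. i \<noteq> j \<longrightarrow> (\<forall>x\<in>carrier (egrp A i j). h (\<beta> i j x) = \<delta> i j x))"

text \<open>A formula cannot quantify over completions of all types. As a completion is generated by the
  images of the groups of the amalgam, it is isomorphic to one whose elements are sets of words in
  the elements of these groups, so it suffices to test universality against completions on
  this type; see \<open>universal_completion_factors\<close> below.\<close>

type_synonym ('a, 'b) amalgam_word = "(nat \<times> 'a + (nat \<times> nat) \<times> 'b) list"

definition is_universal_completion ::
  "nat set \<Rightarrow> ('a, 'b) amalgam \<Rightarrow> 'c monoid \<Rightarrow>
     (nat \<Rightarrow> 'a \<Rightarrow> 'c) \<Rightarrow> (nat \<Rightarrow> nat \<Rightarrow> 'b \<Rightarrow> 'c) \<Rightarrow> bool" where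
  "is_universal_completion I A C \<alpha> \<beta> \<longleftrightarrow>
     is_completion I A C \<alpha> \<beta> \<and>
     (\<forall>(D :: ('a, 'b) amalgam_word set monoid) \<gamma> \<delta>.
        is_completion I A D \<gamma> \<delta> \<longrightarrow> (\<exists>!h. completion_hom I A C \<alpha> \<beta> D \<gamma> \<delta> h))"

definition CT_amalgam :: "nat set \<Rightarrow> nat set set \<Rightarrow> ('k::field^2^2, 'g) amalgam \<Rightarrow> bool" where
  "CT_amalgam I E A \<longleftrightarrow>
     is_amalgam I A \<and>
     (\<forall>i\<in>I. vgrp A i = SL2) \<and>
     (\<forall>i\<in>I. \<forall>j\<in>I. i \<noteq> j \<and> {i, j} \<in> E \<longrightarrow>
        (\<exists>\<phi> \<in> iso (egrp A i j) (SL3 :: ('k^3^3) monoid).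
           standard_pair (\<phi> ` conn A i j ` carrier (vgrp A i)) (\<phi> ` conn A j i ` carrier (vgrp A j)))) \<and>
     (\<forall>i\<in>I. \<forall>j\<in>I. i \<noteq> j \<and> {i, j} \<notin> E \<longrightarrow>
        (\<exists>N \<in> {{(mat 1, mat 1)}, diag_centre}.
           \<exists>\<phi> \<in> iso ((SL2 \<times>\<times> SL2) Mod N) (egrp A i j).
             \<forall>x\<in>carrier SL2.
               \<phi> (N #>\<^bsub>SL2 \<times>\<times> SL2\<^esub> (x, mat 1)) = conn A i j x \<and>
               \<phi> (N #>\<^bsub>SL2 \<times>\<times> SL2\<^esub> (mat 1, x)) = conn A j i x))"

definition D_edge :: "('a, 'b) amalgam \<Rightarrow> nat \<Rightarrow> nat \<Rightarrow> 'b set" where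
  "D_edge A i j =
     normalizer (egrp A i j) (conn A j i ` carrier (vgrp A j)) \<inter> conn A i j ` carrier (vgrp A i)"

definition property_D :: "nat set \<Rightarrow> nat set set \<Rightarrow> ('a, 'b) amalgam \<Rightarrow> bool" where
  "property_D I E A \<longleftrightarrow>
     (\<exists>D. (\<forall>i\<in>I. subgroup (D i) (vgrp A i)) \<and>
          (\<forall>i\<in>I. \<forall>j\<in>I. i \<noteq> j \<and> {i, j} \<in> E \<longrightarrow> conn A i j ` D i = D_edge A i j))"

definition field_aut :: "('k::field \<Rightarrow> 'k) \<Rightarrow> bool" where
  "field_aut \<sigma> \<longleftrightarrow> bij \<sigma> \<and> \<sigma> 1 = 1 \<and>
     (\<forall>x y. \<sigma> (x + y) = \<sigma> x + \<sigma> y) \<and> (\<forall>x y. \<sigma> (x * y) = \<sigma> x * \<sigma> y)"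

text \<open>An element \<open>(t, \<sigma>)\<close> of \<open>\<langle>\<tau>\<rangle> \<times> Aut(k)\<close> stands for \<open>\<tau>\<sigma>\<close> if \<open>t\<close> is true and for \<open>\<sigma>\<close> otherwise.
  The two factors commute in their action on matrices.\<close>

type_synonym 'k twist = "bool \<times> ('k \<Rightarrow> 'k)"

definition twist_set :: "'k::field twist set" where
  "twist_set = UNIV \<times> {\<sigma>. field_aut \<sigma>}"

definition twist_act :: "'k::field twist \<Rightarrow> 'k^2^2 \<Rightarrow> 'k^2^2" where
  "twist_act w A = (let B = map_matrix (snd w) A in if fst w then transpose (matrix_inv B) else B)"

definition block_upper :: "'k::field^2^2 \<Rightarrow> 'k^3^3" where
  "block_upper A = vector [vector [A$1$1, A$1$2, 0],
                           vector [A$2$1, A$2$2, 0],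
                           vector [0, 0, 1]]"

definition block_lower :: "'k::field^2^2 \<Rightarrow> 'k^3^3" where
  "block_lower A = vector [vector [1, 0, 0],
                           vector [0, A$1$1, A$1$2],
                           vector [0, A$2$1, A$2$2]]"

text \<open>The twist is given by the values \<open>\<omega> e\<close> for \<open>e \<in> E - T\<close>, the fundamental group of the
  diagram being free on the corresponding loops. The two kinds of groups \<open>G\<^sub>i\<^sub>j\<close> are
  placed in one type by means of a disjoint sum.\<close>

definition standard_amalgam ::
  "nat set set \<Rightarrow> nat set set \<Rightarrow> (nat set \<Rightarrow> 'k::field twist) \<Rightarrow>
     ('k^2^2, ('k^3^3) + (('k^2^2) \<times> ('k^2^2))) amalgam" where
  "standard_amalgam E T \<omega> =
     \<lparr>vgrp = (\<lambda>i. SL2),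
      egrp = (\<lambda>i j. if {i, j} \<in> E then image_group Inl SL3 else image_group Inr (SL2 \<times>\<times> SL2)),
      conn = (\<lambda>i j A.
        if {i, j} \<in> E then
          Inl (if i < j then block_upper A
               else block_lower (if {i, j} \<in> T then A else twist_act (\<omega> {i, j}) A))
        else
          Inr (if i < j then (A, mat 1) else (mat 1, A)))\<rparr>"

definition of_type ::
  "nat set \<Rightarrow> nat set set \<Rightarrow> nat set set \<Rightarrow> (nat set \<Rightarrow> 'k::field twist) \<Rightarrow>
     ('k^2^2, 'g) amalgam \<Rightarrow> bool" where
  "of_type I E T \<omega> A \<longleftrightarrow> (\<exists>\<phi> \<psi>. amalgam_epi I (standard_amalgam E T \<omega>) A \<phi> \<psi>)"

definition sim0 :: "nat set \<Rightarrow> nat set set \<Rightarrow> (nat \<times> nat) set" where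
  "sim0 I E = {(i, j). i \<in> I \<and> j \<in> I \<and>
     (i = j \<or> {i, j} \<notin> E \<and> neighbors E i \<inter> neighbors E j \<noteq> {} \<and> neighbors E i = neighbors E j)}"

definition sim_amalgam :: "nat set \<Rightarrow> ('k::field^2^2, 'g) amalgam \<Rightarrow> (nat \<times> nat) set" where
  "sim_amalgam I A = {(i, j). i \<in> I \<and> j \<in> I \<and>
     equivclp (\<lambda>i j. i \<in> I \<and> j \<in> I \<and> i \<noteq> j \<and> (sl2_z :: 'k^2^2) \<noteq> mat 1 \<and>
       egrp A i j \<cong> (SL2 \<times>\<times> SL2 :: (('k^2^2) \<times> ('k^2^2)) monoid) Mod diag_centre) i j}"

definition rel_refines :: "(nat \<times> nat) set \<Rightarrow> (nat \<times> nat) set \<Rightarrow> bool" where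
  "rel_refines R S \<longleftrightarrow> (\<forall>i j. (i, j) \<in> R \<longrightarrow> (i, j) \<in> S)"

fun eval_word ::
  "'c monoid \<Rightarrow> (nat \<Rightarrow> 'a \<Rightarrow> 'c) \<Rightarrow> (nat \<Rightarrow> nat \<Rightarrow> 'b \<Rightarrow> 'c) \<Rightarrow> ('a, 'b) amalgam_word \<Rightarrow> 'c" where
  "eval_word C \<alpha> \<beta> [] = \<one>\<^bsub>C\<^esub>"
| "eval_word C \<alpha> \<beta> (Inl (i, x) # w) = \<alpha> i x \<otimes>\<^bsub>C\<^esub> eval_word C \<alpha> \<beta> w"
| "eval_word C \<alpha> \<beta> (Inr ((i, j), x) # w) = \<beta> i j x \<otimes>\<^bsub>C\<^esub> eval_word C \<alpha> \<beta> w"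

definition letters :: "nat set \<Rightarrow> ('a, 'b) amalgam \<Rightarrow> (nat \<times> 'a + (nat \<times> nat) \<times> 'b) set" where
  "letters I A = {Inl (i, x) | i x. i \<in> I \<and> x \<in> carrier (vgrp A i)} \<union>
                 {Inr ((i, j), x) | i j x. i \<in> I \<and> j \<in> I \<and> i \<noteq> j \<and> x \<in> carrier (egrp A i j)}"

lemma completion_closed:
  assumes "is_completion I A C \<alpha> \<beta>"
  shows "i \<in> I \<Longrightarrow> x \<in> carrier (vgrp A i) \<Longrightarrow> \<alpha> i x \<in> carrier C"
    and "i \<in> I \<Longrightarrow> j \<in> I \<Longrightarrow> i \<noteq> j \<Longrightarrow> y \<in> carrier (egrp A i j) \<Longrightarrow> \<beta> i j y \<in> carrier C"
proof -
  show "\<alpha> i x \<in> carrier C" if "i \<in> I" "x \<in> carrier (vgrp A i)"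
  proof (rule hom_in_carrier[OF _ that(2)])
    show "\<alpha> i \<in> hom (vgrp A i) C" using assms that by (simp add: is_completion_def)
  qed
  show "\<beta> i j y \<in> carrier C" if "i \<in> I" "j \<in> I" "i \<noteq> j" "y \<in> carrier (egrp A i j)"
  proof (rule hom_in_carrier[OF _ that(4)])
    show "\<beta> i j \<in> hom (egrp A i j) C" using assms that by (simp add: is_completion_def)
  qed
qed

lemma eval_letter:
  assumes "is_completion I A C \<alpha> \<beta>" "l \<in> letters I A"
  shows "eval_word C \<alpha> \<beta> [l] \<in> carrier C"
    "eval_word C \<alpha> \<beta> (l # w) = eval_word C \<alpha> \<beta> [l] \<otimes>\<^bsub>C\<^esub> eval_word C \<alpha> \<beta> w"
proof -
  interpret group C using assms(1) by (simp add: is_completion_def)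
  note a = completion_closed(1)[OF assms(1)] and b = completion_closed(2)[OF assms(1)]
  show "eval_word C \<alpha> \<beta> [l] \<in> carrier C"
    "eval_word C \<alpha> \<beta> (l # w) = eval_word C \<alpha> \<beta> [l] \<otimes>\<^bsub>C\<^esub> eval_word C \<alpha> \<beta> w"
    using assms(2) a b by (auto simp: letters_def)
qed

lemma eval_word_closed:
  assumes "is_completion I A C \<alpha> \<beta>" "set w \<subseteq> letters I A"
  shows "eval_word C \<alpha> \<beta> w \<in> carrier C"
proof -
  interpret group C using assms(1) by (simp add: is_completion_def)
  show ?thesis using assms(2)
  proof (induction w)
    case (Cons l w)
    then have l: "l \<in> letters I A" and w: "eval_word C \<alpha> \<beta> w \<in> carrier C" by auto
    show ?case
      unfolding eval_letter(2)[OF assms(1) l, of w] using eval_letter(1)[OF assms(1) l] w by (rule m_closed)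
  qed simp
qed

lemma eval_word_append:
  assumes "is_completion I A C \<alpha> \<beta>" "set v \<subseteq> letters I A" "set w \<subseteq> letters I A"
  shows "eval_word C \<alpha> \<beta> (v @ w) = eval_word C \<alpha> \<beta> v \<otimes>\<^bsub>C\<^esub> eval_word C \<alpha> \<beta> w"
proof -
  interpret group C using assms(1) by (simp add: is_completion_def)
  show ?thesis using assms(2)
  proof (induction v)
    case Nil
    then show ?case using eval_word_closed[OF assms(1,3)] by simp
  next
    case (Cons l v)
    then have l: "l \<in> letters I A" and v: "set v \<subseteq> letters I A" by auto
    show ?case
      unfolding append_Cons eval_letter(2)[OF assms(1) l, of "v @ w"]
        eval_letter(2)[OF assms(1) l, of v] Cons.IH[OF v]
      using eval_letter(1)[OF assms(1) l] eval_word_closed[OF assms(1) v]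
        eval_word_closed[OF assms(1,3)]
      by (simp only: m_assoc)
  qed
qed

lemma completion_words:
  assumes "is_amalgam I A" "is_completion I A C \<alpha> \<beta>" "c \<in> carrier C"
  shows "\<exists>w. set w \<subseteq> letters I A \<and> eval_word C \<alpha> \<beta> w = c"
proof -
  interpret group C using assms(2) by (simp add: is_completion_def)
  let ?G = "(\<Union>i\<in>I. \<alpha> i ` carrier (vgrp A i)) \<union> (\<Union>i\<in>I. \<Union>j\<in>I - {i}. \<beta> i j ` carrier (egrp A i j))"
  have Gcases: "(\<exists>i\<in>I. \<exists>x\<in>carrier (vgrp A i). h = \<alpha> i x) \<or>
      (\<exists>i\<in>I. \<exists>j\<in>I. i \<noteq> j \<and> (\<exists>x\<in>carrier (egrp A i j). h = \<beta> i j x))" if "h \<in> ?G" for h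
    using that
  proof (elim UnE UN_E imageE DiffE)
    fix i x assume "i \<in> I" "x \<in> carrier (vgrp A i)" "h = \<alpha> i x"
    then show ?thesis by (intro disjI1 bexI[of _ i] bexI[of _ x])
  next
    fix i j x assume "i \<in> I" "j \<in> I" "j \<notin> {i}" "x \<in> carrier (egrp A i j)" "h = \<beta> i j x"
    then show ?thesis by (intro disjI2 bexI[of _ i] bexI[of _ j] bexI[of _ x] conjI) simp_all
  qed
  have gl: "\<exists>l\<in>letters I A. eval_word C \<alpha> \<beta> [l] = h" if "h \<in> ?G" for h
    using Gcases[OF that]
  proof (elim disjE bexE conjE)
    fix i x assume i: "i \<in> I" "x \<in> carrier (vgrp A i)" and h: "h = \<alpha> i x"
    have "\<alpha> i \<in> hom (vgrp A i) C" using assms(2) i(1) by (simp add: is_completion_def)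
    then have "h \<in> carrier C" unfolding h using i(2) by (rule hom_in_carrier)
    moreover have "Inl (i, x) \<in> letters I A" using i by (simp add: letters_def)
    ultimately show ?thesis using h by (intro bexI[of _ "Inl (i, x)"]) simp_all
  next
    fix i j x assume i: "i \<in> I" "j \<in> I" "i \<noteq> j" and x: "x \<in> carrier (egrp A i j)"
      and h: "h = \<beta> i j x"
    have "\<beta> i j \<in> hom (egrp A i j) C" using assms(2) i by (simp add: is_completion_def)
    then have "h \<in> carrier C" unfolding h using x by (rule hom_in_carrier)
    moreover have "Inr ((i, j), x) \<in> letters I A" using i x by (simp add: letters_def)
    ultimately show ?thesis using h by (intro bexI[of _ "Inr ((i, j), x)"]) simp_all
  qed
  have inv_G: "inv\<^bsub>C\<^esub> h \<in> ?G" if "h \<in> ?G" for h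
    using Gcases[OF that]
  proof (elim disjE bexE conjE)
    fix i x assume i: "i \<in> I" "x \<in> carrier (vgrp A i)" and h: "h = \<alpha> i x"
    have "group (vgrp A i)" "\<alpha> i \<in> hom (vgrp A i) C"
      using assms i(1) by (simp_all add: is_amalgam_def is_completion_def)
    then interpret g: group_hom "vgrp A i" C "\<alpha> i"
      by (simp add: group_hom_def group_hom_axioms_def is_group)
    have "inv\<^bsub>C\<^esub> h = \<alpha> i (inv\<^bsub>vgrp A i\<^esub> x)" using i h by simp
    moreover have "inv\<^bsub>vgrp A i\<^esub> x \<in> carrier (vgrp A i)" using i by simp
    ultimately show ?thesis using i by blast
  next
    fix i j x assume i: "i \<in> I" "j \<in> I" "i \<noteq> j" and x: "x \<in> carrier (egrp A i j)"
      and h: "h = \<beta> i j x"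
    have "group (egrp A i j)" "\<beta> i j \<in> hom (egrp A i j) C"
      using assms i by (simp_all add: is_amalgam_def is_completion_def)
    then interpret g: group_hom "egrp A i j" C "\<beta> i j"
      by (simp add: group_hom_def group_hom_axioms_def is_group)
    have "inv\<^bsub>C\<^esub> h = \<beta> i j (inv\<^bsub>egrp A i j\<^esub> x)" using x h by simp
    moreover have "inv\<^bsub>egrp A i j\<^esub> x \<in> carrier (egrp A i j)" using x by simp
    ultimately show ?thesis using i by blast
  qed
  have word1: "\<exists>w. set w \<subseteq> letters I A \<and> eval_word C \<alpha> \<beta> w = h" if h: "h \<in> ?G" for h
  proof -
    obtain l where "l \<in> letters I A" "eval_word C \<alpha> \<beta> [l] = h" using gl[OF h] by blast
    then show ?thesis by (intro exI[of _ "[l]"]) simp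
  qed
  have "c \<in> generate C ?G" using assms(2,3) by (simp add: is_completion_def)
  then show ?thesis
  proof (induction rule: generate.induct)
    case one show ?case by (intro exI[of _ "[]"]) simp
  next
    case (incl h) then show ?case by (rule word1)
  next
    case (inv h) then show ?case by (intro word1 inv_G)
  next
    case (eng h1 h2)
    then obtain v w where "set v \<subseteq> letters I A" "eval_word C \<alpha> \<beta> v = h1"
      "set w \<subseteq> letters I A" "eval_word C \<alpha> \<beta> w = h2" by blast
    then show ?case using eval_word_append[OF assms(2), of v w] by (intro exI[of _ "v @ w"]) simp
  qed
qed

lemma universal_completion_factors:
  fixes D :: "'d monoid"
  assumes A: "is_amalgam I A" and U: "is_universal_completion I A C \<alpha> \<beta>"
    and D: "is_completion I A D \<gamma> \<delta>"
  shows "\<exists>!h. completion_hom I A C \<alpha> \<beta> D \<gamma> \<delta> h"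
proof -
  have C: "is_completion I A C \<alpha> \<beta>" using U by (simp add: is_universal_completion_def)
  interpret C: group C using C by (simp add: is_completion_def)
  interpret D: group D using D by (simp add: is_completion_def)
  define f where "f d = {w. set w \<subseteq> letters I A \<and> eval_word D \<gamma> \<delta> w = d}" for d
  have inj: "inj_on f (carrier D)"
  proof (rule inj_onI)
    fix d d' assume "d \<in> carrier D" "d' \<in> carrier D" and eq: "f d = f d'"
    obtain w where "w \<in> f d" using completion_words[OF A D \<open>d \<in> carrier D\<close>] by (auto simp: f_def)
    with eq show "d = d'" by (auto simp: f_def)
  qed
  define D' where "D' = image_group f D"
  have grp': "group D'" unfolding D'_def by (rule D.inj_imp_image_group_is_group[OF inj])
  have iso: "f \<in> iso D D'" unfolding D'_def by (rule inj_imp_image_group_iso[OF inj])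
  then have fhom: "f \<in> hom D D'" by (simp add: iso_def)
  let ?g = "inv_into (carrier D) f"
  have ghom: "?g \<in> hom D' D" using D.iso_set_sym[OF iso] by (simp add: iso_def)
  have gh: "group_hom D D' f"
    by (intro group_hom.intro group_hom_axioms.intro D.is_group grp' fhom)
  have car': "carrier D' = f ` carrier D" by (simp add: D'_def image_group_def)
  note gc = completion_closed(1)[OF D] and dc = completion_closed(2)[OF D]
  let ?S = "(\<Union>i\<in>I. \<gamma> i ` carrier (vgrp A i)) \<union> (\<Union>i\<in>I. \<Union>j\<in>I - {i}. \<delta> i j ` carrier (egrp A i j))"
  have genD: "generate D ?S = carrier D" using D unfolding is_completion_def by blast
  have S: "?S \<subseteq> carrier D" 
    by (intro Un_least UN_least image_subsetI) (simp_all add: gc dc)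
  have "(\<Union>i\<in>I. (\<lambda>x. f (\<gamma> i x)) ` carrier (vgrp A i)) \<union>
        (\<Union>i\<in>I. \<Union>j\<in>I - {i}. (\<lambda>x. f (\<delta> i j x)) ` carrier (egrp A i j)) = f ` ?S"
    by (simp only: image_Un image_UN image_image)
  then have gen': "generate D' ((\<Union>i\<in>I. (\<lambda>x. f (\<gamma> i x)) ` carrier (vgrp A i)) \<union>
        (\<Union>i\<in>I. \<Union>j\<in>I - {i}. (\<lambda>x. f (\<delta> i j x)) ` carrier (egrp A i j))) = carrier D'"
    using group_hom.generate_img[OF gh S] unfolding genD car' by (simp only:)
  have D'c: "is_completion I A D' (\<lambda>i x. f (\<gamma> i x)) (\<lambda>i j x. f (\<delta> i j x))"
    unfolding is_completion_def
  proof (intro conjI ballI impI)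
    fix i assume i: "i \<in> I"
    then have "\<gamma> i \<in> hom (vgrp A i) D" using D by (simp add: is_completion_def)
    from hom_compose[OF this fhom] show "(\<lambda>x. f (\<gamma> i x)) \<in> hom (vgrp A i) D'"
      unfolding comp_def .
    fix j assume j: "j \<in> I" "i \<noteq> j"
    then have "\<delta> i j \<in> hom (egrp A i j) D" using D i by (simp add: is_completion_def)
    from hom_compose[OF this fhom] show "(\<lambda>x. f (\<delta> i j x)) \<in> hom (egrp A i j) D'"
      unfolding comp_def .
    fix x
    show "f (\<delta> i j x) = f (\<delta> j i x)" if "x \<in> carrier (egrp A i j)"
    proof (rule arg_cong[of _ _ f])
      show "\<delta> i j x = \<delta> j i x" using D i j that unfolding is_completion_def by metis
    qed
    show "f (\<delta> i j (conn A i j y)) = f (\<gamma> i y)" if "y \<in> carrier (vgrp A i)" for y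
    proof (rule arg_cong[of _ _ f])
      show "\<delta> i j (conn A i j y) = \<gamma> i y" using D i j that unfolding is_completion_def by metis
    qed
  qed (fact grp', fact gen')
  then obtain h where h: "completion_hom I A C \<alpha> \<beta> D' (\<lambda>i x. f (\<gamma> i x)) (\<lambda>i j x. f (\<delta> i j x)) h"
    and uniq: "\<And>k. completion_hom I A C \<alpha> \<beta> D' (\<lambda>i x. f (\<gamma> i x)) (\<lambda>i j x. f (\<delta> i j x)) k \<Longrightarrow> k = h"
    using U unfolding is_universal_completion_def by metis
  note ac = completion_closed(1)[OF C] and bc = completion_closed(2)[OF C]
  show ?thesis
  proof
    let ?k = "restrict (\<lambda>c. ?g (h c)) (carrier C)"
    have "(?g \<circ> h) \<in> hom C D" by (rule hom_compose[OF _ ghom]) (use h in \<open>simp add: completion_hom_def\<close>)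
    then have "?k \<in> hom C D" by (auto simp: hom_def Pi_def)
    then show "completion_hom I A C \<alpha> \<beta> D \<gamma> \<delta> ?k"
      using h by (simp add: completion_hom_def ac bc gc dc inv_into_f_f[OF inj])
  next
    fix k assume k: "completion_hom I A C \<alpha> \<beta> D \<gamma> \<delta> k"
    let ?fk = "restrict (\<lambda>c. f (k c)) (carrier C)"
    have "(f \<circ> k) \<in> hom C D'" by (rule hom_compose[OF _ fhom]) (use k in \<open>simp add: completion_hom_def\<close>)
    then have "?fk \<in> hom C D'" by (auto simp: hom_def Pi_def)
    then have "completion_hom I A C \<alpha> \<beta> D' (\<lambda>i x. f (\<gamma> i x)) (\<lambda>i j x. f (\<delta> i j x)) ?fk"
      using k by (simp add: completion_hom_def ac bc)
    then have fk: "?fk = h" by (rule uniq)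
    have kc: "k c \<in> carrier D" if "c \<in> carrier C" for c
      using k that by (auto simp: completion_hom_def hom_def Pi_def)
    show "k = restrict (\<lambda>c. ?g (h c)) (carrier C)"
    proof
      fix c
      show "k c = restrict (\<lambda>c. ?g (h c)) (carrier C) c"
      proof (cases "c \<in> carrier C")
        case True
        then have "h c = f (k c)" using fk by (metis restrict_apply')
        then show ?thesis using True kc[OF True] by (simp add: inv_into_f_f[OF inj])
      next
        case False
        then show ?thesis using k by (simp add: completion_hom_def extensional_def)
      qed
    qed
  qed
qed

end

theory Submission
  imports Defs "HOL-Library.Function_Algebras"
begin

text \<open>The map from the standard amalgam onto \<open>A\<close> is an isomorphism on edges, and on non-edges its kernel is a
  subgroup of \<open>\<langle>(z, z)\<rangle>\<close>, because every proper normal subgroup of \<open>SL\<^sub>3\<close> is central and \<open>SL\<^sub>3\<close> is not isomorphic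
  to a proper quotient of itself. If \<open>(z, z)\<close> is killed for a non-edge \<open>{i, j}\<close>, then in any completion the images of
  \<open>z\<close> from \<open>i\<close> and \<open>j\<close> coincide, so this element commutes with the group at every vertex \<open>k\<close> not adjacent to one of them. If
  \<open>k\<close> is adjacent to the other, this kills the \<open>SL\<^sub>3\<close> on that edge, and then everything by connectedness.

  Conversely, a non-trivial completion acts on the Kac-Moody Lie algebra over \<open>k\<close> of a covering of the diagram on which
  the twist becomes trivial. There \<open>z\<close> at the vertex \<open>i\<close> acts on the generators \<open>e\<^sub>u\<close> and \<open>f\<^sub>u\<close> by \<open>-1\<close> or \<open>1\<close> according as \<open>u\<close> lies
  above a neighbour of \<open>i\<close> or not, so that \<open>i\<close> and \<open>j\<close> with the same neighbours give the same automorphism \<open>z\<close> of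
  order at most 2, and \<open>(z, z)\<close> acts trivially.\<close>

text \<open>Two obstacles shape the construction. The field k may have any characteristic, so the
  power series of ad e_v and ad f_v cannot be formed over k. The algebra is therefore built as a Lie
  ring of operators on a real vector space: there the divided powers of ad e_v and ad f_v exist,
  they preserve the Lie ring, and only then are scalars changed to k. An integer-valued functional
  with value 1 on the bracket of e_u and e_v, for neighbours u and v, shows that this bracket
  survives the change of scalars in every characteristic. Secondly, a twist would have to act
  semilinearly or by exchanging e and f; over the covering each sheet carries its own twist, and all
  maps stay k-linear. The fibres are the whole group of twists and may be infinite, so a group
  element acts by an infinite product of commuting automorphisms, of which only finitely many move a
  given vector. Homomorphisms out of SL_3 come from a relation between matrices and automorphisms
  that is multiplicative and single-valued.\<close>

section \<open>The algebra of linear operators on a real function space\<close>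

instantiation "fun" :: (type, real_vector) real_vector
begin
definition scaleR_fun :: "real \<Rightarrow> ('a \<Rightarrow> 'b) \<Rightarrow> 'a \<Rightarrow> 'b" where
  "scaleR_fun r f = (\<lambda>x. r *\<^sub>R f x)"
instance
  by standard (simp_all add: scaleR_fun_def fun_eq_iff algebra_simps)
end

text \<open>A type of its own, because the class \<open>real_algebra\<close>, over which brackets
  and Lie rings are developed, has to be instantiated with composition as multiplication.\<close>

typedef (overloaded) ('a::real_vector) endo = "{T :: 'a \<Rightarrow> 'a. linear T}"
  by (rule exI[of _ id]) (simp add: linear_id)

setup_lifting type_definition_endo

instantiation endo :: (real_vector) real_algebra
begin
lift_definition zero_endo :: "'a endo" is "\<lambda>x. 0" by (simp add: linear_zero)
lift_definition plus_endo :: "'a endo \<Rightarrow> 'a endo \<Rightarrow> 'a endo" is "\<lambda>S T x. S x + T x"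
  by (rule linear_compose_add)
lift_definition minus_endo :: "'a endo \<Rightarrow> 'a endo \<Rightarrow> 'a endo" is "\<lambda>S T x. S x - T x"
  by (rule linear_compose_sub)
lift_definition uminus_endo :: "'a endo \<Rightarrow> 'a endo" is "\<lambda>S x. - S x"
  by (rule linear_compose_neg)
lift_definition times_endo :: "'a endo \<Rightarrow> 'a endo \<Rightarrow> 'a endo" is "(\<circ>)"
  by (rule linear_compose)
lift_definition scaleR_endo :: "real \<Rightarrow> 'a endo \<Rightarrow> 'a endo" is "\<lambda>r S x. r *\<^sub>R S x"
  by (rule linear_compose_scale_right)
instance
  by standard (transfer; auto simp: fun_eq_iff algebra_simps linear_add linear_scale)+
end

section \<open>A module for the Serre relations\<close>

definition br :: "'r::ring \<Rightarrow> 'r \<Rightarrow> 'r" where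
  "br x y = x * y - y * x"

definition cart :: "('v \<Rightarrow> 'v \<Rightarrow> bool) \<Rightarrow> 'v \<Rightarrow> 'v \<Rightarrow> real" where
  "cart nb u v = (if u = v then 2 else if nb u v then - 1 else 0)"

text \<open>The Serre presentation of a simply-laced Kac-Moody algebra, with brackets taken in an
  associative algebra. The coroot h_v is not a separate parameter but \<open>br (e v) (f v)\<close>.
  The vertex type may be infinite, as it will be for the covering.\<close>

locale serre =
  fixes nb :: "'v \<Rightarrow> 'v \<Rightarrow> bool" and e f :: "'v \<Rightarrow> 'r::real_algebra"
  assumes nb_sym: "nb u v \<Longrightarrow> nb v u" and nb_irrefl: "\<not> nb v v"
    and ef: "u \<noteq> v \<Longrightarrow> br (e u) (f v) = 0"
    and he: "br (br (e v) (f v)) (e u) = cart nb v u *\<^sub>R e u"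
    and hf: "br (br (e v) (f v)) (f u) = - cart nb v u *\<^sub>R f u"
    and ee: "u \<noteq> v \<Longrightarrow> \<not> nb u v \<Longrightarrow> br (e u) (e v) = 0"
    and ff: "u \<noteq> v \<Longrightarrow> \<not> nb u v \<Longrightarrow> br (f u) (f v) = 0"
    and eee: "nb u v \<Longrightarrow> br (e u) (br (e u) (e v)) = 0"
    and fff: "nb u v \<Longrightarrow> br (f u) (br (f u) (f v)) = 0"

lemma br_alg:
  fixes x y z :: "'r::real_algebra"
  shows "br (x + y) z = br x z + br y z" "br z (x + y) = br z x + br z y"
    "br (x - y) z = br x z - br y z" "br z (x - y) = br z x - br z y"
    "br (- x) z = - br x z" "br z (- x) = - br z x" "br (r *\<^sub>R x) z = r *\<^sub>R br x z" "br z (r *\<^sub>R x) = r *\<^sub>R br z x"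
    "br 0 z = 0" "br z 0 = 0"
  by (simp_all add: br_def algebra_simps)

lemma br_jacobi: "br x (br y z) = br (br x y) z + br y (br x (z::'r::real_algebra))"
  by (simp add: br_def algebra_simps)

lemma br_anti: "br y x = - br x (y::'r::real_algebra)" by (simp add: br_def)

text \<open>Closure under real multiples is deliberately absent: an integral form is what can be
  carried over to a field of positive characteristic.\<close>

inductive_set lieZ :: "'r::ring set \<Rightarrow> 'r set" for S where
  incl: "x \<in> S \<Longrightarrow> x \<in> lieZ S"
| diff: "x \<in> lieZ S \<Longrightarrow> y \<in> lieZ S \<Longrightarrow> x - y \<in> lieZ S"
| brack: "x \<in> lieZ S \<Longrightarrow> y \<in> lieZ S \<Longrightarrow> br x y \<in> lieZ S"

text \<open>On functions of words, \<open>e\<^sub>v\<close> deletes a first letter \<open>v\<close> and \<open>f\<^sub>v\<close> inserts a letter \<open>v\<close>, weighted so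
  that \<open>[e\<^sub>v, f\<^sub>v] = h\<^sub>v\<close> acts on the word \<open>w\<close> by \<open>wt nb v w\<close>; the vacuum (the empty word) has weight 1 for
  every \<open>v\<close>. The relations among the \<open>f\<^sub>v\<close> hold on the whole space, those among the \<open>e\<^sub>v\<close> only on the submodule
  generated by the vacuum, to which the operators are restricted by means of a projection.\<close>

primrec wt :: "('v \<Rightarrow> 'v \<Rightarrow> bool) \<Rightarrow> 'v \<Rightarrow> 'v list \<Rightarrow> real" where
  "wt nb v [] = 1"
| "wt nb v (u # w) = wt nb v w - cart nb v u"

primrec ins :: "('v \<Rightarrow> 'v \<Rightarrow> bool) \<Rightarrow> 'v \<Rightarrow> 'v list \<Rightarrow> ('v list \<Rightarrow> real) \<Rightarrow> real" where
  "ins nb v [] x = 0"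
| "ins nb v (u # w) x = ins nb v w (\<lambda>w'. x (u # w')) + (if u = v then wt nb v w * x w else 0)"

lemma ins_linear: "ins nb v w (x + y) = ins nb v w x + ins nb v w y"
  "ins nb v w (r *\<^sub>R x) = r * ins nb v w x"
proof (induction w arbitrary: x y)
  case (Cons u w)
  { case 1 show ?case using Cons(1)[of "\<lambda>w'. x (u # w')" "\<lambda>w'. y (u # w')"]
      by (simp add: plus_fun_def algebra_simps) }
  { case 2 show ?case using Cons(2)[of "\<lambda>w'. x (u # w')"]
      by (simp add: scaleR_fun_def algebra_simps) }
qed simp_all

lemma ins_scale: "ins nb v w (\<lambda>w. r * x w) = r * ins nb v w x"
  using ins_linear(2)[of nb v w r x] by (simp add: scaleR_fun_def)

type_synonym 'v wop = "('v list \<Rightarrow> real) endo"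

lift_definition opE :: "'v \<Rightarrow> 'v wop" is "\<lambda>v x w. x (v # w)"
  by (rule linearI) (simp_all add: plus_fun_def scaleR_fun_def)
lift_definition opH :: "('v \<Rightarrow> 'v \<Rightarrow> bool) \<Rightarrow> 'v \<Rightarrow> 'v wop" is "\<lambda>nb v x w. wt nb v w * x w"
  by (rule linearI) (simp_all add: plus_fun_def scaleR_fun_def algebra_simps)
lift_definition opF :: "('v \<Rightarrow> 'v \<Rightarrow> bool) \<Rightarrow> 'v \<Rightarrow> 'v wop" is "\<lambda>nb v x w. ins nb v w x"
  by (rule linearI) (auto simp: fun_eq_iff ins_linear scaleR_fun_def ins_scale)

lemma opE_opF: "opE u * opF nb v = opF nb v * opE u + (if u = v then opH nb v else 0)"
  by transfer (auto simp: fun_eq_iff)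

lemma opH_opE: "opH nb v * opE u = opE u * opH nb v + cart nb v u *\<^sub>R opE u"
  by transfer (auto simp: fun_eq_iff scaleR_fun_def algebra_simps)

lemma opH_opH: "opH nb u * opH nb v = opH nb v * opH nb u"
  by transfer (auto simp: fun_eq_iff algebra_simps)

text \<open>Commuting with all \<open>opE u\<close> means that the value of T x at u # w is the
  value of T (E_u x) at w, so T is determined by its values at the empty word. Identities on the
  whole function space are thereby reduced to commutators with the \<open>opE u\<close>.\<close>

lemma vanish_gen:
  fixes T :: "'v wop"
  assumes "\<And>x. Rep_endo T x [] = 0" and "\<And>u. opE u * T = T * opE u"
  shows "T = 0"
proof -
  have c: "Rep_endo T x (u # w) = Rep_endo T (\<lambda>w. x (u # w)) w" for x u w
    using assms(2)[of u] by transfer (auto simp: fun_eq_iff)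
  have "Rep_endo T x w = 0" for x w
    by (induction w arbitrary: x) (simp_all add: assms(1) c)
  then show ?thesis by transfer (auto simp: fun_eq_iff)
qed

lemma opH_opF:
  assumes "\<And>u v. nb u v \<Longrightarrow> nb v u"
  shows "opH nb v * opF nb u = opF nb u * opH nb v - cart nb v u *\<^sub>R opF nb u"
proof -
  have "opH nb v * opF nb u - opF nb u * opH nb v + cart nb v u *\<^sub>R opF nb u = 0"
    (is "?T = 0")
  proof (rule vanish_gen)
    show "Rep_endo ?T x [] = 0" for x by transfer (simp add: scaleR_fun_def)
    show "opE w * ?T = ?T * opE w" for w
    proof -
      have 1: "opE w * opH nb v = opH nb v * opE w - cart nb v w *\<^sub>R opE w"
        by (simp add: opH_opE)
      have 2: "opE w * (opH nb v * X) = opH nb v * (opE w * X) - cart nb v w *\<^sub>R (opE w * X)" for X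
        unfolding mult.assoc[symmetric] 1 by (simp add: algebra_simps)
      have 3: "opE w * (opF nb u * X) = opF nb u * (opE w * X) + (if w = u then opH nb u * X else 0)" for X
        unfolding mult.assoc[symmetric] opE_opF by (simp add: algebra_simps)
      show ?thesis
        by (auto simp: algebra_simps 1 2 3 opE_opF opH_opH)
    qed
  qed
  then show ?thesis by (simp add: algebra_simps eq_neg_iff_add_eq_0)
qed

lemma assoc_rule:
  fixes a b :: "'r::ring"
  assumes "a * b = c" shows "a * (b * x) = c * x"
  using assms by (simp add: mult.assoc[symmetric])

context
  fixes nb :: "'v \<Rightarrow> 'v \<Rightarrow> bool"
  assumes sym: "nb u v \<Longrightarrow> nb v u" and irrefl: "\<not> nb v v"
begin

lemmas op_rules = opE_opF opH_opF[OF sym] opH_opE opE_opF[THEN assoc_rule]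
  opH_opF[OF sym, THEN assoc_rule] opH_opE[THEN assoc_rule]

lemma opF_comm:
  assumes "u \<noteq> v" "\<not> nb u v"
  shows "br (opF nb u) (opF nb v) = 0"
proof (rule vanish_gen)
  show "Rep_endo (br (opF nb u) (opF nb v)) x [] = 0" for x
    unfolding br_def by transfer simp
  have "cart nb u v = 0" "cart nb v u = 0" using assms sym by (auto simp: cart_def)
  then show "opE w * br (opF nb u) (opF nb v) = br (opF nb u) (opF nb v) * opE w" for w
    using assms(1) by (auto simp: br_def algebra_simps op_rules)
qed

text \<open>A Serre relator in the F commutes with every E_w: for w outside {u, v} factor by factor,
  for w = u and w = v by the rank-two computation with Cartan entries 2 and -1. It vanishes at the
  empty word because every image under \<open>opF\<close> does.\<close>

lemma opF_serre:
  assumes "nb u v"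
  shows "br (opF nb u) (br (opF nb u) (opF nb v)) = 0"
proof (rule vanish_gen)
  show "Rep_endo (br (opF nb u) (br (opF nb u) (opF nb v))) x [] = 0" for x
    unfolding br_def by transfer simp
  have c: "cart nb u v = -1" "cart nb v u = -1" "cart nb u u = 2" "u \<noteq> v"
    using assms sym irrefl by (auto simp: cart_def)
  show "opE w * br (opF nb u) (br (opF nb u) (opF nb v)) = br (opF nb u) (br (opF nb u) (opF nb v)) * opE w" for w
    using c(4) by (auto simp: br_def algebra_simps op_rules c scaleR_2)
qed

definition vac :: "'v list \<Rightarrow> real" where "vac w = (if w = [] then 1 else 0)"

primrec fword :: "'v list \<Rightarrow> 'v list \<Rightarrow> real" where
  "fword [] = vac"
| "fword (v # w) = Rep_endo (opF nb v) (fword w)"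

text \<open>A function killed by all \<open>opE u\<close> is a multiple of \<open>vac\<close>, so
  this span is the irreducible highest weight module in which every h_v acts on the vacuum with
  weight 1.\<close>

definition L0 :: "('v list \<Rightarrow> real) set" where "L0 = span (range fword)"

lemma endo_linear: "linear (Rep_endo T)" using Rep_endo by simp

lemma Rep_endo_simps:
  "Rep_endo (S * T) x = Rep_endo S (Rep_endo T x)" "Rep_endo (S + T) x = Rep_endo S x + Rep_endo T x"
  "Rep_endo (S - T) x = Rep_endo S x - Rep_endo T x" "Rep_endo (r *\<^sub>R T) x = r *\<^sub>R Rep_endo T x"
  "Rep_endo 0 x = 0"
  by (simp_all add: times_endo.rep_eq plus_endo.rep_eq minus_endo.rep_eq scaleR_endo.rep_eq zero_endo.rep_eq)

lemma opE_vac: "Rep_endo (opE u) vac = 0"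
  unfolding vac_def[abs_def] by transfer (simp add: fun_eq_iff)

lemma opH_vac: "Rep_endo (opH nb u) vac = vac"
  unfolding vac_def[abs_def] by transfer (auto simp add: fun_eq_iff)

lemma L0_closed:
  assumes "\<And>w. Rep_endo T (fword w) \<in> L0" "x \<in> L0"
  shows "Rep_endo T x \<in> L0"
  using assms(2) unfolding L0_def
proof (rule span_induct)
  show "subspace {x. Rep_endo T x \<in> span (range fword)}"
    by (rule subspaceI)
      (auto simp: linear_0[OF endo_linear] linear_add[OF endo_linear] linear_scale[OF endo_linear]
        intro: span_add span_scale span_zero)
qed (use assms(1) in \<open>auto simp: L0_def\<close>)

lemma L0_fword: "fword w \<in> L0" unfolding L0_def by (rule span_base) simp

lemma L0_opF: "x \<in> L0 \<Longrightarrow> Rep_endo (opF nb v) x \<in> L0"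
  by (rule L0_closed) (use L0_fword[of "v # _"] in simp_all)

lemma fword_opH: "Rep_endo (opH nb u) (fword w) = wt nb u w *\<^sub>R fword w"
proof (induction w)
  case (Cons v w)
  have "Rep_endo (opH nb u) (Rep_endo (opF nb v) (fword w)) = Rep_endo (opH nb u * opF nb v) (fword w)"
    by (simp only: Rep_endo_simps)
  also have "\<dots> = Rep_endo (opF nb v) (Rep_endo (opH nb u) (fword w)) - cart nb u v *\<^sub>R fword (v # w)"
    by (simp only: opH_opF[OF sym] Rep_endo_simps fword.simps)
  finally show ?case
    by (simp only: Cons linear_scale[OF endo_linear] fword.simps wt.simps scaleR_left_diff_distrib)
qed (simp only: opH_vac fword.simps wt.simps scaleR_one)

lemma fword_opE:
  "Rep_endo (opE u) (fword (v # w)) =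
     Rep_endo (opF nb v) (Rep_endo (opE u) (fword w)) + (if u = v then wt nb u w else 0) *\<^sub>R fword w"
proof -
  have "Rep_endo (opE u) (fword (v # w)) = Rep_endo (opE u * opF nb v) (fword w)"
    by (simp only: Rep_endo_simps fword.simps)
  then show ?thesis
    by (cases "u = v") (simp_all only: opE_opF Rep_endo_simps fword_opH if_True if_False scaleR_zero_left refl)
qed

lemma L0_opE: "x \<in> L0 \<Longrightarrow> Rep_endo (opE u) x \<in> L0"
proof (rule L0_closed)
  show "Rep_endo (opE u) (fword w) \<in> L0" for w
  proof (induction w)
    case Nil show ?case by (simp only: fword.simps opE_vac) (simp only: L0_def span_zero)
  next
    case (Cons v w)
    show ?case
      unfolding fword_opE
      using L0_opF[OF Cons] L0_fword[of w] by (auto simp only: L0_def intro!: span_add span_scale)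
  qed
qed

text \<open>The mirror image of \<open>vanish_gen\<close>: the F generate the module from the
  vacuum, so an operator commuting with them is determined there by the image of the vacuum. The
  E-relators commute with the F, which is why their vanishing is obtained on
  \<open>L0\<close>.\<close>

lemma L0_kill:
  assumes "Rep_endo T vac = 0" "\<And>u. T * opF nb u = opF nb u * T" "x \<in> L0"
  shows "Rep_endo T x = 0"
proof (rule linear_eq_0_on_span[OF endo_linear _ assms(3)[unfolded L0_def]])
  fix y assume "y \<in> range fword"
  then obtain w where w: "y = fword w" by blast
  have "Rep_endo T (fword w) = 0"
  proof (induction w)
    case (Cons v w)
    have "Rep_endo T (fword (v # w)) = Rep_endo (T * opF nb v) (fword w)" by (simp only: Rep_endo_simps fword.simps)
    also have "\<dots> = Rep_endo (opF nb v) (Rep_endo T (fword w))" by (simp only: assms(2) Rep_endo_simps)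
    finally show ?case by (simp only: Cons linear_0[OF endo_linear])
  qed (simp only: assms(1) fword.simps)
  then show "Rep_endo T y = 0" by (simp only: w)
qed

lemma opE_comm:
  assumes "u \<noteq> v" "\<not> nb u v" "x \<in> L0"
  shows "Rep_endo (br (opE u) (opE v)) x = 0"
proof (rule L0_kill[OF _ _ assms(3)])
  show "Rep_endo (br (opE u) (opE v)) vac = 0"
    by (simp add: br_def Rep_endo_simps opE_vac linear_0[OF endo_linear])
  have "cart nb u v = 0" "cart nb v u = 0" using assms sym by (auto simp: cart_def)
  then show "br (opE u) (opE v) * opF nb w = opF nb w * br (opE u) (opE v)" for w
    using assms(1) by (auto simp: br_def algebra_simps op_rules)
qed

lemma opE_serre:
  assumes "nb u v" "x \<in> L0"
  shows "Rep_endo (br (opE u) (br (opE u) (opE v))) x = 0"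
proof (rule L0_kill[OF _ _ assms(2)])
  show "Rep_endo (br (opE u) (br (opE u) (opE v))) vac = 0"
    by (simp add: br_def Rep_endo_simps opE_vac linear_0[OF endo_linear])
  have c: "cart nb u v = -1" "cart nb v u = -1" "cart nb u u = 2" "u \<noteq> v"
    using assms sym irrefl by (auto simp: cart_def)
  show "br (opE u) (br (opE u) (opE v)) * opF nb w = opF nb w * br (opE u) (br (opE u) (opE v))" for w
  proof -
    consider "w = u" | "w = v" | "u \<noteq> w" "v \<noteq> w" by blast
    then show ?thesis
      using c(4) c(4)[symmetric] by cases (simp_all add: br_def algebra_simps op_rules c scaleR_2)
  qed
qed

text \<open>\<open>\<Phi>\<close> certifies that a bracket is nonzero in a form that survives
  reduction modulo a prime: integral on the whole Lie ring, with the value 1. It is the vacuum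
  coefficient of y applied to F_v F_u vac.\<close>

lemma serre_model:
  obtains e f :: "'v \<Rightarrow> 'v wop" and \<Phi> :: "'v \<Rightarrow> 'v \<Rightarrow> 'v wop \<Rightarrow> real"
  where "serre nb e f"
    and "\<And>u v. linear (\<Phi> u v)"
    and "\<And>u v. nb u v \<Longrightarrow> \<Phi> u v (br (e u) (e v)) = 1"
    and "\<And>u v y. y \<in> lieZ (range e \<union> range f) \<Longrightarrow> \<Phi> u v y \<in> \<int>"
proof -
  \<comment> \<open>A linear projection onto \<open>L0\<close> exists. Composing with it on the
    right turns relations valid on \<open>L0\<close> into identities of operators on all
    functions.\<close>
  have "inj_on (\<lambda>x :: 'v list \<Rightarrow> real. x) L0" "subspace L0" by (auto simp: L0_def)
  from linear_exists_left_inverse_on[OF linear_id[unfolded id_def] this(2,1)]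
  obtain p :: "('v list \<Rightarrow> real) \<Rightarrow> ('v list \<Rightarrow> real)"
    where p: "range p \<subseteq> L0" "linear p" "\<And>x. x \<in> L0 \<Longrightarrow> p x = x" by auto
  define P where "P = Abs_endo p"
  have Rp: "Rep_endo P = p" unfolding P_def using p(2) by (simp add: Abs_endo_inverse)
  define e where "e v = opE v * P" for v
  define f where "f v = opF nb v * P" for v
  define pres where "pres T \<longleftrightarrow> P * (T * P) = T * P" for T
  have "pres T" if "\<And>x. x \<in> L0 \<Longrightarrow> Rep_endo T x \<in> L0" for T
    unfolding pres_def using p that
    by (auto simp: Rep_endo_inject[symmetric] fun_eq_iff Rep_endo_simps Rp intro!: fun_cong[OF p(3)])
  then have pres_gen: "pres (opE v)" "pres (opF nb v)" for v using L0_opE L0_opF by blast+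
  have pres_br: "pres (br S T)" and br_P: "br (S * P) (T * P) = br S T * P" if "pres S" "pres T" for S T
  proof -
    have "P * (S * (T * P)) = S * (T * P)" "P * (T * (S * P)) = T * (S * P)"
      using that unfolding pres_def by (metis mult.assoc)+
    then show "pres (br S T)" by (simp add: pres_def br_def algebra_simps)
    show "br (S * P) (T * P) = br S T * P" using that by (simp add: pres_def br_def algebra_simps)
  qed
  have zP: "T * P = 0" if "\<And>x. x \<in> L0 \<Longrightarrow> Rep_endo T x = 0" for T
    using p(1) that by (auto simp: Rep_endo_inject[symmetric] fun_eq_iff Rep_endo_simps Rp)
  have efP: "br (e u) (e v) = br (opE u) (opE v) * P" "br (f u) (f v) = br (opF nb u) (opF nb v) * P"
    "br (e u) (f v) = br (opE u) (opF nb v) * P" 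
    "br (e u) (br (e u) (e v)) = br (opE u) (br (opE u) (opE v)) * P"
    "br (f u) (br (f u) (f v)) = br (opF nb u) (br (opF nb u) (opF nb v)) * P"
    "br (br (e v) (f v)) (e u) = br (br (opE v) (opF nb v)) (opE u) * P"
    "br (br (e v) (f v)) (f u) = br (br (opE v) (opF nb v)) (opF nb u) * P" for u v
    by (simp_all add: e_def f_def br_P pres_br pres_gen)
  have bEF: "br (opE u) (opF nb v) = (if u = v then opH nb v else 0)" for u v
    by (simp add: br_def opE_opF)
  have "serre nb e f"
  proof
    show "nb v u" if "nb u v" for u v using sym that .
    show "\<not> nb v v" for v by (rule irrefl)
    show "br (e u) (f v) = 0" if "u \<noteq> v" for u v using that by (simp add: efP bEF)
    show "br (br (e v) (f v)) (e u) = cart nb v u *\<^sub>R e u" for u v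
      unfolding efP(6) bEF by (simp add: br_def opH_opE e_def algebra_simps)
    show "br (br (e v) (f v)) (f u) = - cart nb v u *\<^sub>R f u" for u v
      unfolding efP(7) bEF by (simp add: br_def opH_opF[OF sym] f_def algebra_simps)
    show "br (e u) (e v) = 0" if "u \<noteq> v" "\<not> nb u v" for u v
      unfolding efP(1) using opE_comm[OF that] by (rule zP)
    show "br (f u) (f v) = 0" if "u \<noteq> v" "\<not> nb u v" for u v
      unfolding efP(2) opF_comm[OF that] by simp
    show "br (e u) (br (e u) (e v)) = 0" if "nb u v" for u v
      unfolding efP(4) using opE_serre[OF that] by (rule zP)
    show "br (f u) (br (f u) (f v)) = 0" if "nb u v" for u v
      unfolding efP(5) opF_serre[OF that] by simp
  qed
  define \<Phi> where "\<Phi> u v y = Rep_endo y (fword [v, u]) []" for u v and y :: "'v wop"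
  have Ie: "Rep_endo (e v) x = Rep_endo (opE v) x" "Rep_endo (f v) x = Rep_endo (opF nb v) x" if "x \<in> L0" for v x
    using p(3)[OF that] by (simp_all only: e_def f_def Rep_endo_simps Rp)
  have "linear (\<Phi> u v)" for u v
    by (rule linearI) (simp_all add: \<Phi>_def Rep_endo_simps scaleR_fun_def)
  moreover have "\<Phi> u v (br (e u) (e v)) = 1" if "nb u v" for u v
  proof -
    have c: "v \<noteq> u" "u \<noteq> v" "cart nb u v = -1" "cart nb v u = -1" using that sym irrefl by (auto simp: cart_def)
    \<comment> \<open>The weight of v is 1 - (-1) = 2 on the word [u], whereas that of u is 1 on the
      vacuum. The two orders of E_u and E_v thus give 2 and 1, and the difference 1 is nonzero in
      every field.\<close>
    have 1: "Rep_endo (opE u) (fword [v, u]) = fword [v]" "Rep_endo (opE v) (fword [v, u]) = 2 *\<^sub>R fword [u]"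
      "Rep_endo (opE v) (fword [v]) = vac" "Rep_endo (opE u) (fword [u]) = vac"
      using c by (simp_all only: fword_opE wt.simps fword.simps(1) opE_vac linear_0[OF endo_linear] if_True if_False refl)
        (simp_all add: linear_0[OF endo_linear])
    have "Rep_endo (br (opE u) (opE v)) (fword [v, u]) = 2 *\<^sub>R vac - vac"
      unfolding br_def Rep_endo_simps 1 by (simp only: linear_scale[OF endo_linear] 1)
    then have "Rep_endo (br (opE u) (opE v)) (fword [v, u]) [] = 1"
      by (simp add: vac_def scaleR_fun_def)
    then show ?thesis using p(3)[OF L0_fword[of "[v, u]"]] by (simp only: \<Phi>_def efP Rep_endo_simps Rp)
  qed
  moreover have "\<Phi> u v y \<in> \<int>" if y: "y \<in> lieZ (range e \<union> range f)" for u v y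
  proof -
    \<comment> \<open>A lattice preserved by all generators: the weights, and hence the insertions,
      have integer coefficients.\<close>
    define M where "M = {x \<in> L0. \<forall>w. x w \<in> \<int>}"
    define Z' where "Z' = {T. \<forall>x\<in>M. Rep_endo T x \<in> M}"
    have wtZ: "wt nb v w \<in> \<int>" for v w by (induction w) (auto simp: cart_def)
    have insZ: "(\<And>w. x w \<in> \<int>) \<Longrightarrow> ins nb v w x \<in> \<int>" for v w x
      by (induction w arbitrary: x) (auto simp: wtZ)
    have EM: "Rep_endo (opE v) x \<in> M" and FM: "Rep_endo (opF nb v) x \<in> M" if "x \<in> M" for v x
      using that L0_opE L0_opF by (auto simp: M_def opE.rep_eq opF.rep_eq insZ)
    have gZ: "range e \<union> range f \<subseteq> Z'"
      using EM FM by (auto simp: Z'_def Ie M_def)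
    have Md: "x - y \<in> M" if "x \<in> M" "y \<in> M" for x y
      using that span_diff[of x "range fword" y] unfolding M_def L0_def by simp
    have "x \<in> Z'" if "x \<in> lieZ (range e \<union> range f)" for x
      using that by (induction rule: lieZ.induct) (use gZ in \<open>auto simp: Z'_def br_def Rep_endo_simps intro!: Md\<close>)
    moreover have "fword w \<in> M" for w
    proof (induction w)
      case Nil
      have "vac w \<in> \<int>" for w :: "'v list" by (simp add: vac_def)
      then show ?case using L0_fword[of "[]"] by (simp add: M_def)
    next
      case (Cons v w) show ?case unfolding fword.simps by (rule FM[OF Cons])
    qed
    ultimately show ?thesis using y unfolding \<Phi>_def Z'_def M_def by blast
  qed
  ultimately show thesis by (rule that[OF \<open>serre nb e f\<close>])
qed

end

declare plus_fun_apply [simp del] zero_fun_apply [simp del] minus_apply [simp del] uminus_apply [simp del]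
section \<open>From a Lie ring to a Lie algebra over a field\<close>

lemmas fun_ac_apply = plus_fun_apply zero_fun_apply minus_apply uminus_apply

lemma lieZ_zero: "y \<in> lieZ S \<Longrightarrow> 0 \<in> lieZ S"
  using lieZ.diff[of y S y] by simp

lemma lieZ_minus: "y \<in> lieZ S \<Longrightarrow> - y \<in> lieZ S"
  using lieZ.diff[OF lieZ_zero, of y S y] by simp

lemma lieZ_add: "x \<in> lieZ S \<Longrightarrow> y \<in> lieZ S \<Longrightarrow> x + y \<in> lieZ S"
  using lieZ.diff[OF _ lieZ_minus, of x S y] by simp

lemma lieZ_sum: "0 \<in> lieZ S \<Longrightarrow> (\<And>i. i \<in> A \<Longrightarrow> h i \<in> lieZ S) \<Longrightarrow> sum h A \<in> lieZ S"
  by (induction A rule: infinite_finite_induct) (auto intro: lieZ_add)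

text \<open>The tensor product of a Lie ring with the field \<open>k\<close> is replaced by its image in the functions on the
  \<open>k\<close>-valued additive functionals: \<open>ev S y\<close> is evaluation at \<open>y\<close>, and \<open>lieK S\<close> is the \<open>k\<close>-span of these evaluations.
  The bracket \<open>kbr\<close> extends the one of the Lie ring without any choice of representatives. Functionals are
  total functions, so everything is set to 0 outside \<open>dual S\<close>.\<close>

definition dual :: "'r::ring set \<Rightarrow> ('r \<Rightarrow> 'k::field) set" where
  "dual S = {\<phi>. \<forall>x\<in>lieZ S. \<forall>y\<in>lieZ S. \<phi> (x - y) = \<phi> x - \<phi> y}"

lemma dual_props:
  assumes "\<phi> \<in> dual S" "x \<in> lieZ S"
  shows "\<phi> 0 = 0" "\<phi> (- x) = - \<phi> x" "y \<in> lieZ S \<Longrightarrow> \<phi> (x + y) = \<phi> x + \<phi> y"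
    "y \<in> lieZ S \<Longrightarrow> \<phi> (x - y) = \<phi> x - \<phi> y"
proof -
  show d: "\<phi> (x - y) = \<phi> x - \<phi> y" if "y \<in> lieZ S" for y
    using assms that by (simp add: dual_def)
  show z: "\<phi> 0 = 0" using d[OF assms(2)] by simp
  have m: "\<phi> (- x) = - \<phi> x" if "x \<in> lieZ S" for x
  proof -
    have "\<phi> (0 - x) = \<phi> 0 - \<phi> x" using assms(1) lieZ_zero[OF that] that unfolding dual_def by blast
    then show ?thesis using z by simp
  qed
  then show "\<phi> (- x) = - \<phi> x" using assms(2) .
  show "\<phi> (x + y) = \<phi> x + \<phi> y" if "y \<in> lieZ S"
    using d[OF lieZ_minus[OF that]] m[OF that] by simp
qed

definition ev :: "'r::ring set \<Rightarrow> 'r \<Rightarrow> ('r \<Rightarrow> 'k::field) \<Rightarrow> 'k" where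
  "ev S y = (\<lambda>\<phi>. if \<phi> \<in> dual S then \<phi> y else 0)"

definition ksc :: "'k::field \<Rightarrow> ('d \<Rightarrow> 'k) \<Rightarrow> 'd \<Rightarrow> 'k" where
  "ksc c \<Psi> = (\<lambda>\<phi>. c * \<Psi> \<phi>)"

definition kbr :: "'r::ring set \<Rightarrow> (('r \<Rightarrow> 'k::field) \<Rightarrow> 'k) \<Rightarrow> (('r \<Rightarrow> 'k) \<Rightarrow> 'k) \<Rightarrow> ('r \<Rightarrow> 'k) \<Rightarrow> 'k" where
  "kbr S \<Psi> \<Psi>' = (\<lambda>\<phi>. if \<phi> \<in> dual S then \<Psi> (\<lambda>a. \<Psi>' (\<lambda>b. \<phi> (br a b))) else 0)"

inductive lieKp :: "'r::ring set \<Rightarrow> (('r \<Rightarrow> 'k::field) \<Rightarrow> 'k) \<Rightarrow> bool" for S where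
  ev: "y \<in> lieZ S \<Longrightarrow> lieKp S (ev S y)"
| add: "lieKp S \<Psi> \<Longrightarrow> lieKp S \<Psi>' \<Longrightarrow> lieKp S (\<Psi> + \<Psi>')"
| scale: "lieKp S \<Psi> \<Longrightarrow> lieKp S (ksc c \<Psi>)"

definition lieK :: "'r::ring set \<Rightarrow> (('r \<Rightarrow> 'k::field) \<Rightarrow> 'k) set" where
  "lieK S = {\<Psi>. lieKp S \<Psi>}"

lemma ksc_add: "ksc c (\<Psi> + \<Psi>') = ksc c \<Psi> + ksc c \<Psi>'" "ksc (c + d) \<Psi> = ksc c \<Psi> + ksc d \<Psi>"
  "ksc c (ksc d \<Psi>) = ksc (c * d) \<Psi>" "ksc 1 \<Psi> = \<Psi>" "ksc 0 \<Psi> = 0" "ksc c 0 = 0"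
  "ksc c (\<Psi> - \<Psi>') = ksc c \<Psi> - ksc c \<Psi>'" "ksc (- c) \<Psi> = - ksc c \<Psi>" "ksc c (- \<Psi>) = - ksc c \<Psi>"
  by (simp_all add: ksc_def fun_eq_iff fun_ac_apply algebra_simps)

lemma ksc_sum: "ksc c (sum h A) = (\<Sum>i\<in>A. ksc c (h i))"
  by (induction A rule: infinite_finite_induct) (simp_all add: ksc_add)

lemma ksc_sum_left: "ksc (sum h A) \<Psi> = (\<Sum>i\<in>A. ksc (h i) \<Psi>)"
  by (induction A rule: infinite_finite_induct) (simp_all add: ksc_add)

lemma lieK_intros:
  "y \<in> lieZ S \<Longrightarrow> ev S y \<in> lieK S" "\<Psi> \<in> lieK S \<Longrightarrow> \<Psi>' \<in> lieK S \<Longrightarrow> \<Psi> + \<Psi>' \<in> lieK S"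
  "\<Psi> \<in> lieK S \<Longrightarrow> ksc c \<Psi> \<in> lieK S"
  by (auto simp: lieK_def intro: lieKp.intros)

lemma lieK_sum: "(0 :: ('r \<Rightarrow> 'k::field) \<Rightarrow> 'k) \<in> lieK (S :: 'r::ring set) \<Longrightarrow> (\<And>i. i \<in> A \<Longrightarrow> h i \<in> lieK S) \<Longrightarrow> sum h A \<in> (lieK S :: (('r \<Rightarrow> 'k) \<Rightarrow> 'k) set)"
  by (induction A rule: infinite_finite_induct) (auto intro: lieK_intros)

lemma lieK_zero: "(\<Psi> :: ('r::ring \<Rightarrow> 'k::field) \<Rightarrow> 'k) \<in> lieK S \<Longrightarrow> (0 :: ('r \<Rightarrow> 'k) \<Rightarrow> 'k) \<in> lieK S"
  using lieK_intros(3)[of \<Psi> S 0] by (simp add: ksc_add)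

lemma lieK_induct [consumes 1, case_names ev add scale]:
  assumes "\<Psi> \<in> lieK S" "\<And>y. y \<in> lieZ S \<Longrightarrow> P (ev S y)"
    "\<And>\<Psi> \<Psi>'. \<Psi> \<in> lieK S \<Longrightarrow> P \<Psi> \<Longrightarrow> \<Psi>' \<in> lieK S \<Longrightarrow> P \<Psi>' \<Longrightarrow> P (\<Psi> + \<Psi>')"
    "\<And>\<Psi> c. \<Psi> \<in> lieK S \<Longrightarrow> P \<Psi> \<Longrightarrow> P (ksc c \<Psi>)"
  shows "P \<Psi>"
  using assms(1) unfolding lieK_def mem_Collect_eq
  by (induction rule: lieKp.induct) (use assms(2-4) in \<open>auto simp: lieK_def\<close>)

lemma ev_simps:
  assumes "x \<in> lieZ S"
  shows "ev S 0 = 0" "ev S (- x) = - ev S x"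
    "y \<in> lieZ S \<Longrightarrow> ev S (x + y) = ev S x + ev S y" "y \<in> lieZ S \<Longrightarrow> ev S (x - y) = ev S x - ev S y"
  using dual_props[OF _ assms] by (auto simp: ev_def fun_eq_iff fun_ac_apply)

lemma ev_of_nat:
  fixes x :: "'r::real_algebra"
  assumes "x \<in> lieZ S"
  shows "of_nat n *\<^sub>R x \<in> lieZ S" "ev S (of_nat n *\<^sub>R x) = ksc (of_nat n) (ev S x)"
proof (induction n)
  case 0
  { case 1 show ?case using lieZ_zero[OF assms] by simp }
  { case 2 show ?case by (simp add: ev_simps[OF assms] ksc_add) }
next
  case (Suc n)
  { case 1 show ?case using lieZ_add[OF assms Suc(1)] by (simp add: scaleR_left_distrib) }
  { case 2 show ?case by (simp only: of_nat_Suc scaleR_left_distrib scaleR_one ksc_add ev_simps(3)[OF assms Suc(1)] Suc(2)) }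
qed

lemma dual_lin:
  assumes "\<phi> \<in> dual S"
  shows "\<phi>' \<in> dual S \<Longrightarrow> (\<lambda>a. \<phi> a + \<phi>' a) \<in> dual S"
    "\<phi>' \<in> dual S \<Longrightarrow> (\<lambda>a. \<phi> a - \<phi>' a) \<in> dual S" "(\<lambda>a. c * \<phi> a) \<in> dual S"
  using assms by (simp_all add: dual_def right_diff_distrib)

text \<open>Elements of \<open>lieK S\<close> are finite combinations of evaluations, so they are
  linear on \<open>dual S\<close> and see a functional only through its restriction to
  \<open>lieZ S\<close>. Linearity of \<open>kbr\<close> in its second argument rests on
  this.\<close>

lemma lieK_functional:
  assumes "\<Psi> \<in> lieK S" "\<phi> \<in> dual S"
  shows "\<phi>' \<in> dual S \<Longrightarrow> \<Psi> (\<lambda>a. \<phi> a + \<phi>' a) = \<Psi> \<phi> + \<Psi> \<phi>'"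
    "\<phi>' \<in> dual S \<Longrightarrow> \<Psi> (\<lambda>a. \<phi> a - \<phi>' a) = \<Psi> \<phi> - \<Psi> \<phi>'"
    "\<Psi> (\<lambda>a. c * \<phi> a) = c * \<Psi> \<phi>"
    "\<phi>' \<in> dual S \<Longrightarrow> (\<And>a. a \<in> lieZ S \<Longrightarrow> \<phi> a = \<phi>' a) \<Longrightarrow> \<Psi> \<phi> = \<Psi> \<phi>'"
  subgoal using assms(1)
    by (induction rule: lieK_induct) (simp_all add: ev_def assms(2) dual_lin ksc_def fun_ac_apply algebra_simps)
  subgoal using assms(1)
    by (induction rule: lieK_induct) (simp_all add: ev_def assms(2) dual_lin ksc_def fun_ac_apply right_diff_distrib)
  subgoal using assms(1)
    by (induction rule: lieK_induct) (simp_all add: ev_def assms(2) dual_lin ksc_def fun_ac_apply algebra_simps)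
  subgoal using assms(1)
    by (induction rule: lieK_induct) (simp_all add: ev_def assms(2) ksc_def fun_ac_apply)
  done

lemma dual_br: "\<phi> \<in> dual S \<Longrightarrow> a \<in> lieZ S \<Longrightarrow> (\<lambda>b. \<phi> (br a b)) \<in> dual S"
  "\<phi> \<in> dual S \<Longrightarrow> a \<in> lieZ S \<Longrightarrow> (\<lambda>b. \<phi> (br b a)) \<in> dual (S :: 'r::real_algebra set)"
  unfolding dual_def by (simp_all add: br_alg lieZ.brack)

text \<open>The inner function in the definition of \<open>kbr\<close> is again additive on the Lie
  ring, so the outer element of \<open>lieK S\<close> is evaluated at a legitimate argument.\<close>

lemma dual_kbr:
  fixes S :: "'r::real_algebra set"
  assumes "\<phi> \<in> dual S" "\<Psi> \<in> lieK S"
  shows "(\<lambda>a. \<Psi> (\<lambda>b. \<phi> (br a b))) \<in> dual S"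
  unfolding dual_def
proof (rule CollectI, intro ballI)
  fix x y assume xy: "x \<in> lieZ S" "y \<in> lieZ S"
  have "\<Psi> (\<lambda>b. \<phi> (br (x - y) b)) = \<Psi> (\<lambda>b. \<phi> (br x b) - \<phi> (br y b))"
  proof (rule lieK_functional(4)[OF assms(2)])
    show "(\<lambda>b. \<phi> (br (x - y) b)) \<in> dual S" by (rule dual_br[OF assms(1)]) (rule lieZ.diff[OF xy])
    show "\<phi> (br (x - y) b) = \<phi> (br x b) - \<phi> (br y b)" if "b \<in> lieZ S" for b
      using dual_props(4)[OF assms(1) lieZ.brack[OF xy(1) that] lieZ.brack[OF xy(2) that]] by (simp add: br_alg)
    show "(\<lambda>b. \<phi> (br x b) - \<phi> (br y b)) \<in> dual S"
      using dual_br(1)[OF assms(1) xy(1)] dual_br(1)[OF assms(1) xy(2)] unfolding dual_def by simp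
  qed
  then show "\<Psi> (\<lambda>b. \<phi> (br (x - y) b)) = \<Psi> (\<lambda>b. \<phi> (br x b)) - \<Psi> (\<lambda>b. \<phi> (br y b))"
    using lieK_functional(2)[OF assms(2) dual_br(1)[OF assms(1) xy(1)] dual_br(1)[OF assms(1) xy(2)]] by simp
qed

lemma kbr_ev:
  fixes S :: "'r::real_algebra set"
  assumes "x \<in> lieZ S" "y \<in> lieZ S"
  shows "kbr S (ev S x) (ev S y) = ev S (br x y)"
proof
  fix \<phi> :: "'r \<Rightarrow> 'k::field"
  show "kbr S (ev S x) (ev S y) \<phi> = ev S (br x y) \<phi>"
    using dual_kbr[OF _ lieK_intros(1)[OF assms(2)], of \<phi>] dual_br(1)[OF _ assms(1), of \<phi>]
    by (auto simp: kbr_def ev_def)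
qed

lemma kbr_bilinear:
  fixes S :: "'r::real_algebra set"
  assumes "\<Psi> \<in> lieK S" "\<Psi>1 \<in> lieK S" "\<Psi>2 \<in> lieK S"
  shows "kbr S (\<Psi>1 + \<Psi>2) \<Psi> = kbr S \<Psi>1 \<Psi> + kbr S \<Psi>2 \<Psi>" "kbr S (ksc c \<Psi>1) \<Psi> = ksc c (kbr S \<Psi>1 \<Psi>)"
    "kbr S \<Psi> (\<Psi>1 + \<Psi>2) = kbr S \<Psi> \<Psi>1 + kbr S \<Psi> \<Psi>2" "kbr S \<Psi> (ksc c \<Psi>1) = ksc c (kbr S \<Psi> \<Psi>1)"
proof -
  show "kbr S (\<Psi>1 + \<Psi>2) \<Psi> = kbr S \<Psi>1 \<Psi> + kbr S \<Psi>2 \<Psi>" "kbr S (ksc c \<Psi>1) \<Psi> = ksc c (kbr S \<Psi>1 \<Psi>)"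
    by (auto simp: kbr_def ksc_def fun_eq_iff fun_ac_apply)
  show "kbr S \<Psi> (\<Psi>1 + \<Psi>2) = kbr S \<Psi> \<Psi>1 + kbr S \<Psi> \<Psi>2"
    using lieK_functional(1)[OF assms(1) dual_kbr[OF _ assms(2)] dual_kbr[OF _ assms(3)]]
    by (auto simp: kbr_def fun_eq_iff fun_ac_apply)
  show "kbr S \<Psi> (ksc c \<Psi>1) = ksc c (kbr S \<Psi> \<Psi>1)"
    using lieK_functional(3)[OF assms(1) dual_kbr[OF _ assms(2)]]
    by (auto simp: kbr_def ksc_def fun_eq_iff fun_ac_apply)
qed

lemma kbr_closed:
  fixes S :: "'r::real_algebra set"
  assumes "\<Psi> \<in> lieK S" "\<Psi>' \<in> lieK S"
  shows "kbr S \<Psi> \<Psi>' \<in> lieK S"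
  using assms(1)
proof (induction rule: lieK_induct)
  case (ev y)
  show ?case using assms(2)
    by (induction rule: lieK_induct)
      (simp_all add: kbr_ev ev kbr_bilinear lieK_intros lieZ.brack)
qed (simp_all add: kbr_bilinear assms(2) lieK_intros)

section \<open>Endomorphisms and automorphisms of the Lie algebra over k\<close>

definition lie_end :: "'r::ring set \<Rightarrow> ((('r \<Rightarrow> 'k::field) \<Rightarrow> 'k) \<Rightarrow> (('r \<Rightarrow> 'k) \<Rightarrow> 'k)) \<Rightarrow> bool" where
  "lie_end S \<theta> \<longleftrightarrow> (\<forall>\<Psi>\<in>lieK S. \<theta> \<Psi> \<in> lieK S \<and> (\<forall>c. \<theta> (ksc c \<Psi>) = ksc c (\<theta> \<Psi>)) \<and>
     (\<forall>\<Psi>'\<in>lieK S. \<theta> (\<Psi> + \<Psi>') = \<theta> \<Psi> + \<theta> \<Psi>' \<and> \<theta> (kbr S \<Psi> \<Psi>') = kbr S (\<theta> \<Psi>) (\<theta> \<Psi>')))"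

lemma lie_endD:
  assumes "lie_end S \<theta>" "\<Psi> \<in> lieK S"
  shows "\<theta> \<Psi> \<in> lieK S" "\<theta> (ksc c \<Psi>) = ksc c (\<theta> \<Psi>)"
    "\<Psi>' \<in> lieK S \<Longrightarrow> \<theta> (\<Psi> + \<Psi>') = \<theta> \<Psi> + \<theta> \<Psi>'"
    "\<Psi>' \<in> lieK S \<Longrightarrow> \<theta> (\<Psi> - \<Psi>') = \<theta> \<Psi> - \<theta> \<Psi>'"
    "\<Psi>' \<in> lieK S \<Longrightarrow> \<theta> (kbr S \<Psi> \<Psi>') = kbr S (\<theta> \<Psi>) (\<theta> \<Psi>')"
proof -
  note d = assms(1)[unfolded lie_end_def, rule_format]
  show "\<theta> \<Psi> \<in> lieK S" "\<theta> (ksc c \<Psi>) = ksc c (\<theta> \<Psi>)"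
    "\<Psi>' \<in> lieK S \<Longrightarrow> \<theta> (\<Psi> + \<Psi>') = \<theta> \<Psi> + \<theta> \<Psi>'"
    "\<Psi>' \<in> lieK S \<Longrightarrow> \<theta> (kbr S \<Psi> \<Psi>') = kbr S (\<theta> \<Psi>) (\<theta> \<Psi>')"
    using d[OF assms(2)] by blast+
  assume "\<Psi>' \<in> lieK S"
  then have "\<theta> (\<Psi> + ksc (-1) \<Psi>') = \<theta> \<Psi> + ksc (-1) (\<theta> \<Psi>')"
    using d[OF assms(2)] d[of \<Psi>'] lieK_intros(3)[of \<Psi>' S "-1"] by metis
  then show "\<theta> (\<Psi> - \<Psi>') = \<theta> \<Psi> - \<theta> \<Psi>'" by (simp only: ksc_add diff_conv_add_uminus)
qed

lemma lie_endI:
  fixes S :: "'r::real_algebra set"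
  assumes cl: "\<And>y. y \<in> lieZ S \<Longrightarrow> \<theta> (ev S y) \<in> lieK S"
    and sc: "\<And>\<Psi> c. \<Psi> \<in> lieK S \<Longrightarrow> \<theta> (ksc c \<Psi>) = ksc c (\<theta> \<Psi>)"
    and ad: "\<And>\<Psi> \<Psi>'. \<Psi> \<in> lieK S \<Longrightarrow> \<Psi>' \<in> lieK S \<Longrightarrow> \<theta> (\<Psi> + \<Psi>') = \<theta> \<Psi> + \<theta> \<Psi>'"
    and kb: "\<And>x y. x \<in> lieZ S \<Longrightarrow> y \<in> lieZ S \<Longrightarrow> \<theta> (ev S (br x y)) = kbr S (\<theta> (ev S x)) (\<theta> (ev S y))"
  shows "lie_end S \<theta>"
proof -
  have c: "\<theta> \<Psi> \<in> lieK S" if "\<Psi> \<in> lieK S" for \<Psi>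
    using that by (induction rule: lieK_induct) (simp_all add: cl sc ad lieK_intros)
  have "\<theta> (kbr S \<Psi> \<Psi>') = kbr S (\<theta> \<Psi>) (\<theta> \<Psi>')" if "\<Psi> \<in> lieK S" "\<Psi>' \<in> lieK S" for \<Psi> \<Psi>'
    using that(1)
  proof (induction rule: lieK_induct)
    case (ev x)
    show ?case using that(2)
      by (induction rule: lieK_induct)
        (simp_all add: kbr_ev ev kb kbr_bilinear lieK_intros kbr_closed c ad sc)
  qed (simp_all add: kbr_bilinear that(2) kbr_closed c ad sc lieK_intros)
  then show ?thesis using c sc ad by (simp add: lie_end_def)
qed

lemma lie_end_eq:
  fixes S :: "'r::real_algebra set"
  assumes "lie_end S \<theta>" "lie_end S \<theta>'" "\<And>s. s \<in> S \<Longrightarrow> \<theta> (ev S s) = \<theta>' (ev S s)" "\<Psi> \<in> lieK S"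
  shows "\<theta> \<Psi> = \<theta>' \<Psi>"
proof -
  have "\<theta> (ev S y) = \<theta>' (ev S y)" if "y \<in> lieZ S" for y
    using that
  proof (induction rule: lieZ.induct)
    case (diff x y)
    then show ?case
      by (simp add: ev_simps lie_endD(4)[OF assms(1)] lie_endD(4)[OF assms(2)] lieK_intros)
  next
    case (brack x y)
    then show ?case
      by (simp add: kbr_ev[symmetric] lie_endD(5)[OF assms(1)] lie_endD(5)[OF assms(2)] lieK_intros)
  qed (use assms(3) in simp)
  with assms(4) show ?thesis
    by (induction rule: lieK_induct) (use assms(1,2) in \<open>simp_all add: lie_end_def\<close>)
qed

text \<open>\<open>permutes\<close> forces the identity outside \<open>lieK S\<close>. Hence
  automorphisms that agree on the generators are equal as functions, and plain composition is the
  group law.\<close>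

definition LA :: "'r::ring set \<Rightarrow> ((('r \<Rightarrow> 'k::field) \<Rightarrow> 'k) \<Rightarrow> (('r \<Rightarrow> 'k) \<Rightarrow> 'k)) monoid" where
  "LA S = \<lparr>carrier = {\<theta>. \<theta> permutes lieK S \<and> lie_end S \<theta>}, mult = (\<circ>), one = id\<rparr>"

lemma lie_end_comp: "lie_end S \<theta> \<Longrightarrow> lie_end S \<theta>' \<Longrightarrow> lie_end S (\<theta> \<circ> \<theta>')"
  by (simp add: lie_end_def)

lemma LA_group:
  fixes S :: "'r::real_algebra set"
  shows "group (LA S :: ((('r \<Rightarrow> 'k::field) \<Rightarrow> 'k) \<Rightarrow> (('r \<Rightarrow> 'k) \<Rightarrow> 'k)) monoid)"
proof (rule groupI)
  fix \<theta> :: "(('r \<Rightarrow> 'k) \<Rightarrow> 'k) \<Rightarrow> (('r \<Rightarrow> 'k) \<Rightarrow> 'k)" assume "\<theta> \<in> carrier (LA S)"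
  then have p: "\<theta> permutes lieK S" and l: "lie_end S \<theta>" by (auto simp: LA_def)
  define g where "g = inv_into UNIV \<theta>"
  note pg = permutes_inv[OF p, folded g_def] and gi = permutes_inverses[OF p, folded g_def]
  have i: "g \<Psi> \<in> lieK S" if "\<Psi> \<in> lieK S" for \<Psi> using permutes_in_image[OF pg] that by simp
  have e: "g \<Psi> = \<Psi>'" if "\<theta> \<Psi>' = \<Psi>" for \<Psi> \<Psi>' using that gi by metis
  have "lie_end S g"
    unfolding lie_end_def by (auto intro!: i e simp: lie_endD[OF l] i gi)
  then show "\<exists>\<theta>'\<in>carrier (LA S). \<theta>' \<otimes>\<^bsub>LA S\<^esub> \<theta> = \<one>\<^bsub>LA S\<^esub>"
    using pg permutes_inv_o[OF p] by (intro bexI[of _ g]) (auto simp: LA_def g_def)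
qed (auto simp: LA_def permutes_compose lie_end_comp permutes_id, auto simp: lie_end_def fun_eq_iff)

section \<open>Exponentials\<close>

definition dp :: "'r::real_algebra \<Rightarrow> nat \<Rightarrow> 'r \<Rightarrow> 'r" where
  "dp a n y = (br a ^^ n) y /\<^sub>R fact n"

lemma dp_0 [simp]: "dp a 0 y = y" by (simp add: dp_def)

lemma dp_Suc: "dp a (Suc n) y = br a (dp a n y) /\<^sub>R of_nat (Suc n)"
  by (simp add: dp_def br_alg mult.commute del: of_nat_Suc)

lemma br_dp: "br a (dp a n y) = of_nat (Suc n) *\<^sub>R dp a (Suc n) y"
  by (simp add: dp_Suc del: of_nat_Suc)

lemma dp_lin: "dp a n (x - y) = dp a n x - dp a n y" "dp a n (r *\<^sub>R x) = r *\<^sub>R dp a n x" "dp a n 0 = 0"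
  by (induction n) (simp_all add: dp_Suc br_alg scaleR_diff_right)

lemma dp_dp: "dp a n (dp a m y) = of_nat (n + m choose n) *\<^sub>R dp a (n + m) y"
proof (induction n)
  case (Suc n)
  have "(br a ^^ Suc n) (dp a m y) = (br a ^^ (Suc n + m)) y /\<^sub>R fact m" for n
    by (simp add: dp_def funpow_add) (induction n, simp_all add: br_alg)
  have "dp a (Suc n) (dp a m y) = (of_nat (n + m choose n) * of_nat (Suc (n + m)) / of_nat (Suc n)) *\<^sub>R dp a (Suc n + m) y"
    by (simp add: dp_Suc[of a n] Suc br_alg br_dp divide_inverse_commute del: of_nat_Suc)
  also have "of_nat (n + m choose n) * of_nat (Suc (n + m)) / of_nat (Suc n) = (of_nat (Suc n + m choose Suc n) :: real)"
    using Suc_times_binomial_eq[of "n + m" n] 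
    by (simp add: field_simps del: of_nat_Suc flip: of_nat_mult)
  finally show ?case .
qed simp

lemma br_sum: "br (sum h A) (y::'r::real_algebra) = (\<Sum>i\<in>A. br (h i) y)" "br y (sum h A) = (\<Sum>i\<in>A. br y (h i))"
  by (induction A rule: infinite_finite_induct) (simp_all add: br_alg)

text \<open>The Leibniz rule; division by factorials absorbs the binomial coefficients. The
  induction step is multiplied by n + 1, which is then split as i + (n + 1 - i).\<close>

lemma dp_br: "dp a n (br x y) = (\<Sum>i\<le>n. br (dp a i x) (dp a (n - i) y))"
proof (induction n)
  case (Suc n)
  let ?g = "\<lambda>i j. br (dp a i x) (dp a j y)"
  have *: "br a (?g i j) = of_nat (Suc i) *\<^sub>R ?g (Suc i) j + of_nat (Suc j) *\<^sub>R ?g i (Suc j)" for i j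
    by (subst br_jacobi) (simp add: br_dp br_alg del: of_nat_Suc)
  have "of_nat (Suc n) *\<^sub>R dp a (Suc n) (br x y) = (\<Sum>i\<le>n. br a (?g i (n - i)))"
    by (simp add: br_dp[symmetric] Suc br_sum del: of_nat_Suc)
  also have "\<dots> = (\<Sum>i\<le>n. of_nat (Suc i) *\<^sub>R ?g (Suc i) (Suc n - Suc i)) + (\<Sum>i\<le>n. of_nat (Suc n - i) *\<^sub>R ?g i (Suc n - i))"
    by (simp add: * sum.distrib Suc_diff_le del: of_nat_Suc)
  also have "(\<Sum>i\<le>n. of_nat (Suc i) *\<^sub>R ?g (Suc i) (Suc n - Suc i)) = (\<Sum>i\<le>Suc n. of_nat i *\<^sub>R ?g i (Suc n - i))"
    by (subst sum.atMost_Suc_shift) simp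
  also have "(\<Sum>i\<le>n. of_nat (Suc n - i) *\<^sub>R ?g i (Suc n - i)) = (\<Sum>i\<le>Suc n. of_nat (Suc n - i) *\<^sub>R ?g i (Suc n - i))"
    by simp
  also have "(\<Sum>i\<le>Suc n. of_nat i *\<^sub>R ?g i (Suc n - i)) + (\<Sum>i\<le>Suc n. of_nat (Suc n - i) *\<^sub>R ?g i (Suc n - i))
      = (\<Sum>i\<le>Suc n. of_nat (Suc n) *\<^sub>R ?g i (Suc n - i))"
    unfolding sum.distrib[symmetric] by (rule sum.cong) (auto simp: scaleR_left_distrib[symmetric] of_nat_diff)
  also have "\<dots> = of_nat (Suc n) *\<^sub>R (\<Sum>i\<le>Suc n. ?g i (Suc n - i))"
    by (simp only: scaleR_sum_right)
  finally show ?case by (simp only: real_vector.scale_cancel_left) simp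
qed simp

text \<open>Local nilpotence together with integrality: division by n! takes place in the real
  algebra, and the quotient has to return to the Lie ring before it can be evaluated in k.\<close>

definition integrable_on :: "'r::real_algebra \<Rightarrow> 'r set \<Rightarrow> bool" where
  "integrable_on a Z \<longleftrightarrow> (\<forall>y\<in>Z. (\<forall>n. dp a n y \<in> lieZ Z) \<and> (\<exists>N. \<forall>n\<ge>N. dp a n y = 0))"

lemma integrable_lieZ:
  assumes "integrable_on a S" "y \<in> lieZ S"
  shows "dp a n y \<in> lieZ S" "\<exists>N. \<forall>n\<ge>N. dp a n y = 0"
proof -
  have "(\<forall>n. dp a n y \<in> lieZ S) \<and> (\<exists>N. \<forall>n\<ge>N. dp a n y = 0)"
    using assms(2)
  proof (induction rule: lieZ.induct)
    case (incl x) then show ?case using assms(1) by (auto simp: integrable_on_def)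
  next
    case (diff x y)
    then obtain N M where "\<forall>n\<ge>N. dp a n x = 0" "\<forall>n\<ge>M. dp a n y = 0" by blast
    then have "\<forall>n\<ge>max N M. dp a n (x - y) = 0" by (simp add: dp_lin)
    moreover have "dp a n (x - y) \<in> lieZ S" for n using diff by (simp add: dp_lin lieZ.diff)
    ultimately show ?case by blast
  next
    case (brack x y)
    then obtain N M where N: "\<forall>n\<ge>N. dp a n x = 0" and M: "\<forall>n\<ge>M. dp a n y = 0" by blast
    have "br (dp a i x) (dp a (n - i) y) = 0" if "n \<ge> N + M" for i n
      using that N M by (cases "i \<ge> N") (simp_all add: br_alg)
    then have "\<forall>n\<ge>N + M. dp a n (br x y) = 0" by (simp add: dp_br)
    then show ?case
      using brack lieZ_zero[OF brack(1)] by (auto simp: dp_br intro!: lieZ_sum lieZ.brack)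
  qed
  then show "dp a n y \<in> lieZ S" "\<exists>N. \<forall>n\<ge>N. dp a n y = 0" by auto
qed

text \<open>The transpose of exp(t ad a). Acting on functionals avoids choosing an expression of an
  element of \<open>lieK S\<close> through evaluations. The index set is cut down to the nonzero
  terms because a sum over an infinite set is 0 by convention.\<close>

definition expd :: "'r::real_algebra set \<Rightarrow> 'r \<Rightarrow> 'k::field \<Rightarrow> ('r \<Rightarrow> 'k) \<Rightarrow> 'r \<Rightarrow> 'k" where
  "expd S a t \<phi> = (\<lambda>y. \<Sum>n | dp a n y \<noteq> 0. t ^ n * \<phi> (dp a n y))"

definition expL :: "'r::real_algebra set \<Rightarrow> 'r \<Rightarrow> 'k::field \<Rightarrow> (('r \<Rightarrow> 'k) \<Rightarrow> 'k) \<Rightarrow> ('r \<Rightarrow> 'k) \<Rightarrow> 'k" where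
  "expL S a t \<Psi> = (if \<Psi> \<in> lieK S then (\<lambda>\<phi>. if \<phi> \<in> dual S then \<Psi> (expd S a t \<phi>) else 0) else \<Psi>)"

lemma expd_bound:
  assumes "\<phi> \<in> dual S" "y \<in> lieZ S" "\<forall>n\<ge>N. dp a n y = 0"
  shows "expd S a t \<phi> y = (\<Sum>n<N. t ^ n * \<phi> (dp a n y))"
  unfolding expd_def
proof (rule sum.mono_neutral_left)
  show "\<forall>i\<in>{..<N} - {n. dp a n y \<noteq> 0}. t ^ i * \<phi> (dp a i y) = 0"
    using dual_props(1)[OF assms(1,2)] by auto
qed (use assms(3) in \<open>auto simp: not_less[symmetric]\<close>)

context
  fixes S :: "'r::real_algebra set" and a :: 'r
  assumes int: "integrable_on a S"
begin

lemma common_bound: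
  assumes "y \<in> lieZ S" "z \<in> lieZ S"
  obtains N where "\<forall>n\<ge>N. dp a n y = 0" "\<forall>n\<ge>N. dp a n z = 0"
proof -
  obtain N M where "\<forall>n\<ge>N. dp a n y = 0" "\<forall>n\<ge>M. dp a n z = 0"
    using integrable_lieZ(2)[OF int] assms by meson
  then show thesis by (intro that[of "max N M"]) simp_all
qed

lemma expd_dual:
  assumes "\<phi> \<in> dual S"
  shows "expd S a t \<phi> \<in> dual S"
  unfolding dual_def
proof (intro CollectI ballI)
  fix x y assume xy: "x \<in> lieZ S" "y \<in> lieZ S"
  obtain N where N: "\<forall>n\<ge>N. dp a n x = 0" "\<forall>n\<ge>N. dp a n y = 0"
    using common_bound[OF xy] by blast
  have "expd S a t \<phi> (x - y) = (\<Sum>n<N. t ^ n * \<phi> (dp a n (x - y)))"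
    by (rule expd_bound[OF assms lieZ.diff[OF xy]]) (simp add: dp_lin N)
  also have "\<dots> = (\<Sum>n<N. t ^ n * \<phi> (dp a n x) - t ^ n * \<phi> (dp a n y))"
    by (simp add: dp_lin dual_props(4)[OF assms integrable_lieZ(1)[OF int] integrable_lieZ(1)[OF int]] xy right_diff_distrib)
  finally show "expd S a t \<phi> (x - y) = expd S a t \<phi> x - expd S a t \<phi> y"
    by (simp add: expd_bound[OF assms xy(1) N(1)] expd_bound[OF assms xy(2) N(2)] sum_subtractf)
qed

lemma expL_ev:
  fixes t :: "'k::field"
  assumes "y \<in> lieZ S" "\<forall>n\<ge>N. dp a n y = 0"
  shows "expL S a t (ev S y) = (\<Sum>n<N. ksc (t ^ n) (ev S (dp a n y)))"
proof
  fix \<phi> :: "'r \<Rightarrow> 'k"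
  have "(\<Sum>n<N. ksc (t ^ n) (ev S (dp a n y))) \<phi> = (\<Sum>n<N. ksc (t ^ n) (ev S (dp a n y)) \<phi>)"
    by (induction N) (simp_all add: fun_ac_apply)
  moreover have "expL S a t (ev S y) \<phi> = (if \<phi> \<in> dual S then ev S y (expd S a t \<phi>) else 0)"
    by (simp add: expL_def lieK_intros assms)
  moreover have "\<dots> = (\<Sum>n<N. ksc (t ^ n) (ev S (dp a n y)) \<phi>)"
    by (simp add: ev_def ksc_def expd_bound[OF _ assms] expd_dual)
  ultimately show "expL S a t (ev S y) \<phi> = (\<Sum>n<N. ksc (t ^ n) (ev S (dp a n y))) \<phi>" by simp
qed

lemma expL_lin:
  fixes t :: "'k::field"
  assumes "\<Psi> \<in> lieK S"
  shows "expL S a t (ksc c \<Psi>) = ksc c (expL S a t \<Psi>)"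
    "\<Psi>' \<in> lieK S \<Longrightarrow> expL S a t (\<Psi> + \<Psi>') = expL S a t \<Psi> + expL S a t \<Psi>'"
  using assms by (simp_all add: expL_def lieK_intros) (auto simp: ksc_def fun_eq_iff fun_ac_apply)

lemma expL_ev_closed:
  assumes "y \<in> lieZ S" shows "expL S a (t :: 'k::field) (ev S y) \<in> lieK S"
proof -
  obtain N where N: "\<forall>n\<ge>N. dp a n y = 0" using common_bound[OF assms assms] by blast
  show ?thesis
    unfolding expL_ev[OF assms N]
    by (intro lieK_sum lieK_intros integrable_lieZ(1)[OF int] assms lieK_zero[OF lieK_intros(1)[OF assms]])
qed

lemma kbr_sum:
  assumes "(0 :: ('r \<Rightarrow> 'k::field) \<Rightarrow> 'k) \<in> lieK S" "\<And>i. i \<in> A \<Longrightarrow> h i \<in> lieK S"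
    "(\<Psi> :: ('r \<Rightarrow> 'k) \<Rightarrow> 'k) \<in> lieK S"
  shows "kbr S (sum h A) \<Psi> = (\<Sum>i\<in>A. kbr S (h i) \<Psi>)" "kbr S \<Psi> (sum h A) = (\<Sum>i\<in>A. kbr S \<Psi> (h i))"
proof -
  have z: "kbr S (ksc 0 \<Psi>) \<Psi> = ksc 0 (kbr S \<Psi> \<Psi>)" "kbr S \<Psi> (ksc 0 \<Psi>) = ksc 0 (kbr S \<Psi> \<Psi>)"
    using kbr_bilinear[OF assms(3) assms(3) assms(3)] by blast+
  show "kbr S (sum h A) \<Psi> = (\<Sum>i\<in>A. kbr S (h i) \<Psi>)" "kbr S \<Psi> (sum h A) = (\<Sum>i\<in>A. kbr S \<Psi> (h i))"
    using assms(2)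
    by (induction A rule: infinite_finite_induct)
      (use z in \<open>simp_all add: ksc_add kbr_bilinear assms(1,3) lieK_sum\<close>)
qed

lemma expL_kbr:
  fixes t :: "'k::field"
  assumes xy: "x \<in> lieZ S" "y \<in> lieZ S"
  shows "expL S a t (ev S (br x y)) = kbr S (expL S a t (ev S x)) (expL S a t (ev S y))"
proof -
  obtain N where N: "\<forall>n\<ge>N. dp a n x = 0" "\<forall>n\<ge>N. dp a n y = 0"
    using common_bound[OF xy] by blast
  have z: "br (dp a i x) (dp a j y) = 0" if "i \<ge> N \<or> j \<ge> N" for i j
    using that N by (auto simp: br_alg)
  have d0: "\<forall>n\<ge>2*N. dp a n (br x y) = 0"
    unfolding dp_br by (intro allI impI sum.neutral) (auto intro!: z)
  note c = lieK_intros(1)[OF integrable_lieZ(1)[OF int xy(1)]] lieK_intros(1)[OF integrable_lieZ(1)[OF int xy(2)]]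
  have z0: "(0 :: ('r \<Rightarrow> 'k) \<Rightarrow> 'k) \<in> lieK S" by (rule lieK_zero[OF lieK_intros(1)[OF xy(1)]])
  have zL: "0 \<in> lieZ S" using lieZ_zero[OF xy(1)] .
  have ev_sum: "(ev S (sum h A) :: ('r \<Rightarrow> 'k) \<Rightarrow> 'k) = (\<Sum>i\<in>A. ev S (h i))" if "\<And>i. i \<in> A \<Longrightarrow> h i \<in> lieZ S" for h :: "nat \<Rightarrow> 'r" and A
    using that
    by (induction A rule: infinite_finite_induct)
      (simp_all add: ev_simps(1)[OF zL] ev_simps(3) lieZ_sum[OF zL])
  let ?g = "\<lambda>i j. ksc (t ^ (i + j)) (ev S (br (dp a i x) (dp a j y)))"
  have "expL S a t (ev S (br x y)) = (\<Sum>n<2*N. ksc (t ^ n) (ev S (dp a n (br x y))))"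
    by (rule expL_ev[OF lieZ.brack[OF xy] d0])
  also have "\<dots> = (\<Sum>n<2*N. \<Sum>i\<le>n. ?g i (n - i))"
    unfolding dp_br by (subst ev_sum) (auto simp: ksc_sum integrable_lieZ(1)[OF int] xy intro!: lieZ.brack)
  also have "\<dots> = (\<Sum>(i, j)\<in>{(i, j). i + j < 2 * N}. ?g i j)"
    by (rule sum.triangle_reindex[symmetric])
  \<comment> \<open>Terms with i or j at least N vanish, so the triangle i + j < 2 * N, on which the
    terms are collected by degree, may be replaced by the square on which the sum factors.\<close>
  also have "\<dots> = (\<Sum>(i, j)\<in>{..<N} \<times> {..<N}. ?g i j)"
  proof (rule sum.mono_neutral_right)
    have "{(i, j). i + j < 2 * N} \<subseteq> {..<2*N} \<times> {..<2*N}" by auto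
    then show "finite {(i, j). i + j < 2 * N}" by (rule finite_subset) simp
  qed (auto simp: z not_less ev_simps(1)[OF zL] ksc_add)
  also have "\<dots> = (\<Sum>i<N. \<Sum>j<N. ?g i j)" by (simp add: sum.cartesian_product)
  also have "\<dots> = (\<Sum>i<N. \<Sum>j<N. kbr S (ksc (t ^ i) (ev S (dp a i x))) (ksc (t ^ j) (ev S (dp a j y))))"
  proof (intro sum.cong refl)
    fix i j
    show "?g i j = kbr S (ksc (t ^ i) (ev S (dp a i x))) (ksc (t ^ j) (ev S (dp a j y)))"
      by (simp add: kbr_bilinear(2)[OF lieK_intros(3)[OF c(2)] c(1) c(1)] kbr_bilinear(4)[OF c(1) c(2) c(2)]
        kbr_ev[OF integrable_lieZ(1)[OF int xy(1)] integrable_lieZ(1)[OF int xy(2)]] ksc_add power_add)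
  qed
  also have "\<dots> = kbr S (\<Sum>i<N. ksc (t ^ i) (ev S (dp a i x))) (\<Sum>j<N. ksc (t ^ j) (ev S (dp a j y)))"
    by (simp add: kbr_sum z0 c lieK_intros lieK_sum) (rule sum.swap)
  finally show ?thesis by (simp add: expL_ev[OF xy(1) N(1)] expL_ev[OF xy(2) N(2)])
qed

lemma expL_end: "lie_end S (expL S a t)"
  by (rule lie_endI) (auto simp: expL_ev_closed expL_lin expL_kbr)

lemma expL_sum:
  fixes t :: "'k::field"
  assumes "(0 :: ('r \<Rightarrow> 'k) \<Rightarrow> 'k) \<in> lieK S" "\<And>i. i \<in> A \<Longrightarrow> h i \<in> lieK S"
  shows "expL S a t (sum h A) = (\<Sum>i\<in>A. expL S a t (h i))"
proof -
  have z: "expL S a t 0 = 0" using expL_lin(1)[OF assms(1), of t 0] by (simp add: ksc_add)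
  show ?thesis using assms(2)
    by (induction A rule: infinite_finite_induct) (simp_all add: z expL_lin(2) lieK_sum assms(1))
qed

text \<open>The binomial coefficients produced by \<open>dp_dp\<close>, read in k, are those of the
  binomial theorem for \<open>(s + t) ^ k\<close>; this is valid in every characteristic.\<close>

lemma expL_expL:
  fixes s t :: "'k::field"
  assumes "\<Psi> \<in> lieK S"
  shows "expL S a s (expL S a t \<Psi>) = expL S a (s + t) \<Psi>"
  using assms
proof (induction rule: lieK_induct)
  case (ev y)
  obtain N where N: "\<forall>n\<ge>N. dp a n y = 0" using common_bound[OF ev ev] by blast
  have dd: "\<forall>n\<ge>N. dp a n (dp a m y) = 0" for m using N by (simp add: dp_dp)
  have z0: "(0 :: ('r \<Rightarrow> 'k) \<Rightarrow> 'k) \<in> lieK S" by (rule lieK_zero[OF lieK_intros(1)[OF ev]])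
  note c = lieK_intros(1)[OF integrable_lieZ(1)[OF int ev]] and i = integrable_lieZ(1)[OF int ev]
  let ?g = "\<lambda>n m. ksc (of_nat (n + m choose n) * s ^ n * t ^ m) (ev S (dp a (n + m) y))"
  have "expL S a s (expL S a t (ev S y)) = (\<Sum>m<N. expL S a s (ksc (t ^ m) (ev S (dp a m y))))"
    by (simp add: expL_ev[OF ev N] expL_sum z0 c lieK_intros)
  also have "\<dots> = (\<Sum>m<N. \<Sum>n<N. ?g n m)"
    by (simp add: expL_lin(1) c expL_ev[OF i dd] ksc_sum dp_dp ev_of_nat[OF i] ksc_add mult_ac)
  also have "\<dots> = (\<Sum>n<N. \<Sum>m<N. ?g n m)" by (rule sum.swap)
  also have "\<dots> = (\<Sum>(n, m)\<in>{..<N} \<times> {..<N}. ?g n m)" by (simp add: sum.cartesian_product)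
  also have "\<dots> = (\<Sum>(n, m)\<in>{(n, m). n + m < 2 * N}. ?g n m)"
  proof (rule sum.mono_neutral_left)
    have "{(i, j). i + j < 2 * N} \<subseteq> {..<2*N} \<times> {..<2*N}" by auto
    then show "finite {(i, j). i + j < 2 * N}" by (rule finite_subset) simp
  qed (auto simp: N not_less ev_simps(1)[OF ev] ksc_add)
  also have "\<dots> = (\<Sum>k<2*N. \<Sum>n\<le>k. ?g n (k - n))" by (rule sum.triangle_reindex)
  also have "\<dots> = (\<Sum>k<2*N. ksc ((s + t) ^ k) (ev S (dp a k y)))"
    by (rule sum.cong) (simp_all add: binomial_ring ksc_sum_left)
  also have "\<dots> = expL S a (s + t) (ev S y)" by (rule expL_ev[OF ev, symmetric]) (simp add: N)
  finally show ?case .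
qed (simp_all add: expL_lin lie_endD[OF expL_end])

lemma expL_LA: "expL S a (t :: 'k::field) \<in> carrier (LA S)"
proof -
  have e0: "expL S a 0 \<Psi> = \<Psi>" if "\<Psi> \<in> lieK S" for \<Psi> :: "('r \<Rightarrow> 'k) \<Rightarrow> 'k"
    using that
  proof (induction rule: lieK_induct)
    case (ev y)
    obtain N where N: "\<forall>n\<ge>N. dp a n y = 0" using common_bound[OF ev ev] by blast
    have "expL S a 0 (ev S y) = (\<Sum>n<Suc N. ksc (0 ^ n) (ev S (dp a n y)))"
      by (rule expL_ev[OF ev]) (simp add: N)
    then show ?case by (subst (asm) sum.lessThan_Suc_shift) (simp add: ksc_add)
  qed (simp_all add: expL_lin)
  have inv: "expL S a (- t) (expL S a t \<Psi>) = \<Psi>" for t :: 'k and \<Psi>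
  proof (cases "\<Psi> \<in> lieK S")
    case False then show ?thesis by (simp add: expL_def)
  qed (simp add: expL_expL e0)
  from inv[of "- t"] inv[of t] have "bij (expL S a t)"
    by (intro bijI') (metis minus_minus)+
  then have "expL S a t permutes lieK S"
    by (auto simp: permutes_def expL_def bij_iff)
  then show ?thesis by (simp add: LA_def expL_end)
qed

text \<open>The explicit actions on chains and doublets are made of strings of length at most two,
  on which exp(t ad a) is 1 + t ad a.\<close>

lemma expL_string:
  fixes t :: "'k::field"
  assumes "y \<in> lieZ S" "z \<in> lieZ S" "br a y = z" "br a z = 0"
  shows "expL S a t (ev S y) = ev S y + ksc t (ev S z)" "expL S a t (ev S z) = ev S z"
proof -
  have d: "dp a (Suc 0) y = z" "dp a (Suc 0) z = 0" using assms(3,4) by (simp_all add: dp_Suc)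
  have 2: "dp a (Suc (Suc n)) y = 0" "dp a (Suc n) z = 0" for n
  proof -
    show "dp a (Suc n) z = 0" by (induction n) (simp_all add: dp_Suc assms br_alg)
    show "dp a (Suc (Suc n)) y = 0" by (induction n) (simp_all add: dp_Suc assms br_alg)
  qed
  have 3: "\<forall>n\<ge>2. dp a n y = 0"
  proof (intro allI impI)
    fix n :: nat assume "n \<ge> 2"
    then have "n = Suc (Suc (n - 2))" by simp
    then show "dp a n y = 0" using 2(1)[of "n - 2"] by simp
  qed
  have 4: "\<forall>n\<ge>1. dp a n z = 0"
  proof (intro allI impI)
    fix n :: nat assume "n \<ge> 1"
    then show "dp a n z = 0" using 2(2)[of "n - 1"] by simp
  qed
  show "expL S a t (ev S y) = ev S y + ksc t (ev S z)"
    using expL_ev[OF assms(1) 3, of t] by (simp add: numeral_2_eq_2 d ksc_add)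
  show "expL S a t (ev S z) = ev S z"
    using expL_ev[OF assms(2) 4, of t] by (simp add: ksc_add)
qed

end

section \<open>Elementary matrices\<close>

definition M3 :: "'k \<Rightarrow> 'k \<Rightarrow> 'k \<Rightarrow> 'k \<Rightarrow> 'k \<Rightarrow> 'k \<Rightarrow> 'k \<Rightarrow> 'k \<Rightarrow> 'k \<Rightarrow> 'k::field^3^3" where
  "M3 a b c d e f g h i = vector [vector [a, b, c], vector [d, e, f], vector [g, h, i]]"

definition M2 :: "'k \<Rightarrow> 'k \<Rightarrow> 'k \<Rightarrow> 'k \<Rightarrow> 'k::field^2^2" where
  "M2 a b c d = vector [vector [a, b], vector [c, d]]"

lemma M3_nth [simp]:
  "M3 a b c d e f g h i $ 1 $ 1 = a" "M3 a b c d e f g h i $ 1 $ 2 = b" "M3 a b c d e f g h i $ 1 $ 3 = c"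
  "M3 a b c d e f g h i $ 2 $ 1 = d" "M3 a b c d e f g h i $ 2 $ 2 = e" "M3 a b c d e f g h i $ 2 $ 3 = f"
  "M3 a b c d e f g h i $ 3 $ 1 = g" "M3 a b c d e f g h i $ 3 $ 2 = h" "M3 a b c d e f g h i $ 3 $ 3 = i"
  by (simp_all add: M3_def)

lemma M2_nth [simp]:
  "M2 a b c d $ 1 $ 1 = a" "M2 a b c d $ 1 $ 2 = b" "M2 a b c d $ 2 $ 1 = c" "M2 a b c d $ 2 $ 2 = d"
  by (simp_all add: M2_def)

lemma M3_cases: obtains a b c d e f g h i where "A = M3 a b c d e f g h i"
proof
  show "A = M3 (A$1$1) (A$1$2) (A$1$3) (A$2$1) (A$2$2) (A$2$3) (A$3$1) (A$3$2) (A$3$3)"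
    by (simp add: vec_eq_iff forall_3)
qed

lemma M2_cases: obtains a b c d where "A = M2 a b c d"
proof
  show "A = M2 (A$1$1) (A$1$2) (A$2$1) (A$2$2)"
    by (simp add: vec_eq_iff forall_2)
qed

lemma M3_eq: "M3 a b c d e f g h i = M3 a' b' c' d' e' f' g' h' i' \<longleftrightarrow>
    a = a' \<and> b = b' \<and> c = c' \<and> d = d' \<and> e = e' \<and> f = f' \<and> g = g' \<and> h = h' \<and> i = i'"
  by (auto simp add: vec_eq_iff forall_3)

lemma M2_eq: "M2 a b c d = M2 a' b' c' d' \<longleftrightarrow> a = a' \<and> b = b' \<and> c = c' \<and> d = d'"
  by (auto simp add: vec_eq_iff forall_2)

lemma M3_mult: "M3 a b c d e f g h i ** M3 a' b' c' d' e' f' g' h' i' =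
    M3 (a*a'+b*d'+c*g') (a*b'+b*e'+c*h') (a*c'+b*f'+c*i')
       (d*a'+e*d'+f*g') (d*b'+e*e'+f*h') (d*c'+e*f'+f*i')
       (g*a'+h*d'+i*g') (g*b'+h*e'+i*h') (g*c'+h*f'+i*i')"
  by (simp add: vec_eq_iff forall_3 matrix_matrix_mult_def sum_3)

lemma M2_mult: "M2 a b c d ** M2 a' b' c' d' = M2 (a*a'+b*c') (a*b'+b*d') (c*a'+d*c') (c*b'+d*d')"
  by (simp add: vec_eq_iff forall_2 matrix_matrix_mult_def sum_2)

lemma M3_one: "mat 1 = M3 1 0 0 0 1 0 0 0 1"
  by (simp add: vec_eq_iff forall_3 mat_def)

lemma M2_one: "mat 1 = M2 1 0 0 1"
  by (simp add: vec_eq_iff forall_2 mat_def)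

lemma M3_det: "det (M3 a b c d e f g h i) = a*e*i + b*f*g + c*d*h - a*f*h - b*d*i - c*e*g"
  by (simp add: det_3)

lemma M2_det: "det (M2 a b c d) = a * d - b * c" by (simp add: det_2)

lemma block_M2: "block_upper (M2 a b c d) = M3 a b 0 c d 0 0 0 1" "block_lower (M2 a b c d) = M3 1 0 0 0 a b 0 c d"
  by (simp_all add: block_upper_def block_lower_def M3_def)

abbreviation "x12 t \<equiv> M3 1 t 0 0 1 0 0 0 1"
abbreviation "x21 t \<equiv> M3 1 0 0 t 1 0 0 0 1"
abbreviation "x23 t \<equiv> M3 1 0 0 0 1 t 0 0 1"
abbreviation "x32 t \<equiv> M3 1 0 0 0 1 0 0 t 1"

text \<open>Generation by elementary matrices as an induction rule. If c is nonzero, an upper, a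
  lower and an upper factor suffice; if c = 0 then a is nonzero, and adding the first row to the
  second leads back to that case.\<close>

lemma SL2_induct [consumes 1, case_names mult x y]:
  fixes A :: "'k::field^2^2"
  assumes A: "det A = 1"
    and m: "\<And>A B. det A = 1 \<Longrightarrow> det B = 1 \<Longrightarrow> P A \<Longrightarrow> P B \<Longrightarrow> P (A ** B)"
    and x: "\<And>t. P (M2 1 t 0 1)" and y: "\<And>t. P (M2 1 0 t 1)"
  shows "P A"
proof -
  have nz: "P (M2 a b c d)" if "c \<noteq> 0" "a * d - b * c = 1" for a b c d
  proof -
    have "M2 a b c d = M2 1 ((a-1)/c) 0 1 ** (M2 1 0 c 1 ** M2 1 ((d-1)/c) 0 1)"
      using that by (simp add: M2_mult M2_eq field_simps)
    then show ?thesis by (simp add: m x y det_mul M2_det)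
  qed
  obtain a b c d where A': "A = M2 a b c d" by (rule M2_cases)
  show ?thesis
  proof (cases "c = 0")
    case True
    have "A = M2 1 0 (-1) 1 ** M2 a b (c + a) (d + b)" by (simp add: A' M2_mult M2_eq)
    moreover have "c + a \<noteq> 0" using A True by (auto simp: A' M2_det)
    moreover have "a * (d + b) - b * (c + a) = 1" using A by (simp add: A' M2_det algebra_simps)
    ultimately show ?thesis using nz[of "c + a" a "d + b" b] by (simp add: m y M2_det)
  next
    case False then show ?thesis using A nz by (simp add: A' M2_det)
  qed
qed

text \<open>The base cases are the root subgroups of the two simple roots and their negatives; the
  remaining two arise as commutators. A nonzero entry at (2,1) serves to make the corner entry 1,
  after which the first row and column are cleared and a lower SL_2 block remains.\<close>

lemma SL3_induct [consumes 1, case_names mult x12 x21 x23 x32]: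
  fixes A :: "'k::field^3^3"
  assumes A: "det A = 1"
    and m: "\<And>A B. det A = 1 \<Longrightarrow> det B = 1 \<Longrightarrow> P A \<Longrightarrow> P B \<Longrightarrow> P (A ** B)"
    and el: "\<And>t. P (x12 t)" "\<And>t. P (x21 t)" "\<And>t. P (x23 t)" "\<And>t. P (x32 t)"
  shows "P A"
proof -
  have x13: "P (M3 1 0 t 0 1 0 0 0 1)" for t
  proof -
    have "M3 1 0 t 0 1 0 0 0 1 = x12 1 ** (x23 t ** (x12 (-1) ** x23 (-t)))" by (simp add: M3_mult)
    then show ?thesis by (simp add: m el det_mul M3_det)
  qed
  have x31: "P (M3 1 0 0 0 1 0 t 0 1)" for t
  proof -
    have "M3 1 0 0 0 1 0 t 0 1 = x32 t ** (x21 1 ** (x32 (-t) ** x21 (-1)))" by (simp add: M3_mult)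
    then show ?thesis by (simp add: m el det_mul M3_det)
  qed
  have low: "P (block_lower B)" if "det B = 1" for B
    using that
  proof (induction B rule: SL2_induct)
    case (mult A B)
    have "block_lower (A ** B) = block_lower A ** block_lower B"
      by (rule M2_cases[of A], rule M2_cases[of B]) (simp add: block_M2 M2_mult M3_mult)
    moreover have "det (block_lower A) = det A" "det (block_lower B) = det B"
      by (rule M2_cases[of A], simp add: block_M2 M2_det M3_det, rule M2_cases[of B], simp add: block_M2 M2_det M3_det)
    ultimately show ?case using mult by (simp add: m)
  qed (simp_all add: block_M2 el)
  have one: "P (M3 1 b c d e f g h i)" if "det (M3 1 b c d e f g h i) = 1" for b c d e f g h i
  proof -
    have eq: "M3 1 b c d e f g h i = x21 d ** (M3 1 0 0 0 1 0 g 0 1 ** 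
        (block_lower (M2 (e - d * b) (f - d * c) (h - g * b) (i - g * c)) ** (M3 1 0 c 0 1 0 0 0 1 ** x12 b)))"
      by (simp add: block_M2 M3_mult algebra_simps)
    have "det (M2 (e - d * b) (f - d * c) (h - g * b) (i - g * c)) = 1"
      using that by (simp add: M2_det M3_det algebra_simps)
    moreover from this have "det (block_lower (M2 (e - d * b) (f - d * c) (h - g * b) (i - g * c))) = 1"
      by (simp add: block_M2 M2_det M3_det)
    ultimately show ?thesis unfolding eq by (simp add: m el x13 x31 low det_mul M3_det)
  qed
  have dnz: "P (M3 a b c d e f g h i)" if "det (M3 a b c d e f g h i) = 1" "d \<noteq> 0" for a b c d e f g h i
  proof -
    let ?s = "(1 - a) / d"
    have eq: "M3 a b c d e f g h i = x12 (- ?s) ** M3 1 (b + ?s * e) (c + ?s * f) d e f g h i"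
      using that(2) by (simp add: M3_mult)
    then have "det (M3 1 (b + ?s * e) (c + ?s * f) d e f g h i) = 1"
      using that(1) by (metis (no_types, lifting) M3_det det_mul mult_cancel_right2 add_0 diff_zero mult.right_neutral mult_zero_left mult_zero_right add.right_neutral)
    then show ?thesis unfolding eq by (simp only: m el one M3_det) (simp add: m el one M3_det)
  qed
  obtain a b c d e f g h i where A': "A = M3 a b c d e f g h i" by (rule M3_cases)
  have up: "P (M3 a b c d e f g h i)" if "P (M3 a b c (d + a) (e + b) (f + c) g h i)" "det (M3 a b c d e f g h i) = 1"
    for a b c d e f g h i
  proof -
    have "M3 a b c d e f g h i = x21 (-1) ** M3 a b c (d + a) (e + b) (f + c) g h i" by (simp add: M3_mult)
    moreover have "det (M3 a b c (d + a) (e + b) (f + c) g h i) = 1"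
      using that(2) by (simp add: M3_det algebra_simps)
    ultimately show ?thesis using that(1) by (simp add: m el M3_det)
  qed
  have up2: "P (M3 a b c d e f g h i)" if "P (M3 a b c (d + g) (e + h) (f + i) g h i)" "det (M3 a b c d e f g h i) = 1"
    for a b c d e f g h i
  proof -
    have "M3 a b c d e f g h i = x23 (-1) ** M3 a b c (d + g) (e + h) (f + i) g h i" by (simp add: M3_mult)
    moreover have "det (M3 a b c (d + g) (e + h) (f + i) g h i) = 1"
      using that(2) by (simp add: M3_det algebra_simps)
    ultimately show ?thesis using that(1) by (simp add: m el M3_det)
  qed
  show ?thesis
  proof (cases "d = 0")
    case True
    show ?thesis
    proof (cases "g = 0")
      case True2: True
      have "a \<noteq> 0" using A True True2 by (auto simp: A' M3_det)
      then have "P (M3 a b c (d + a) (e + b) (f + c) g h i)"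
        using A True by (intro dnz) (auto simp: A' M3_det algebra_simps)
      then show ?thesis unfolding A' by (rule up) (use A in \<open>simp add: A'\<close>)
    next
      case False
      then have "P (M3 a b c (d + g) (e + h) (f + i) g h i)"
        using A True by (intro dnz) (auto simp: A' M3_det algebra_simps)
      then show ?thesis unfolding A' by (rule up2) (use A in \<open>simp add: A'\<close>)
    qed
  next
    case False then show ?thesis using A dnz by (simp add: A')
  qed
qed

lemma matrix_inv_eqI:
  fixes A :: "'k::field^'n^'n"
  assumes "A ** B = mat 1" shows "matrix_inv A = B"
proof -
  have "B ** A = mat 1" using assms by (simp add: matrix_left_right_inverse)
  have "A ** matrix_inv A = mat 1" "matrix_inv A ** A = mat 1"
    using someI_ex[of "\<lambda>A'. A ** A' = mat 1 \<and> A' ** A = mat 1"] assms \<open>B ** A = mat 1\<close>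
    by (auto simp: matrix_inv_def)
  then show ?thesis by (metis assms matrix_mul_assoc matrix_mul_lid matrix_mul_rid)
qed

lemma matrix_inv_SL:
  fixes A :: "'k::field^'n^'n"
  assumes "det A = 1"
  shows "A ** matrix_inv A = mat 1" "matrix_inv A ** A = mat 1" "det (matrix_inv A) = 1"
proof -
  obtain B where B: "A ** B = mat 1"
    using assms by (metis invertible_det_nz invertible_def zero_neq_one)
  then show 1: "A ** matrix_inv A = mat 1" using matrix_inv_eqI[OF B] by simp
  then show "matrix_inv A ** A = mat 1" by (simp add: matrix_left_right_inverse)
  show "det (matrix_inv A) = 1" using arg_cong[OF 1, of det] assms by (simp add: det_mul)
qed

definition cof :: "'k::field^'n^'n \<Rightarrow> 'k^'n^'n" where "cof A = transpose (matrix_inv A)"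

lemma cof_mult:
  fixes A B :: "'k::field^'n^'n"
  assumes "det A = 1" "det B = 1"
  shows "cof (A ** B) = cof A ** cof B"
proof -
  have "(A ** B) ** (matrix_inv B ** matrix_inv A) = mat 1"
    by (metis assms matrix_inv_SL(1) matrix_mul_assoc matrix_mul_rid)
  then show ?thesis by (simp add: cof_def matrix_inv_eqI matrix_transpose_mul)
qed

lemma cof_det: "det A = 1 \<Longrightarrow> det (cof A) = 1"
  by (simp add: cof_def matrix_inv_SL)

lemma cof_eqI: "A ** transpose B = mat 1 \<Longrightarrow> cof A = B"
  by (simp add: cof_def matrix_inv_eqI)

lemma M3_transpose: "transpose (M3 a b c d e f g h i) = M3 a d g b e h c f i"
  by (simp add: transpose_def vec_eq_iff forall_3)

lemma M2_transpose: "transpose (M2 a b c d) = M2 a c b d"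
  by (simp add: transpose_def vec_eq_iff forall_2)

section \<open>Rank-two subgroups of the adjoint group\<close>

text \<open>Column j of A holds the coordinates of the image of c j, so composition corresponds to
  the matrix product. The vectors c i may be dependent over k; what is exploited is that A
  determines the values of \<open>\<theta>\<close> on them.\<close>

definition act :: "'r::real_algebra set \<Rightarrow> ((('r \<Rightarrow> 'k::field) \<Rightarrow> 'k) \<Rightarrow> (('r \<Rightarrow> 'k) \<Rightarrow> 'k)) \<Rightarrow> 'k^'n^'n \<Rightarrow> ('n::finite \<Rightarrow> 'r) \<Rightarrow> bool" where
  "act S \<theta> A c \<longleftrightarrow> (\<forall>j. \<theta> (ev S (c j)) = (\<Sum>i\<in>UNIV. ksc (A$i$j) (ev S (c i))))"

lemma lie_end_zero:
  fixes \<theta> :: "(('r::real_algebra \<Rightarrow> 'k::field) \<Rightarrow> 'k) \<Rightarrow> (('r \<Rightarrow> 'k) \<Rightarrow> 'k)"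
  assumes "lie_end S \<theta>" "(0 :: ('r \<Rightarrow> 'k) \<Rightarrow> 'k) \<in> lieK S"
  shows "\<theta> 0 = 0"
  using lie_endD(2)[OF assms, of 0] by (simp add: ksc_add)

lemma lie_end_sum:
  fixes \<theta> :: "(('r::real_algebra \<Rightarrow> 'k::field) \<Rightarrow> 'k) \<Rightarrow> (('r \<Rightarrow> 'k) \<Rightarrow> 'k)"
  assumes "lie_end S \<theta>" "(0 :: ('r \<Rightarrow> 'k) \<Rightarrow> 'k) \<in> lieK S" "\<And>i. i \<in> A \<Longrightarrow> h i \<in> lieK S"
  shows "\<theta> (sum h A) = (\<Sum>i\<in>A. \<theta> (h i))"
  using assms(3)
  by (induction A rule: infinite_finite_induct)
    (simp_all add: lie_end_zero[OF assms(1,2)] lie_endD[OF assms(1)] lieK_sum assms(2))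

lemma act_comp:
  fixes \<theta> \<theta>' :: "(('r::real_algebra \<Rightarrow> 'k::field) \<Rightarrow> 'k) \<Rightarrow> (('r \<Rightarrow> 'k) \<Rightarrow> 'k)"
  assumes "lie_end S \<theta>" "\<And>i. c i \<in> lieZ S" "act S \<theta> A c" "act S \<theta>' B c"
  shows "act S (\<theta> \<circ> \<theta>') (A ** B) c"
  unfolding act_def
proof
  fix j
  have L: "ev S (c i) \<in> lieK S" for i using assms(2) by (rule lieK_intros)
  have z: "(0 :: ('r \<Rightarrow> 'k) \<Rightarrow> 'k) \<in> lieK S" by (rule lieK_zero[OF L])
  have "(\<theta> \<circ> \<theta>') (ev S (c j)) = (\<Sum>i\<in>UNIV. ksc (B$i$j) (\<Sum>l\<in>UNIV. ksc (A$l$i) (ev S (c l))))"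
    using assms(3,4) by (simp add: act_def lie_end_sum[OF assms(1) z] lieK_intros L lie_endD[OF assms(1)])
  also have "\<dots> = (\<Sum>l\<in>UNIV. \<Sum>i\<in>UNIV. ksc (A$l$i * B$i$j) (ev S (c l)))"
    by (subst sum.swap) (simp add: ksc_sum ksc_add mult.commute)
  also have "\<dots> = (\<Sum>l\<in>UNIV. ksc ((A ** B)$l$j) (ev S (c l)))"
    by (simp add: matrix_matrix_mult_def ksc_sum_left)
  finally show "(\<theta> \<circ> \<theta>') (ev S (c j)) = (\<Sum>l\<in>UNIV. ksc ((A ** B)$l$j) (ev S (c l)))" .
qed

lemma act_3:
  fixes c :: "3 \<Rightarrow> 'r::real_algebra"
  shows "act S \<theta> A c \<longleftrightarrow> (\<forall>j. \<theta> (ev S (c j)) = ksc (A$1$j) (ev S (c 1)) + ksc (A$2$j) (ev S (c 2)) + ksc (A$3$j) (ev S (c 3)))"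
  by (simp add: act_def sum_3)

text \<open>For u adjacent to w but not to v: the lowest weight vector e_u and its successive images
  under ad e_w and ad e_v. Numbering from the top makes ad e_v and ad e_w act as the matrix units
  (1,2) and (2,3).\<close>

definition chain :: "('v \<Rightarrow> 'r::real_algebra) \<Rightarrow> 'v \<Rightarrow> 'v \<Rightarrow> 'v \<Rightarrow> 3 \<Rightarrow> 'r" where
  "chain e v w u = (\<lambda>i. if i = 3 then e u else if i = 2 then br (e w) (e u) else br (e v) (br (e w) (e u)))"

lemma chain_simps [simp]:
  "chain e v w u 1 = br (e v) (br (e w) (e u))" "chain e v w u 2 = br (e w) (e u)" "chain e v w u 3 = e u"
  by (simp_all add: chain_def)

text \<open>The Chevalley involution, applied to the hypotheses instead of the algebra: each fact
  about the e yields one about the f.\<close>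

lemma serre_swap: assumes "serre nb e f" shows "serre nb f e"
proof -
  interpret serre nb e f by fact
  show ?thesis
  proof
    show "nb u v \<Longrightarrow> nb v u" for u v by (rule nb_sym)
    show "\<not> nb v v" for v by (rule nb_irrefl)
    show "br (f u) (e v) = 0" if "u \<noteq> v" for u v using ef[of v u] that br_anti[of "f u" "e v"] by simp
    show "br (br (f v) (e v)) (f u) = cart nb v u *\<^sub>R f u" for u v
      by (subst br_anti) (simp add: br_alg hf)
    show "br (br (f v) (e v)) (e u) = - cart nb v u *\<^sub>R e u" for u v
      by (subst br_anti) (simp add: br_alg he)
  qed (fact ee ff eee fff)+
qed

context serre
begin

abbreviation gens where "gens \<equiv> range e \<union> range f"

lemma gens_lieZ: "e v \<in> lieZ gens" "f v \<in> lieZ gens"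
  by (auto intro: lieZ.incl)

lemma dp_const: "br a y = 0 \<Longrightarrow> dp a (Suc n) y = 0"
  by (induction n) (simp_all add: dp_Suc br_alg)

lemma cart_simps: "cart nb v v = 2" "nb u v \<Longrightarrow> cart nb u v = -1" "u \<noteq> v \<Longrightarrow> \<not> nb u v \<Longrightarrow> cart nb u v = 0"
  using nb_irrefl by (auto simp: cart_def)

lemma eh: "br (e u) (br (e v) (f v)) = - cart nb v u *\<^sub>R e u"
  using he[of v u] br_anti[of "e u" "br (e v) (f v)"] by simp

text \<open>On the generators the longest string is f_v, h_v, e_v. The Cartan entry 2 cancels the
  denominator 2!, so the second divided power takes f_v to -e_v, which lies in the Lie ring.\<close>

lemma integrable_e: "integrable_on (e v) gens"
  unfolding integrable_on_def
proof (intro ballI)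
  have *: "(\<forall>n. dp (e v) n y \<in> lieZ gens) \<and> (\<exists>N. \<forall>n\<ge>N. dp (e v) n y = 0)"
    if "y \<in> lieZ gens" "dp (e v) 1 y \<in> lieZ gens" "dp (e v) 2 y \<in> lieZ gens" "\<And>n. dp (e v) (Suc (Suc (Suc n))) y = 0" for y
  proof -
    have "dp (e v) n y \<in> lieZ gens" for n
    proof -
      consider "n = 0" | "n = 1" | "n = 2" | m where "n = Suc (Suc (Suc m))"
        by (metis One_nat_def Suc_1 not0_implies_Suc)
      then show ?thesis using that lieZ_zero[OF that(1)] by cases simp_all
    qed
    moreover have "dp (e v) n y = 0" if "n \<ge> 3" for n
      using that \<open>\<And>n. dp (e v) (Suc (Suc (Suc n))) y = 0\<close>[of "n - 3"] by (simp add: numeral_3_eq_3 Suc_diff_Suc)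
    ultimately show ?thesis by blast
  qed
  have zero: "(\<forall>n. dp (e v) n y \<in> lieZ gens) \<and> (\<exists>N. \<forall>n\<ge>N. dp (e v) n y = 0)" if "y \<in> lieZ gens" "br (e v) y = 0" for y
    using that lieZ_zero[OF that(1)] dp_const[OF that(2)] by (intro *) (simp_all add: numeral_2_eq_2)
  fix y assume "y \<in> gens"
  then consider u where "y = e u" "nb v u" | u where "y = e u" "\<not> nb v u" | u where "y = f u" "u \<noteq> v" | "y = f v" by blast
  then show "(\<forall>n. dp (e v) n y \<in> lieZ gens) \<and> (\<exists>N. \<forall>n\<ge>N. dp (e v) n y = 0)"
  proof cases
    case 1
    have 2: "dp (e v) (Suc (Suc n)) (e u) = 0" for n
      by (induction n) (simp_all add: dp_Suc 1 eee br_alg)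
    show ?thesis
      using lieZ.brack[OF gens_lieZ(1) gens_lieZ(1), of v u] lieZ_zero[OF gens_lieZ(1)]
      by (intro *) (simp_all add: 2 numeral_2_eq_2 gens_lieZ 1, simp add: dp_Suc)
  next
    case 2
    then have "br (e v) y = 0" using ee[of v u] by (cases "u = v") (auto simp: br_def)
    then show ?thesis using 2 gens_lieZ by (intro zero) auto
  next
    case 3
    then show ?thesis using gens_lieZ ef[of v u] by (intro zero) auto
  next
    case 4
    have 1: "dp (e v) 1 (f v) = br (e v) (f v)" by (simp add: dp_Suc)
    have 2: "dp (e v) 2 (f v) = - e v" by (simp add: numeral_2_eq_2 dp_Suc br_alg eh cart_simps)
    have 3: "dp (e v) (Suc (Suc (Suc n))) (f v) = 0" for n
      using 2 by (induction n) (simp_all add: dp_Suc[of _ "Suc (Suc _)"] br_alg numeral_2_eq_2, simp add: br_def)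
    show ?thesis unfolding 4
      by (intro *) (simp_all add: 1[simplified] 2[simplified] 3 gens_lieZ lieZ.brack lieZ_minus)
  qed
qed

lemma chain_lieZ: "chain e v w u i \<in> lieZ gens"
  by (auto simp: chain_def intro!: lieZ.brack gens_lieZ)

lemma chain_facts:
  assumes "nb v w" "nb w u" "\<not> nb v u" "u \<noteq> v"
  shows "br (e v) (e u) = 0" "br (e v) (br (e v) (br (e w) (e u))) = 0"
    "br (f v) (e u) = 0" "br (f v) (br (e w) (e u)) = 0" "br (f v) (br (e v) (br (e w) (e u))) = br (e w) (e u)"
    "br (e w) (br (e w) (e u)) = 0" "br (e w) (br (e v) (br (e w) (e u))) = 0"
    "br (f w) (e u) = 0" "br (f w) (br (e w) (e u)) = e u" "br (f w) (br (e v) (br (e w) (e u))) = 0"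
proof -
  have ne: "v \<noteq> w" "w \<noteq> u" using assms(1,2) nb_irrefl by auto
  have fe: "br (f x) (e y) = 0" if "x \<noteq> y" for x y
    using ef[of y x] that br_anti[of "f x" "e y"] by simp
  have fv: "br (f x) (br (e x) (e y)) = e y" if "nb x y" for x y
  proof -
    have "br (f x) (br (e x) (e y)) = br (br (f x) (e x)) (e y)"
      using fe[of x y] that nb_irrefl by (subst br_jacobi) (cases "x = y"; simp add: br_alg)
    also have "\<dots> = e y" using he[of x y] that
      by (subst br_anti) (simp add: br_alg cart_simps)
    finally show ?thesis .
  qed
  show 1: "br (e v) (e u) = 0" using ee[of v u] assms by simp
  show "br (f v) (e u) = 0" using fe assms by simp
  show fvc: "br (f v) (br (e w) (e u)) = 0" using assms ne by (subst br_jacobi) (simp add: fe br_alg)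
  show "br (f w) (e u) = 0" using fe ne by simp
  show "br (f w) (br (e w) (e u)) = e u" using fv assms by simp
  show 6: "br (e w) (br (e w) (e u)) = 0" using eee assms by simp
  show "br (f w) (br (e v) (br (e w) (e u))) = 0"
    using ne assms by (subst br_jacobi) (simp add: fe fv br_alg 1)
  have "br (e v) (br (e v) (br (e w) (e u))) = br (br (e v) (br (e v) (e w))) (e u)"
    by (simp add: br_jacobi[of "e v" "e w" "e u"] 1 br_alg) (simp add: br_jacobi[of "e v" "br (e v) (e w)" "e u"] 1 br_alg)
  then show "br (e v) (br (e v) (br (e w) (e u))) = 0" using eee[OF assms(1)] by (simp add: br_alg)
  have "br (f v) (br (e v) (br (e w) (e u))) = - br (br (e v) (f v)) (br (e w) (e u))"
    by (subst br_jacobi, subst br_anti[of "e v" "f v"]) (simp add: fvc br_alg)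
  also have "\<dots> = - (cart nb v w + cart nb v u) *\<^sub>R br (e w) (e u)"
    by (subst br_jacobi) (simp add: he br_alg algebra_simps)
  finally show "br (f v) (br (e v) (br (e w) (e u))) = br (e w) (e u)"
    using assms by (simp add: cart_simps)
  \<comment> \<open>Applying (ad e_w)^2 to [e_v, e_u] = 0 leaves twice the mixed term
    \<open>?q\<close>, since the Serre relations at w remove the two outer terms. Real scalars allow
    the division by 2.\<close>
  let ?q = "br (br (e w) (e v)) (br (e w) (e u))"
  have "0 = br (e w) (br (e w) (br (e v) (e u)))" by (simp add: 1 br_alg)
  also have "\<dots> = ?q + ?q"
    using eee[OF nb_sym[OF assms(1)]] 6
    by (simp add: br_jacobi[of "e w" "e v" "e u"] br_alg)
       (simp add: br_jacobi[of "e w" "br (e w) (e v)" "e u"] br_jacobi[of "e w" "e v" "br (e w) (e u)"] br_alg)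
  finally have "2 *\<^sub>R ?q = 0" by (simp add: scaleR_2)
  then have "?q = 0" by simp
  then show "br (e w) (br (e v) (br (e w) (e u))) = 0"
    by (subst br_jacobi) (simp add: 6 br_alg)
qed

lemma chain_act:
  fixes t :: "'k::field"
  assumes "nb v w" "nb w u" "\<not> nb v u" "u \<noteq> v" and int_f: "\<And>x. integrable_on (f x) gens"
  shows "act gens (expL gens (e v) t) (x12 t) (chain e v w u)"
    "act gens (expL gens (f v) t) (x21 t) (chain e v w u)"
    "act gens (expL gens (e w) t) (x23 t) (chain e v w u)"
    "act gens (expL gens (f w) t) (x32 t) (chain e v w u)"
proof -
  note cf = chain_facts[OF assms(1-4)]
  have c: "br (e w) (e u) \<in> lieZ gens" "br (e v) (br (e w) (e u)) \<in> lieZ gens"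
    by (auto intro: lieZ.brack gens_lieZ)
  have z: "0 \<in> lieZ gens" by (rule lieZ_zero[OF gens_lieZ(1)])
  have fix_: "expL gens a t (ev gens y) = ev gens y" if "integrable_on a gens" "br a y = 0" "y \<in> lieZ gens" for a y
    using expL_string(1)[OF that(1,3) z that(2), of t] by (simp add: br_alg ev_simps(1)[OF z] ksc_add)
  note s = expL_string[where S = gens]
  show "act gens (expL gens (e v) t) (x12 t) (chain e v w u)"
    unfolding act_3 forall_3
    by (simp add: ksc_add fix_ integrable_e cf gens_lieZ c s(1)[OF integrable_e c refl cf(2)] add.commute)
  show "act gens (expL gens (f v) t) (x21 t) (chain e v w u)"
    unfolding act_3 forall_3
    by (simp add: ksc_add fix_ int_f cf gens_lieZ c s(1)[OF int_f c(2,1) cf(5,4)] add.commute)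
  show "act gens (expL gens (e w) t) (x23 t) (chain e v w u)"
    unfolding act_3 forall_3
    by (simp add: ksc_add fix_ integrable_e cf gens_lieZ c s(1)[OF integrable_e gens_lieZ(1) c(1) refl cf(6)] add.commute)
  show "act gens (expL gens (f w) t) (x32 t) (chain e v w u)"
    unfolding act_3 forall_3
    by (simp add: ksc_add fix_ int_f cf gens_lieZ c s(1)[OF int_f c(1) gens_lieZ(1) cf(9,8)] add.commute)
qed

end

lemma LA_simps:
  "\<theta> \<in> carrier (LA S) \<longleftrightarrow> \<theta> permutes lieK S \<and> lie_end S \<theta>" "\<theta> \<otimes>\<^bsub>LA S\<^esub> \<theta>' = \<theta> \<circ> \<theta>'" "\<one>\<^bsub>LA S\<^esub> = id"
  by (simp_all add: LA_def)

lemma LA_comp: "\<theta> \<in> carrier (LA S) \<Longrightarrow> \<theta>' \<in> carrier (LA S) \<Longrightarrow> \<theta> \<circ> \<theta>' \<in> carrier (LA S)"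
  by (simp add: LA_simps permutes_compose lie_end_comp)

lemma LA_eqI:
  fixes S :: "'r::real_algebra set"
  assumes "\<theta> \<in> carrier (LA S)" "\<theta>' \<in> carrier (LA S)" "\<And>s. s \<in> S \<Longrightarrow> \<theta> (ev S s) = \<theta>' (ev S s)"
  shows "\<theta> = \<theta>'"
proof
  fix \<Psi>
  show "\<theta> \<Psi> = \<theta>' \<Psi>"
  proof (cases "\<Psi> \<in> lieK S")
    case True then show ?thesis using assms lie_end_eq[of S \<theta> \<theta>' \<Psi>] by (simp add: LA_simps)
  next
    case False then show ?thesis using assms(1,2) by (auto simp add: LA_simps permutes_def)
  qed
qed

lemma dp_commute:
  assumes "br a b = 0"
  shows "dp a n (dp b m y) = dp b m (dp a n y)"
proof -
  have ab: "br a (br b x) = br b (br a x)" for x using br_jacobi[of a b x] assms by (simp add: br_alg)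
  have "br a (dp b m x) = dp b m (br a x)" for x
    by (induction m) (simp_all add: dp_Suc br_alg ab)
  then show ?thesis by (induction n) (simp_all add: dp_Suc dp_lin br_alg)
qed

lemma expL_commute:
  fixes S :: "'r::real_algebra set" and s t :: "'k::field"
  assumes "integrable_on a S" "integrable_on b S" "br a b = 0"
  shows "expL S a s \<circ> expL S b t = expL S b t \<circ> expL S a s"
proof (rule LA_eqI)
  fix y assume "y \<in> S"
  then have y: "y \<in> lieZ S" by (rule lieZ.incl)
  have *: "(expL S a s \<circ> expL S b t) (ev S y) = (\<Sum>m<M. \<Sum>n<N. ksc (t ^ m * s ^ n) (ev S (dp a n (dp b m y))))"
    if "integrable_on a S" "integrable_on b S" "br a b = 0" "\<forall>n\<ge>N. dp a n y = 0" "\<forall>m\<ge>M. dp b m y = 0"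
    for a b and s t :: 'k and N M
  proof -
    have z: "(0 :: ('r \<Rightarrow> 'k) \<Rightarrow> 'k) \<in> lieK S" by (rule lieK_zero[OF lieK_intros(1)[OF y]])
    note i = integrable_lieZ(1)[OF that(2) y]
    have nz: "\<forall>n\<ge>N. dp a n (dp b m y) = 0" for m using that(4) by (simp add: dp_commute[OF that(3)] dp_lin)
    show ?thesis
      by (simp add: expL_ev[OF that(2) y that(5)] expL_sum[OF that(1) z] lieK_intros i
        expL_lin[OF that(1)] expL_ev[OF that(1) i nz] ksc_sum ksc_add)
  qed
  obtain N where N: "\<forall>n\<ge>N. dp a n y = 0" using integrable_lieZ(2)[OF assms(1) y] by blast
  obtain M where M: "\<forall>n\<ge>M. dp b n y = 0" using integrable_lieZ(2)[OF assms(2) y] by blast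
  have "br b a = 0" using assms(3) br_anti[of b a] by simp
  show "(expL S a s \<circ> expL S b t) (ev S y) = (expL S b t \<circ> expL S a s) (ev S y)"
    unfolding *[OF assms N M] *[OF assms(2,1) \<open>br b a = 0\<close> M N]
    by (subst sum.swap) (simp add: dp_commute[OF assms(3)] mult.commute)
qed (intro LA_comp expL_LA assms)+

definition D3 :: "'k::field^3^3" where "D3 = M3 1 0 0 0 (-1) 0 0 0 1"
definition P3 :: "'k::field^3^3" where "P3 = M3 0 0 1 0 1 0 1 0 0"
definition rev3 :: "'k::field^3^3 \<Rightarrow> 'k^3^3" where "rev3 A = P3 ** A ** P3"
text \<open>The inverse transpose sends \<open>x12 t\<close> to \<open>x21 (- t)\<close>;
  conjugation by \<open>D3\<close> removes the sign, so \<open>neg3\<close> realises the exchange of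
  e and f on root elements. Reversing the basis by \<open>rev3\<close> also interchanges the two
  ends of the edge, as is required for chains based at a neighbour of v.\<close>

definition neg3 :: "'k::field^3^3 \<Rightarrow> 'k^3^3" where "neg3 A = D3 ** cof A ** D3"

lemma rev3_mult: "rev3 (A ** B) = rev3 A ** rev3 B"
proof -
  have "P3 ** P3 = (mat 1 :: 'k::field^3^3)" by (simp add: P3_def M3_mult M3_one)
  then show ?thesis unfolding rev3_def by (metis matrix_mul_assoc matrix_mul_rid)
qed

lemma neg3_mult: "det A = 1 \<Longrightarrow> det B = 1 \<Longrightarrow> neg3 (A ** B) = neg3 A ** neg3 B"
proof -
  assume "det A = 1" "det B = 1"
  moreover have "D3 ** D3 = (mat 1 :: 'k::field^3^3)" by (simp add: D3_def M3_mult M3_one)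
  ultimately show ?thesis unfolding neg3_def by (metis matrix_mul_assoc matrix_mul_rid cof_mult)
qed

lemma cof_elt: "cof (x12 t) = x21 (-t)" "cof (x21 t) = x12 (-t)" "cof (x23 t) = x32 (-t)" "cof (x32 t) = x23 (-t)"
  by (rule cof_eqI, simp add: M3_transpose M3_mult M3_one)+

lemma elt_maps:
  "neg3 (x12 t) = x21 t" "neg3 (x21 t) = x12 t" "neg3 (x23 t) = x32 t" "neg3 (x32 t) = x23 t"
  "rev3 (x12 t) = x32 t" "rev3 (x21 t) = x23 t" "rev3 (x23 t) = x21 t" "rev3 (x32 t) = x12 t"
  by (simp_all add: neg3_def rev3_def cof_elt D3_def P3_def M3_mult)

context serre
begin

lemmas swap = serre_swap[OF serre_axioms]

lemma gens_swap: "range f \<union> range e = gens" by blast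

lemma integrable_f: "integrable_on (f v) gens"
  using serre.integrable_e[OF swap] by (simp only: gens_swap)

lemmas integ = integrable_e integrable_f

lemma chain_act_f:
  fixes t :: "'k::field"
  assumes "nb v w" "nb w u" "\<not> nb v u" "u \<noteq> v"
  shows "act gens (expL gens (f v) t) (x12 t) (chain f v w u)"
    "act gens (expL gens (e v) t) (x21 t) (chain f v w u)"
    "act gens (expL gens (f w) t) (x23 t) (chain f v w u)"
    "act gens (expL gens (e w) t) (x32 t) (chain f v w u)"
  using serre.chain_act[OF swap assms, of t] integrable_e unfolding gens_swap by blast+

lemma expL_fix:
  fixes t :: "'k::field"
  assumes "integrable_on a gens" "br a y = 0" "y \<in> lieZ gens"
  shows "expL gens a t (ev gens y) = ev gens y"
proof -
  have z: "0 \<in> lieZ gens" by (rule lieZ_zero[OF gens_lieZ(1)])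
  show ?thesis
    using expL_string(1)[OF assms(1,3) z assms(2), of t] by (simp add: br_alg ev_simps(1)[OF z] ksc_add)
qed

lemma far:
  assumes "u \<noteq> v" "\<not> nb u v"
  shows "br (e v) (e u) = 0" "br (f v) (e u) = 0" "br (e v) (f u) = 0" "br (f v) (f u) = 0"
  using assms nb_sym ee[of v u] ff[of v u] ef[of v u] ef[of u v] br_anti[of "f v" "e u"] by auto

lemma e_rec: "nb y u \<Longrightarrow> br (br (e y) (e u)) (f u) = e y"
proof -
  assume a: "nb y u"
  then have ne: "y \<noteq> u" using nb_irrefl by blast
  have "br (e y) (br (e u) (f u)) = br (br (e y) (e u)) (f u)"
    by (subst br_jacobi) (simp add: ef[OF ne] br_alg)
  then show ?thesis using eh[of y u] cart_simps(2)[OF nb_sym[OF a]] by simp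
qed

lemma e_rec2:
  assumes "nb z y" "nb y u" "z \<noteq> u"
  shows "br (br (e z) (br (e y) (e u))) (f u) = br (e z) (e y)"
proof -
  have "br (e z) (br (br (e y) (e u)) (f u)) = br (br (e z) (br (e y) (e u))) (f u)"
    by (subst br_jacobi) (simp add: ef[OF assms(3)] br_alg)
  then show ?thesis by (simp add: e_rec assms)
qed

lemmas f_rec = serre.e_rec[OF swap] and f_rec2 = serre.e_rec2[OF swap]

definition agree where
  "agree \<theta> \<theta>' x \<longleftrightarrow> x \<in> lieZ gens \<and> \<theta> (ev gens x) = \<theta>' (ev gens x)"

lemma agree_br:
  assumes "lie_end gens \<theta>" "lie_end gens \<theta>'" "agree \<theta> \<theta>' x" "agree \<theta> \<theta>' y"
  shows "agree \<theta> \<theta>' (br x y)"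
  using assms lieZ.brack
  by (auto simp: agree_def kbr_ev[symmetric] lie_endD(5) lieK_intros)

text \<open>Bracketing with f_u or e_u strips the outer vertex u off a chain, and bracketing with
  f_y or e_y then isolates z. So the values on the chains at u determine an endomorphism on the
  generators of the edge.\<close>

lemma agree_gen:
  assumes l: "lie_end gens \<theta>" "lie_end gens \<theta>'" and "nb z y" "nb y u" "z \<noteq> u"
    and a: "agree \<theta> \<theta>' (e u)" "agree \<theta> \<theta>' (f u)" "agree \<theta> \<theta>' (br (e y) (e u))" "agree \<theta> \<theta>' (br (f y) (f u))"
     "agree \<theta> \<theta>' (br (e z) (br (e y) (e u)))" "agree \<theta> \<theta>' (br (f z) (br (f y) (f u)))"
  shows "agree \<theta> \<theta>' (e y)" "agree \<theta> \<theta>' (f y)" "agree \<theta> \<theta>' (e z)" "agree \<theta> \<theta>' (f z)"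
proof -
  note b = agree_br[OF l]
  show y: "agree \<theta> \<theta>' (e y)" "agree \<theta> \<theta>' (f y)"
    using b[OF a(3,2)] b[OF a(4,1)] by (simp_all add: e_rec f_rec assms)
  have "agree \<theta> \<theta>' (br (e z) (e y))" "agree \<theta> \<theta>' (br (f z) (f y))"
    using b[OF a(5,2)] b[OF a(6,1)] by (simp_all add: e_rec2 f_rec2 assms)
  from b[OF this(1) y(2)] b[OF this(2) y(1)]
  show "agree \<theta> \<theta>' (e z)" "agree \<theta> \<theta>' (f z)" by (simp_all add: e_rec f_rec assms)
qed

text \<open>The adjoint action of the \<open>SL\<^sub>3\<close> of an edge \<open>{v, w}\<close> is pinned down by what it does to the generators at the
  other vertices \<open>u\<close>: as there are no triangles, \<open>e\<^sub>u\<close> and \<open>f\<^sub>u\<close> are either fixed or extreme vectors of a natural or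
  a dual natural module, whose basis is a \<open>chain\<close>. Both the existence and the uniqueness of the automorphism
  attached to a matrix are read off from this relation.\<close>

definition rel where
  "rel v w A \<theta> \<longleftrightarrow> \<theta> \<in> carrier (LA gens) \<and> (\<forall>u. u \<noteq> v \<and> u \<noteq> w \<longrightarrow>
     (nb w u \<longrightarrow> act gens \<theta> A (chain e v w u) \<and> act gens \<theta> (neg3 A) (chain f v w u)) \<and>
     (nb v u \<longrightarrow> act gens \<theta> (rev3 (neg3 A)) (chain e w v u) \<and> act gens \<theta> (rev3 A) (chain f w v u)) \<and>
     (\<not> nb w u \<and> \<not> nb v u \<longrightarrow> \<theta> (ev gens (e u)) = ev gens (e u) \<and> \<theta> (ev gens (f u)) = ev gens (f u)))"

lemma relI:
  assumes "\<theta> \<in> carrier (LA gens)"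
    "\<And>u. u \<noteq> v \<Longrightarrow> u \<noteq> w \<Longrightarrow> nb w u \<Longrightarrow> act gens \<theta> A (chain e v w u)"
    "\<And>u. u \<noteq> v \<Longrightarrow> u \<noteq> w \<Longrightarrow> nb w u \<Longrightarrow> act gens \<theta> (neg3 A) (chain f v w u)"
    "\<And>u. u \<noteq> v \<Longrightarrow> u \<noteq> w \<Longrightarrow> nb v u \<Longrightarrow> act gens \<theta> (rev3 (neg3 A)) (chain e w v u)"
    "\<And>u. u \<noteq> v \<Longrightarrow> u \<noteq> w \<Longrightarrow> nb v u \<Longrightarrow> act gens \<theta> (rev3 A) (chain f w v u)"
    "\<And>u. u \<noteq> v \<Longrightarrow> u \<noteq> w \<Longrightarrow> \<not> nb w u \<Longrightarrow> \<not> nb v u \<Longrightarrow> \<theta> (ev gens (e u)) = ev gens (e u)"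
    "\<And>u. u \<noteq> v \<Longrightarrow> u \<noteq> w \<Longrightarrow> \<not> nb w u \<Longrightarrow> \<not> nb v u \<Longrightarrow> \<theta> (ev gens (f u)) = ev gens (f u)"
  shows "rel v w A \<theta>"
  unfolding rel_def using assms by blast

lemma relD:
  assumes "rel v w A \<theta>" 
  shows "\<theta> \<in> carrier (LA gens)" "lie_end gens \<theta>"
    "u \<noteq> v \<Longrightarrow> u \<noteq> w \<Longrightarrow> nb w u \<Longrightarrow> act gens \<theta> A (chain e v w u)"
    "u \<noteq> v \<Longrightarrow> u \<noteq> w \<Longrightarrow> nb w u \<Longrightarrow> act gens \<theta> (neg3 A) (chain f v w u)"
    "u \<noteq> v \<Longrightarrow> u \<noteq> w \<Longrightarrow> nb v u \<Longrightarrow> act gens \<theta> (rev3 (neg3 A)) (chain e w v u)"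
    "u \<noteq> v \<Longrightarrow> u \<noteq> w \<Longrightarrow> nb v u \<Longrightarrow> act gens \<theta> (rev3 A) (chain f w v u)"
    "u \<noteq> v \<Longrightarrow> u \<noteq> w \<Longrightarrow> \<not> nb w u \<Longrightarrow> \<not> nb v u \<Longrightarrow> \<theta> (ev gens (e u)) = ev gens (e u)"
    "u \<noteq> v \<Longrightarrow> u \<noteq> w \<Longrightarrow> \<not> nb w u \<Longrightarrow> \<not> nb v u \<Longrightarrow> \<theta> (ev gens (f u)) = ev gens (f u)"
  using assms unfolding rel_def LA_simps by blast+

lemma chain_lieZ_f: "chain f v w u i \<in> lieZ gens"
  using serre.chain_lieZ[OF swap] by (simp add: gens_swap)

lemma rel_mult:
  assumes "det A = 1" "det B = 1" "rel v w A \<theta>" "rel v w B \<theta>'"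
  shows "rel v w (A ** B) (\<theta> \<circ> \<theta>')"
proof (rule relI)
  note A = relD[OF assms(3)] and B = relD[OF assms(4)]
  note ac = act_comp[OF A(2), of "chain e _ _ _", OF chain_lieZ] act_comp[OF A(2), of "chain f _ _ _", OF chain_lieZ_f]
  fix u
  show "\<theta> \<circ> \<theta>' \<in> carrier (LA gens)" using A(1) B(1) by (rule LA_comp)
  assume u: "u \<noteq> v" "u \<noteq> w"
  { assume n: "nb w u"
    show "act gens (\<theta> \<circ> \<theta>') (A ** B) (chain e v w u)" by (rule ac(1)[OF A(3)[OF u n] B(3)[OF u n]])
    show "act gens (\<theta> \<circ> \<theta>') (neg3 (A ** B)) (chain f v w u)"
      unfolding neg3_mult[OF assms(1,2)] by (rule ac(2)[OF A(4)[OF u n] B(4)[OF u n]]) }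
  { assume n: "nb v u"
    show "act gens (\<theta> \<circ> \<theta>') (rev3 (neg3 (A ** B))) (chain e w v u)"
      unfolding neg3_mult[OF assms(1,2)] rev3_mult by (rule ac(1)[OF A(5)[OF u n] B(5)[OF u n]])
    show "act gens (\<theta> \<circ> \<theta>') (rev3 (A ** B)) (chain f w v u)"
      unfolding rev3_mult by (rule ac(2)[OF A(6)[OF u n] B(6)[OF u n]]) }
  { assume n: "\<not> nb w u" "\<not> nb v u"
    show "(\<theta> \<circ> \<theta>') (ev gens (e u)) = ev gens (e u)" using A(7)[OF u n] B(7)[OF u n] by simp
    show "(\<theta> \<circ> \<theta>') (ev gens (f u)) = ev gens (f u)" using A(8)[OF u n] B(8)[OF u n] by simp }
qed

text \<open>\<open>rel\<close> says nothing directly about e_v, f_v, e_w and f_w; it is the chains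
  at an outside neighbour u of the edge that determine the values there. This is the reason for
  asking for such a u.\<close>

lemma rel_unique:
  assumes "rel v w A \<theta>" "rel v w A \<theta>'" "nb v w" "u \<noteq> v" "u \<noteq> w" "nb v u \<or> nb w u"
  shows "\<theta> = \<theta>'"
proof (rule LA_eqI[of _ gens])
  show L: "\<theta> \<in> carrier (LA gens)" "\<theta>' \<in> carrier (LA gens)" using assms(1,2) by (simp_all add: rel_def)
  then have l: "lie_end gens \<theta>" "lie_end gens \<theta>'" by (simp_all add: LA_simps)
  have ac: "agree \<theta> \<theta>' (c i)" if "act gens \<theta> B c" "act gens \<theta>' B c" "\<And>i. c i \<in> lieZ gens" for B and c :: "3 \<Rightarrow> 'r" and i
    using that by (simp add: act_def agree_def)
  note A = relD[OF assms(1)] and B = relD[OF assms(2)]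
  have ch: "agree \<theta> \<theta>' (chain e v w u i)" "agree \<theta> \<theta>' (chain f v w u i)" if n: "nb w u" and u: "u \<noteq> v" "u \<noteq> w" for u i
    using ac[OF A(3)[OF u n] B(3)[OF u n] chain_lieZ] ac[OF A(4)[OF u n] B(4)[OF u n] chain_lieZ_f] by simp_all
  have ch': "agree \<theta> \<theta>' (chain e w v u i)" "agree \<theta> \<theta>' (chain f w v u i)" if n: "nb v u" and u: "u \<noteq> v" "u \<noteq> w" for u i
    using ac[OF A(5)[OF u n] B(5)[OF u n] chain_lieZ] ac[OF A(6)[OF u n] B(6)[OF u n] chain_lieZ_f] by simp_all
  have out: "agree \<theta> \<theta>' (e u) \<and> agree \<theta> \<theta>' (f u)" if u: "u \<noteq> v" "u \<noteq> w" for u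
  proof -
    consider "nb w u" | "nb v u" | "\<not> nb w u" "\<not> nb v u" by blast
    then show ?thesis
    proof cases
      case 1 then show ?thesis using ch[OF 1 u, of 3] by simp
    next
      case 2 then show ?thesis using ch'[OF 2 u, of 3] by simp
    next
      case 3 then show ?thesis using A(7,8)[OF u 3] B(7,8)[OF u 3] gens_lieZ by (simp add: agree_def)
    qed
  qed
  have "agree \<theta> \<theta>' (e v) \<and> agree \<theta> \<theta>' (f v) \<and> agree \<theta> \<theta>' (e w) \<and> agree \<theta> \<theta>' (f w)"
    using assms(6)
  proof
    assume "nb v u"
    then show ?thesis
      using agree_gen[OF l nb_sym[OF assms(3)] \<open>nb v u\<close>] out[OF assms(4,5)] assms(4,5)
        ch'[OF \<open>nb v u\<close> assms(4,5), of 1] ch'[OF \<open>nb v u\<close> assms(4,5), of 2] by simp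
  next
    assume "nb w u"
    then show ?thesis
      using agree_gen[OF l assms(3) \<open>nb w u\<close>] out[OF assms(4,5)] assms(4,5)
        ch[OF \<open>nb w u\<close> assms(4,5), of 1] ch[OF \<open>nb w u\<close> assms(4,5), of 2] by simp
  qed
  then have "agree \<theta> \<theta>' (e u) \<and> agree \<theta> \<theta>' (f u)" for u using out by metis
  then show "\<theta> (ev gens s) = \<theta>' (ev gens s)" if "s \<in> gens" for s using that by (auto simp: agree_def)
qed

end

lemma block_mult: "block_upper (A ** B) = block_upper A ** block_upper B" "block_lower (A ** B) = block_lower A ** block_lower B"
  by (rule M2_cases[of A], rule M2_cases[of B], simp add: block_M2 M2_mult M3_mult)+

lemma block_det: "det (block_upper A) = det A" "det (block_lower A) = det A"
  by (rule M2_cases[of A], simp add: block_M2 M2_det M3_det)+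

section \<open>Representations of edge and vertex groups on the Kac-Moody algebra\<close>

locale kac_moody = serre nb e f
  for nb :: "'v \<Rightarrow> 'v \<Rightarrow> bool" and e f :: "'v \<Rightarrow> 'r::real_algebra" +
  assumes tri: "nb u v \<Longrightarrow> nb v w \<Longrightarrow> \<not> nb u w"
    and outer: "nb v w \<Longrightarrow> \<exists>u. u \<noteq> v \<and> u \<noteq> w \<and> (nb v u \<or> nb w u)"
begin

text \<open>As there are no triangles, an outside vertex is adjacent to at most one end of the edge,
  so the computation on chains applies wherever \<open>rel\<close> mentions one, and all other
  generators outside the edge are fixed.\<close>

lemma rel_elt:
  fixes t :: "'k::field"
  assumes "nb v w"
  shows "rel v w (x12 t) (expL gens (e v) t)" "rel v w (x21 t) (expL gens (f v) t)"
    "rel v w (x23 t) (expL gens (e w) t)" "rel v w (x32 t) (expL gens (f w) t)"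
proof -
  have wv: "nb w v" using assms nb_sym by blast
  have n1: "\<not> nb v u" if "nb w u" for u using tri[OF assms that] .
  have n2: "\<not> nb w u" if "nb v u" for u using tri[OF wv that] .
  have fix_: "expL gens (e x) t (ev gens (e u)) = ev gens (e u)" "expL gens (f x) t (ev gens (e u)) = ev gens (e u)"
     "expL gens (e x) t (ev gens (f u)) = ev gens (f u)" "expL gens (f x) t (ev gens (f u)) = ev gens (f u)"
     if "u \<noteq> x" "\<not> nb x u" for u x
    using that nb_sym by (auto intro!: expL_fix integ gens_lieZ far)
  note far_ = expL_LA[OF integrable_e] expL_LA[OF integrable_f] fix_
  note n = chain_act[OF assms _ n1 _ integrable_f] chain_act_f[OF assms _ n1]
    chain_act[OF wv _ n2 _ integrable_f] chain_act_f[OF wv _ n2]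
  show "rel v w (x12 t) (expL gens (e v) t)"
    by (rule relI; (simp only: elt_maps)?) (blast intro: far_ n)+
  show "rel v w (x21 t) (expL gens (f v) t)"
    by (rule relI; (simp only: elt_maps)?) (blast intro: far_ n)+
  show "rel v w (x23 t) (expL gens (e w) t)"
    by (rule relI; (simp only: elt_maps)?) (blast intro: far_ n)+
  show "rel v w (x32 t) (expL gens (f w) t)"
    by (rule relI; (simp only: elt_maps)?) (blast intro: far_ n)+
qed

text \<open>Since \<open>rel\<close> is closed under products and determines the automorphism, this
  definite description is automatically a homomorphism; elementary matrices enter to show that a
  related automorphism exists.\<close>

definition R3 :: "'v \<Rightarrow> 'v \<Rightarrow> 'k::field^3^3 \<Rightarrow> (('r \<Rightarrow> 'k) \<Rightarrow> 'k) \<Rightarrow> (('r \<Rightarrow> 'k) \<Rightarrow> 'k)" where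
  "R3 v w A = (THE \<theta>. rel v w A \<theta>)"

lemma R3_rel:
  fixes A :: "'k::field^3^3"
  assumes "nb v w" "det A = 1"
  shows "rel v w A (R3 v w A)"
proof -
  have "\<exists>\<theta>. rel v w A \<theta>"
    using assms(2)
  proof (induction A rule: SL3_induct)
    case (mult A B) then show ?case using rel_mult by blast
  qed (use rel_elt[OF assms(1)] in blast)+
  moreover obtain u where "u \<noteq> v" "u \<noteq> w" "nb v u \<or> nb w u" using outer[OF assms(1)] by blast
  ultimately have "\<exists>!\<theta>. rel v w A \<theta>" using rel_unique[OF _ _ assms(1)] by blast
  then show ?thesis unfolding R3_def by (rule theI')
qed

lemma R3_eqI:
  assumes "nb v w" "det A = 1" "rel v w A \<theta>"
  shows "R3 v w A = \<theta>"
  using outer[OF assms(1)] rel_unique[OF R3_rel[OF assms(1,2)] assms(3,1)] by blast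

lemma R3_elt:
  fixes t :: "'k::field"
  assumes "nb v w"
  shows "R3 v w (x12 t) = expL gens (e v) t" "R3 v w (x21 t) = expL gens (f v) t"
    "R3 v w (x23 t) = expL gens (e w) t" "R3 v w (x32 t) = expL gens (f w) t"
  using rel_elt[OF assms] by (auto intro!: R3_eqI[OF assms] simp: M3_det)

lemma R3_LA: "nb v w \<Longrightarrow> det A = 1 \<Longrightarrow> R3 v w A \<in> carrier (LA gens)"
  using R3_rel by (auto simp: rel_def)

lemma R3_mult: "nb v w \<Longrightarrow> det A = 1 \<Longrightarrow> det B = 1 \<Longrightarrow> R3 v w (A ** B) = R3 v w A \<circ> R3 v w B"
  by (rule R3_eqI) (auto intro!: rel_mult R3_rel simp: det_mul)

lemma R3_far:
  assumes "nb v w" "det A = 1" "u \<noteq> v" "u \<noteq> w" "\<not> nb v u" "\<not> nb w u"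
  shows "R3 v w A (ev gens (e u)) = ev gens (e u)" "R3 v w A (ev gens (f u)) = ev gens (f u)"
  using R3_rel[OF assms(1,2)] assms by (auto simp: rel_def)

text \<open>The automorphism does not depend on the neighbour \<open>w\<close>, as both choices agree on root subgroups.\<close>

definition R2 :: "'v \<Rightarrow> 'k::field^2^2 \<Rightarrow> (('r \<Rightarrow> 'k) \<Rightarrow> 'k) \<Rightarrow> (('r \<Rightarrow> 'k) \<Rightarrow> 'k)" where
  "R2 v A = R3 v (SOME w. nb v w) (block_upper A)"

lemma R2_elt:
  fixes t :: "'k::field"
  assumes "nb v w"
  shows "R2 v (M2 1 t 0 1) = expL gens (e v) t" "R2 v (M2 1 0 t 1) = expL gens (f v) t"
  using R3_elt[OF someI[of "nb v", OF assms]] by (simp_all add: R2_def block_M2)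

lemma R2_mult: "nb v w \<Longrightarrow> det A = 1 \<Longrightarrow> det B = 1 \<Longrightarrow> R2 v (A ** B) = R2 v A \<circ> R2 v B"
  unfolding R2_def block_mult by (rule R3_mult[OF someI[of "nb v"]]) (simp_all add: block_det)

lemma R2_LA: "nb v w \<Longrightarrow> det A = 1 \<Longrightarrow> R2 v A \<in> carrier (LA gens)"
  unfolding R2_def by (rule R3_LA[OF someI[of "nb v"]]) (simp_all add: block_det)

lemma R3_block:
  fixes A :: "'k::field^2^2"
  assumes "nb v w" "det A = 1"
  shows "R3 v w (block_upper A) = R2 v A" "R3 v w (block_lower A) = R2 w A"
proof -
  have wv: "nb w v" using assms nb_sym by blast
  show "R3 v w (block_upper A) = R2 v A"
    using assms(2)
    by (induction A rule: SL2_induct)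
      (simp_all add: block_mult block_det R3_mult[OF assms(1)] R2_mult[OF assms(1)] R2_elt[OF assms(1)] block_M2 R3_elt[OF assms(1)])
  show "R3 v w (block_lower A) = R2 w A"
    using assms(2)
    by (induction A rule: SL2_induct)
      (simp_all add: block_mult block_det R3_mult[OF assms(1)] R2_mult[OF wv] R2_elt[OF wv] block_M2 R3_elt[OF assms(1)])
qed

lemma comp_commute:
  assumes "X \<circ> Z = Z \<circ> X" "Y \<circ> Z = Z \<circ> Y"
  shows "(X \<circ> Y) \<circ> Z = Z \<circ> (X \<circ> Y)"
  using assms by (simp add: fun_eq_iff)

lemma R2_commute:
  fixes A B :: "'k::field^2^2"
  assumes "nb v v'" "nb u u'" "u \<noteq> v" "\<not> nb u v" "det A = 1" "det B = 1"
  shows "R2 u A \<circ> R2 v B = R2 v B \<circ> R2 u A"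
proof -
  have 0: "br (e u) (e v) = 0" "br (f u) (e v) = 0" "br (e u) (f v) = 0" "br (f u) (f v) = 0"
    using far[of v u] assms nb_sym by auto
  have 1: "R2 u A \<circ> expL gens a t = expL gens a t \<circ> R2 u A"
    if "integrable_on a gens" "br (e u) a = 0" "br (f u) a = 0" for a and t :: 'k
    using assms(5)
  proof (induction A rule: SL2_induct)
    case (mult A B) then show ?case by (simp only: R2_mult[OF assms(2)] comp_commute)
  qed (simp_all only: R2_elt[OF assms(2)] expL_commute integ that)
  have "R2 v B \<circ> R2 u A = R2 u A \<circ> R2 v B"
    using assms(6)
  proof (induction B rule: SL2_induct)
    case (mult A B) then show ?case by (simp only: R2_mult[OF assms(1)] comp_commute)
  qed (simp_all only: R2_elt[OF assms(1)] 1 integ 0)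
  then show ?thesis by simp
qed

lemma R2_far:
  fixes A :: "'k::field^2^2"
  assumes "nb v v'" "u \<noteq> v" "\<not> nb u v" "det A = 1"
  shows "R2 v A (ev gens (e u)) = ev gens (e u)" "R2 v A (ev gens (f u)) = ev gens (f u)"
proof -
  note 0 = far[OF assms(2,3)]
  show "R2 v A (ev gens (e u)) = ev gens (e u)"
    using assms(4) by (induction A rule: SL2_induct)
      (simp_all add: R2_mult[OF assms(1)] R2_elt[OF assms(1)] expL_fix integ 0 gens_lieZ)
  show "R2 v A (ev gens (f u)) = ev gens (f u)"
    using assms(4) by (induction A rule: SL2_induct)
      (simp_all add: R2_mult[OF assms(1)] R2_elt[OF assms(1)] expL_fix integ 0 gens_lieZ)
qed

text \<open>The vectors [e_v, e_u] and e_u behave like the standard basis of the natural module of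
  the SL_2 at v, the first being the highest weight vector; this explains the order of the
  family.\<close>

lemma R2_act_near:
  fixes A :: "'k::field^2^2"
  assumes "nb v u" "det A = 1"
  shows "act gens (R2 v A) A (\<lambda>i. if i = 2 then e u else br (e v) (e u))" (is "act _ _ _ ?c")
proof -
  have cz: "?c i \<in> lieZ gens" for i by (auto intro: lieZ.brack gens_lieZ)
  have ne: "u \<noteq> v" using assms(1) nb_irrefl by auto
  have 1: "br (e v) (br (e v) (e u)) = 0" using eee[OF assms(1)] .
  have 2: "br (f v) (e u) = 0" using ef[OF ne] br_anti[of "f v" "e u"] by simp
  have "br (f v) (br (e v) (e u)) = br (br (f v) (e v)) (e u)"
    by (subst br_jacobi) (simp add: 2 br_alg)
  also have "\<dots> = e u" using he[of v u] cart_simps(2)[OF assms(1)] by (subst br_anti) (simp add: br_alg)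
  finally have 3: "br (f v) (br (e v) (e u)) = e u" .
  have c: "br (e v) (e u) \<in> lieZ gens" by (intro lieZ.brack gens_lieZ)
  show ?thesis
    using assms(2)
  proof (induction A rule: SL2_induct)
    case (mult A B)
    have "lie_end gens (R2 v A)" using R2_LA[OF assms(1) mult(1)] by (simp add: LA_simps)
    then show ?case unfolding R2_mult[OF assms(1) mult(1,2)] by (rule act_comp[OF _ cz mult(3,4)])
  next
    case (x t)
    show ?case
      unfolding R2_elt[OF assms(1)] act_def forall_2 sum_2
      using expL_string[OF integrable_e gens_lieZ(1) c refl 1, of t] by (simp add: ksc_add add.commute)
  next
    case (y t)
    show ?case
      unfolding R2_elt[OF assms(1)] act_def forall_2 sum_2
      using expL_string[OF integrable_f c gens_lieZ(1) 3 2, of t] by (simp add: ksc_add add.commute)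
  qed
qed

end

section \<open>Locally finite products of automorphisms\<close>

text \<open>Only the factors that move x enter, and their set depends on x. If this set is infinite
  the fold returns x by default, so the product is meaningful under \<open>lfam\<close>, where it is
  finite.\<close>

definition lprod :: "'w set \<Rightarrow> ('w \<Rightarrow> 'x \<Rightarrow> 'x) \<Rightarrow> 'x \<Rightarrow> 'x" where
  "lprod W c x = Finite_Set.fold (\<lambda>w. c w) x {w \<in> W. c w x \<noteq> x}"

definition lfam :: "'r::real_algebra set \<Rightarrow> 'w set \<Rightarrow> ('w \<Rightarrow> (('r \<Rightarrow> 'k::field) \<Rightarrow> 'k) \<Rightarrow> (('r \<Rightarrow> 'k) \<Rightarrow> 'k)) \<Rightarrow> bool" where
  "lfam S W c \<longleftrightarrow> (\<forall>w\<in>W. c w \<in> carrier (LA S)) \<and>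
     (\<forall>w\<in>W. \<forall>w'\<in>W. w \<noteq> w' \<longrightarrow> c w \<circ> c w' = c w' \<circ> c w) \<and>
     (\<forall>s\<in>S. finite {w\<in>W. c w (ev S s) \<noteq> ev S s})"

context
  fixes S :: "'r::real_algebra set" and W :: "'w set"
begin

lemma lfam_commute: "lfam S W c \<Longrightarrow> comp_fun_commute_on W c"
  by standard (metis lfam_def)

lemma lfam_finite:
  assumes "lfam S W c"
  shows "finite {w\<in>W. c w \<Psi> \<noteq> \<Psi>}"
proof (cases "\<Psi> \<in> lieK S")
  case True
  have l: "lie_end S (c w)" if "w \<in> W" for w using assms that by (simp add: lfam_def LA_simps)
  have evs: "finite {w\<in>W. c w (ev S y) \<noteq> ev S y}" if "y \<in> lieZ S" for y
    using that
  proof (induction rule: lieZ.induct)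
    case (diff x y)
    have "{w\<in>W. c w (ev S (x - y)) \<noteq> ev S (x - y)} \<subseteq> {w\<in>W. c w (ev S x) \<noteq> ev S x} \<union> {w\<in>W. c w (ev S y) \<noteq> ev S y}"
      using diff(1,2) by (auto simp: ev_simps lie_endD[OF l] lieK_intros)
    then show ?case using diff(3,4) finite_subset by blast
  next
    case (brack x y)
    have "{w\<in>W. c w (ev S (br x y)) \<noteq> ev S (br x y)} \<subseteq> {w\<in>W. c w (ev S x) \<noteq> ev S x} \<union> {w\<in>W. c w (ev S y) \<noteq> ev S y}"
      using brack(1,2) by (auto simp: kbr_ev[symmetric] lie_endD[OF l] lieK_intros)
    then show ?case using brack(3,4) finite_subset by blast
  qed (use assms in \<open>simp add: lfam_def\<close>)
  show ?thesis using True
  proof (induction rule: lieK_induct)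
    case (add \<Psi> \<Psi>')
    have "{w\<in>W. c w (\<Psi> + \<Psi>') \<noteq> \<Psi> + \<Psi>'} \<subseteq> {w\<in>W. c w \<Psi> \<noteq> \<Psi>} \<union> {w\<in>W. c w \<Psi>' \<noteq> \<Psi>'}"
      using add by (auto simp: lie_endD[OF l])
    then show ?case using add finite_subset[OF _ finite_UnI] by blast
  next
    case (scale \<Psi> r)
    have "{w\<in>W. c w (ksc r \<Psi>) \<noteq> ksc r \<Psi>} \<subseteq> {w\<in>W. c w \<Psi> \<noteq> \<Psi>}"
      using scale(1) by (auto simp: lie_endD[OF l])
    then show ?case using scale(2) finite_subset by blast
  qed (rule evs)
next
  case False
  then have "c w \<Psi> = \<Psi>" if "w \<in> W" for w
    using assms that by (auto simp: lfam_def LA_simps permutes_def)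
  then have "{w\<in>W. c w \<Psi> \<noteq> \<Psi>} = {}" by auto
  then show ?thesis by (simp only: finite.emptyI)
qed

text \<open>The surplus factors in F fix \<open>\<Psi>\<close>; by commutativity they may be applied
  first, where they have no effect. A product can therefore be computed over any convenient finite
  superset.\<close>

lemma lprod_ext:
  assumes "lfam S W c" "finite F" "F \<subseteq> W" "\<And>w. w \<in> W - F \<Longrightarrow> c w \<Psi> = \<Psi>"
  shows "lprod W c \<Psi> = Finite_Set.fold c \<Psi> F"
proof -
  interpret comp_fun_commute_on W c by (rule lfam_commute[OF assms(1)])
  let ?F0 = "{w \<in> W. c w \<Psi> \<noteq> \<Psi>}"
  have sub: "?F0 \<subseteq> F" using assms(4) by auto
  have "Finite_Set.fold c \<Psi> (?F0 \<union> G) = Finite_Set.fold c \<Psi> ?F0" if "finite G" "G \<subseteq> F - ?F0" for G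
    using that
  proof (induction G)
    case (insert g G)
    have "Finite_Set.fold c \<Psi> (insert g (?F0 \<union> G)) = Finite_Set.fold c (c g \<Psi>) (?F0 \<union> G)"
    proof (rule fold_insert2)
      show "insert g (?F0 \<union> G) \<subseteq> W" using insert(4) assms(3) by auto
      show "finite (?F0 \<union> G)" using insert(1) lfam_finite[OF assms(1)] by simp
      show "g \<notin> ?F0 \<union> G" using insert(2,4) by auto
    qed
    moreover have "c g \<Psi> = \<Psi>" using insert(4) assms(3) by auto
    ultimately show ?case using insert by simp
  qed simp
  from this[of "F - ?F0"] have "Finite_Set.fold c \<Psi> F = Finite_Set.fold c \<Psi> ?F0"
    using sub assms(2) by (simp add: Un_absorb1)
  then show ?thesis by (simp add: lprod_def)
qed

lemma fold_LA:
  assumes "lfam S W c" "finite F" "F \<subseteq> W"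
  shows "(\<lambda>\<Psi>. Finite_Set.fold c \<Psi> F) \<in> carrier (LA S)"
proof -
  interpret comp_fun_commute_on W c by (rule lfam_commute[OF assms(1)])
  show ?thesis using assms(2,3)
  proof (induction F)
    case empty
    have "(id :: (('r \<Rightarrow> 'a) \<Rightarrow> 'a) \<Rightarrow> _) \<in> carrier (LA S)" by (simp add: LA_simps lie_end_def permutes_id)
    then show ?case by (simp add: id_def)
  next
    case (insert w F)
    have "c w \<circ> (\<lambda>\<Psi>. Finite_Set.fold c \<Psi> F) \<in> carrier (LA S)"
      using insert assms(1) by (intro LA_comp) (auto simp: lfam_def)
    moreover have "(\<lambda>\<Psi>. Finite_Set.fold c \<Psi> (insert w F)) = c w \<circ> (\<lambda>\<Psi>. Finite_Set.fold c \<Psi> F)"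
      using insert by (simp add: fun_eq_iff fold_insert)
    ultimately show ?case by simp
  qed
qed

lemma lprod_end:
  assumes "lfam S W c"
  shows "lie_end S (lprod W c)" and "\<Psi> \<notin> lieK S \<Longrightarrow> lprod W c \<Psi> = \<Psi>"
proof -
  \<comment> \<open>Finitely many arguments share one finite set of relevant factors, so each law of
    an endomorphism reduces to a finite product.\<close>
  have ex: "\<exists>F. finite F \<and> F \<subseteq> W \<and> (\<forall>\<Psi>\<in>X. lprod W c \<Psi> = Finite_Set.fold c \<Psi> F)" if "finite X" for X
  proof -
    have f: "finite (\<Union>\<Psi>\<in>X. {w \<in> W. c w \<Psi> \<noteq> \<Psi>})" using that lfam_finite[OF assms] by simp
    have "\<forall>\<Psi>\<in>X. lprod W c \<Psi> = Finite_Set.fold c \<Psi> (\<Union>\<Psi>\<in>X. {w \<in> W. c w \<Psi> \<noteq> \<Psi>})"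
      by (intro ballI lprod_ext[OF assms f]) auto
    with f show ?thesis by (intro exI[of _ "\<Union>\<Psi>\<in>X. {w \<in> W. c w \<Psi> \<noteq> \<Psi>}"]) auto
  qed
  have fe: "lie_end S (\<lambda>\<Psi>. Finite_Set.fold c \<Psi> F)" "(\<lambda>\<Psi>. Finite_Set.fold c \<Psi> F) permutes lieK S" if "finite F" "F \<subseteq> W" for F
    using fold_LA[OF assms that] by (simp_all add: LA_simps)
  show "lprod W c \<Psi> = \<Psi>" if n: "\<Psi> \<notin> lieK S" for \<Psi>
  proof -
    obtain F where "finite F" "F \<subseteq> W" "lprod W c \<Psi> = Finite_Set.fold c \<Psi> F" using ex[of "{\<Psi>}"] by auto
    then show ?thesis using fe(2) n by (simp add: permutes_def)
  qed
  show "lie_end S (lprod W c)"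
    unfolding lie_end_def
  proof (intro ballI conjI allI)
    fix \<Psi> \<Psi>' :: "('r \<Rightarrow> 'a) \<Rightarrow> 'a" and r assume L: "\<Psi> \<in> lieK S" "\<Psi>' \<in> lieK S"
    obtain F where F: "finite F" "F \<subseteq> W"
      and X: "\<forall>\<Phi>\<in>{\<Psi>, \<Psi>', \<Psi> + \<Psi>', kbr S \<Psi> \<Psi>', ksc r \<Psi>}. lprod W c \<Phi> = Finite_Set.fold c \<Phi> F"
      using ex[of "{\<Psi>, \<Psi>', \<Psi> + \<Psi>', kbr S \<Psi> \<Psi>', ksc r \<Psi>}"] by (metis finite.emptyI finite.insertI)
    note d = lie_endD[OF fe(1)[OF F] L(1)]
    show "lprod W c (\<Psi> + \<Psi>') = lprod W c \<Psi> + lprod W c \<Psi>'" "lprod W c (kbr S \<Psi> \<Psi>') = kbr S (lprod W c \<Psi>) (lprod W c \<Psi>')"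
      using X d(3,5)[OF L(2)] by simp_all
  next
    fix \<Psi> :: "('r \<Rightarrow> 'a) \<Rightarrow> 'a" and r assume L: "\<Psi> \<in> lieK S"
    obtain F where F: "finite F" "F \<subseteq> W"
      and X: "\<forall>\<Phi>\<in>{\<Psi>, ksc r \<Psi>}. lprod W c \<Phi> = Finite_Set.fold c \<Phi> F"
      using ex[of "{\<Psi>, ksc r \<Psi>}"] by (metis finite.emptyI finite.insertI)
    show "lprod W c \<Psi> \<in> lieK S" "lprod W c (ksc r \<Psi>) = ksc r (lprod W c \<Psi>)"
      using X lie_endD(1,2)[OF fe(1)[OF F] L] by simp_all
  qed
qed

lemma lfam_comp:
  assumes "lfam S W c" "lfam S W d" "\<And>w w'. w \<in> W \<Longrightarrow> w' \<in> W \<Longrightarrow> w \<noteq> w' \<Longrightarrow> c w \<circ> d w' = d w' \<circ> c w"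
  shows "lfam S W (\<lambda>w. c w \<circ> d w)"
  unfolding lfam_def
proof (intro conjI ballI impI)
  fix w w' assume w: "w \<in> W" "w' \<in> W" "w \<noteq> w'"
  have "c w (c w' x) = c w' (c w x)" "d w (d w' x) = d w' (d w x)" "c w (d w' x) = d w' (c w x)" "c w' (d w x) = d w (c w' x)" for x
    using w assms unfolding lfam_def fun_eq_iff comp_def by metis+
  then show "c w \<circ> d w \<circ> (c w' \<circ> d w') = c w' \<circ> d w' \<circ> (c w \<circ> d w)"
    by (intro ext) (metis comp_apply)
next
  fix s assume s: "s \<in> S"
  have "{w \<in> W. (c w \<circ> d w) (ev S s) \<noteq> ev S s} \<subseteq> {w \<in> W. c w (ev S s) \<noteq> ev S s} \<union> {w \<in> W. d w (ev S s) \<noteq> ev S s}"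
    by auto
  then show "finite {w \<in> W. (c w \<circ> d w) (ev S s) \<noteq> ev S s}"
    using lfam_finite[OF assms(1)] lfam_finite[OF assms(2)] finite_subset by blast
qed (use assms in \<open>auto simp: lfam_def intro!: LA_comp\<close>)

text \<open>Commutation is available only between factors at different indices; c w and d w need not
  commute. A factor c w with w outside the common finite set F fixes the image of
  \<open>\<Psi>\<close> under the product of the d, because it passes through that product to
  \<open>\<Psi>\<close> itself.\<close>

lemma lprod_comp:
  assumes c: "lfam S W c" and d: "lfam S W d" and cd: "\<And>w w'. w \<in> W \<Longrightarrow> w' \<in> W \<Longrightarrow> w \<noteq> w' \<Longrightarrow> c w \<circ> d w' = d w' \<circ> c w"
  shows "lprod W c \<circ> lprod W d = lprod W (\<lambda>w. c w \<circ> d w)"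
proof
  fix \<Psi>
  interpret c: comp_fun_commute_on W c by (rule lfam_commute[OF c])
  interpret d: comp_fun_commute_on W d by (rule lfam_commute[OF d])
  note b = lfam_comp[OF assms]
  interpret b: comp_fun_commute_on W "\<lambda>w. c w \<circ> d w" by (rule lfam_commute[OF b])
  define F where "F = {w\<in>W. c w \<Psi> \<noteq> \<Psi>} \<union> {w\<in>W. d w \<Psi> \<noteq> \<Psi>}"
  have F: "finite F" "F \<subseteq> W" using lfam_finite[OF c] lfam_finite[OF d] by (auto simp: F_def)
  have cd': "c w (Finite_Set.fold d x G) = Finite_Set.fold d (c w x) G" if "finite G" "G \<subseteq> W" "w \<in> W" "w \<notin> G" for w G x
    using that
  proof (induction G)
    case (insert g G)
    then have "c w \<circ> d g = d g \<circ> c w" by (intro cd) auto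
    then have "c w (d g y) = d g (c w y)" for y by (metis comp_apply)
    then show ?case using insert by (simp add: d.fold_insert)
  qed simp
  have dc': "d w (Finite_Set.fold c x G) = Finite_Set.fold c (d w x) G" if "finite G" "G \<subseteq> W" "w \<in> W" "w \<notin> G" for w G x
    using that
  proof (induction G)
    case (insert g G)
    then have "c g \<circ> d w = d w \<circ> c g" by (intro cd) auto
    then have "d w (c g y) = c g (d w y)" for y by (metis comp_apply)
    then show ?case using insert by (simp add: c.fold_insert)
  qed simp
  have "Finite_Set.fold c (Finite_Set.fold d x G) G = Finite_Set.fold (\<lambda>w. c w \<circ> d w) x G" if "finite G" "G \<subseteq> W" for G x
    using that
  proof (induction G)
    case (insert g G)
    then show ?case
      using dc'[of G g "Finite_Set.fold d x G"] by (simp add: c.fold_insert d.fold_insert b.fold_insert[unfolded comp_def])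
  qed simp
  moreover have "lprod W d \<Psi> = Finite_Set.fold d \<Psi> F" by (rule lprod_ext[OF d F]) (auto simp: F_def)
  moreover have "lprod W c (Finite_Set.fold d \<Psi> F) = Finite_Set.fold c (Finite_Set.fold d \<Psi> F) F"
  proof (rule lprod_ext[OF c F])
    fix w assume "w \<in> W - F"
    then show "c w (Finite_Set.fold d \<Psi> F) = Finite_Set.fold d \<Psi> F" using cd'[OF F, of w \<Psi>] by (auto simp: F_def)
  qed
  moreover have "lprod W (\<lambda>w. c w \<circ> d w) \<Psi> = Finite_Set.fold (\<lambda>w. c w \<circ> d w) \<Psi> F"
    by (rule lprod_ext[OF b F]) (auto simp: F_def)
  ultimately show "(lprod W c \<circ> lprod W d) \<Psi> = lprod W (\<lambda>w. c w \<circ> d w) \<Psi>" using F by simp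
qed

text \<open>The pointwise inverses form a family of the same kind, since they commute and move no
  further vectors; the two products cancel.\<close>

lemma lprod_LA:
  assumes c: "lfam S W c"
  shows "lprod W c \<in> carrier (LA S)"
proof -
  interpret L: group "LA S :: ((('r \<Rightarrow> 'a::field) \<Rightarrow> 'a) \<Rightarrow> (('r \<Rightarrow> 'a) \<Rightarrow> 'a)) monoid" by (rule LA_group)
  define d where "d w = inv\<^bsub>LA S\<^esub> (c w)" for w
  have cL: "c w \<in> carrier (LA S)" if "w \<in> W" for w using c that by (simp add: lfam_def)
  have dL: "d w \<in> carrier (LA S)" if "w \<in> W" for w using cL[OF that] by (simp add: d_def)
  have cd: "c w \<circ> d w = id" "d w \<circ> c w = id" if "w \<in> W" for w
    using L.r_inv[OF cL[OF that]] L.l_inv[OF cL[OF that]] by (simp_all add: d_def LA_simps)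
  have dx: "d w x = x" if "c w x = x" "w \<in> W" for w x
    using cd(2)[OF that(2)] that(1) by (metis comp_apply id_apply)
  have comm: "c w \<circ> d w' = d w' \<circ> c w" if "w \<in> W" "w' \<in> W" "w \<noteq> w'" for w w'
  proof -
    have 1: "c w \<circ> c w' = c w' \<circ> c w" using c that by (simp add: lfam_def)
    have "d w' \<circ> c w = d w' \<circ> (c w \<circ> c w') \<circ> d w'" by (simp only: comp_assoc cd[OF that(2)] comp_id)
    also have "\<dots> = (d w' \<circ> c w') \<circ> c w \<circ> d w'" by (simp only: 1 comp_assoc)
    finally show ?thesis by (simp only: cd[OF that(2)] id_comp)
  qed
  have d: "lfam S W d"
    unfolding lfam_def
  proof (intro conjI ballI impI)
    fix w w' assume w: "w \<in> W" "w' \<in> W" "w \<noteq> w'"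
    have "d w \<circ> d w' = d w \<circ> (d w' \<circ> c w) \<circ> d w" by (simp only: comp_assoc cd[OF w(1)] comp_id)
    also have "\<dots> = (d w \<circ> c w) \<circ> d w' \<circ> d w" by (simp only: comm[OF w, symmetric] comp_assoc)
    finally show "d w \<circ> d w' = d w' \<circ> d w" by (simp only: cd[OF w(1)] id_comp)
  next
    fix s assume "s \<in> S"
    have "{w \<in> W. d w (ev S s) \<noteq> ev S s} \<subseteq> {w \<in> W. c w (ev S s) \<noteq> ev S s}" using dx by auto
    then show "finite {w \<in> W. d w (ev S s) \<noteq> ev S s}" using lfam_finite[OF c] finite_subset by blast
  qed (rule dL)
  have "lprod W c' = id" if "\<And>w. w \<in> W \<Longrightarrow> c' w = id" for c' :: "'w \<Rightarrow> (('r \<Rightarrow> 'a) \<Rightarrow> 'a) \<Rightarrow> (('r \<Rightarrow> 'a) \<Rightarrow> 'a)"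
  proof
    fix \<Psi>
    have "{w \<in> W. c' w \<Psi> \<noteq> \<Psi>} = {}" using that by auto
    then show "lprod W c' \<Psi> = id \<Psi>" by (simp only: lprod_def fold_empty id_apply)
  qed
  note idp = this
  have "lprod W c \<circ> lprod W d = id"
    by (subst lprod_comp[OF c d comm]) (auto intro: idp cd)
  moreover have "lprod W d \<circ> lprod W c = id"
    by (subst lprod_comp[OF d c comm[symmetric]]) (auto intro: idp cd)
  ultimately have "bij (lprod W c)" by (intro o_bij)
  then show ?thesis
    using lprod_end[OF c] by (auto simp: LA_simps permutes_def bij_iff)
qed

lemma lprod_reindex:
  assumes "bij_betw g W' W"
  shows "lprod W' (\<lambda>w. c (g w)) = lprod W c"
proof
  fix x
  have i: "inj_on g {w \<in> W'. c (g w) x \<noteq> x}" and im: "g ` {w \<in> W'. c (g w) x \<noteq> x} = {w \<in> W. c w x \<noteq> x}"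
    using assms by (auto simp: bij_betw_def inj_on_def)
  show "lprod W' (\<lambda>w. c (g w)) x = lprod W c x"
    unfolding lprod_def im[symmetric] fold_image[OF i] by (simp add: comp_def)
qed

end

section \<open>The centre of the rank-one subgroups, and twists\<close>

lemma sl2_z_M2: "sl2_z = M2 (-1) 0 0 (-1)"
  by (simp add: sl2_z_def vec_eq_iff forall_2 mat_def)

lemma sl2_z_det: "det (sl2_z :: 'k::field^2^2) = 1" by (simp add: sl2_z_M2 M2_det)

text \<open>On the doublet of f_u the elements e_v and f_v change roles, so upper and lower
  unipotent matrices have to be interchanged, without a sign.\<close>

definition rev2 :: "'k::field^2^2 \<Rightarrow> 'k^2^2" where "rev2 A = M2 0 1 1 0 ** A ** M2 0 1 1 0"

lemma rev2_M2: "rev2 (M2 a b c d) = M2 d c b a" by (simp add: rev2_def M2_mult)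

lemma rev2_mult: "rev2 (A ** B) = rev2 A ** rev2 B"
  by (rule M2_cases[of A], rule M2_cases[of B]) (simp add: rev2_M2 M2_mult M2_eq algebra_simps)

lemma (in serre) doublet:
  assumes "nb v u"
  shows "br (e v) (br (e v) (e u)) = 0" "br (f v) (e u) = 0" "br (f v) (br (e v) (e u)) = e u"
proof -
  have ne: "u \<noteq> v" using assms nb_irrefl by auto
  show "br (e v) (br (e v) (e u)) = 0" using eee[OF assms] .
  show 2: "br (f v) (e u) = 0" using ef[OF ne] br_anti[of "f v" "e u"] by simp
  have "br (f v) (br (e v) (e u)) = br (br (f v) (e v)) (e u)"
    by (subst br_jacobi) (simp add: 2 br_alg)
  also have "\<dots> = e u" using he[of v u] cart_simps(2)[OF assms] by (subst br_anti) (simp add: br_alg)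
  finally show "br (f v) (br (e v) (e u)) = e u" .
qed

context kac_moody
begin

lemma R2_act_near_f:
  fixes A :: "'k::field^2^2"
  assumes "nb v u" "det A = 1"
  shows "act gens (R2 v A) (rev2 A) (\<lambda>i. if i = 2 then f u else br (f v) (f u))" (is "act _ _ _ ?c")
proof -
  have cz: "?c i \<in> lieZ gens" for i by (auto intro: lieZ.brack gens_lieZ)
  note d = serre.doublet[OF swap assms(1)]
  have c: "br (f v) (f u) \<in> lieZ gens" by (intro lieZ.brack gens_lieZ)
  show ?thesis
    using assms(2)
  proof (induction A rule: SL2_induct)
    case (mult A B)
    have "lie_end gens (R2 v A)" using R2_LA[OF assms(1) mult(1)] by (simp add: LA_simps)
    then show ?case unfolding R2_mult[OF assms(1) mult(1,2)] rev2_mult by (rule act_comp[OF _ cz mult(3,4)])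
  next
    case (x t)
    show ?case
      unfolding R2_elt[OF assms(1)] act_def forall_2 sum_2
      using expL_string[OF integrable_e c gens_lieZ(2) d(3,2), of t] by (simp add: ksc_add rev2_M2 add.commute)
  next
    case (y t)
    show ?case
      unfolding R2_elt[OF assms(1)] act_def forall_2 sum_2
      using expL_string[OF integrable_f gens_lieZ(2) c refl d(1), of t] by (simp add: ksc_add rev2_M2 add.commute)
  qed
qed

lemma R2_z_near:
  assumes "nb v u"
  shows "R2 v (sl2_z :: 'k::field^2^2) (ev gens (e u)) = - ev gens (e u)"
    "R2 v (sl2_z :: 'k::field^2^2) (ev gens (br (e v) (e u))) = - ev gens (br (e v) (e u))"
    "R2 v (sl2_z :: 'k::field^2^2) (ev gens (f u)) = - ev gens (f u)"
    "R2 v (sl2_z :: 'k::field^2^2) (ev gens (br (f v) (f u))) = - ev gens (br (f v) (f u))"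
  using R2_act_near[OF assms, of "sl2_z :: 'k^2^2"] R2_act_near_f[OF assms, of "sl2_z :: 'k^2^2"]
  unfolding act_def forall_2 sum_2 by (simp_all add: sl2_z_M2 M2_det rev2_M2 ksc_add)

lemma kbr_minus:
  fixes \<Psi> :: "('r \<Rightarrow> 'k::field) \<Rightarrow> 'k"
  assumes "\<Psi> \<in> lieK gens" "\<Psi>' \<in> lieK gens"
  shows "kbr gens (- \<Psi>) (- \<Psi>') = kbr gens \<Psi> \<Psi>'"
proof -
  have "kbr gens (ksc (-1) \<Psi>) (ksc (-1) \<Psi>') = ksc (-1) (ksc (-1) (kbr gens \<Psi> \<Psi>'))"
    by (simp only: kbr_bilinear(2)[OF lieK_intros(3)[OF assms(2)] assms(1,1)] kbr_bilinear(4)[OF assms(1,2,2)])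
  then show ?thesis by (simp add: ksc_add)
qed

text \<open>e_v is the bracket of [e_v, e_u] with f_u, and z acts by -1 on both; the signs cancel. A
  neighbour u thus enters although the statement concerns v alone.\<close>

lemma R2_z_self:
  assumes "nb v u"
  shows "R2 v (sl2_z :: 'k::field^2^2) (ev gens (e v)) = ev gens (e v)"
    "R2 v (sl2_z :: 'k::field^2^2) (ev gens (f v)) = ev gens (f v)"
proof -
  have l: "lie_end gens (R2 v (sl2_z :: 'k^2^2))"
    using R2_LA[OF assms sl2_z_det[where 'k = 'k]] by (simp add: LA_simps)
  note z = R2_z_near[OF assms, where 'k = 'k]
  have c: "br (e v) (e u) \<in> lieZ gens" "br (f v) (f u) \<in> lieZ gens" by (intro lieZ.brack gens_lieZ)+
  have "R2 v (sl2_z :: 'k^2^2) (kbr gens (ev gens (br (e v) (e u))) (ev gens (f u))) = kbr gens (ev gens (br (e v) (e u))) (ev gens (f u))"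
    "R2 v (sl2_z :: 'k^2^2) (kbr gens (ev gens (br (f v) (f u))) (ev gens (e u))) = kbr gens (ev gens (br (f v) (f u))) (ev gens (e u))"
    by (simp_all add: lie_endD(5)[OF l] lieK_intros gens_lieZ c z kbr_minus)
  then show "R2 v (sl2_z :: 'k^2^2) (ev gens (e v)) = ev gens (e v)"
    "R2 v (sl2_z :: 'k^2^2) (ev gens (f v)) = ev gens (f v)"
    by (simp_all add: kbr_ev c gens_lieZ e_rec f_rec assms)
qed

lemma R3_commute:
  assumes "nb v w" "det B = 1" "\<And>A. det A = 1 \<Longrightarrow> R2 v A \<circ> \<theta> = \<theta> \<circ> R2 v A" "\<And>A. det A = 1 \<Longrightarrow> R2 w A \<circ> \<theta> = \<theta> \<circ> R2 w A"
  shows "R3 v w B \<circ> \<theta> = \<theta> \<circ> R3 v w B"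
  using assms(2)
proof (induction B rule: SL3_induct)
  case (mult A B) then show ?case by (simp only: R3_mult[OF assms(1)] comp_commute)
next
  case (x12 t) then show ?case using assms(3)[of "M2 1 t 0 1"] by (simp only: R3_elt[OF assms(1)] R2_elt[OF assms(1)] M2_det) simp
next
  case (x21 t) then show ?case using assms(3)[of "M2 1 0 t 1"] by (simp only: R3_elt[OF assms(1)] R2_elt[OF assms(1)] M2_det) simp
next
  case (x23 t) then show ?case using assms(4)[of "M2 1 t 0 1"]
    by (simp only: R3_elt[OF assms(1)] R2_elt[OF nb_sym[OF assms(1)]] M2_det) simp
next
  case (x32 t) then show ?case using assms(4)[of "M2 1 0 t 1"]
    by (simp only: R3_elt[OF assms(1)] R2_elt[OF nb_sym[OF assms(1)]] M2_det) simp
qed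

end

text \<open>Twists act on matrices of every size. On SL_2 this is \<open>twist_act\<close>; on SL_3
  it is compatible with both block embeddings, so a twist can be carried from vertices to
  edges.\<close>

definition twm :: "'k::field twist \<Rightarrow> 'k^'n^'n \<Rightarrow> 'k^'n^'n" where
  "twm w A = (if fst w then cof (map_matrix (snd w) A) else map_matrix (snd w) A)"

lemma twist_act_twm: "twist_act w A = twm w A"
  by (simp add: twist_act_def twm_def cof_def Let_def)

definition tmul :: "'k::field twist \<Rightarrow> 'k twist \<Rightarrow> 'k twist" where
  "tmul w w' = (fst w \<noteq> fst w', snd w \<circ> snd w')"

lemma field_aut_props:
  assumes "field_aut \<sigma>"
  shows "\<sigma> 0 = 0" "\<sigma> 1 = 1" "\<sigma> (x + y) = \<sigma> x + \<sigma> y" "\<sigma> (x * y) = \<sigma> x * \<sigma> y" "\<sigma> (- x) = - \<sigma> x" "\<sigma> (x - y) = \<sigma> x - \<sigma> y"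
proof -
  note a = assms[unfolded field_aut_def]
  show "\<sigma> 1 = 1" "\<sigma> (x + y) = \<sigma> x + \<sigma> y" "\<sigma> (x * y) = \<sigma> x * \<sigma> y" using a by auto
  show z: "\<sigma> 0 = 0" using a by (metis add_cancel_right_left)
  have m: "\<sigma> (- x) = - \<sigma> x" for x using a z by (metis add.right_inverse add_eq_0_iff)
  then show "\<sigma> (- x) = - \<sigma> x" .
  show "\<sigma> (x - y) = \<sigma> x - \<sigma> y" using a m by (metis diff_conv_add_uminus)
qed

lemma tw_id: "(False, id) \<in> twist_set"
  by (simp add: twist_set_def field_aut_def)

lemma tmul_closed: "w \<in> twist_set \<Longrightarrow> w' \<in> twist_set \<Longrightarrow> tmul w w' \<in> twist_set"
  by (auto simp: twist_set_def tmul_def field_aut_def intro: bij_comp)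

lemma tmul_bij:
  assumes "w0 \<in> twist_set"
  shows "bij_betw (\<lambda>w. tmul w w0) twist_set (twist_set :: 'k::field twist set)"
proof -
  obtain t \<sigma> where w0: "w0 = (t, \<sigma>)" by (cases w0)
  define g where "g = inv_into UNIV \<sigma>"
  have s: "field_aut \<sigma>" using assms by (simp add: w0 twist_set_def)
  then have b: "bij \<sigma>" by (simp add: field_aut_def)
  have g: "g (\<sigma> x) = x" "\<sigma> (g x) = x" for x
    using b by (simp_all add: g_def bij_is_inj bij_is_surj surj_f_inv_f)
  have "field_aut g"
    unfolding field_aut_def
  proof (intro conjI allI)
    show "bij g" using g by (metis bijI')
    show "g 1 = 1" using field_aut_props(2)[OF s] g by metis
    show "g (x + y) = g x + g y" for x y using field_aut_props(3)[OF s] g by metis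
    show "g (x * y) = g x * g y" for x y using field_aut_props(4)[OF s] g by metis
  qed
  then have "(t, g) \<in> twist_set" by (simp add: twist_set_def)
  then have "tmul w (t, g) \<in> twist_set" if "w \<in> twist_set" for w using tmul_closed that by blast
  moreover have "tmul (tmul w w0) (t, g) = w" "tmul (tmul w (t, g)) w0 = w" for w
    by (cases w; auto simp: tmul_def w0 g fun_eq_iff)+
  ultimately show ?thesis
    using tmul_closed[OF _ assms] by (intro bij_betwI[where g = "\<lambda>w. tmul w (t, g)"]) auto
qed

lemma tmul_cancel: "w \<in> twist_set \<Longrightarrow> w' \<in> twist_set \<Longrightarrow> w0 \<in> twist_set \<Longrightarrow> tmul w w0 = tmul w' w0 \<Longrightarrow> w = w'"
  using tmul_bij[of w0] by (auto simp: bij_betw_def inj_on_def)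

lemma map_M2: "map_matrix \<sigma> (M2 a b c d) = M2 (\<sigma> a) (\<sigma> b) (\<sigma> c) (\<sigma> d)"
  by (simp add: map_matrix_def vec_eq_iff forall_2)

lemma map_M3: "map_matrix \<sigma> (M3 a b c d e f g h i) = M3 (\<sigma> a) (\<sigma> b) (\<sigma> c) (\<sigma> d) (\<sigma> e) (\<sigma> f) (\<sigma> g) (\<sigma> h) (\<sigma> i)"
  by (simp add: map_matrix_def vec_eq_iff forall_3)

lemma cof_M2: "a * d - b * c = 1 \<Longrightarrow> cof (M2 a b c d) = M2 d (- c) (- b) a"
  by (rule cof_eqI) (simp add: M2_transpose M2_mult M2_one M2_eq algebra_simps)

lemma cof_block:
  assumes "det A = 1"
  shows "cof (block_upper A) = block_upper (cof A)" "cof (block_lower A) = block_lower (cof A)"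
proof -
  obtain a b c d where A: "A = M2 a b c d" by (rule M2_cases)
  have d: "a * d - b * c = 1" using assms by (simp add: A M2_det)
  then show "cof (block_upper A) = block_upper (cof A)" "cof (block_lower A) = block_lower (cof A)"
    unfolding A cof_M2[OF d] block_M2
    by (intro cof_eqI; simp add: M3_transpose M3_mult M3_one M3_eq algebra_simps)+
qed

lemma map_det: "field_aut \<sigma> \<Longrightarrow> det (map_matrix \<sigma> A) = \<sigma> (det (A :: 'k::field^2^2))"
  "field_aut \<sigma> \<Longrightarrow> det (map_matrix \<sigma> B) = \<sigma> (det (B :: 'k::field^3^3))"
  by (rule M2_cases[of A], simp add: map_M2 M2_det field_aut_props,
      rule M3_cases[of B], simp add: map_M3 M3_det field_aut_props)

lemma map_mult:
  fixes A B :: "'k::field^2^2" and C D :: "'k^3^3"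
  assumes "field_aut \<sigma>"
  shows "map_matrix \<sigma> (A ** B) = map_matrix \<sigma> A ** map_matrix \<sigma> B"
    "map_matrix \<sigma> (C ** D) = map_matrix \<sigma> C ** map_matrix \<sigma> D"
  by (rule M2_cases[of A], rule M2_cases[of B], simp add: map_M2 M2_mult field_aut_props[OF assms],
      rule M3_cases[of C], rule M3_cases[of D], simp add: map_M3 M3_mult field_aut_props[OF assms])

lemma twm_props:
  fixes A A' :: "'k::field^2^2" and B B' :: "'k^3^3"
  assumes "w \<in> twist_set"
  shows "det A = 1 \<Longrightarrow> det (twm w A) = 1" "det B = 1 \<Longrightarrow> det (twm w B) = 1"
    "det A = 1 \<Longrightarrow> det A' = 1 \<Longrightarrow> twm w (A ** A') = twm w A ** twm w A'"
    "det B = 1 \<Longrightarrow> det B' = 1 \<Longrightarrow> twm w (B ** B') = twm w B ** twm w B'"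
    "det A = 1 \<Longrightarrow> twm w (block_upper A) = block_upper (twm w A)"
    "det A = 1 \<Longrightarrow> twm w (block_lower A) = block_lower (twm w A)"
    "twm w sl2_z = (sl2_z :: 'k^2^2)"
proof -
  have s: "field_aut (snd w)" using assms by (auto simp: twist_set_def)
  note m = map_det[OF s] map_mult[OF s] field_aut_props[OF s] cof_det cof_mult
  have mb: "map_matrix (snd w) (block_upper A) = block_upper (map_matrix (snd w) A)"
    "map_matrix (snd w) (block_lower A) = block_lower (map_matrix (snd w) A)"
    by (rule M2_cases[of A], simp add: block_M2 map_M2 map_M3 m)+
  show "det A = 1 \<Longrightarrow> det (twm w A) = 1" "det B = 1 \<Longrightarrow> det (twm w B) = 1"
    "det A = 1 \<Longrightarrow> det A' = 1 \<Longrightarrow> twm w (A ** A') = twm w A ** twm w A'"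
    "det B = 1 \<Longrightarrow> det B' = 1 \<Longrightarrow> twm w (B ** B') = twm w B ** twm w B'"
    "det A = 1 \<Longrightarrow> twm w (block_upper A) = block_upper (twm w A)"
    "det A = 1 \<Longrightarrow> twm w (block_lower A) = block_lower (twm w A)"
    by (simp_all add: twm_def m mb cof_block)
  show "twm w sl2_z = (sl2_z :: 'k^2^2)"
    by (simp add: twm_def sl2_z_M2 map_M2 m(5-) cof_M2)
qed

lemma twm_tmul:
  assumes "w \<in> twist_set" "w' \<in> twist_set" "det (A :: 'k::field^2^2) = 1"
  shows "twm (tmul w w') A = twm w (twm w' A)"
proof -
  obtain a b c d where A: "A = M2 a b c d" by (rule M2_cases)
  have d: "a * d - b * c = 1" using assms(3) by (simp add: A M2_det)
  have s: "field_aut (snd w)" "field_aut (snd w')" using assms by (auto simp: twist_set_def)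
  have d': "snd w' a * snd w' d - snd w' b * snd w' c = 1"
    using field_aut_props[OF s(2)] d by metis
  then have d'': "snd w (snd w' a) * snd w (snd w' d) - snd w (snd w' b) * snd w (snd w' c) = 1"
    using field_aut_props[OF s(1)] by metis
  show ?thesis
    using d' d'' by (auto simp: twm_def tmul_def A map_M2 cof_M2 field_aut_props[OF s(1)] algebra_simps)
qed

lemma twm_id: "twm (False, id) A = A" by (simp add: twm_def map_matrix_def vec_eq_iff)

lemma lprod_cong:
  assumes "lfam S W c" "\<And>w. w \<in> W \<Longrightarrow> c w = c' w"
  shows "lprod W c = lprod W c'"
proof
  fix x
  have c': "lfam S W c'" using assms by (simp add: lfam_def cong: conj_cong)
  have eq: "{w \<in> W. c' w x \<noteq> x} = {w \<in> W. c w x \<noteq> x}" using assms(2) by auto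
  show "lprod W c x = lprod W c' x"
    unfolding lprod_def eq
    by (rule Finite_Set.fold_cong[OF lfam_commute[OF assms(1)] lfam_commute[OF c']])
      (use assms lfam_finite[OF assms(1)] in auto)
qed

section \<open>The covering graph\<close>

locale twisted_graph =
  fixes I :: "nat set" and E T :: "nat set set" and \<omega> :: "nat set \<Rightarrow> 'k::field twist"
  assumes simple: "finite_simple_graph I E" and card3: "3 \<le> card I"
    and conn: "connected_graph I E" and no_triangle: "triangle_free E"
    and \<omega>: "\<forall>e \<in> E - T. \<omega> e \<in> twist_set"
begin

definition om :: "nat set \<Rightarrow> 'k twist" where "om e = (if e \<in> T then (False, id) else \<omega> e)"

lemma om_tw: "e \<in> E \<Longrightarrow> om e \<in> twist_set"
  using \<omega> tw_id by (auto simp: om_def)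

lemma edge: "{i, j} \<in> E \<Longrightarrow> i \<in> I \<and> j \<in> I \<and> i \<noteq> j"
  using simple unfolding finite_simple_graph_def by (metis doubleton_eq_iff)

lemma edge_tri: "{i, j} \<in> E \<Longrightarrow> {j, l} \<in> E \<Longrightarrow> {i, l} \<notin> E"
proof
  assume e: "{i, j} \<in> E" "{j, l} \<in> E" "{i, l} \<in> E"
  then have "i \<noteq> j" "j \<noteq> l" "i \<noteq> l" using edge by blast+
  then have "is_circuit E [i, j, l]"
    using e by (auto simp: is_circuit_def less_Suc_eq nth_Cons' insert_commute)
  then show False using no_triangle by (auto simp: triangle_free_def)
qed

lemma path_leaves:
  assumes "(i, j) \<in> (adj E)\<^sup>*" "i \<in> X" "j \<notin> X"
  shows "\<exists>a b. a \<in> X \<and> b \<notin> X \<and> {a, b} \<in> E"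
  using assms
proof (induction rule: rtrancl_induct)
  case (step y z)
  then show ?case by (cases "y \<in> X") (auto simp: adj_def)
qed simp

lemma fin: "finite I" using simple by (simp add: finite_simple_graph_def)

text \<open>Applied to sets of one and of two vertices: the former gives each vertex a neighbour,
  the latter gives each edge the outside neighbour that pins down its automorphisms.\<close>

lemma leaves:
  assumes "X \<subseteq> I" "X \<noteq> {}" "card X < 3"
  shows "\<exists>a\<in>X. \<exists>b\<in>I - X. {a, b} \<in> E"
proof -
  obtain j where "j \<in> I" "j \<notin> X"
    using assms card3 by (metis card_mono fin infinite_super linorder_not_less order_less_le_trans subsetI not_le)
  moreover obtain i where "i \<in> X" using assms by blast
  ultimately obtain a b where "a \<in> X" "b \<notin> X" "{a, b} \<in> E"
    using path_leaves[of i j X] conn assms(1) unfolding connected_graph_def by blast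
  then show ?thesis using edge by blast
qed

lemma neighbor: "i \<in> I \<Longrightarrow> \<exists>j. {i, j} \<in> E"
  using leaves[of "{i}"] by auto

text \<open>The vertices of the covering are all pairs \<open>(i, w)\<close> with \<open>w\<close> in the group of twists; it is in general disconnected.
  A group of the amalgam acts on its Kac-Moody algebra by a product over the fibre, and the shift of the second
  component along an edge absorbs the twist in the connecting map of the amalgam.\<close>

fun cov :: "nat \<times> 'k twist \<Rightarrow> nat \<times> 'k twist \<Rightarrow> bool" where
  "cov (i, w) (j, w') \<longleftrightarrow> w \<in> twist_set \<and> w' \<in> twist_set \<and> {i, j} \<in> E \<and>
     (if i < j then w' = tmul w (om {i, j}) else w = tmul w' (om {i, j}))"

text \<open>Unique lifting of edges. Towards the larger label the lift is right translation by
  \<open>om {i, j}\<close>, towards the smaller one its inverse, which exists because the twists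
  form a group.\<close>

lemma cov_lift:
  assumes "{i, j} \<in> E" "w \<in> twist_set"
  shows "\<exists>!w'. cov (i, w) (j, w')"
proof (cases "i < j")
  case True
  then show ?thesis
    using assms tmul_closed[OF assms(2) om_tw[OF assms(1)]]
    by (intro ex1I[of _ "tmul w (om {i, j})"]) simp_all
next
  case False
  have b: "bij_betw (\<lambda>w. tmul w (om {i, j})) twist_set twist_set"
    by (rule tmul_bij[OF om_tw[OF assms(1)]])
  then have "w \<in> (\<lambda>w. tmul w (om {i, j})) ` twist_set"
    using assms(2) by (simp add: bij_betw_def)
  then obtain w' where "w' \<in> twist_set" "tmul w' (om {i, j}) = w"
    by (elim imageE) simp
  then show ?thesis
    using False assms tmul_cancel[OF _ _ om_tw[OF assms(1)]] by (intro ex1I[of _ w']) auto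
qed

lemma cov_sym: "cov x y \<Longrightarrow> cov y x"
proof (cases x; cases y)
  fix i w j w' assume "cov x y" "x = (i, w)" "y = (j, w')"
  then show "cov y x" using edge[of i j] by (auto simp: insert_commute)
qed

lemma cov_edge: "cov (i, w) (j, w') \<Longrightarrow> {i, j} \<in> E \<and> w \<in> twist_set \<and> w' \<in> twist_set" by simp

lemma cov_up: "{i, j} \<in> E \<Longrightarrow> i < j \<Longrightarrow> w \<in> twist_set \<Longrightarrow> cov (i, w) (j, tmul w (om {i, j}))"
  using tmul_closed[of w "om {i, j}"] om_tw[of "{i, j}"] by simp

lemma cov_upD: "cov (i, w) (j, w') \<Longrightarrow> i < j \<Longrightarrow> w' = tmul w (om {i, j})"
  by simp

declare cov.simps [simp del]

lemma cov_tri: "cov x y \<Longrightarrow> cov y z \<Longrightarrow> \<not> cov x z"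
  using edge_tri by (cases x; cases y; cases z) (blast dest: cov_edge)

lemma cov_outer: "cov x y \<Longrightarrow> \<exists>u. u \<noteq> x \<and> u \<noteq> y \<and> (cov x u \<or> cov y u)"
proof (cases x; cases y)
  fix i w j w' assume c: "cov x y" "x = (i, w)" "y = (j, w')"
  then have e: "{i, j} \<in> E" "w \<in> twist_set" "w' \<in> twist_set" by (blast dest: cov_edge)+
  have "\<exists>a\<in>{i, j}. \<exists>l\<in>I - {i, j}. {a, l} \<in> E"
    by (rule leaves) (use edge[OF e(1)] in auto)
  then obtain a l where l: "l \<noteq> i" "l \<noteq> j" "a = i \<or> a = j" "{a, l} \<in> E" by blast
  then obtain w'' where "cov (i, w) (l, w'') \<or> cov (j, w') (l, w'')"
    using cov_lift[of i l w] cov_lift[of j l w'] e by blast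
  then show ?thesis using c l by (intro exI[of _ "(l, w'')"]) auto
qed

lemma cov_irrefl: "\<not> cov x x"
proof -
  obtain i w where "x = (i, w)" by (cases x)
  then show ?thesis using edge[of i i] cov_edge[of i w i w] by auto
qed

end

section \<open>Action of the amalgam on the Kac-Moody algebra of the covering\<close>

locale twisted_rep = twisted_graph I E T \<omega> + kac_moody cov e f
  for I E T and \<omega> :: "nat set \<Rightarrow> 'k::field twist" and e f :: "nat \<times> 'k twist \<Rightarrow> 'r::real_algebra"
begin

abbreviation tws where "tws \<equiv> (twist_set :: 'k twist set)"

definition gam_fam :: "nat \<Rightarrow> 'k^2^2 \<Rightarrow> 'k twist \<Rightarrow> (('r \<Rightarrow> 'k) \<Rightarrow> 'k) \<Rightarrow> (('r \<Rightarrow> 'k) \<Rightarrow> 'k)" where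
  "gam_fam i A w = R2 (i, w) (twm w A)"

text \<open>The lifts of an edge are indexed by the sheet w of the end with the smaller label; the
  other end then lies in the sheet shifted by \<open>om {i, j}\<close>.\<close>

definition del_fam :: "nat \<Rightarrow> nat \<Rightarrow> 'k^3^3 \<Rightarrow> 'k twist \<Rightarrow> (('r \<Rightarrow> 'k) \<Rightarrow> 'k) \<Rightarrow> (('r \<Rightarrow> 'k) \<Rightarrow> 'k)" where
  "del_fam i j B w = R3 (i, w) (j, tmul w (om {i, j})) (twm w B)"

definition gam where "gam i A = lprod tws (gam_fam i A)"
definition del where "del i j B = lprod tws (del_fam i j B)"

lemma nbr:
  assumes "i \<in> I" "w \<in> twist_set"
  shows "\<exists>y. cov (i, w) y"
  using neighbor[OF assms(1)] cov_lift[OF _ assms(2)] by blast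

lemma fin_adj: "finite {w\<in>tws. cov (l, v) (i, w)}"
proof (cases "{l, i} \<in> E \<and> v \<in> tws")
  case True
  then obtain w0 where "\<And>w. cov (l, v) (i, w) \<Longrightarrow> w = w0" using cov_lift[of l i v] by blast
  then have "{w\<in>tws. cov (l, v) (i, w)} \<subseteq> {w0}" by blast
  then show ?thesis by (rule finite_subset) simp
next
  case False
  then have "{w\<in>tws. cov (l, v) (i, w)} = {}" by (auto dest: cov_edge)
  then show ?thesis by (simp only: finite.emptyI)
qed

text \<open>By unique lifting a vertex of the covering has at most one neighbour in each fibre. This
  is the local finiteness behind the infinite products.\<close>

lemma fin_near: "finite {w\<in>tws. (i, w) = x \<or> cov x (i, w)}"
proof -
  obtain l v where x: "x = (l, v)" by (cases x)
  have "{w\<in>tws. (i, w) = x \<or> cov x (i, w)} \<subseteq> {v} \<union> {w\<in>tws. cov (l, v) (i, w)}" by (auto simp: x)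
  then show ?thesis using fin_adj[of l v i] finite_subset by blast
qed

lemma gam_comm:
  assumes "i \<in> I" "j \<in> I" "{i, j} \<notin> E" "(i, w) \<noteq> (j, w')" "w \<in> tws" "w' \<in> tws" "det A = 1" "det B = 1"
  shows "R2 (i, w) (A :: 'k^2^2) \<circ> R2 (j, w') B = R2 (j, w') B \<circ> R2 (i, w) A"
proof -
  obtain y y' where "cov (i, w) y" "cov (j, w') y'" using nbr assms by metis
  moreover have "\<not> cov (i, w) (j, w')" using assms(3) cov_edge by blast
  ultimately show ?thesis using R2_commute assms(4,7,8) by blast
qed

lemma no_loop: "{i, i} \<notin> E" using edge[of i i] by auto

lemma gam_lfam:
  assumes "i \<in> I" "det A = 1"
  shows "lfam gens tws (gam_fam i A)"
  unfolding lfam_def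
proof (intro conjI ballI impI)
  fix w assume w: "w \<in> tws"
  obtain y where y: "cov (i, w) y" using nbr[OF assms(1) w] by blast
  show "gam_fam i A w \<in> carrier (LA gens)"
    unfolding gam_fam_def by (rule R2_LA[OF y]) (simp add: twm_props w assms)
next
  fix w w' assume w: "w \<in> tws" "w' \<in> tws" "w \<noteq> w'"
  show "gam_fam i A w \<circ> gam_fam i A w' = gam_fam i A w' \<circ> gam_fam i A w"
    unfolding gam_fam_def using w assms by (intro gam_comm) (auto simp: twm_props no_loop[simplified])
next
  fix s assume "s \<in> gens"
  then obtain x where x: "s = e x \<or> s = f x" by blast
  have "{w \<in> tws. gam_fam i A w (ev gens s) \<noteq> ev gens s} \<subseteq> {w\<in>tws. (i, w) = x \<or> cov x (i, w)}"
  proof (intro subsetI CollectI conjI; elim CollectE conjE)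
    fix w assume w: "w \<in> tws" "gam_fam i A w (ev gens s) \<noteq> ev gens s"
    obtain y where y: "cov (i, w) y" using nbr[OF assms(1) w(1)] by blast
    show "(i, w) = x \<or> cov x (i, w)"
      using R2_far[OF y, of x "twm w A"] w x assms by (auto simp: gam_fam_def twm_props)
  qed
  then show "finite {w \<in> tws. gam_fam i A w (ev gens s) \<noteq> ev gens s}"
    using fin_near finite_subset by blast
qed

lemma gam_mult:
  assumes "i \<in> I" "det A = 1" "det B = 1"
  shows "gam i (A ** B) = gam i A \<circ> gam i B"
proof -
  have "gam i A \<circ> gam i B = lprod tws (\<lambda>w. gam_fam i A w \<circ> gam_fam i B w)"
    unfolding gam_def
    by (rule lprod_comp[OF gam_lfam gam_lfam])
      (use assms in \<open>auto simp: gam_fam_def twm_props no_loop[simplified] intro!: gam_comm\<close>)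
  also have "\<dots> = gam i (A ** B)"
    unfolding gam_def
  proof (rule lprod_cong[symmetric, OF gam_lfam[OF assms(1)]])
    fix w assume w: "w \<in> tws"
    obtain y where y: "cov (i, w) y" using nbr[OF assms(1) w(1)] by blast
    show "gam_fam i (A ** B) w = gam_fam i A w \<circ> gam_fam i B w"
      using R2_mult[OF y, of "twm w A" "twm w B"] w assms by (simp add: gam_fam_def twm_props)
  qed (simp add: det_mul assms)
  finally show ?thesis by simp
qed

lemma gam_commute:
  assumes "i \<in> I" "j \<in> I" "i \<noteq> j" "{i, j} \<notin> E" "det A = 1" "det B = 1"
  shows "gam i A \<circ> gam j B = gam j B \<circ> gam i A"
proof -
  have c: "gam_fam i A w \<circ> gam_fam j B w' = gam_fam j B w' \<circ> gam_fam i A w" if "w \<in> tws" "w' \<in> tws" for w w'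
    unfolding gam_fam_def using that assms by (intro gam_comm) (auto simp: twm_props)
  have "gam i A \<circ> gam j B = lprod tws (\<lambda>w. gam_fam i A w \<circ> gam_fam j B w)"
    "gam j B \<circ> gam i A = lprod tws (\<lambda>w. gam_fam j B w \<circ> gam_fam i A w)"
    unfolding gam_def
    by (rule lprod_comp[OF gam_lfam[OF assms(1,5)] gam_lfam[OF assms(2,6)]], rule c, assumption+,
        rule lprod_comp[OF gam_lfam[OF assms(2,6)] gam_lfam[OF assms(1,5)]], rule c[symmetric], assumption+)
  moreover have "lprod tws (\<lambda>w. gam_fam i A w \<circ> gam_fam j B w) = lprod tws (\<lambda>w. gam_fam j B w \<circ> gam_fam i A w)"
    by (rule lprod_cong[OF lfam_comp[OF gam_lfam gam_lfam]]) (use c assms in auto)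
  ultimately show ?thesis by simp
qed

lemma gam_LA: "i \<in> I \<Longrightarrow> det A = 1 \<Longrightarrow> gam i A \<in> carrier (LA gens)"
  unfolding gam_def by (rule lprod_LA[OF gam_lfam])

text \<open>Distinct lifts of an edge share no vertex and have no edge between them, because right
  translation by \<open>om {i, j}\<close> is injective. So the vertex groups at their ends commute
  across the two lifts, and these generate the images of SL_3.\<close>

lemma del_comm:
  assumes "{i, j} \<in> E" "i < j" "w \<in> tws" "w' \<in> tws" "w \<noteq> w'" "det B = 1" "det C = 1"
  shows "del_fam i j B w \<circ> del_fam i j C w' = del_fam i j C w' \<circ> del_fam i j B w"
proof -
  let ?o = "om {i, j}"
  have I: "i \<in> I" "j \<in> I" using edge[OF assms(1)] by auto
  have c: "cov (i, w) (j, tmul w ?o)" "cov (i, w') (j, tmul w' ?o)" using cov_up assms by auto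
  have ne: "tmul w ?o \<noteq> tmul w' ?o" using tmul_cancel[OF assms(3,4) om_tw[OF assms(1)]] assms(5) by blast
  have t: "tmul w ?o \<in> tws" "tmul w' ?o \<in> tws" using tmul_closed[OF _ om_tw[OF assms(1)]] assms by auto
  have R: "R2 x (A :: 'k^2^2) \<circ> R2 x' A' = R2 x' A' \<circ> R2 x A"
    if xx: "x \<in> {(i, w), (j, tmul w ?o)}" "x' \<in> {(i, w'), (j, tmul w' ?o)}" and d: "det A = 1" "det A' = 1" for x x' A A'
  proof -
    have "\<not> cov (i, w) (i, w')" "\<not> cov (j, tmul w ?o) (j, tmul w' ?o)" using cov_edge no_loop by blast+
    moreover have "\<not> cov (i, w) (j, tmul w' ?o)" using cov_upD[OF _ assms(2)] ne by metis
    moreover have "\<not> cov (j, tmul w ?o) (i, w')" using cov_upD[OF cov_sym assms(2)] ne by metis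
    ultimately have 1: "\<not> cov x x'" using xx by auto
    have 2: "x \<noteq> x'" using xx ne assms(2,5) by auto
    have "\<exists>y. cov x y" using xx(1) nbr[OF I(1) assms(3)] nbr[OF I(2) t(1)] by fast
    moreover have "\<exists>y. cov x' y" using xx(2) nbr[OF I(1) assms(4)] nbr[OF I(2) t(2)] by fast
    ultimately obtain y y' where "cov x y" "cov x' y'" by blast
    then show ?thesis using R2_commute[of x' y' x y A A'] 1 2 d by simp
  qed
  have dd: "det (twm w B) = 1" "det (twm w' C) = 1" by (simp_all add: twm_props assms)
  have R': "R2 x' A' \<circ> R3 (i, w) (j, tmul w ?o) (twm w B) = R3 (i, w) (j, tmul w ?o) (twm w B) \<circ> R2 x' A'"
    if "x' \<in> {(i, w'), (j, tmul w' ?o)}" "det A' = 1" for x' A'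
    using R3_commute[OF c(1) dd(1), of "R2 x' A'"] R[of _ x'] that by simp
  show ?thesis
    unfolding del_fam_def
    using R3_commute[OF c(2) dd(2), of "R3 (i, w) (j, tmul w ?o) (twm w B)"] R' by simp
qed

lemma del_lfam:
  assumes "{i, j} \<in> E" "i < j" "det B = 1"
  shows "lfam gens tws (del_fam i j B)"
  unfolding lfam_def
proof (intro conjI ballI impI)
  fix w assume w: "w \<in> tws"
  show "del_fam i j B w \<in> carrier (LA gens)"
    unfolding del_fam_def by (rule R3_LA[OF cov_up[OF assms(1,2) w]]) (simp add: twm_props w assms)
next
  fix w w' assume w: "w \<in> tws" "w' \<in> tws" "w \<noteq> w'"
  then show "del_fam i j B w \<circ> del_fam i j B w' = del_fam i j B w' \<circ> del_fam i j B w"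
    using assms by (intro del_comm) auto
next
  fix s assume "s \<in> gens"
  then obtain x where x: "s = e x \<or> s = f x" by blast
  let ?W = "{w\<in>tws. (i, w) = x \<or> cov x (i, w)}" and ?W' = "{w\<in>tws. (j, w) = x \<or> cov x (j, w)}"
  let ?g = "\<lambda>w. tmul w (om {i, j})"
  have inj: "inj_on ?g tws" using tmul_bij[OF om_tw[OF assms(1)]] by (simp add: bij_betw_def)
  have f: "finite {w\<in>tws. ?g w \<in> ?W'}" 
    by (rule finite_imageD[of ?g]) (use fin_near[of j x] inj in \<open>auto elim!: finite_subset[rotated] inj_on_subset\<close>)
  have "{w \<in> tws. del_fam i j B w (ev gens s) \<noteq> ev gens s} \<subseteq> ?W \<union> {w\<in>tws. ?g w \<in> ?W'}"
  proof (intro subsetI; elim CollectE conjE)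
    fix w assume w: "w \<in> tws" "del_fam i j B w (ev gens s) \<noteq> ev gens s"
    note c = cov_up[OF assms(1,2) w(1)]
    have "x = (i, w) \<or> x = (j, ?g w) \<or> cov (i, w) x \<or> cov (j, ?g w) x"
      using R3_far[OF c, of "twm w B" x] w x assms by (auto simp: del_fam_def twm_props)
    then have "(i, w) = x \<or> (j, ?g w) = x \<or> cov x (i, w) \<or> cov x (j, ?g w)" using cov_sym by metis
    then show "w \<in> ?W \<union> {w\<in>tws. ?g w \<in> ?W'}"
      using w(1) tmul_closed[OF w(1) om_tw[OF assms(1)]] by blast
  qed
  then show "finite {w \<in> tws. del_fam i j B w (ev gens s) \<noteq> ev gens s}"
    using fin_near f finite_subset by blast
qed

lemma del_LA: "{i, j} \<in> E \<Longrightarrow> i < j \<Longrightarrow> det B = 1 \<Longrightarrow> del i j B \<in> carrier (LA gens)"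
  unfolding del_def by (rule lprod_LA[OF del_lfam])

lemma del_mult:
  assumes "{i, j} \<in> E" "i < j" "det A = 1" "det B = 1"
  shows "del i j (A ** B) = del i j A \<circ> del i j B"
proof -
  have "del i j A \<circ> del i j B = lprod tws (\<lambda>w. del_fam i j A w \<circ> del_fam i j B w)"
    unfolding del_def
    by (rule lprod_comp[OF del_lfam del_lfam]) (use assms in \<open>auto intro!: del_comm\<close>)
  also have "\<dots> = del i j (A ** B)"
    unfolding del_def
  proof (rule lprod_cong[symmetric, OF del_lfam[OF assms(1,2)]])
    fix w assume w: "w \<in> tws"
    show "del_fam i j (A ** B) w = del_fam i j A w \<circ> del_fam i j B w"
      using R3_mult[OF cov_up[OF assms(1,2) w], of "twm w A" "twm w B"] w assms by (simp add: del_fam_def twm_props)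
  qed (simp add: det_mul assms)
  finally show ?thesis by simp
qed

lemma del_upper:
  assumes "{i, j} \<in> E" "i < j" "det A = 1"
  shows "del i j (block_upper A) = gam i A"
  unfolding del_def gam_def
proof (rule lprod_cong[OF del_lfam[OF assms(1,2)]])
  fix w assume w: "w \<in> tws"
  show "del_fam i j (block_upper A) w = gam_fam i A w"
    using R3_block(1)[OF cov_up[OF assms(1,2) w], of "twm w A"] w assms by (simp add: del_fam_def gam_fam_def twm_props)
qed (simp add: block_det assms)

text \<open>In the sheet w of i the argument is twisted first by \<open>om {i, j}\<close> and then
  by w, that is by their product, which is the sheet of the upper end. The twist in the connecting
  map thus becomes a relabelling of the fibre over j.\<close>

lemma del_lower:
  assumes "{i, j} \<in> E" "i < j" "det A = 1"
  shows "del i j (block_lower (twm (om {i, j}) A)) = gam j A"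
proof -
  note o = om_tw[OF assms(1)]
  have "del i j (block_lower (twm (om {i, j}) A)) = lprod tws (\<lambda>w. gam_fam j A (tmul w (om {i, j})))"
    unfolding del_def
  proof (rule lprod_cong[OF del_lfam[OF assms(1,2)]])
    fix w assume w: "w \<in> tws"
    show "del_fam i j (block_lower (twm (om {i, j}) A)) w = gam_fam j A (tmul w (om {i, j}))"
      using R3_block(2)[OF cov_up[OF assms(1,2) w], of "twm w (twm (om {i, j}) A)"] w assms
      by (simp add: del_fam_def gam_fam_def twm_props o twm_tmul)
  qed (simp add: block_det twm_props o assms)
  also have "\<dots> = gam j A" unfolding gam_def by (rule lprod_reindex[OF tmul_bij[OF o]])
  finally show ?thesis .
qed

text \<open>A vertex (l, v) with v a twist has exactly one neighbour in the fibre over i if {i, l}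
  is an edge, and none otherwise; so at most one factor of the infinite product contributes a
  sign.\<close>

lemma gam_z:
  assumes "i \<in> I"
  shows "gam i sl2_z (ev gens (e (l, v))) = (if {i, l} \<in> E \<and> v \<in> tws then - ev gens (e (l, v)) else ev gens (e (l, v)))"
    "gam i sl2_z (ev gens (f (l, v))) = (if {i, l} \<in> E \<and> v \<in> tws then - ev gens (f (l, v)) else ev gens (f (l, v)))"
proof -
  have "gam i sl2_z (ev gens s) = (if {i, l} \<in> E \<and> v \<in> tws then - ev gens s else ev gens s)"
    if s: "s = e (l, v) \<or> s = f (l, v)" for s
  proof -
    note lf = gam_lfam[OF assms sl2_z_det]
    have fam: "gam_fam i sl2_z w (ev gens s) = (if cov (i, w) (l, v) then - ev gens s else ev gens s)" if w: "w \<in> tws" for w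
    proof -
      obtain y where y: "cov (i, w) y" using nbr[OF assms w] by blast
      show ?thesis
      proof (cases "cov (i, w) (l, v)")
        case True
        then show ?thesis using s R2_z_near[OF True] w by (auto simp: gam_fam_def twm_props)
      next
        case False
        then have n: "\<not> cov (l, v) (i, w)" using cov_sym by blast
        show ?thesis
        proof (cases "(l, v) = (i, w)")
          case True
          then show ?thesis using s R2_z_self[OF y] w False by (auto simp: gam_fam_def twm_props)
        next
          case neq: False
          show ?thesis using s R2_far[OF y neq n sl2_z_det] w False by (auto simp: gam_fam_def twm_props)
        qed
      qed
    qed
    show ?thesis
    proof (cases "{i, l} \<in> E \<and> v \<in> tws")
      case True
      then have "{l, i} \<in> E" by (simp add: insert_commute)
      then obtain w0 where w0: "cov (l, v) (i, w0)" "\<And>w. cov (l, v) (i, w) \<Longrightarrow> w = w0"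
        using cov_lift[of l i v] True by blast
      have w0t: "w0 \<in> tws" using w0(1) by (blast dest: cov_edge)
      have nc: "\<not> cov (i, w) (l, v)" if "w \<noteq> w0" for w using w0(2) cov_sym that by blast
      have "gam i sl2_z (ev gens s) = Finite_Set.fold (gam_fam i sl2_z) (ev gens s) {w0}"
        unfolding gam_def
        by (rule lprod_ext[OF lf]) (use w0t fam nc in auto)
      also have "\<dots> = gam_fam i sl2_z w0 (ev gens s)"
      proof -
        interpret comp_fun_commute_on tws "gam_fam i sl2_z" by (rule lfam_commute[OF lf])
        show ?thesis using w0t by (subst fold_insert) auto
      qed
      finally show ?thesis using fam[OF w0t] cov_sym[OF w0(1)] True by simp
    next
      case False
      have nc: "\<not> cov (i, w) (l, v)" for w using False cov_edge by blast
      have "gam i sl2_z (ev gens s) = Finite_Set.fold (gam_fam i sl2_z) (ev gens s) {}"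
        unfolding gam_def
        by (rule lprod_ext[OF lf]) (use fam nc in auto)
      then show ?thesis using False by (simp only: fold_empty if_False)
    qed
  qed
  then show "gam i sl2_z (ev gens (e (l, v))) = (if {i, l} \<in> E \<and> v \<in> tws then - ev gens (e (l, v)) else ev gens (e (l, v)))"
    "gam i sl2_z (ev gens (f (l, v))) = (if {i, l} \<in> E \<and> v \<in> tws then - ev gens (f (l, v)) else ev gens (f (l, v)))"
    by blast+
qed

lemma gam_z_eq:
  assumes "i \<in> I" "j \<in> I" "neighbors E i = neighbors E j"
  shows "gam i sl2_z = gam j sl2_z"
proof (rule LA_eqI)
  have n: "{i, l} \<in> E \<longleftrightarrow> {j, l} \<in> E" for l using assms(3) by (auto simp: neighbors_def)
  show "gam i sl2_z \<in> carrier (LA gens)" "gam j sl2_z \<in> carrier (LA gens)"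
    using gam_LA assms sl2_z_det by auto
  fix s assume "s \<in> gens"
  then obtain l v where "s = e (l, v) \<or> s = f (l, v)" by auto
  then show "gam i sl2_z (ev gens s) = gam j sl2_z (ev gens s)"
    using assms n by (auto simp: gam_z)
qed

text \<open>At the identity sheet the transvection adds to e_(l,v) its bracket with the generator
  over i; the other sheets over i fix e_(l,v). That the added term is nonzero over k is what the
  second hypothesis supplies.\<close>

lemma gam_nontriv:
  assumes "{i, l} \<in> E" "\<And>x y. cov x y \<Longrightarrow> \<exists>\<phi>\<in>dual gens. \<phi> (br (e x) (e y)) \<noteq> (0::'k)"
  shows "gam i (M2 1 1 0 1) \<noteq> id"
proof -
  have i: "i \<in> I" using edge[OF assms(1)] by simp
  obtain v where v: "cov (i, (False, id)) (l, v)" using cov_lift[OF assms(1) tw_id] by blast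
  have d: "det (M2 1 1 0 1 :: 'k^2^2) = 1" by (simp add: M2_det)
  let ?s = "e (l, v)" and ?t = "(False, id) :: 'k twist"
  note lf = gam_lfam[OF i d]
  have "gam i (M2 1 1 0 1) (ev gens ?s) = Finite_Set.fold (gam_fam i (M2 1 1 0 1)) (ev gens ?s) {?t}"
    unfolding gam_def
  proof (rule lprod_ext[OF lf])
    show "{?t} \<subseteq> tws" using tw_id by simp
    fix w assume w: "w \<in> tws - {?t}"
    obtain y where y: "cov (i, w) y" using nbr[OF i] w by blast
    have "(l, v) \<noteq> (i, w)" using edge[OF assms(1)] by auto
    moreover have "\<not> cov (l, v) (i, w)"
    proof
      assume "cov (l, v) (i, w)"
      moreover have "cov (l, v) (i, ?t)" using cov_sym[OF v] .
      ultimately show False using cov_lift[of l i v] w cov_edge by blast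
    qed
    ultimately show "gam_fam i (M2 1 1 0 1) w (ev gens ?s) = ev gens ?s"
      using R2_far[OF y, of "(l, v)" "twm w (M2 1 1 0 1)"] w d by (simp add: gam_fam_def twm_props)
  qed simp
  also have "\<dots> = gam_fam i (M2 1 1 0 1) ?t (ev gens ?s)"
  proof -
    interpret comp_fun_commute_on tws "gam_fam i (M2 1 1 0 1)" by (rule lfam_commute[OF lf])
    show ?thesis using tw_id by (subst fold_insert) auto
  qed
  also have "\<dots> = ev gens ?s + ev gens (br (e (i, ?t)) ?s)"
    using R2_act_near[OF v d] unfolding act_def forall_2 sum_2
    by (simp add: gam_fam_def twm_id ksc_add add.commute)
  finally have *: "gam i (M2 1 1 0 1) (ev gens ?s) = ev gens ?s + ev gens (br (e (i, ?t)) ?s)" .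
  obtain \<phi> where \<phi>: "\<phi> \<in> dual gens" "\<phi> (br (e (i, ?t)) ?s) \<noteq> (0::'k)" using assms(2)[OF v] by blast
  then have "(ev gens (br (e (i, ?t)) ?s) :: ('r \<Rightarrow> 'k) \<Rightarrow> 'k) \<noteq> 0"
    by (auto simp: ev_def fun_eq_iff zero_fun_apply)
  then show ?thesis using * by auto
qed

end

section \<open>Normal subgroups of the special linear groups\<close>

abbreviation sc :: "'k::field \<Rightarrow> 'k^3^3" where "sc c \<equiv> M3 c 0 0 0 c 0 0 0 c"

lemma SL_simps:
  "A \<in> carrier SL \<longleftrightarrow> det A = 1" "A \<otimes>\<^bsub>SL\<^esub> B = A ** B" "\<one>\<^bsub>SL\<^esub> = mat 1"
  by (simp_all add: SL_def)

lemma SL_inv: "det A = 1 \<Longrightarrow> inv\<^bsub>SL\<^esub> A = matrix_inv (A :: 'k::field^'n^'n)"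
  by (rule monoid.inv_char[OF group.is_monoid[OF SL_group]]) (simp_all add: SL_simps matrix_inv_SL)

text \<open>One nontrivial transvection generates SL_3 as a normal subgroup: diagonal conjugation
  adjusts its parameter, and monomial matrices move it to the other root subgroups.\<close>

lemma SL3_normal_elt:
  fixes K :: "'k::field^3^3 \<Rightarrow> bool"
  assumes m: "\<And>A B. K A \<Longrightarrow> K B \<Longrightarrow> K (A ** B)" and c: "\<And>A P Q. K A \<Longrightarrow> P ** Q = mat 1 \<Longrightarrow> det P = 1 \<Longrightarrow> K (P ** A ** Q)"
    and "K (x23 t)" "t \<noteq> 0" "det B = 1" and one: "K (mat 1)"
  shows "K B"
proof -
  have 23: "K (x23 s)" for s
  proof (cases "s = 0")
    case False
    have "K (M3 (t/s) 0 0 0 (s/t) 0 0 0 1 ** x23 t ** M3 (s/t) 0 0 0 (t/s) 0 0 0 1)"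
      using False assms(4) by (intro c assms(3)) (simp_all add: M3_mult M3_one M3_det)
    then show ?thesis using assms(4) False by (simp add: M3_mult)
  qed (use one in \<open>simp add: M3_one\<close>)
  have cyc: "K (M3 0 0 1 1 0 0 0 1 0 ** A ** M3 0 1 0 0 0 1 1 0 0)" if "K A" for A
    by (intro c that) (simp_all add: M3_mult M3_one M3_det)
  have 32: "K (x32 s)" for s
  proof -
    have "K (M3 1 0 0 0 0 1 0 (-1) 0 ** x23 (-s) ** M3 1 0 0 0 0 (-1) 0 1 0)"
      by (intro c 23) (simp_all add: M3_mult M3_one M3_det)
    then show ?thesis by (simp add: M3_mult)
  qed
  show ?thesis using assms(5)
  proof (induction B rule: SL3_induct)
    case (x12 s) then show ?case using cyc[OF cyc[OF 23[of s]]] by (simp add: M3_mult)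
  next
    case (x21 s) then show ?case using cyc[OF cyc[OF 32[of s]]] by (simp add: M3_mult)
  qed (use m 23 32 in auto)
qed

text \<open>A nonscalar A has a vector v such that v and A v are independent. A third vector
  completes them to a basis of determinant 1, in which the first column of A is the second unit
  vector.\<close>

lemma nonscalar_vector:
  fixes A :: "'k::field^3^3"
  assumes "\<And>c. A \<noteq> sc c"
  obtains P Q where "P ** Q = mat 1" "det P = 1" "(Q ** A ** P)$1$1 = 0" "(Q ** A ** P)$2$1 = 1" "(Q ** A ** P)$3$1 = 0"
proof -
  obtain a b c d e f g h i where A: "A = M3 a b c d e f g h i" by (rule M3_cases)
  note main = that
  have goal: thesis if w: "w1 = a * v1+b * v2+c * v3" "w2 = d * v1+e * v2+f * v3" "w3 = g * v1+h * v2+i * v3"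
     and n: "v2 * w3-v3 * w2 \<noteq> 0 \<or> v3 * w1-v1 * w3 \<noteq> 0 \<or> v1 * w2-v2 * w1 \<noteq> 0" for v1 v2 v3 w1 w2 w3
  proof -
    obtain p1 p2 p3 where p: "(v2 * w3-v3 * w2) * p1 + (v3 * w1-v1 * w3) * p2 + (v1 * w2-v2 * w1) * p3 = 1"
    proof -
      consider "v2 * w3-v3 * w2 \<noteq> 0" | "v3 * w1-v1 * w3 \<noteq> 0" | "v1 * w2-v2 * w1 \<noteq> 0" using n by blast
      then show ?thesis
      proof cases
        case 1 show ?thesis by (rule that[of "1/(v2 * w3-v3 * w2)" 0 0]) (use 1 in simp)
      next
        case 2 show ?thesis by (rule that[of 0 "1/(v3 * w1-v1 * w3)" 0]) (use 2 in simp)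
      next
        case 3 show ?thesis by (rule that[of 0 0 "1/(v1 * w2-v2 * w1)"]) (use 3 in simp)
      qed
    qed
    define P where "P = M3 v1 w1 p1 v2 w2 p2 v3 w3 p3"
    have d: "det P = 1" using p by (simp add: P_def M3_det algebra_simps)
    define Q where "Q = matrix_inv P"
    have PQ: "P ** Q = mat 1" "Q ** P = mat 1" using matrix_inv_SL[OF d] by (simp_all add: Q_def)
    have "\<forall>k. (A ** P)$k$1 = P$k$2"
      by (simp add: forall_3 A P_def M3_mult w)
    then have "(Q ** (A ** P))$k$1 = (Q ** P)$k$2" for k
      by (simp add: matrix_matrix_mult_def)
    then have "(Q ** A ** P)$k$1 = (mat 1 :: 'k^3^3)$k$2" for k
      by (simp add: PQ matrix_mul_assoc)
    then show thesis by (intro main[OF PQ(1) d]) (simp_all add: mat_def)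
  qed
  show thesis
  \<comment> \<open>A unit vector that is not an eigenvector serves as v. If all three are
    eigenvectors, two consecutive diagonal entries differ, and the sum of the two corresponding unit
    vectors serves.\<close>
  proof (cases "b = 0 \<and> c = 0 \<and> d = 0 \<and> f = 0 \<and> g = 0 \<and> h = 0")
    case True
    then have "a \<noteq> e \<or> e \<noteq> i" using assms[of a] by (auto simp: A)
    then show thesis
      using goal[of a 1 1 0 e 0, simplified] goal[of 0 0 1 1 e i, simplified] True by auto
  next
    case False
    then show thesis
      using goal[of a 1 0 0 d g, simplified] goal[of b 0 1 0 e h, simplified] goal[of c 0 0 1 f i, simplified] by auto
  qed
qed

text \<open>Commutators with the root element at position (1,3) turn a nonscalar member into a
  nontrivial transvection, from which the whole group is obtained.\<close>

lemma SL3_normal: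
  fixes K :: "'k::field^3^3 \<Rightarrow> bool"
  assumes m: "\<And>A B. K A \<Longrightarrow> K B \<Longrightarrow> K (A ** B)" and c: "\<And>A P Q. K A \<Longrightarrow> P ** Q = mat 1 \<Longrightarrow> det P = 1 \<Longrightarrow> K (P ** A ** Q)"
    and inv: "\<And>A. K A \<Longrightarrow> det A = 1 \<and> K (matrix_inv A)"
    and A: "K A" "\<And>c. A \<noteq> sc c" and "det B = 1" and one: "K (mat 1)"
  shows "K B"
proof -
  obtain P Q where PQ: "P ** Q = mat 1" "det P = 1" and
    n: "(Q ** A ** P)$1$1 = 0" "(Q ** A ** P)$2$1 = 1" "(Q ** A ** P)$3$1 = 0"
    using nonscalar_vector[OF A(2)] by blast
  have "det Q = 1" using arg_cong[OF PQ(1), of det] PQ(2) by (simp add: det_mul)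
  moreover have "Q ** P = mat 1" using PQ(1) by (simp add: matrix_left_right_inverse)
  ultimately have KG: "K (Q ** A ** P)" using c[OF A(1)] by blast
  obtain b c' e f h i where G: "Q ** A ** P = M3 0 b c' 1 e f 0 h i"
    using n M3_cases[of "Q ** A ** P"] by (metis M3_nth(1,4,7))
  let ?G = "M3 0 b c' 1 e f 0 h i"
  have KG: "K ?G" using KG G by simp
  then have d: "c' * h - b * i = 1" using inv by (force simp: M3_det)
  define G' where "G' = M3 (e*i-f*h) (c'*h-b*i) (b*f-c'*e) (-i) 0 c' h 0 (-b)"
  have G': "?G ** G' = mat 1" using d by (simp add: G'_def M3_mult M3_one M3_eq algebra_simps)
  have KG': "K G'" using inv[OF KG] matrix_inv_eqI[OF G'] by simp
  \<comment> \<open>\<open>?G\<close> takes the first unit vector to the second, so it conjugates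
    the root element at (1,3) into a matrix that differs from the identity in the second row only.
    This keeps the commutator simple.\<close>
  have "K (M3 1 0 (-1) 0 1 0 0 0 1 ** ?G ** M3 1 0 1 0 1 0 0 0 1)"
    by (intro c KG) (simp_all add: M3_mult M3_one M3_det)
  then have "K (M3 1 0 (-1) 0 1 0 0 0 1 ** ?G ** M3 1 0 1 0 1 0 0 0 1 ** G')" using m KG' by blast
  moreover have "M3 1 0 (-1) 0 1 0 0 0 1 ** ?G ** M3 1 0 1 0 1 0 0 0 1 ** G' = M3 1 0 (-1) h 1 (-b) 0 0 1"
    using d by (simp add: G'_def M3_mult M3_eq algebra_simps)
  ultimately have H: "K (M3 1 0 (-1) h 1 (-b) 0 0 1)" by simp
  show ?thesis
  \<comment> \<open>If h = 0, the determinant condition gives b * i = -1, so b is invertible and a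
    conjugation clears the entry at (1,3). Otherwise a second commutator leaves
    \<open>x23 h\<close>.\<close>
  proof (cases "h = 0")
    case True
    then have b: "b \<noteq> 0" using d by auto
    have "K (x12 (-1/b) ** M3 1 0 (-1) h 1 (-b) 0 0 1 ** x12 (1/b))"
      by (intro c H) (simp_all add: M3_mult M3_one M3_det)
    then have "K (x23 (-b))" using b True by (simp add: M3_mult)
    then show ?thesis using SL3_normal_elt[of K] m c assms(6) one b by (metis neg_equal_0_iff_equal)
  next
    case False
    let ?H = "M3 1 0 (-1) h 1 (-b) 0 0 1" and ?H' = "M3 1 0 1 (-h) 1 (b-h) 0 0 1"
    have "?H ** ?H' = mat 1" by (simp add: M3_mult M3_one)
    then have "K ?H'" using inv[OF H] by (simp add: matrix_inv_eqI)
    then have "K (M3 1 0 1 0 1 0 0 0 1 ** ?H' ** M3 1 0 (-1) 0 1 0 0 0 1)"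
      by (intro c) (simp_all add: M3_mult M3_one M3_det)
    then have "K (?H ** (M3 1 0 1 0 1 0 0 0 1 ** ?H' ** M3 1 0 (-1) 0 1 0 0 0 1))" using m H by blast
    then have "K (x23 h)" by (simp add: M3_mult)
    then show ?thesis using SL3_normal_elt[of K] m c assms(6) one False by metis
  qed
qed

lemma SL3_hom_trivial:
  fixes h :: "'k::field^3^3 \<Rightarrow> 'g"
  assumes "group G" "h \<in> hom SL3 G" "det A = 1" "h A = \<one>\<^bsub>G\<^esub>" "\<And>c. A \<noteq> sc c" "det B = 1"
  shows "h B = \<one>\<^bsub>G\<^esub>"
proof -
  interpret group_hom SL3 G h
    using assms(1,2) SL_group by (simp add: group_hom_def group_hom_axioms_def)
  have m: "h (C ** D) = h C \<otimes>\<^bsub>G\<^esub> h D" "h C \<in> carrier G" if "det C = 1" "det D = 1" for C D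
    using hom_mult[of C D] hom_closed[of C] that by (simp_all add: SL_simps)
  have "det B = 1 \<and> h B = \<one>\<^bsub>G\<^esub>"
  proof (rule SL3_normal[where K = "\<lambda>A. det A = 1 \<and> h A = \<one>\<^bsub>G\<^esub>" and A = A])
    show "det (C ** D) = 1 \<and> h (C ** D) = \<one>\<^bsub>G\<^esub>" if "det C = 1 \<and> h C = \<one>\<^bsub>G\<^esub>" "det D = 1 \<and> h D = \<one>\<^bsub>G\<^esub>" for C D
      using that m by (simp add: det_mul)
    show "det (P ** C ** Q) = 1 \<and> h (P ** C ** Q) = \<one>\<^bsub>G\<^esub>" if C: "det C = 1 \<and> h C = \<one>\<^bsub>G\<^esub>" and PQ: "P ** Q = mat 1" "det P = 1" for C P Q
    proof -
      have Q: "det Q = 1" using arg_cong[OF PQ(1), of det] PQ(2) by (simp add: det_mul)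
      then have "h (P ** C ** Q) = h P \<otimes>\<^bsub>G\<^esub> h Q" using m C PQ(2) by (simp add: det_mul)
      also have "\<dots> = h (mat 1)" using m(1)[OF PQ(2) Q] PQ(1) by simp
      finally show ?thesis using Q PQ(2) C hom_one by (simp add: det_mul SL_simps)
    qed
    show "det C = 1 \<and> det (matrix_inv C) = 1 \<and> h (matrix_inv C) = \<one>\<^bsub>G\<^esub>" if "det C = 1 \<and> h C = \<one>\<^bsub>G\<^esub>" for C
      using that hom_inv[of C] by (simp add: SL_simps SL_inv matrix_inv_SL)
  qed (use assms hom_one in \<open>simp_all add: SL_simps\<close>)
  then show ?thesis by simp
qed

lemma SL3_scalarI:
  fixes A :: "'k::field^3^3"
  assumes "A ** x12 1 = x12 1 ** A" "A ** x21 1 = x21 1 ** A" "A ** x23 1 = x23 1 ** A" "A ** x32 1 = x32 1 ** A"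
  shows "\<exists>c. A = sc c"
proof -
  obtain a b c d e f g h i where A: "A = M3 a b c d e f g h i" by (rule M3_cases)
  show ?thesis using assms unfolding A M3_mult M3_eq by (intro exI[of _ a]) auto
qed

text \<open>If c differs from 1, comparing entries of the two products forces a whole row of A to
  vanish, contrary to det A = 1.\<close>

lemma SL3_scaled_commute:
  fixes A :: "'k::field^3^3"
  assumes "det A = 1" "X \<in> {x12 1, x21 1, x23 1, x32 1}" "A ** X = sc c ** X ** A"
  shows "A ** X = X ** A"
proof (cases "c = 1")
  case True then show ?thesis using assms(3) by (simp add: M3_one[symmetric])
next
  case False
  obtain a b c' d e f g h i where A: "A = M3 a b c' d e f g h i" by (rule M3_cases)
  have z: "x = 0" if "x = c * x" for x using that False by auto
  have "d = 0 \<and> e = 0 \<and> f = 0 \<or> a = 0 \<and> b = 0 \<and> c' = 0 \<or> g = 0 \<and> h = 0 \<and> i = 0"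
    using assms(2)
  proof (elim insertE emptyE)
    assume "X = x12 1"
    then have "d = c * d" "d + e = c * e" "f = c * f" using assms(3) by (auto simp: A M3_mult M3_eq)
    then have "d = 0" "d + e = c * e" "f = 0" using z by blast+
    then show ?thesis using z[of e] by simp
  next
    assume "X = x21 1"
    then have "b = c * b" "a + b = c * a" "c' = c * c'" using assms(3) by (auto simp: A M3_mult M3_eq)
    then have "b = 0" "a + b = c * a" "c' = 0" using z by blast+
    then show ?thesis using z[of a] by simp
  next
    assume "X = x23 1"
    then have "g = c * g" "h = c * h" "h + i = c * i" using assms(3) by (auto simp: A M3_mult M3_eq)
    then have "g = 0" "h = 0" "h + i = c * i" using z by blast+
    then show ?thesis using z[of i] by simp
  next
    assume "X = x32 1"
    then have "d = c * d" "f = c * f" "e + f = c * e" using assms(3) by (auto simp: A M3_mult M3_eq)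
    then have "d = 0" "f = 0" "e + f = c * e" using z by blast+
    then show ?thesis using z[of e] by simp
  qed
  then have "det A = 0" unfolding A M3_det by auto
  then show ?thesis using assms(1) by simp
qed

text \<open>SL_3 is Hopfian. The kernel is scalar, and so is every preimage C of a central element:
  for a root element X the commutator of C and X lies in the kernel, hence is scalar, and
  \<open>SL3_scaled_commute\<close> makes it trivial. So the image of the finite centre contains the
  centre, and by counting h is injective on it.\<close>

lemma SL3_epi_inj:
  fixes h :: "'k::field^3^3 \<Rightarrow> 'k^3^3"
  assumes hom: "h \<in> hom SL3 SL3" and sur: "h ` carrier SL3 = carrier SL3" and A: "det A = 1" "h A = mat 1"
  shows "A = mat 1"
proof -
  interpret group_hom SL3 SL3 h
    using hom SL_group by (simp add: group_hom_def group_hom_axioms_def)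
  have m: "h (C ** D) = h C ** h D" "det (h C) = 1" if "det C = 1" "det D = 1" for C D
    using hom_mult[of C D] hom_closed[of C] that by (simp_all add: SL_simps)
  have ker: "\<exists>c. C = sc c" if "det C = 1" "h C = mat 1" for C
  proof (rule ccontr)
    assume n: "\<not> (\<exists>c. C = sc c)"
    have "h B = mat 1" if "det B = 1" for B
      using SL3_hom_trivial[OF SL_group hom \<open>det C = 1\<close> _ _ that] \<open>h C = mat 1\<close> n by (auto simp: SL_simps)
    moreover obtain B where "det B = 1" "h B = x12 1"
    proof -
      have "x12 1 \<in> h ` carrier SL3" unfolding sur by (simp add: SL_simps M3_det)
      then show thesis using that by (auto simp: SL_simps)
    qed
    ultimately show False by (auto simp: M3_one M3_eq)
  qed
  let ?Z = "{sc c | c. c ^ 3 = (1::'k)}"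
  have scd: "det (sc c) = c ^ 3" for c :: 'k by (simp add: M3_det power3_eq_cube)
  have quad: "c * c + c + 1 = 0" if "c ^ 3 = 1" "c \<noteq> 1" for c :: 'k
  proof -
    have "(c - 1) * (c * c + c + 1) = 0" using that(1) by (simp add: power3_eq_cube algebra_simps)
    then show ?thesis using that(2) by simp
  qed
  have "finite {c :: 'k. c ^ 3 = 1}"
  proof (cases "\<exists>r::'k. r ^ 3 = 1 \<and> r \<noteq> 1")
    case True
    then obtain r :: 'k where r: "r * r + r + 1 = 0" using quad by blast
    have "c \<in> {1, r, - 1 - r}" if "c ^ 3 = 1" for c
    proof (cases "c = 1")
      case False
      have "(c - r) * (c + r + 1) = (c * c + c + 1) - (r * r + r + 1)" by (simp add: algebra_simps)
      then have "c = r \<or> c + r + 1 = 0" using quad[OF that False] r by simp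
      then show ?thesis by (auto simp: eq_neg_iff_add_eq_0 algebra_simps)
    qed simp
    then have "{c :: 'k. c ^ 3 = 1} \<subseteq> {1, r, - 1 - r}" by blast
    then show ?thesis by (rule finite_subset) simp
  next
    case False
    then have "{c :: 'k. c ^ 3 = 1} \<subseteq> {1}" by blast
    then show ?thesis by (rule finite_subset) simp
  qed
  then have fin: "finite ?Z" by simp
  have "?Z \<subseteq> h ` ?Z"
  proof
    fix z assume "z \<in> ?Z"
    then obtain c where z: "z = sc c" "c ^ 3 = 1" by blast
    then have "z \<in> h ` carrier SL3" unfolding sur by (simp add: SL_simps scd)
    then obtain C where C: "det C = 1" "h C = z" by (auto simp: SL_simps)
    have zc: "z ** X = X ** z" for X by (rule M3_cases[of X]) (simp add: z M3_mult M3_eq mult.commute)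
    have "C ** X = X ** C" if X: "X \<in> {x12 1, x21 1, x23 1, x32 1}" for X
    proof -
      have dX: "det X = 1" using X by (auto simp: M3_det)
      define Y where "Y = C ** X ** matrix_inv (X ** C)"
      have d: "det (X ** C) = 1" "det (C ** X) = 1" using dX C by (simp_all add: det_mul)
      have Y: "Y ** (X ** C) = C ** X" unfolding Y_def
        by (metis d(1) matrix_inv_SL(2) matrix_mul_assoc matrix_mul_rid)
      have dY: "det Y = 1" using d by (simp add: Y_def det_mul matrix_inv_SL)
      have "h Y ** (h X ** z) = z ** h X" using arg_cong[OF Y, of h] m dX C d dY by (simp add: det_mul)
      then have "h Y ** (z ** h X) = z ** h X" by (simp add: zc)
      then have "h Y = mat 1" using d m[of C X] dX C(1)
        by (metis C(2) m(2) matrix_inv_SL(1) matrix_mul_assoc matrix_mul_rid)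
      then obtain r where "Y = sc r" using ker dY by blast
      then have "C ** X = sc r ** X ** C" using Y by (simp add: matrix_mul_assoc)
      then show ?thesis by (rule SL3_scaled_commute[OF C(1) X])
    qed
    then obtain r where r: "C = sc r" using SL3_scalarI[of C] by auto
    then show "z \<in> h ` ?Z" using C scd[of r] by auto
  qed
  then have "inj_on h ?Z"
    using fin by (metis (no_types, lifting) card_image_le card_mono eq_card_imp_inj_on finite_imageI le_antisym)
  moreover obtain c where "A = sc c" using ker A by blast
  then have "A \<in> ?Z" using A(1) scd by auto
  moreover have "mat 1 \<in> ?Z" by (auto simp: M3_one intro: exI[of _ 1])
  moreover have "h (mat 1) = mat 1" using hom_one by (simp add: SL_simps)
  ultimately show ?thesis using A(2) by (simp add: inj_on_def)
qed

lemma SL2_centre: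
  fixes A :: "'k::field^2^2"
  assumes "det A = 1" "\<And>X. det X = 1 \<Longrightarrow> A ** X = X ** A"
  shows "A = mat 1 \<or> A = sl2_z"
proof -
  have "A \<in> {z \<in> carrier SL2. \<forall>x\<in>carrier SL2. z \<otimes>\<^bsub>SL2\<^esub> x = x \<otimes>\<^bsub>SL2\<^esub> z}"
    using assms by (simp add: SL_simps)
  then have "A \<in> generate SL2 {sl2_z}" by (simp only: generate_sl2_z)
  then show ?thesis
  proof (induction rule: generate.induct)
    case (inv h)
    have "matrix_inv sl2_z = (sl2_z :: 'k^2^2)" by (rule matrix_inv_eqI) (simp add: sl2_z_M2 M2_mult M2_one)
    then show ?case using inv by (simp add: SL_inv sl2_z_det)
  next
    case (eng h1 h2)
    have "sl2_z ** sl2_z = (mat 1 :: 'k^2^2)" by (simp add: sl2_z_M2 M2_mult M2_one)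
    then show ?case using eng by (auto simp: SL_simps)
  qed (auto simp: SL_simps)
qed

section \<open>Existence of the universal completion\<close>

definition words :: "nat set \<Rightarrow> ('a, 'b) amalgam \<Rightarrow> ('a, 'b) amalgam_word set" where
  "words I A = {w. set w \<subseteq> letters I A}"

text \<open>Two words are identified when every completion on the test type identifies them. With
  this congruence universality is immediate; what remains is that the quotient is a group and itself
  a completion.\<close>

definition weq :: "nat set \<Rightarrow> ('a, 'b) amalgam \<Rightarrow> ('a, 'b) amalgam_word \<Rightarrow> ('a, 'b) amalgam_word \<Rightarrow> bool" where
  "weq I A v w \<longleftrightarrow> (\<forall>(D :: ('a, 'b) amalgam_word set monoid) \<gamma> \<delta>.
     is_completion I A D \<gamma> \<delta> \<longrightarrow> eval_word D \<gamma> \<delta> v = eval_word D \<gamma> \<delta> w)"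

definition wcls :: "nat set \<Rightarrow> ('a, 'b) amalgam \<Rightarrow> ('a, 'b) amalgam_word \<Rightarrow> ('a, 'b) amalgam_word set" where
  "wcls I A w = {v \<in> words I A. weq I A w v}"

definition univ :: "nat set \<Rightarrow> ('a, 'b) amalgam \<Rightarrow> ('a, 'b) amalgam_word set monoid" where
  "univ I A = \<lparr>carrier = wcls I A ` words I A,
     mult = (\<lambda>X Y. {z \<in> words I A. \<exists>x\<in>X. \<exists>y\<in>Y. weq I A (x @ y) z}), one = wcls I A []\<rparr>"

context
  fixes I :: "nat set" and A :: "('a, 'b) amalgam"
  assumes A: "is_amalgam I A"
begin

lemma weq_refl: "weq I A w w" and weq_sym: "weq I A v w \<Longrightarrow> weq I A w v"
  and weq_trans: "weq I A u v \<Longrightarrow> weq I A v w \<Longrightarrow> weq I A u w"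
  by (auto simp: weq_def)

lemma weq_append:
  assumes "u \<in> words I A" "u' \<in> words I A" "v \<in> words I A" "v' \<in> words I A" "weq I A u u'" "weq I A v v'"
  shows "weq I A (u @ v) (u' @ v')"
  using assms by (simp add: weq_def words_def eval_word_append)

lemma words_simps: "[] \<in> words I A" "u @ v \<in> words I A \<longleftrightarrow> u \<in> words I A \<and> v \<in> words I A"
  "l # u \<in> words I A \<longleftrightarrow> l \<in> letters I A \<and> u \<in> words I A"
  by (auto simp: words_def)

lemma wcls_eq_iff: "v \<in> words I A \<Longrightarrow> w \<in> words I A \<Longrightarrow> wcls I A v = wcls I A w \<longleftrightarrow> weq I A v w"
  using weq_refl weq_sym weq_trans unfolding wcls_def by blast

lemma univ_mult:
  assumes "u \<in> words I A" "v \<in> words I A"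
  shows "wcls I A u \<otimes>\<^bsub>univ I A\<^esub> wcls I A v = wcls I A (u @ v)"
proof -
  have "(\<exists>x\<in>wcls I A u. \<exists>y\<in>wcls I A v. weq I A (x @ y) z) \<longleftrightarrow> weq I A (u @ v) z" if "z \<in> words I A" for z
  proof
    assume "\<exists>x\<in>wcls I A u. \<exists>y\<in>wcls I A v. weq I A (x @ y) z"
    then obtain x y where "x \<in> words I A" "weq I A u x" "y \<in> words I A" "weq I A v y" "weq I A (x @ y) z"
      unfolding wcls_def by blast
    then show "weq I A (u @ v) z" using weq_append[of u x v y] assms weq_trans by blast
  next
    assume "weq I A (u @ v) z"
    then show "\<exists>x\<in>wcls I A u. \<exists>y\<in>wcls I A v. weq I A (x @ y) z"
      using assms weq_refl unfolding wcls_def by blast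
  qed
  then show ?thesis by (auto simp: univ_def wcls_def)
qed

lemma weq_letters:
  assumes i: "i \<in> I"
  shows "x \<in> carrier (vgrp A i) \<Longrightarrow> y \<in> carrier (vgrp A i) \<Longrightarrow>
      weq I A [Inl (i, x), Inl (i, y)] [Inl (i, x \<otimes>\<^bsub>vgrp A i\<^esub> y)]"
    "weq I A [Inl (i, \<one>\<^bsub>vgrp A i\<^esub>)] []"
    "j \<in> I \<Longrightarrow> i \<noteq> j \<Longrightarrow> x' \<in> carrier (egrp A i j) \<Longrightarrow> y' \<in> carrier (egrp A i j) \<Longrightarrow>
      weq I A [Inr ((i, j), x'), Inr ((i, j), y')] [Inr ((i, j), x' \<otimes>\<^bsub>egrp A i j\<^esub> y')]"
    "j \<in> I \<Longrightarrow> i \<noteq> j \<Longrightarrow> weq I A [Inr ((i, j), \<one>\<^bsub>egrp A i j\<^esub>)] []"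
    "j \<in> I \<Longrightarrow> i \<noteq> j \<Longrightarrow> x' \<in> carrier (egrp A i j) \<Longrightarrow> weq I A [Inr ((i, j), x')] [Inr ((j, i), x')]"
    "j \<in> I \<Longrightarrow> i \<noteq> j \<Longrightarrow> x \<in> carrier (vgrp A i) \<Longrightarrow> weq I A [Inr ((i, j), conn A i j x)] [Inl (i, x)]"
proof -
  have *: "group D" "\<gamma> i \<in> hom (vgrp A i) D" "group (vgrp A i)"
    "j \<in> I \<Longrightarrow> i \<noteq> j \<Longrightarrow> \<delta> i j \<in> hom (egrp A i j) D \<and> group (egrp A i j) \<and>
        (\<forall>x\<in>carrier (egrp A i j). \<delta> i j x = \<delta> j i x) \<and> egrp A j i = egrp A i j \<and>
        (\<forall>x\<in>carrier (vgrp A i). \<delta> i j (conn A i j x) = \<gamma> i x)"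
    if "is_completion I A D \<gamma> \<delta>" for D :: "('a, 'b) amalgam_word set monoid" and \<gamma> \<delta> j
    using that A i unfolding is_completion_def is_amalgam_def by auto
  note c = completion_closed
  show "weq I A [Inl (i, x), Inl (i, y)] [Inl (i, x \<otimes>\<^bsub>vgrp A i\<^esub> y)]"
    if "x \<in> carrier (vgrp A i)" "y \<in> carrier (vgrp A i)"
    unfolding weq_def
  proof (intro allI impI)
    fix D :: "('a, 'b) amalgam_word set monoid" and \<gamma> \<delta> assume D: "is_completion I A D \<gamma> \<delta>"
    interpret group_hom "vgrp A i" D "\<gamma> i" using *(1-3)[OF D] by (simp add: group_hom_def group_hom_axioms_def)
    show "eval_word D \<gamma> \<delta> [Inl (i, x), Inl (i, y)] = eval_word D \<gamma> \<delta> [Inl (i, x \<otimes>\<^bsub>vgrp A i\<^esub> y)]"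
      using that by simp
  qed
  show "weq I A [Inl (i, \<one>\<^bsub>vgrp A i\<^esub>)] []"
    unfolding weq_def
  proof (intro allI impI)
    fix D :: "('a, 'b) amalgam_word set monoid" and \<gamma> \<delta> assume D: "is_completion I A D \<gamma> \<delta>"
    interpret group_hom "vgrp A i" D "\<gamma> i" using *(1-3)[OF D] by (simp add: group_hom_def group_hom_axioms_def)
    show "eval_word D \<gamma> \<delta> [Inl (i, \<one>\<^bsub>vgrp A i\<^esub>)] = eval_word D \<gamma> \<delta> []" by simp
  qed
  show "weq I A [Inr ((i, j), x'), Inr ((i, j), y')] [Inr ((i, j), x' \<otimes>\<^bsub>egrp A i j\<^esub> y')]"
    if "j \<in> I" "i \<noteq> j" "x' \<in> carrier (egrp A i j)" "y' \<in> carrier (egrp A i j)"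
    unfolding weq_def
  proof (intro allI impI)
    fix D :: "('a, 'b) amalgam_word set monoid" and \<gamma> \<delta> assume D: "is_completion I A D \<gamma> \<delta>"
    interpret group_hom "egrp A i j" D "\<delta> i j" using *(1)[OF D] *(4)[OF D that(1,2)] by (simp add: group_hom_def group_hom_axioms_def)
    show "eval_word D \<gamma> \<delta> [Inr ((i, j), x'), Inr ((i, j), y')] = eval_word D \<gamma> \<delta> [Inr ((i, j), x' \<otimes>\<^bsub>egrp A i j\<^esub> y')]"
      using that by simp
  qed
  show "weq I A [Inr ((i, j), \<one>\<^bsub>egrp A i j\<^esub>)] []" if "j \<in> I" "i \<noteq> j"
    unfolding weq_def
  proof (intro allI impI)
    fix D :: "('a, 'b) amalgam_word set monoid" and \<gamma> \<delta> assume D: "is_completion I A D \<gamma> \<delta>"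
    interpret group_hom "egrp A i j" D "\<delta> i j" using *(1)[OF D] *(4)[OF D that(1,2)] by (simp add: group_hom_def group_hom_axioms_def)
    show "eval_word D \<gamma> \<delta> [Inr ((i, j), \<one>\<^bsub>egrp A i j\<^esub>)] = eval_word D \<gamma> \<delta> []" by simp
  qed
  show "weq I A [Inr ((i, j), x')] [Inr ((j, i), x')]" if "j \<in> I" "i \<noteq> j" "x' \<in> carrier (egrp A i j)"
    unfolding weq_def
  proof (intro allI impI)
    fix D :: "('a, 'b) amalgam_word set monoid" and \<gamma> \<delta> assume D: "is_completion I A D \<gamma> \<delta>"
    have "\<delta> i j x' = \<delta> j i x'" using *(4)[OF D that(1,2)] that(3) by blast
    then show "eval_word D \<gamma> \<delta> [Inr ((i, j), x')] = eval_word D \<gamma> \<delta> [Inr ((j, i), x')]" by simp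
  qed
  show "weq I A [Inr ((i, j), conn A i j x)] [Inl (i, x)]" if "j \<in> I" "i \<noteq> j" "x \<in> carrier (vgrp A i)"
    unfolding weq_def
  proof (intro allI impI)
    fix D :: "('a, 'b) amalgam_word set monoid" and \<gamma> \<delta> assume D: "is_completion I A D \<gamma> \<delta>"
    have "\<delta> i j (conn A i j x) = \<gamma> i x" using *(4)[OF D that(1,2)] that(3) by blast
    then show "eval_word D \<gamma> \<delta> [Inr ((i, j), conn A i j x)] = eval_word D \<gamma> \<delta> [Inl (i, x)]" by simp
  qed
qed

lemma letters_cases:
  assumes "l \<in> letters I A"
  obtains i x where "l = Inl (i, x)" "i \<in> I" "x \<in> carrier (vgrp A i)"
  | i j x where "l = Inr ((i, j), x)" "i \<in> I" "j \<in> I" "i \<noteq> j" "x \<in> carrier (egrp A i j)"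
  using assms unfolding letters_def by blast

lemma letters_intros: "i \<in> I \<Longrightarrow> x \<in> carrier (vgrp A i) \<Longrightarrow> Inl (i, x) \<in> letters I A"
  "i \<in> I \<Longrightarrow> j \<in> I \<Longrightarrow> i \<noteq> j \<Longrightarrow> y \<in> carrier (egrp A i j) \<Longrightarrow> Inr ((i, j), y) \<in> letters I A"
  by (simp_all add: letters_def)

lemma amalgam_groups: "i \<in> I \<Longrightarrow> group (vgrp A i)" "i \<in> I \<Longrightarrow> j \<in> I \<Longrightarrow> i \<noteq> j \<Longrightarrow> group (egrp A i j)"
  using A by (auto simp: is_amalgam_def)

lemma letter_inverse:
  assumes "l \<in> letters I A"
  shows "\<exists>l'\<in>letters I A. weq I A [l', l] []"
  using assms
proof (cases rule: letters_cases)
  case (1 i x)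
  interpret group "vgrp A i" using amalgam_groups 1 by blast
  show ?thesis
    using weq_letters(1)[OF 1(2), of "inv\<^bsub>vgrp A i\<^esub> x" x] weq_letters(2)[OF 1(2)] 1 weq_trans
    by (intro bexI[of _ "Inl (i, inv\<^bsub>vgrp A i\<^esub> x)"]) (auto intro: letters_intros)
next
  case (2 i j x)
  interpret group "egrp A i j" using amalgam_groups 2 by blast
  show ?thesis
    using weq_letters(3)[OF 2(2,3,4), of "inv\<^bsub>egrp A i j\<^esub> x" x] weq_letters(4)[OF 2(2,3,4)] 2 weq_trans
    by (intro bexI[of _ "Inr ((i, j), inv\<^bsub>egrp A i j\<^esub> x)"]) (auto intro: letters_intros)
qed

text \<open>Each letter comes from a group, so inverse letters are already present and formal
  inverses do not have to be added to the alphabet.\<close>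

lemma word_inverse: "w \<in> words I A \<Longrightarrow> \<exists>w'\<in>words I A. weq I A (w' @ w) []"
proof (induction w)
  case Nil then show ?case using weq_refl by (intro bexI[of _ "[]"]) auto
next
  case (Cons l w)
  then obtain w' where w': "w' \<in> words I A" "weq I A (w' @ w) []" by (auto simp: words_simps)
  obtain l' where l': "l' \<in> letters I A" "weq I A [l', l] []" using letter_inverse Cons(2) by (auto simp: words_simps)
  have 1: "weq I A ([l', l] @ w) ([] @ w)"
    using Cons(2) l' weq_refl by (intro weq_append) (auto simp: words_simps)
  have "weq I A (w' @ ([l', l] @ w)) (w' @ ([] @ w))"
    by (rule weq_append[OF w'(1) w'(1) _ _ weq_refl 1]) (use Cons(2) l' in \<open>auto simp: words_simps\<close>)
  then have "weq I A ((w' @ [l']) @ (l # w)) []" using weq_trans[OF _ w'(2)] by simp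
  then show ?case using w' l' by (intro bexI[of _ "w' @ [l']"]) (auto simp: words_simps)
qed

lemma univ_carrier: "X \<in> carrier (univ I A) \<longleftrightarrow> (\<exists>w\<in>words I A. X = wcls I A w)"
  by (auto simp: univ_def)

lemma univ_in: "w \<in> words I A \<Longrightarrow> wcls I A w \<in> carrier (univ I A)"
  by (auto simp: univ_carrier)

lemma univ_one: "\<one>\<^bsub>univ I A\<^esub> = wcls I A []" by (simp add: univ_def)

lemma univ_group: "group (univ I A)"
proof (rule groupI)
  fix X assume "X \<in> carrier (univ I A)"
  then obtain w where w: "w \<in> words I A" "X = wcls I A w" by (auto simp: univ_carrier)
  then obtain w' where "w' \<in> words I A" "weq I A (w' @ w) []" using word_inverse by blast
  then show "\<exists>Y\<in>carrier (univ I A). Y \<otimes>\<^bsub>univ I A\<^esub> X = \<one>\<^bsub>univ I A\<^esub>"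
    using w by (intro bexI[of _ "wcls I A w'"]) (simp_all add: univ_mult univ_one wcls_eq_iff words_simps univ_in)
qed (auto simp: univ_carrier univ_mult univ_one words_simps)

lemma universal_completion_exists:
  "is_universal_completion I A (univ I A) (\<lambda>i x. wcls I A [Inl (i, x)]) (\<lambda>i j x. wcls I A [Inr ((i, j), x)])"
proof -
  let ?\<alpha> = "\<lambda>i x. wcls I A [Inl (i, x)]" and ?\<beta> = "\<lambda>i j x. wcls I A [Inr ((i, j), x)]"
  interpret U: group "univ I A" by (rule univ_group)
  have w1: "[l] \<in> words I A" if "l \<in> letters I A" for l using that by (simp add: words_simps)
  let ?S = "(\<Union>i\<in>I. ?\<alpha> i ` carrier (vgrp A i)) \<union> (\<Union>i\<in>I. \<Union>j\<in>I - {i}. ?\<beta> i j ` carrier (egrp A i j))"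
  have letS: "wcls I A [l] \<in> ?S" if "l \<in> letters I A" for l
    using that by (cases rule: letters_cases) blast+
  have Sc: "?S \<subseteq> carrier (univ I A)"
    by (auto intro!: univ_in w1 letters_intros)
  have gen: "wcls I A w \<in> generate (univ I A) ?S" if "w \<in> words I A" for w
    using that
  proof (induction w)
    case Nil show ?case using generate.one[of "univ I A" ?S] by (simp only: univ_one)
  next
    case (Cons l w)
    then have l: "l \<in> letters I A" "w \<in> words I A" by (auto simp: words_simps)
    then have "wcls I A (l # w) = wcls I A [l] \<otimes>\<^bsub>univ I A\<^esub> wcls I A w"
      using univ_mult[OF w1[OF l(1)] l(2)] by simp
    then show ?case using generate.eng[OF generate.incl[OF letS[OF l(1)]] Cons.IH[OF l(2)]] by simp
  qed
  have compl: "is_completion I A (univ I A) ?\<alpha> ?\<beta>"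
    unfolding is_completion_def
  proof (intro conjI ballI impI)
    fix i assume i: "i \<in> I"
    interpret V: group "vgrp A i" using amalgam_groups i by blast
    show "?\<alpha> i \<in> hom (vgrp A i) (univ I A)"
      using i weq_letters(1)[OF i] weq_sym
      by (intro homI) (auto intro!: univ_in simp: univ_mult w1 letters_intros wcls_eq_iff words_simps)
    fix j assume j: "j \<in> I" "i \<noteq> j"
    interpret E: group "egrp A i j" using amalgam_groups i j by blast
    have e: "egrp A i j = egrp A j i" and "conn A i j \<in> hom (vgrp A i) (egrp A i j)"
      using A i j unfolding is_amalgam_def by blast+
    then have cc: "conn A i j x \<in> carrier (egrp A i j)" if "x \<in> carrier (vgrp A i)" for x
      using that by (rule_tac hom_in_carrier)
    show "?\<beta> i j \<in> hom (egrp A i j) (univ I A)"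
      using i j weq_letters(3)[OF i j] weq_sym
      by (intro homI) (auto intro!: univ_in simp: univ_mult w1 letters_intros wcls_eq_iff words_simps)
    show "?\<beta> i j x = ?\<beta> j i x" if "x \<in> carrier (egrp A i j)" for x
      using i j weq_letters(5)[OF i j that] that e by (subst wcls_eq_iff) (auto intro!: w1 letters_intros)
    show "?\<beta> i j (conn A i j x) = ?\<alpha> i x" if "x \<in> carrier (vgrp A i)" for x
      using i j weq_letters(6)[OF i j that] that cc by (subst wcls_eq_iff) (auto intro!: w1 letters_intros)
  next
    show "generate (univ I A) ?S = carrier (univ I A)"
      using gen U.generate_incl[OF Sc] by (auto simp: univ_carrier)
  qed (rule univ_group)
  moreover have "\<exists>!h. completion_hom I A (univ I A) ?\<alpha> ?\<beta> D \<gamma> \<delta> h"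
    if D: "is_completion I A D \<gamma> \<delta>" for D :: "('a, 'b) amalgam_word set monoid" and \<gamma> \<delta>
  proof -
    interpret D: group D using D by (simp add: is_completion_def)
    have ev: "eval_word D \<gamma> \<delta> v = eval_word D \<gamma> \<delta> w" if "weq I A v w" for v w
      using that D by (auto simp: weq_def)
    define h where "h = restrict (\<lambda>X. eval_word D \<gamma> \<delta> (SOME w. w \<in> X)) (carrier (univ I A))"
    have h: "h (wcls I A w) = eval_word D \<gamma> \<delta> w" if "w \<in> words I A" for w
    proof -
      have "w \<in> wcls I A w" using that weq_refl by (simp add: wcls_def)
      then have "(SOME v. v \<in> wcls I A w) \<in> wcls I A w" by (rule someI)
      then have "eval_word D \<gamma> \<delta> (SOME v. v \<in> wcls I A w) = eval_word D \<gamma> \<delta> w"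
        using ev by (auto simp: wcls_def)
      then show ?thesis using that by (auto simp: h_def univ_carrier)
    qed
    note cl = completion_closed[OF D]
    show ?thesis
    proof
      have "h \<in> hom (univ I A) D"
      proof (rule homI)
        fix X Y assume "X \<in> carrier (univ I A)" "Y \<in> carrier (univ I A)"
        then obtain v w where vw: "v \<in> words I A" "w \<in> words I A" "X = wcls I A v" "Y = wcls I A w"
          by (auto simp: univ_carrier)
        then show "h X \<in> carrier D" using eval_word_closed[OF D, of v] by (simp add: h words_def)
        show "h (X \<otimes>\<^bsub>univ I A\<^esub> Y) = h X \<otimes>\<^bsub>D\<^esub> h Y"
          using vw eval_word_append[OF D, of v w] by (simp add: h univ_mult words_simps) (simp add: words_def)
      qed
      then show "completion_hom I A (univ I A) ?\<alpha> ?\<beta> D \<gamma> \<delta> h"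
        by (auto simp: completion_hom_def h w1 letters_intros cl) (simp add: h_def)
    next
      fix k assume k: "completion_hom I A (univ I A) ?\<alpha> ?\<beta> D \<gamma> \<delta> k"
      then have kh: "k \<in> hom (univ I A) D" by (simp add: completion_hom_def)
      interpret k: group_hom "univ I A" D k
        using univ_group kh D.is_group by (simp add: group_hom_def group_hom_axioms_def)
      have "k (wcls I A w) = eval_word D \<gamma> \<delta> w" if "w \<in> words I A" for w
        using that
      proof (induction w)
        case Nil show ?case using k.hom_one by (simp add: univ_one)
      next
        case (Cons l w)
        then have l: "l \<in> letters I A" "w \<in> words I A" by (auto simp: words_simps)
        have "k (wcls I A (l # w)) = k (wcls I A [l] \<otimes>\<^bsub>univ I A\<^esub> wcls I A w)"
          using univ_mult[OF w1[OF l(1)] l(2)] by simp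
        also have "\<dots> = k (wcls I A [l]) \<otimes>\<^bsub>D\<^esub> eval_word D \<gamma> \<delta> w"
          using l w1 Cons.IH by (subst k.hom_mult) (auto intro!: univ_in)
        also have "k (wcls I A [l]) = eval_word D \<gamma> \<delta> [l]"
          using l(1) by (cases rule: letters_cases) (use k cl in \<open>auto simp: completion_hom_def\<close>)
        finally show ?case unfolding eval_letter(2)[OF D l(1), of w] .
      qed
      then show "k = h"
        using k by (intro extensionalityI[of _ "carrier (univ I A)"]) (auto simp: completion_hom_def univ_carrier h, simp add: h_def)
    qed
  qed
  ultimately show ?thesis by (simp add: is_universal_completion_def)
qed

text \<open>Transfers nontriviality from a completion on any type: if the universal group were
  trivial, the homomorphism to D would make all images trivial, and these generate D.\<close>

lemma nontrivial_universal_iff: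
  fixes D :: "'d monoid"
  assumes D: "is_completion I A D \<gamma> \<delta>" "\<not> trivial_group D"
  shows "\<exists>(C :: ('a, 'b) amalgam_word set monoid) \<alpha> \<beta>. is_universal_completion I A C \<alpha> \<beta> \<and> \<not> trivial_group C"
proof -
  obtain h where h: "completion_hom I A (univ I A) (\<lambda>i x. wcls I A [Inl (i, x)]) (\<lambda>i j x. wcls I A [Inr ((i, j), x)]) D \<gamma> \<delta> h"
    using universal_completion_factors[OF A universal_completion_exists D(1)] by blast
  interpret D: group D using D by (simp add: is_completion_def)
  interpret h: group_hom "univ I A" D h
    using h univ_group D.is_group by (simp add: completion_hom_def group_hom_def group_hom_axioms_def)
  have False if "trivial_group (univ I A)"
  proof -
    have "h X = \<one>\<^bsub>D\<^esub>" if "X \<in> carrier (univ I A)" for X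
      using \<open>trivial_group (univ I A)\<close> that h.hom_one by (auto simp: trivial_group_def)
    moreover have "wcls I A [l] \<in> carrier (univ I A)" if "l \<in> letters I A" for l
      using that by (auto intro!: univ_in simp: words_simps)
    ultimately have 1: "\<gamma> i x = \<one>\<^bsub>D\<^esub>" "j \<in> I \<Longrightarrow> i \<noteq> j \<Longrightarrow> y \<in> carrier (egrp A i j) \<Longrightarrow> \<delta> i j y = \<one>\<^bsub>D\<^esub>"
      if "i \<in> I" "x \<in> carrier (vgrp A i)" for i j x y
      using h that letters_intros unfolding completion_hom_def by metis+
    have "j \<in> I \<Longrightarrow> i \<noteq> j \<Longrightarrow> y \<in> carrier (egrp A i j) \<Longrightarrow> \<delta> i j y = \<one>\<^bsub>D\<^esub>" if "i \<in> I" for i j y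
      using 1(2)[OF that] group.is_monoid[OF amalgam_groups(1)[OF that]] monoid.one_closed by blast
    then have "(\<Union>i\<in>I. \<gamma> i ` carrier (vgrp A i)) \<union> (\<Union>i\<in>I. \<Union>j\<in>I - {i}. \<delta> i j ` carrier (egrp A i j)) \<subseteq> {\<one>\<^bsub>D\<^esub>}"
      using 1(1) by auto
    from D.mono_generate[OF this] have "carrier D \<subseteq> generate D {\<one>\<^bsub>D\<^esub>}"
      using D(1) by (simp add: is_completion_def)
    then have "carrier D = {\<one>\<^bsub>D\<^esub>}" using D.generate_one by auto
    then show False using D(2) by (simp add: trivial_group_def)
  qed
  then show ?thesis using universal_completion_exists by blast
qed

end

section \<open>Images of the standard amalgam\<close>

lemma hom_factor:
  assumes "group G" "group H" "group C" "p \<in> hom G H" "p ` carrier G = carrier H" "h \<in> hom G C"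
    "\<And>x. x \<in> carrier G \<Longrightarrow> p x = \<one>\<^bsub>H\<^esub> \<Longrightarrow> h x = \<one>\<^bsub>C\<^esub>"
  shows "\<exists>q \<in> hom H C. \<forall>x\<in>carrier G. q (p x) = h x"
proof -
  interpret p: group_hom G H p using assms by (simp add: group_hom_def group_hom_axioms_def)
  interpret h: group_hom G C h using assms by (simp add: group_hom_def group_hom_axioms_def)
  have eq: "h x = h y" if "x \<in> carrier G" "y \<in> carrier G" "p x = p y" for x y
  proof -
    have "h (x \<otimes>\<^bsub>G\<^esub> inv\<^bsub>G\<^esub> y) = \<one>\<^bsub>C\<^esub>" using that by (intro assms(7)) simp_all
    then show ?thesis using that by (simp add: h.H.inv_solve_right')
  qed
  define q where "q y = h (inv_into (carrier G) p y)" for y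
  have r: "inv_into (carrier G) p y \<in> carrier G" "p (inv_into (carrier G) p y) = y" if "y \<in> carrier H" for y
    using that assms(5) by (metis inv_into_into, metis f_inv_into_f)
  have q: "q (p x) = h x" if "x \<in> carrier G" for x
    unfolding q_def using that r[of "p x"] by (intro eq) auto
  have "q \<in> hom H C"
  proof (rule homI)
    fix y z assume yz: "y \<in> carrier H" "z \<in> carrier H"
    then show "q y \<in> carrier C" unfolding q_def using r by simp
    have "q (p (inv_into (carrier G) p y \<otimes>\<^bsub>G\<^esub> inv_into (carrier G) p z)) = q y \<otimes>\<^bsub>C\<^esub> q z"
      using r yz by (subst q) (simp_all add: q_def)
    then show "q (y \<otimes>\<^bsub>H\<^esub> z) = q y \<otimes>\<^bsub>C\<^esub> q z" using r yz by simp
  qed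
  with q show ?thesis by blast
qed

text \<open>The generation clause of a completion is met by passing to the subgroup generated by the
  images; a single nontrivial image keeps this subgroup nontrivial.\<close>

lemma completion_generated:
  fixes C :: "'c monoid"
  assumes C: "group C" and \<alpha>: "\<And>i. i \<in> I \<Longrightarrow> \<alpha> i \<in> hom (vgrp A i) C"
    and \<beta>: "\<And>i j. i \<in> I \<Longrightarrow> j \<in> I \<Longrightarrow> i \<noteq> j \<Longrightarrow> \<beta> i j \<in> hom (egrp A i j) C"
    and sym: "\<And>i j x. i \<in> I \<Longrightarrow> j \<in> I \<Longrightarrow> i \<noteq> j \<Longrightarrow> x \<in> carrier (egrp A i j) \<Longrightarrow> \<beta> i j x = \<beta> j i x"
    and con: "\<And>i j x. i \<in> I \<Longrightarrow> j \<in> I \<Longrightarrow> i \<noteq> j \<Longrightarrow> x \<in> carrier (vgrp A i) \<Longrightarrow> \<beta> i j (conn A i j x) = \<alpha> i x"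
    and nt: "i \<in> I" "x \<in> carrier (vgrp A i)" "\<alpha> i x \<noteq> \<one>\<^bsub>C\<^esub>"
  shows "\<exists>D. is_completion I A D \<alpha> \<beta> \<and> \<not> trivial_group D"
proof -
  interpret group C by (rule C)
  let ?S = "(\<Union>i\<in>I. \<alpha> i ` carrier (vgrp A i)) \<union> (\<Union>i\<in>I. \<Union>j\<in>I - {i}. \<beta> i j ` carrier (egrp A i j))"
  have "\<alpha> i x \<in> carrier C" if "i \<in> I" "x \<in> carrier (vgrp A i)" for i x
    using hom_in_carrier[OF \<alpha>] that by blast
  moreover have "\<beta> i j x \<in> carrier C" if "i \<in> I" "j \<in> I - {i}" "x \<in> carrier (egrp A i j)" for i j x
    using hom_in_carrier[OF \<beta>] that by blast
  ultimately have S: "?S \<subseteq> carrier C" by blast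
  let ?D = "C\<lparr>carrier := generate C ?S\<rparr>"
  note sub = generate_is_subgroup[OF S]
  have D: "group ?D" using subgroup_imp_group[OF sub] .
  have h: "h \<in> hom G ?D" if "h \<in> hom G C" "\<And>x. x \<in> carrier G \<Longrightarrow> h x \<in> ?S" for h and G :: "('x, 'y) monoid_scheme"
    using that generate.incl[of _ ?S C] by (auto simp: hom_def)
  have "?S \<subseteq> generate C ?S" by (rule subsetI) (rule generate.incl)
  then have "generate ?D ?S = carrier ?D"
    using generate_consistent[OF _ sub, of ?S] by simp
  note gen = this
  have "is_completion I A ?D \<alpha> \<beta>"
    unfolding is_completion_def
  proof (intro conjI ballI impI)
    show "\<alpha> i \<in> hom (vgrp A i) ?D" if "i \<in> I" for i by (rule h[OF \<alpha>[OF that]]) (use that in blast)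
    show "\<beta> i j \<in> hom (egrp A i j) ?D" if "i \<in> I" "j \<in> I" "i \<noteq> j" for i j
      by (rule h[OF \<beta>[OF that]]) (use that in blast)
    show "\<beta> i j x = \<beta> j i x" if "i \<in> I" "j \<in> I" "i \<noteq> j" "x \<in> carrier (egrp A i j)" for i j x by (rule sym[OF that])
    show "\<beta> i j (conn A i j x) = \<alpha> i x" if "i \<in> I" "j \<in> I" "i \<noteq> j" "x \<in> carrier (vgrp A i)" for i j x by (rule con[OF that])
  qed (rule D, rule gen)
  moreover have "\<not> trivial_group ?D"
  proof
    assume "trivial_group ?D"
    moreover have "\<alpha> i x \<in> carrier ?D" using generate.incl[of "\<alpha> i x" ?S C] nt(1,2) by (simp add: bexI[of _ i])
    ultimately show False using nt(3) by (auto simp: trivial_group_def)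
  qed
  ultimately show ?thesis by blast
qed

lemma diag_centre_eq: "diag_centre = {(mat 1, mat 1), (sl2_z, sl2_z :: 'k::field^2^2)}"
proof -
  let ?z = "sl2_z :: 'k^2^2"
  interpret G: group "SL2 \<times>\<times> SL2 :: (('k^2^2) \<times> ('k^2^2)) monoid"
    by (rule DirProd_group) (rule SL_group)+
  have zz: "sl2_z ** sl2_z = (mat 1 :: 'k^2^2)" by (simp add: sl2_z_M2 M2_mult M2_one)
  have iz: "inv\<^bsub>SL2 \<times>\<times> SL2\<^esub> (?z, ?z) = (?z, ?z)"
    by (rule G.inv_equality) (simp_all add: SL_simps zz sl2_z_det)
  have "x = (mat 1, mat 1) \<or> x = (?z, ?z)" if "x \<in> generate (SL2 \<times>\<times> SL2) {(?z, ?z)}" for x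
    using that
  proof (induction rule: generate.induct)
    case (eng h1 h2) then show ?case by (auto simp: SL_simps zz)
  qed (auto simp: SL_simps iz)
  then show ?thesis
    using generate.one[of "SL2 \<times>\<times> SL2" "{(?z, ?z)}"]
      generate.incl[of "(?z, ?z)" "{(?z, ?z)}" "SL2 \<times>\<times> SL2"]
    unfolding diag_centre_def by (auto simp: SL_simps)
qed

lemma sl2_z_simps: "sl2_z ** X = X ** (sl2_z :: 'k::field^2^2)" "sl2_z ** sl2_z = (mat 1 :: 'k^2^2)"
  by (rule M2_cases[of X], simp add: sl2_z_M2 M2_mult, simp add: sl2_z_M2 M2_mult M2_one)

lemma SL2_factor_normal:
  assumes N: "N \<in> {{(mat 1, mat 1)}, diag_centre}"
  shows "N \<lhd> (SL2 \<times>\<times> SL2 :: (('k::field^2^2) \<times> ('k^2^2)) monoid)"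
proof -
  let ?G = "SL2 \<times>\<times> SL2 :: (('k^2^2) \<times> ('k^2^2)) monoid"
  interpret G: group ?G by (rule DirProd_group) (rule SL_group)+
  have zc: "sl2_z ** X = X ** sl2_z" for X :: "'k^2^2" by (rule M2_cases[of X]) (simp add: sl2_z_M2 M2_mult)
  have zz: "sl2_z ** sl2_z = (mat 1 :: 'k^2^2)" by (simp add: sl2_z_M2 M2_mult M2_one)
  have sub: "subgroup N ?G"
  proof -
    have "subgroup {\<one>\<^bsub>?G\<^esub>} ?G" by (rule G.triv_subgroup)
    moreover have "subgroup diag_centre ?G" unfolding diag_centre_def
      by (rule G.generate_is_subgroup) (simp add: SL_simps sl2_z_det)
    ultimately show ?thesis using N by (auto simp: SL_simps)
  qed
  have cent: "n \<otimes>\<^bsub>?G\<^esub> x = x \<otimes>\<^bsub>?G\<^esub> n" if "n \<in> N" for n x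
    using that N by (cases x) (auto simp: diag_centre_eq SL_simps zc)
  show "N \<lhd> ?G"
    unfolding G.normal_inv_iff
  proof (intro conjI ballI sub)
    fix x n assume x: "x \<in> carrier ?G" and n: "n \<in> N"
    have "n \<in> carrier ?G" using subgroup.mem_carrier[OF sub n] .
    then have "x \<otimes>\<^bsub>?G\<^esub> n \<otimes>\<^bsub>?G\<^esub> inv\<^bsub>?G\<^esub> x = n"
      using x by (simp only: cent[OF n, symmetric] G.m_assoc G.inv_closed G.r_inv G.r_one)
    then show "x \<otimes>\<^bsub>?G\<^esub> n \<otimes>\<^bsub>?G\<^esub> inv\<^bsub>?G\<^esub> x \<in> N" using n by simp
  qed
qed

section \<open>Kernels of the map from the standard amalgam\<close>

locale ct_graph = twisted_graph I E T \<omega> for I E T and \<omega> :: "nat set \<Rightarrow> 'k::field twist" +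
  fixes A :: "('k^2^2, 'g) amalgam" and \<phi> \<psi>
  assumes CT: "CT_amalgam I E A" and epi: "amalgam_epi I (standard_amalgam E T \<omega>) A \<phi> \<psi>"
begin

abbreviation "std \<equiv> standard_amalgam E T \<omega>"

lemma amalg: "is_amalgam I A" and vgrp: "i \<in> I \<Longrightarrow> vgrp A i = SL2"
  using CT by (auto simp: CT_amalgam_def)

lemma egrp_group: "i \<in> I \<Longrightarrow> j \<in> I \<Longrightarrow> i \<noteq> j \<Longrightarrow> group (egrp A i j)"
  using amalg by (auto simp: is_amalgam_def)

lemma egrp_sym: "i \<in> I \<Longrightarrow> j \<in> I \<Longrightarrow> i \<noteq> j \<Longrightarrow> egrp A j i = egrp A i j"
  using amalg by (simp add: is_amalgam_def)

lemma conn_hom: "i \<in> I \<Longrightarrow> j \<in> I \<Longrightarrow> i \<noteq> j \<Longrightarrow> conn A i j \<in> hom SL2 (egrp A i j)"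
  using amalg vgrp[of i] unfolding is_amalgam_def by metis

lemma std_simps: "vgrp std i = SL2"
  "{i, j} \<in> E \<Longrightarrow> egrp std i j = image_group Inl SL3"
  "{i, j} \<notin> E \<Longrightarrow> egrp std i j = image_group Inr (SL2 \<times>\<times> SL2)"
  "{i, j} \<in> E \<Longrightarrow> i < j \<Longrightarrow> conn std i j X = Inl (block_upper X)"
  "{i, j} \<in> E \<Longrightarrow> i < j \<Longrightarrow> conn std j i X = Inl (block_lower (twm (om {i, j}) X))"
  "{i, j} \<notin> E \<Longrightarrow> i < j \<Longrightarrow> conn std i j X = Inr (X, mat 1)"
  "{i, j} \<notin> E \<Longrightarrow> i < j \<Longrightarrow> conn std j i X = Inr (mat 1, X)"
  by (auto simp: standard_amalgam_def insert_commute om_def twm_id twist_act_twm)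

lemma \<phi>_hom: "i \<in> I \<Longrightarrow> \<phi> i \<in> hom SL2 SL2" "i \<in> I \<Longrightarrow> \<phi> i ` carrier SL2 = carrier SL2"
  using epi vgrp[of i] by (auto simp: amalgam_epi_def amalgam_hom_def std_simps)

lemma \<phi>_mult: "i \<in> I \<Longrightarrow> det X = 1 \<Longrightarrow> det Y = 1 \<Longrightarrow> \<phi> i (X ** Y) = \<phi> i X ** \<phi> i Y"
  "i \<in> I \<Longrightarrow> det X = 1 \<Longrightarrow> det (\<phi> i X) = 1" "i \<in> I \<Longrightarrow> \<phi> i (mat 1) = mat 1"
proof -
  assume i: "i \<in> I"
  interpret group_hom SL2 SL2 "\<phi> i"
    using \<phi>_hom(1)[OF i] SL_group by (simp add: group_hom_def group_hom_axioms_def)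
  show "det X = 1 \<Longrightarrow> det Y = 1 \<Longrightarrow> \<phi> i (X ** Y) = \<phi> i X ** \<phi> i Y" "det X = 1 \<Longrightarrow> det (\<phi> i X) = 1" "\<phi> i (mat 1) = mat 1"
    using hom_mult[of X Y] hom_closed[of X] hom_one by (simp_all add: SL_simps)
qed

lemma \<psi>_hom:
  assumes "i \<in> I" "j \<in> I" "i \<noteq> j"
  shows "\<psi> i j \<in> hom (egrp std i j) (egrp A i j)" "\<psi> i j ` carrier (egrp std i j) = carrier (egrp A i j)"
    "x \<in> carrier (egrp std i j) \<Longrightarrow> \<psi> i j x = \<psi> j i x"
    "det X = 1 \<Longrightarrow> \<psi> i j (conn std i j X) = conn A i j (\<phi> i X)"
  using epi assms by (auto simp: amalgam_epi_def amalgam_hom_def std_simps SL_simps)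

lemma image_group_iso: "inj_on h (carrier G) \<Longrightarrow> h \<in> hom G (image_group h G)" "carrier (image_group h G) = h ` carrier G"
  using inj_imp_image_group_iso[of h G] by (simp_all add: iso_def image_group_def)

definition psi3 where "psi3 i j B = \<psi> i j (Inl B)"

lemma psi3_hom:
  assumes "{i, j} \<in> E"
  shows "psi3 i j \<in> hom SL3 (egrp A i j)" "psi3 i j ` carrier SL3 = carrier (egrp A i j)"
proof -
  have ij: "i \<in> I" "j \<in> I" "i \<noteq> j" using edge[OF assms] by auto
  have "Inl \<in> hom SL3 (egrp std i j)" using image_group_iso(1)[of Inl SL3] assms by (simp add: std_simps)
  from hom_compose[OF this \<psi>_hom(1)[OF ij]] show "psi3 i j \<in> hom SL3 (egrp A i j)"
    by (simp add: comp_def psi3_def[abs_def])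
  show "psi3 i j ` carrier SL3 = carrier (egrp A i j)"
    using \<psi>_hom(2)[OF ij] assms by (simp add: std_simps image_group_iso image_image psi3_def[abs_def])
qed

lemma psi3_block:
  assumes "{i, j} \<in> E" "i < j" "det X = 1"
  shows "psi3 i j (block_upper X) = conn A i j (\<phi> i X)"
    "psi3 i j (block_lower (twm (om {i, j}) X)) = conn A j i (\<phi> j X)"
proof -
  have ij: "i \<in> I" "j \<in> I" "i \<noteq> j" using edge[OF assms(1)] by auto
  show "psi3 i j (block_upper X) = conn A i j (\<phi> i X)"
    using \<psi>_hom(4)[OF ij assms(3)] assms by (simp add: std_simps psi3_def)
  have "Inl (block_lower (twm (om {i, j}) X)) \<in> carrier (egrp std i j)"
    using assms om_tw by (simp add: std_simps image_group_iso SL_simps block_det twm_props)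
  then show "psi3 i j (block_lower (twm (om {i, j}) X)) = conn A j i (\<phi> j X)"
    using \<psi>_hom(4)[OF ij(2,1) ij(3)[symmetric] assms(3)] \<psi>_hom(3)[OF ij] assms by (simp add: std_simps psi3_def)
qed

text \<open>Composed with the isomorphism of the edge group onto SL_3, the map becomes a surjective
  endomorphism of SL_3, and those are injective.\<close>

lemma psi3_inj:
  assumes "{i, j} \<in> E" "det B = 1" "psi3 i j B = \<one>\<^bsub>egrp A i j\<^esub>"
  shows "B = mat 1"
proof -
  have ij: "i \<in> I" "j \<in> I" "i \<noteq> j" using edge[OF assms(1)] by auto
  obtain \<eta> where \<eta>: "\<eta> \<in> iso (egrp A i j) (SL3 :: ('k^3^3) monoid)"
    using CT ij assms(1) unfolding CT_amalgam_def by blast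
  then have h: "\<eta> \<in> hom (egrp A i j) SL3" "\<eta> ` carrier (egrp A i j) = carrier SL3"
    by (auto simp: iso_def bij_betw_def)
  interpret \<eta>: group_hom "egrp A i j" "SL3 :: ('k^3^3) monoid" \<eta>
    using h egrp_group[OF ij] SL_group by (simp add: group_hom_def group_hom_axioms_def)
  have "\<eta> \<circ> psi3 i j \<in> hom SL3 SL3" by (rule hom_compose[OF psi3_hom(1)[OF assms(1)] h(1)])
  moreover have "(\<eta> \<circ> psi3 i j) ` carrier SL3 = carrier SL3"
    using psi3_hom(2)[OF assms(1)] h(2) by (metis image_comp)
  moreover have "(\<eta> \<circ> psi3 i j) B = mat 1" using assms(3) \<eta>.hom_one by (simp add: SL_simps)
  ultimately show ?thesis using SL3_epi_inj[of "\<eta> \<circ> psi3 i j" B] assms(2) by blast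
qed

lemma conn_one: "i \<in> I \<Longrightarrow> j \<in> I \<Longrightarrow> i \<noteq> j \<Longrightarrow> conn A i j (mat 1) = \<one>\<^bsub>egrp A i j\<^esub>"
  using hom_one[OF conn_hom SL_group egrp_group] by (simp add: SL_simps)

lemma block_one: "block_upper X = mat 1 \<longleftrightarrow> X = mat 1" "block_lower X = mat 1 \<longleftrightarrow> X = mat 1"
  by (rule M2_cases[of X], auto simp: block_M2 M3_one M2_one M3_eq M2_eq)+

lemma twm_one:
  assumes "w \<in> twist_set" "det (X :: 'k^2^2) = 1" "twm w X = mat 1"
  shows "X = mat 1"
proof -
  obtain a b c d where A: "X = M2 a b c d" by (rule M2_cases)
  have d: "a * d - b * c = 1" using assms(2) by (simp add: A M2_det)
  have s: "field_aut (snd w)" using assms by (auto simp: twist_set_def)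
  note p = field_aut_props[OF s]
  have d': "snd w a * snd w d - snd w b * snd w c = 1" using p d by metis
  have inj: "snd w x = snd w y \<longleftrightarrow> x = y" for x y
    using s unfolding field_aut_def by (metis bij_pointE)
  have i0: "snd w x = 0 \<longleftrightarrow> x = 0" "snd w x = 1 \<longleftrightarrow> x = 1" for x using inj[of x] p(1,2) by metis+
  show ?thesis
    using assms(3) by (auto simp: twm_def A map_M2 cof_M2[OF d'] M2_one M2_eq i0 split: if_splits)
qed

text \<open>Injectivity is inherited from an edge at i: the standard connecting map into SL_3 is
  injective, and so is \<open>psi3\<close>. If i carries the larger label a twist intervenes, which
  is injective as well.\<close>

lemma \<phi>_inj:
  assumes "i \<in> I" "det X = 1" "\<phi> i X = mat 1"
  shows "X = mat 1"
proof -
  obtain j where e: "{i, j} \<in> E" using neighbor[OF assms(1)] by blast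
  have ij: "i \<in> I" "j \<in> I" "i \<noteq> j" "{j, i} \<in> E" using edge[OF e] e by (auto simp: insert_commute)
  have 1: "conn A i j (\<phi> i X) = \<one>\<^bsub>egrp A i j\<^esub>" using assms conn_one[OF ij(1-3)] by simp
  show ?thesis
  proof (cases "i < j")
    case True
    then have "block_upper X = mat 1"
      using psi3_inj[OF e, of "block_upper X"] psi3_block(1)[OF e True assms(2)] 1 assms(2) by (simp add: block_det)
    then show ?thesis by (simp add: block_one)
  next
    case False
    then have "j < i" using ij by simp
    then have "block_lower (twm (om {j, i}) X) = mat 1"
      using psi3_inj[OF ij(4), of "block_lower (twm (om {j, i}) X)"] psi3_block(2)[OF ij(4) _ assms(2)] 1 assms(2)
        egrp_sym[OF ij(1-3)] om_tw[OF ij(4)] by (simp add: block_det twm_props)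
    then show ?thesis using twm_one[OF om_tw[OF ij(4)] assms(2)] by (simp add: block_one)
  qed
qed

text \<open>A surjective homomorphism sends the centre into the centre, and injectivity then leaves
  only z as the image of z.\<close>

lemma \<phi>_z: "i \<in> I \<Longrightarrow> \<phi> i sl2_z = sl2_z"
proof -
  assume i: "i \<in> I"
  have "\<phi> i sl2_z ** Y = Y ** \<phi> i sl2_z" if "det Y = 1" for Y
  proof -
    have "Y \<in> \<phi> i ` carrier SL2" using \<phi>_hom(2)[OF i] that by (simp add: SL_simps)
    then obtain X where X: "det X = 1" "Y = \<phi> i X" by (auto simp: SL_simps)
    have "sl2_z ** X = X ** sl2_z" by (rule M2_cases[of X]) (simp add: sl2_z_M2 M2_mult)
    then show ?thesis using X \<phi>_mult(1)[OF i, of X sl2_z] \<phi>_mult(1)[OF i, of sl2_z X] by (simp add: sl2_z_det)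
  qed
  then have "\<phi> i sl2_z = mat 1 \<or> \<phi> i sl2_z = sl2_z"
    using \<phi>_mult(2)[OF i sl2_z_det] by (intro SL2_centre) auto
  then show ?thesis using \<phi>_inj[OF i sl2_z_det] \<phi>_mult(3)[OF i] by metis
qed

lemma \<phi>_cancel:
  assumes "i \<in> I" "det X = 1" "det Y = 1" "\<phi> i X = \<phi> i Y"
  shows "X = Y"
proof -
  have i: "det (matrix_inv Y) = 1" using matrix_inv_SL assms by blast
  have "\<phi> i (X ** matrix_inv Y) = \<phi> i (Y ** matrix_inv Y)"
    using assms i by (simp add: \<phi>_mult)
  then have "\<phi> i (X ** matrix_inv Y) = mat 1"
    using assms by (simp add: matrix_inv_SL \<phi>_mult)
  then have "X ** matrix_inv Y = mat 1"
    using \<phi>_inj[OF assms(1)] assms(2) i by (simp add: det_mul)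
  then have "X ** matrix_inv Y ** Y = Y" by simp
  then show ?thesis using matrix_inv_SL(2)[OF assms(3)] by (simp add: matrix_mul_assoc[symmetric])
qed

text \<open>Both forms of the group at a non-edge are handled at once: N is trivial or
  \<open>diag_centre\<close>, and it is exactly the kernel of multiplying the two connecting
  maps.\<close>

lemma nonedge:
  assumes "i \<in> I" "j \<in> I" "i \<noteq> j" "{i, j} \<notin> E"
  obtains N \<eta> where "N \<in> {{(mat 1, mat 1)}, diag_centre}" "\<eta> \<in> iso ((SL2 \<times>\<times> SL2) Mod N) (egrp A i j)"
    "\<And>x y. det x = 1 \<Longrightarrow> det y = 1 \<Longrightarrow> conn A i j x \<otimes>\<^bsub>egrp A i j\<^esub> conn A j i y = \<eta> (N #>\<^bsub>SL2 \<times>\<times> SL2\<^esub> (x, y))"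
    "\<And>x y. det x = 1 \<Longrightarrow> det y = 1 \<Longrightarrow> conn A j i y \<otimes>\<^bsub>egrp A i j\<^esub> conn A i j x = \<eta> (N #>\<^bsub>SL2 \<times>\<times> SL2\<^esub> (x, y))"
    "\<And>x y. det x = 1 \<Longrightarrow> det y = 1 \<Longrightarrow> conn A i j x \<otimes>\<^bsub>egrp A i j\<^esub> conn A j i y = \<one>\<^bsub>egrp A i j\<^esub> \<longleftrightarrow> (x, y) \<in> N"
    "N \<lhd> SL2 \<times>\<times> SL2"
proof -
  let ?G = "SL2 \<times>\<times> SL2 :: (('k^2^2) \<times> ('k^2^2)) monoid"
  interpret G: group ?G by (rule DirProd_group) (rule SL_group)+
  obtain N \<eta> where N: "N \<in> {{(mat 1, mat 1)}, diag_centre}" and \<eta>: "\<eta> \<in> iso (?G Mod N) (egrp A i j)"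
    and c: "\<And>x. x \<in> carrier SL2 \<Longrightarrow> \<eta> (N #>\<^bsub>?G\<^esub> (x, mat 1)) = conn A i j x"
      "\<And>x. x \<in> carrier SL2 \<Longrightarrow> \<eta> (N #>\<^bsub>?G\<^esub> (mat 1, x)) = conn A j i x"
    using CT assms unfolding CT_amalgam_def by metis
  have nor: "N \<lhd> ?G" by (rule SL2_factor_normal[OF N])
  have sub: "subgroup N ?G" by (rule normal_imp_subgroup[OF nor])
  interpret Q: group "?G Mod N" using nor by (rule normal.factorgroup_is_group)
  interpret \<eta>: group_hom "?G Mod N" "egrp A i j" \<eta>
    using \<eta> Q.is_group egrp_group[OF assms(1-3)] by (simp add: group_hom_def group_hom_axioms_def iso_def)
  have in_Q: "N #>\<^bsub>?G\<^esub> (x, y) \<in> carrier (?G Mod N)" if "det x = 1" "det y = 1" for x y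
    using that G.rcosetsI[OF subgroup.subset[OF sub]] by (simp add: FactGroup_def SL_simps)
  have mult: "(N #>\<^bsub>?G\<^esub> (x, y)) \<otimes>\<^bsub>?G Mod N\<^esub> (N #>\<^bsub>?G\<^esub> (x', y')) = N #>\<^bsub>?G\<^esub> (x ** x', y ** y')"
    if "det x = 1" "det y = 1" "det x' = 1" "det y' = 1" for x y x' y'
    using normal.rcos_sum[OF nor, of "(x, y)" "(x', y')"] that by (simp add: FactGroup_def SL_simps)
  have d1: "det (mat 1 :: 'k^2^2) = 1" by simp
  have 1: "conn A i j x \<otimes>\<^bsub>egrp A i j\<^esub> conn A j i y = \<eta> (N #>\<^bsub>?G\<^esub> (x, y))" if "det x = 1" "det y = 1" for x y
    using \<eta>.hom_mult[OF in_Q[OF that(1) d1] in_Q[OF d1 that(2)]] mult[OF that(1) d1 d1 that(2)] c that by (simp add: SL_simps)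
  have 2: "conn A j i y \<otimes>\<^bsub>egrp A i j\<^esub> conn A i j x = \<eta> (N #>\<^bsub>?G\<^esub> (x, y))" if "det x = 1" "det y = 1" for x y
    using \<eta>.hom_mult[OF in_Q[OF d1 that(2)] in_Q[OF that(1) d1]] mult[OF d1 that(2) that(1) d1] c that by (simp add: SL_simps)
  have inj: "inj_on \<eta> (carrier (?G Mod N))" using \<eta> by (simp add: iso_def bij_betw_def)
  have 3: "conn A i j x \<otimes>\<^bsub>egrp A i j\<^esub> conn A j i y = \<one>\<^bsub>egrp A i j\<^esub> \<longleftrightarrow> (x, y) \<in> N" if "det x = 1" "det y = 1" for x y
  proof -
    have "\<eta> (N #>\<^bsub>?G\<^esub> (x, y)) = \<one>\<^bsub>egrp A i j\<^esub> \<longleftrightarrow> N #>\<^bsub>?G\<^esub> (x, y) = \<one>\<^bsub>?G Mod N\<^esub>"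
      using inj in_Q[OF that] Q.one_closed \<eta>.hom_one by (metis inj_onD)
    also have "\<dots> \<longleftrightarrow> N #>\<^bsub>?G\<^esub> (x, y) = N" by (simp add: FactGroup_def)
    also have "\<dots> \<longleftrightarrow> (x, y) \<in> N"
      using G.coset_join1[OF _ _ sub, of "(x, y)"] G.coset_join2[OF _ sub, of "(x, y)"] subgroup.subset[OF sub] that
      by (auto simp: SL_simps)
    finally show ?thesis by (simp only: 1[OF that])
  qed
  show thesis by (rule that[OF N \<eta> 1 2 3 nor])
qed

lemma nonedge_prod:
  assumes "i \<in> I" "j \<in> I" "i \<noteq> j" "{i, j} \<notin> E" "y \<in> carrier (egrp A i j)"
  obtains u v where "det u = 1" "det v = 1" "y = conn A i j u \<otimes>\<^bsub>egrp A i j\<^esub> conn A j i v"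
proof -
  obtain N \<eta> where N: "\<eta> \<in> iso ((SL2 \<times>\<times> SL2) Mod N) (egrp A i j)"
    "\<And>x y. det x = 1 \<Longrightarrow> det y = 1 \<Longrightarrow> conn A i j x \<otimes>\<^bsub>egrp A i j\<^esub> conn A j i y = \<eta> (N #>\<^bsub>SL2 \<times>\<times> SL2\<^esub> (x, y))"
    by (rule nonedge[OF assms(1-4)]) (rule that, assumption+)
  then have "y \<in> \<eta> ` carrier ((SL2 \<times>\<times> SL2) Mod N)" using assms(5) by (simp add: iso_def bij_betw_def)
  then obtain p where p: "p \<in> carrier ((SL2 \<times>\<times> SL2) Mod N)" "y = \<eta> p" by blast
  then obtain u v where uv: "det u = 1" "det v = 1" "p = N #>\<^bsub>SL2 \<times>\<times> SL2\<^esub> (u, v)"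
    by (auto simp: FactGroup_def RCOSETS_def SL_simps)
  then have "y = conn A i j u \<otimes>\<^bsub>egrp A i j\<^esub> conn A j i v" using N(2)[of u v] p by simp
  then show thesis by (rule that[OF uv(1,2)])
qed

lemma conn_mult:
  assumes "i \<in> I" "j \<in> I" "i \<noteq> j"
  shows "det X = 1 \<Longrightarrow> conn A i j X \<in> carrier (egrp A i j)"
    "det X = 1 \<Longrightarrow> det Y = 1 \<Longrightarrow> conn A i j (X ** Y) = conn A i j X \<otimes>\<^bsub>egrp A i j\<^esub> conn A i j Y"
    "det X = 1 \<Longrightarrow> conn A j i X \<in> carrier (egrp A i j)"
    "det X = 1 \<Longrightarrow> det Y = 1 \<Longrightarrow> conn A j i (X ** Y) = conn A j i X \<otimes>\<^bsub>egrp A i j\<^esub> conn A j i Y"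
  using hom_in_carrier[OF conn_hom[OF assms]] hom_in_carrier[OF conn_hom[OF assms(2,1) assms(3)[symmetric]]]
    hom_mult[OF conn_hom[OF assms], of X Y] hom_mult[OF conn_hom[OF assms(2,1) assms(3)[symmetric]], of X Y]
  by (simp_all add: egrp_sym[OF assms] SL_simps)

lemma nonedge_commute:
  assumes "i \<in> I" "j \<in> I" "i \<noteq> j" "{i, j} \<notin> E" "det X = 1" "det Y = 1"
  shows "conn A i j X \<otimes>\<^bsub>egrp A i j\<^esub> conn A j i Y = conn A j i Y \<otimes>\<^bsub>egrp A i j\<^esub> conn A i j X"
proof -
  obtain N \<eta> where N: 
      "\<And>x y. det x = 1 \<Longrightarrow> det y = 1 \<Longrightarrow> conn A i j x \<otimes>\<^bsub>egrp A i j\<^esub> conn A j i y = \<eta> (N #>\<^bsub>SL2 \<times>\<times> SL2\<^esub> (x, y))"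
      "\<And>x y. det x = 1 \<Longrightarrow> det y = 1 \<Longrightarrow> conn A j i y \<otimes>\<^bsub>egrp A i j\<^esub> conn A i j x = \<eta> (N #>\<^bsub>SL2 \<times>\<times> SL2\<^esub> (x, y))"
    by (rule nonedge[OF assms(1-4)]) (rule that, assumption+)
  then show ?thesis using assms by simp
qed

lemma nonedge_central:
  assumes "i \<in> I" "j \<in> I" "i \<noteq> j" "{i, j} \<notin> E" "y \<in> carrier (egrp A i j)"
  shows "conn A i j sl2_z \<otimes>\<^bsub>egrp A i j\<^esub> y = y \<otimes>\<^bsub>egrp A i j\<^esub> conn A i j sl2_z"
proof -
  interpret group "egrp A i j" by (rule egrp_group[OF assms(1-3)])
  note c = conn_mult[OF assms(1-3)]
  obtain u v where uv: "det u = 1" "det v = 1" "y = conn A i j u \<otimes>\<^bsub>egrp A i j\<^esub> conn A j i v"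
    by (rule nonedge_prod[OF assms])
  have 1: "conn A i j sl2_z \<otimes>\<^bsub>egrp A i j\<^esub> conn A i j u = conn A i j u \<otimes>\<^bsub>egrp A i j\<^esub> conn A i j sl2_z"
    using c(2)[of sl2_z u] c(2)[of u sl2_z] uv by (simp add: sl2_z_det sl2_z_simps(1))
  have 2: "conn A i j sl2_z \<otimes>\<^bsub>egrp A i j\<^esub> conn A j i v = conn A j i v \<otimes>\<^bsub>egrp A i j\<^esub> conn A i j sl2_z"
    by (rule nonedge_commute[OF assms(1-4) sl2_z_det uv(2)])
  have "conn A i j sl2_z \<otimes>\<^bsub>egrp A i j\<^esub> y = conn A i j u \<otimes>\<^bsub>egrp A i j\<^esub> conn A i j sl2_z \<otimes>\<^bsub>egrp A i j\<^esub> conn A j i v"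
    using c(1,3) uv 1 by (simp add: sl2_z_det m_assoc[symmetric])
  also have "\<dots> = y \<otimes>\<^bsub>egrp A i j\<^esub> conn A i j sl2_z"
    using c(1,3) uv 2 by (simp add: sl2_z_det m_assoc)
  finally show ?thesis .
qed

lemma conn_z_neq:
  assumes "i \<in> I" "j \<in> I" "i \<noteq> j" "(sl2_z :: 'k^2^2) \<noteq> mat 1"
  shows "conn A i j sl2_z \<noteq> \<one>\<^bsub>egrp A i j\<^esub>"
proof -
  have "inj_on (conn A i j) (carrier SL2)" using amalg assms vgrp[of i] unfolding is_amalgam_def by metis
  moreover have "sl2_z \<in> carrier (SL2 :: ('k^2^2) monoid)" "mat 1 \<in> carrier (SL2 :: ('k^2^2) monoid)"
    by (simp_all add: SL_simps sl2_z_det)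
  ultimately show ?thesis using assms(4) conn_one[OF assms(1-3)] unfolding inj_on_def by metis
qed

end

section \<open>Collapsing completions\<close>

lemma sim0_sym: "(i, j) \<in> sim0 I E \<Longrightarrow> (j, i) \<in> sim0 I E"
  unfolding sim0_def by (auto simp: insert_commute)

lemma sim0_trans:
  assumes "(i, j) \<in> sim0 I E" "(j, k) \<in> sim0 I E"
  shows "(i, k) \<in> sim0 I E"
proof (cases "i = j \<or> j = k")
  case False
  then have n: "i \<in> I" "k \<in> I" "neighbors E i = neighbors E j" "neighbors E j = neighbors E k"
    "neighbors E i \<inter> neighbors E j \<noteq> {}" "{j, k} \<notin> E"
    using assms unfolding sim0_def by blast+
  moreover have "{i, k} \<notin> E" using n(3,6) unfolding neighbors_def by blast
  ultimately show ?thesis by (simp add: sim0_def)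
qed (use assms in auto)

text \<open>\<open>sim0\<close> is itself an equivalence relation, so it suffices to treat the
  generating pairs of \<open>sim_amalgam\<close>.\<close>

lemma sim_amalgam_refinesI:
  fixes A :: "('k::field^2^2, 'g) amalgam"
  assumes "\<And>i j. i \<in> I \<Longrightarrow> j \<in> I \<Longrightarrow> i \<noteq> j \<Longrightarrow> (sl2_z :: 'k^2^2) \<noteq> mat 1 \<Longrightarrow>
      egrp A i j \<cong> (SL2 \<times>\<times> SL2 :: (('k^2^2) \<times> ('k^2^2)) monoid) Mod diag_centre \<Longrightarrow> (i, j) \<in> sim0 I E"
  shows "rel_refines (sim_amalgam I A) (sim0 I E)"
  unfolding rel_refines_def
proof (intro allI impI)
  fix i j assume "(i, j) \<in> sim_amalgam I A"
  then have "i \<in> I" "equivclp (\<lambda>i j. i \<in> I \<and> j \<in> I \<and> i \<noteq> j \<and> (sl2_z :: 'k^2^2) \<noteq> mat 1 \<and>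
       egrp A i j \<cong> (SL2 \<times>\<times> SL2 :: (('k^2^2) \<times> ('k^2^2)) monoid) Mod diag_centre) i j"
    unfolding sim_amalgam_def by auto
  from this(2,1) show "(i, j) \<in> sim0 I E"
  proof (induction rule: equivclp_induct)
    case base then show ?case by (simp add: sim0_def)
  next
    case (step y z)
    then have "(y, z) \<in> sim0 I E \<or> (z, y) \<in> sim0 I E" using assms by blast
    then have "(y, z) \<in> sim0 I E" using sim0_sym by blast
    then show ?case by (rule sim0_trans[OF step.IH[OF step.prems]])
  qed
qed

lemma twm_unip:
  assumes "w \<in> twist_set"
  shows "twm w (M2 1 1 0 1 :: 'k::field^2^2) \<in> {M2 1 1 0 1, M2 1 0 (-1) 1}"
proof -
  have "field_aut (snd w)" using assms by (auto simp: twist_set_def)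
  then show ?thesis by (simp add: twm_def map_M2 field_aut_props cof_M2)
qed

locale ct_completion = ct_graph I E T \<omega> A \<phi> \<psi>
  for I E T and \<omega> :: "nat set \<Rightarrow> 'k::field twist" and A :: "('k^2^2, 'g) amalgam" and \<phi> \<psi> +
  fixes C :: "'c monoid" and \<alpha> \<beta>
  assumes compl: "is_completion I A C \<alpha> \<beta>"
begin

sublocale C: group C using compl by (simp add: is_completion_def)

text \<open>The completion is pulled back along the epimorphism to the standard amalgam, where
  elements are explicit matrices.\<close>

definition gm where "gm i X = \<alpha> i (\<phi> i X)"
definition dl where "dl i j B = \<beta> i j (psi3 i j B)"

lemma \<alpha>_hom: "i \<in> I \<Longrightarrow> \<alpha> i \<in> hom SL2 C"
  using compl vgrp[of i] unfolding is_completion_def by metis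

lemma \<beta>:
  assumes "i \<in> I" "j \<in> I" "i \<noteq> j"
  shows "\<beta> i j \<in> hom (egrp A i j) C" "x \<in> carrier (egrp A i j) \<Longrightarrow> \<beta> i j x = \<beta> j i x"
    "det X = 1 \<Longrightarrow> \<beta> i j (conn A i j X) = \<alpha> i X" "det X = 1 \<Longrightarrow> \<beta> i j (conn A j i X) = \<alpha> j X"
proof -
  have c: "\<beta> i j \<in> hom (egrp A i j) C \<and> (\<forall>x\<in>carrier (egrp A i j). \<beta> i j x = \<beta> j i x) \<and>
      (\<forall>x\<in>carrier (vgrp A i). \<beta> i j (conn A i j x) = \<alpha> i x)" if "i \<in> I" "j \<in> I" "i \<noteq> j" for i j
    using compl that unfolding is_completion_def by fast
  have 1: "\<beta> i j x = \<beta> j i x" if "x \<in> carrier (egrp A i j)" for x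
    by (rule bspec[OF conjunct1[OF conjunct2[OF c[OF assms]]] that])
  have 2: "\<beta> i j (conn A i j X) = \<alpha> i X" if "det X = 1" "i \<in> I" "j \<in> I" "i \<noteq> j" for i j X
    by (rule bspec[OF conjunct2[OF conjunct2[OF c[OF that(2-4)]]]]) (use that in \<open>simp add: vgrp SL_simps\<close>)
  show "\<beta> i j \<in> hom (egrp A i j) C" by (rule conjunct1[OF c[OF assms]])
  show "x \<in> carrier (egrp A i j) \<Longrightarrow> \<beta> i j x = \<beta> j i x" by (rule 1)
  show "det X = 1 \<Longrightarrow> \<beta> i j (conn A i j X) = \<alpha> i X" by (rule 2) (use assms in auto)
  assume X: "det X = 1"
  have "conn A j i X \<in> carrier (egrp A j i)"
    by (rule hom_in_carrier[OF conn_hom]) (use assms X in \<open>auto simp: SL_simps\<close>)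
  then have "\<beta> i j (conn A j i X) = \<beta> j i (conn A j i X)" using egrp_sym[OF assms] by (intro 1) simp
  also have "\<dots> = \<alpha> j X" using assms by (intro 2[OF X]) auto
  finally show "\<beta> i j (conn A j i X) = \<alpha> j X" .
qed

lemma dl_hom: "{i, j} \<in> E \<Longrightarrow> dl i j \<in> hom SL3 C"
  using hom_compose[OF psi3_hom(1) \<beta>(1), of i j] edge[of i j] by (simp add: comp_def dl_def[abs_def])

lemma dl_simps:
  assumes "{i, j} \<in> E"
  shows "det X = 1 \<Longrightarrow> dl i j X \<in> carrier C" "det X = 1 \<Longrightarrow> det Y = 1 \<Longrightarrow> dl i j (X ** Y) = dl i j X \<otimes>\<^bsub>C\<^esub> dl i j Y"
    "dl i j (mat 1) = \<one>\<^bsub>C\<^esub>"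
proof -
  interpret group_hom SL3 C "dl i j" using dl_hom[OF assms] SL_group C.is_group by (simp add: group_hom_def group_hom_axioms_def)
  show "det X = 1 \<Longrightarrow> dl i j X \<in> carrier C" "det X = 1 \<Longrightarrow> det Y = 1 \<Longrightarrow> dl i j (X ** Y) = dl i j X \<otimes>\<^bsub>C\<^esub> dl i j Y"
    "dl i j (mat 1) = \<one>\<^bsub>C\<^esub>"
    using hom_mult[of X Y] hom_closed[of X] hom_one by (simp_all add: SL_simps)
qed

lemma dl_block:
  assumes "{i, j} \<in> E" "i < j" "det X = 1"
  shows "dl i j (block_upper X) = gm i X" "dl i j (block_lower (twm (om {i, j}) X)) = gm j X"
  using edge[OF assms(1)] assms by (simp_all add: dl_def gm_def psi3_block \<beta> \<phi>_mult)

definition killed where "killed i \<longleftrightarrow> (\<forall>X. det X = 1 \<longrightarrow> gm i X = \<one>\<^bsub>C\<^esub>)"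

text \<open>A nonscalar element in the kernel kills the whole SL_3 of the edge, and with it both
  vertex groups embedded there.\<close>

lemma edge_kill:
  assumes "{i, j} \<in> E" "i < j" "det B = 1" "\<And>c. B \<noteq> sc c" "dl i j B = \<one>\<^bsub>C\<^esub>"
  shows "killed i" "killed j"
proof -
  have "dl i j X = \<one>\<^bsub>C\<^esub>" if "det X = 1" for X
    by (rule SL3_hom_trivial[OF C.is_group dl_hom[OF assms(1)] assms(3,5,4) that])
  then show "killed i" "killed j"
    unfolding killed_def
    using dl_block[OF assms(1,2)] om_tw[OF assms(1)] by (metis block_det(1), metis block_det(2) twm_props(1))
qed

lemma unip: "det (M2 1 1 0 1 :: 'k^2^2) = 1" by (simp add: M2_det)

lemma lower_unip:
  assumes "{i, j} \<in> E"
  shows "block_lower (twm (om {i, j}) (M2 1 1 0 1)) \<in> {x23 1, x32 (-1)}"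
  using twm_unip[OF om_tw[OF assms]] by (auto simp: block_M2)

text \<open>A killed vertex group contributes a root element of the edge to the kernel. A twist may
  turn an upper unipotent matrix into a lower one, but the element stays nonscalar, so the other end
  is killed too.\<close>

lemma spread_killed:
  assumes "{i, j} \<in> E" "killed i"
  shows "killed j"
proof (cases "i < j")
  case True
  have "dl i j (x12 1) = \<one>\<^bsub>C\<^esub>"
    using dl_block(1)[OF assms(1) True unip] assms(2) unip by (simp add: killed_def block_M2)
  then show ?thesis using edge_kill(2)[OF assms(1) True, of "x12 1"] by (simp add: M3_det M3_eq)
next
  case False
  have e: "{j, i} \<in> E" "j < i" using assms(1) edge[OF assms(1)] False by (auto simp: insert_commute)
  let ?B = "block_lower (twm (om {j, i}) (M2 1 1 0 1))"
  have "dl j i ?B = \<one>\<^bsub>C\<^esub>" using dl_block(2)[OF e unip] assms(2) unip by (simp add: killed_def)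
  then show ?thesis using edge_kill(1)[OF e, of ?B] lower_unip[OF e(1)] by (auto simp: M3_det M3_eq)
qed

lemma all_killed:
  assumes "killed i" "i \<in> I" "j \<in> I"
  shows "killed j"
proof -
  have "(i, j) \<in> (adj E)\<^sup>*" using conn assms unfolding connected_graph_def by blast
  then show ?thesis
    using assms(1) by (induction rule: rtrancl_induct) (auto simp: adj_def intro: spread_killed)
qed

lemma killed_trivial:
  assumes "killed i" "i \<in> I"
  shows "trivial_group C"
proof -
  have k: "gm j X = \<one>\<^bsub>C\<^esub>" if "j \<in> I" "det X = 1" for j X
    using all_killed[OF assms that(1)] that(2) by (simp add: killed_def)
  have a: "\<alpha> j X = \<one>\<^bsub>C\<^esub>" if "j \<in> I" "det X = 1" for j X
  proof -
    have "X \<in> \<phi> j ` carrier SL2" using \<phi>_hom(2)[OF that(1)] that(2) by (simp add: SL_simps)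
    then show ?thesis using k[OF that(1)] by (auto simp: SL_simps gm_def)
  qed
  have eb: "\<beta> j l y = \<one>\<^bsub>C\<^esub>" if e: "{j, l} \<in> E" "j < l" and y: "y \<in> carrier (egrp A j l)" for j l y
  proof -
    have j: "j \<in> I" using edge[OF e(1)] by simp
    have "dl j l (x12 1) = \<one>\<^bsub>C\<^esub>" using dl_block(1)[OF e unip] k[OF j unip] by (simp add: block_M2)
    then have "dl j l B = \<one>\<^bsub>C\<^esub>" if "det B = 1" for B
      using SL3_hom_trivial[OF C.is_group dl_hom[OF e(1)] _ _ _ that, of "x12 1"] by (simp add: M3_det M3_eq)
    moreover obtain B where "det B = 1" "psi3 j l B = y"
      using psi3_hom(2)[OF e(1)] y by (auto simp: SL_simps elim!: equalityE)
    ultimately show ?thesis by (auto simp: dl_def)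
  qed
  have b: "\<beta> j l y = \<one>\<^bsub>C\<^esub>" if jl: "j \<in> I" "l \<in> I" "j \<noteq> l" and y: "y \<in> carrier (egrp A j l)" for j l y
  proof (cases "{j, l} \<in> E")
    case True
    then have e: "{l, j} \<in> E" by (simp add: insert_commute)
    show ?thesis
      using eb[OF True _ y] eb[OF e, of y] \<beta>(2)[OF jl y] y egrp_sym[OF jl] jl(3) by (cases "j < l") auto
  next
    case False
    obtain u v where uv: "det u = 1" "det v = 1" and "y = conn A j l u \<otimes>\<^bsub>egrp A j l\<^esub> conn A l j v"
      by (rule nonedge_prod[OF jl False y])
    moreover have "conn A j l u \<in> carrier (egrp A j l)" "conn A l j v \<in> carrier (egrp A j l)"
      using conn_mult(1,3)[OF jl] uv by simp_all
    ultimately show ?thesis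
      using hom_mult[OF \<beta>(1)[OF jl]] \<beta>(3,4)[OF jl] uv a jl by simp
  qed
  have "(\<Union>i\<in>I. \<alpha> i ` carrier (vgrp A i)) \<union> (\<Union>i\<in>I. \<Union>j\<in>I - {i}. \<beta> i j ` carrier (egrp A i j)) \<subseteq> {\<one>\<^bsub>C\<^esub>}"
    using a b by (auto simp: vgrp SL_simps)
  from C.mono_generate[OF this] have "carrier C \<subseteq> generate C {\<one>\<^bsub>C\<^esub>}"
    using compl by (simp add: is_completion_def)
  then have "carrier C = {\<one>\<^bsub>C\<^esub>}" using C.generate_one by auto
  then show ?thesis by (simp add: trivial_group_def C.is_group)
qed

lemma gm_nonedge_commute:
  assumes "i \<in> I" "j \<in> I" "i \<noteq> j" "{i, j} \<notin> E" "det X = 1" "det Y = 1"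
  shows "gm i X \<otimes>\<^bsub>C\<^esub> gm j Y = gm j Y \<otimes>\<^bsub>C\<^esub> gm i X"
proof -
  have d: "det (\<phi> i X) = 1" "det (\<phi> j Y) = 1" using \<phi>_mult assms by auto
  note c = conn_mult[OF assms(1-3)]
  note nonedge_commute[OF assms(1-4) d]
  from arg_cong[OF this, of "\<beta> i j"] show ?thesis
    using hom_mult[OF \<beta>(1)[OF assms(1-3)]] c \<beta>(3,4)[OF assms(1-3)] d by (simp add: gm_def)
qed

text \<open>If \<open>k\<close> were adjacent to \<open>i\<close> but not to \<open>j\<close>, then the common image of \<open>z\<close> under \<open>gm i\<close> and \<open>gm j\<close>
  would centralize the image of \<open>gm k\<close>. This does not
  hold in \<open>SL\<^sub>3\<close>, where a commutator of \<open>z\<close> with a root element is a non-scalar element of the kernel.\<close>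

lemma neighbors_sub:
  assumes "\<not> trivial_group C" "i \<in> I" "j \<in> I" "i \<noteq> j" "{i, j} \<notin> E" "gm i sl2_z = gm j sl2_z"
    and z: "(sl2_z :: 'k^2^2) \<noteq> mat 1" and k: "{i, k} \<in> E"
  shows "{j, k} \<in> E"
proof (rule ccontr)
  assume jk: "{j, k} \<notin> E"
  \<comment> \<open>z differs from 1 exactly outside characteristic 2. The commutator of z with a
    root element of parameter 1 or -1 has parameter 2 up to sign, so this is what makes it
    nonscalar.\<close>
  have two: "(1::'k) + 1 \<noteq> 0"
  proof
    assume "(1::'k) + 1 = 0"
    then have "(1::'k) = -1" unfolding add_eq_0_iff .
    then show False using z by (metis sl2_z_def)
  qed
  have kI: "k \<in> I" "k \<noteq> i" using edge[OF k] by auto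
  have "j \<noteq> k" using k assms(5) by (auto simp: insert_commute)
  then have comm: "gm i sl2_z \<otimes>\<^bsub>C\<^esub> gm k X = gm k X \<otimes>\<^bsub>C\<^esub> gm i sl2_z" if "det X = 1" for X
    using gm_nonedge_commute[OF assms(3) kI(1) _ jk, of sl2_z X] that assms(6) by (simp add: sl2_z_det)
  have not_killed: "\<not> killed i" using killed_trivial assms(1,2) by blast
  have contr: False if e: "{a, b} \<in> E" "a < b" "i = a \<or> i = b"
    and ZU: "det Z = 1" "det U = 1" "det U' = 1" "Z ** Z = mat 1" "U ** U' = mat 1" "dl a b Z \<otimes>\<^bsub>C\<^esub> dl a b U = dl a b U \<otimes>\<^bsub>C\<^esub> dl a b Z"
    and ns: "\<And>c. Z ** U ** Z ** U' \<noteq> sc c" for a b Z U U'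
  proof -
    note m = dl_simps(1,2)[OF e(1)]
    have "dl a b (Z ** U ** Z ** U') = dl a b Z \<otimes>\<^bsub>C\<^esub> dl a b U \<otimes>\<^bsub>C\<^esub> dl a b Z \<otimes>\<^bsub>C\<^esub> dl a b U'"
      using ZU(1-3) by (simp add: m det_mul)
    also have "\<dots> = dl a b U \<otimes>\<^bsub>C\<^esub> dl a b (Z ** Z) \<otimes>\<^bsub>C\<^esub> dl a b U'"
      unfolding ZU(6) using ZU(1-3) by (simp add: m C.m_assoc)
    also have "\<dots> = dl a b (U ** U')"
      using ZU(1-4) dl_simps(3)[OF e(1)] by (simp add: m)
    also have "\<dots> = \<one>\<^bsub>C\<^esub>" using ZU(5) dl_simps(3)[OF e(1)] by simp
    finally have "killed a" "killed b"
      using edge_kill[OF e(1,2) _ ns] ZU by (simp_all add: det_mul)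
    then show False using not_killed e(3) by blast
  qed
  show False
  proof (cases "i < k")
    case True
    let ?U = "block_lower (twm (om {i, k}) (M2 1 1 0 1)) :: 'k^3^3"
    have zb: "dl i k (M3 (-1) 0 0 0 (-1) 0 0 0 1) = gm i sl2_z"
      using dl_block(1)[OF k True sl2_z_det] by (simp add: sl2_z_M2 block_M2)
    have c: "dl i k (M3 (-1) 0 0 0 (-1) 0 0 0 1) \<otimes>\<^bsub>C\<^esub> dl i k ?U = dl i k ?U \<otimes>\<^bsub>C\<^esub> dl i k (M3 (-1) 0 0 0 (-1) 0 0 0 1)"
      unfolding zb dl_block(2)[OF k True unip] by (rule comm[OF unip])
    from lower_unip[OF k] show False
    proof
      assume "?U = x23 1"
      then show False using c two
        by (intro contr[OF k True, of "M3 (-1) 0 0 0 (-1) 0 0 0 1" "x23 1" "x23 (-1)"])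
          (simp_all add: M3_det M3_mult M3_one M3_eq eq_neg_iff_add_eq_0 neg_eq_iff_add_eq_0)
    next
      assume "?U \<in> {x32 (-1)}"
      then show False using c two
        by (intro contr[OF k True, of "M3 (-1) 0 0 0 (-1) 0 0 0 1" "x32 (-1)" "x32 1"])
          (simp_all add: M3_det M3_mult M3_one M3_eq eq_neg_iff_add_eq_0 neg_eq_iff_add_eq_0)
    qed
  next
    case False
    then have e: "{k, i} \<in> E" "k < i" using k kI(2) by (auto simp: insert_commute)
    have "twm (om {k, i}) sl2_z = (sl2_z :: 'k^2^2)" using om_tw[OF e(1)] by (simp add: twm_props)
    then have zb: "dl k i (M3 1 0 0 0 (-1) 0 0 0 (-1)) = gm i sl2_z"
      using dl_block(2)[OF e sl2_z_det] by (simp add: sl2_z_M2 block_M2)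
    have ub: "dl k i (x12 1) = gm k (M2 1 1 0 1)" using dl_block(1)[OF e unip] by (simp add: block_M2)
    have c: "dl k i (M3 1 0 0 0 (-1) 0 0 0 (-1)) \<otimes>\<^bsub>C\<^esub> dl k i (x12 1) = dl k i (x12 1) \<otimes>\<^bsub>C\<^esub> dl k i (M3 1 0 0 0 (-1) 0 0 0 (-1))"
      unfolding zb ub by (rule comm[OF unip])
    show False using c two
      by (intro contr[OF e, of "M3 1 0 0 0 (-1) 0 0 0 (-1)" "x12 1" "x12 (-1)"])
        (simp_all add: M3_det M3_mult M3_one M3_eq eq_neg_iff_add_eq_0 neg_eq_iff_add_eq_0)
  qed
qed

end

section \<open>Recognising the central product by its centre\<close>

declare mult_FactGroup [simp del] one_FactGroup [simp del]

text \<open>A central matrix is a scalar c, here with c^2 = c^3 = 1. As the central product has a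
  central involution when z is not 1, it cannot be isomorphic to the group of an edge.\<close>

lemma SL3_no_central_involution:
  fixes B :: "'k::field^3^3"
  assumes "det B = 1" "B ** B = mat 1" "\<And>X. det X = 1 \<Longrightarrow> B ** X = X ** B"
  shows "B = mat 1"
proof -
  obtain c where B: "B = sc c" using SL3_scalarI[of B] assms(3) by (force simp: M3_det)
  then have "c * c = 1" "c * c * c = 1" using assms(1,2) by (auto simp: M3_det M3_mult M3_one M3_eq)
  then show ?thesis by (simp add: B M3_one)
qed

context
  fixes G :: "(('k::field^2^2) \<times> ('k^2^2)) monoid" and q :: "'k^2^2 \<Rightarrow> 'k^2^2 \<Rightarrow> (('k^2^2) \<times> ('k^2^2)) set"
  assumes z: "(sl2_z :: 'k^2^2) \<noteq> mat 1"
    and G: "G = SL2 \<times>\<times> SL2" and q: "\<And>X Y. q X Y = diag_centre #>\<^bsub>G\<^esub> (X, Y)"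
begin

lemma central_quotient_eq:
  "q X Y = q X' Y' \<longleftrightarrow> (X = X' \<and> Y = Y') \<or> (X = sl2_z ** X' \<and> Y = sl2_z ** Y')"
proof -
  have q': "q X Y = {(X, Y), (sl2_z ** X, sl2_z ** Y)}" for X Y
    by (auto simp: q G r_coset_def diag_centre_eq SL_simps)
  have "sl2_z ** (sl2_z ** X) = (X :: 'k^2^2)" for X by (simp only: matrix_mul_assoc sl2_z_simps(2) matrix_mul_lid)
  then show ?thesis unfolding q' by (auto simp: doubleton_eq_iff)
qed

lemma central_quotient:
  "group (G Mod diag_centre)"
  "x \<in> carrier (G Mod diag_centre) \<longleftrightarrow> (\<exists>X Y. det X = 1 \<and> det Y = 1 \<and> x = q X Y)"
  "det X = 1 \<Longrightarrow> det Y = 1 \<Longrightarrow> det X' = 1 \<Longrightarrow> det Y' = 1 \<Longrightarrow>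
    q X Y \<otimes>\<^bsub>G Mod diag_centre\<^esub> q X' Y' = q (X ** X') (Y ** Y')"
  "\<one>\<^bsub>G Mod diag_centre\<^esub> = q (mat 1) (mat 1)"
proof -
  note nor = SL2_factor_normal[of "diag_centre :: (('k^2^2) \<times> ('k^2^2)) set", folded G]
  interpret normal diag_centre G by (rule nor) simp
  show "group (G Mod diag_centre)" by (rule factorgroup_is_group)
  show "x \<in> carrier (G Mod diag_centre) \<longleftrightarrow> (\<exists>X Y. det X = 1 \<and> det Y = 1 \<and> x = q X Y)"
    by (auto simp: FactGroup_def RCOSETS_def q G SL_simps Bex_def)
  show "det X = 1 \<Longrightarrow> det Y = 1 \<Longrightarrow> det X' = 1 \<Longrightarrow> det Y' = 1 \<Longrightarrow>
    q X Y \<otimes>\<^bsub>G Mod diag_centre\<^esub> q X' Y' = q (X ** X') (Y ** Y')"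
    using rcos_sum[of "(X, Y)" "(X', Y')"] by (simp add: FactGroup_def q G SL_simps)
  show "\<one>\<^bsub>G Mod diag_centre\<^esub> = q (mat 1) (mat 1)"
    using coset_mult_one[OF subset] by (simp add: FactGroup_def q G SL_simps)
qed

lemma sl2_z_fixes: "det Y = 1 \<Longrightarrow> Y \<noteq> sl2_z ** (Y :: 'k^2^2)"
proof
  assume "det Y = 1" "Y = sl2_z ** Y"
  then have "sl2_z ** Y ** matrix_inv Y = mat 1" using matrix_inv_SL(1)[of Y] by simp
  then have "sl2_z ** (Y ** matrix_inv Y) = mat 1" by (simp add: matrix_mul_assoc)
  then show False using matrix_inv_SL(1)[of Y] z \<open>det Y = 1\<close> by simp
qed

text \<open>If (a, b) commutes with (X, 1) up to (z, z), comparing second coordinates excludes the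
  factor z, because b is not z b. So a and b are central, and modulo (z, z) the only nontrivial
  class is that of (z, 1).\<close>

lemma central_quotient_centre:
  assumes "x \<in> carrier (G Mod diag_centre)" "x \<noteq> \<one>\<^bsub>G Mod diag_centre\<^esub>"
    "\<And>y. y \<in> carrier (G Mod diag_centre) \<Longrightarrow> x \<otimes>\<^bsub>G Mod diag_centre\<^esub> y = y \<otimes>\<^bsub>G Mod diag_centre\<^esub> x"
  shows "x = q sl2_z (mat 1)"
proof -
  obtain a b where x: "x = q a b" "det a = 1" "det b = 1" using assms(1) central_quotient(2) by blast
  have c: "q (a ** X) (b ** Y) = q (X ** a) (Y ** b)" if "det X = 1" "det Y = 1" for X Y
    using assms(3)[of "q X Y"] that x central_quotient(2,3) by auto
  have "a ** X = X ** a" if "det X = 1" for X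
    using c[OF that, of "mat 1"] sl2_z_fixes[OF x(3)] by (simp add: central_quotient_eq)
  moreover have "b ** Y = Y ** b" if "det Y = 1" for Y
    using c[OF _ that, of "mat 1"] sl2_z_fixes[OF x(2)] by (simp add: central_quotient_eq)
  ultimately have "a = mat 1 \<or> a = sl2_z" "b = mat 1 \<or> b = sl2_z" using SL2_centre x(2,3) by blast+
  then show ?thesis using assms(2) x(1) by (auto simp: central_quotient_eq central_quotient(4) sl2_z_simps(2))
qed

lemma central_quotient_involution:
  "q sl2_z (mat 1) \<in> carrier (G Mod diag_centre)" "q sl2_z (mat 1) \<noteq> \<one>\<^bsub>G Mod diag_centre\<^esub>"
  "q sl2_z (mat 1) \<otimes>\<^bsub>G Mod diag_centre\<^esub> q sl2_z (mat 1) = \<one>\<^bsub>G Mod diag_centre\<^esub>"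
  "y \<in> carrier (G Mod diag_centre) \<Longrightarrow> q sl2_z (mat 1) \<otimes>\<^bsub>G Mod diag_centre\<^esub> y = y \<otimes>\<^bsub>G Mod diag_centre\<^esub> q sl2_z (mat 1)"
proof -
  have d: "det (sl2_z :: 'k^2^2) = 1" "det (mat 1 :: 'k^2^2) = 1" by (simp_all add: sl2_z_det)
  show "q sl2_z (mat 1) \<in> carrier (G Mod diag_centre)" using d central_quotient(2) by blast
  show "q sl2_z (mat 1) \<noteq> \<one>\<^bsub>G Mod diag_centre\<^esub>" using z unfolding central_quotient(4) by (simp add: central_quotient_eq)
  show "q sl2_z (mat 1) \<otimes>\<^bsub>G Mod diag_centre\<^esub> q sl2_z (mat 1) = \<one>\<^bsub>G Mod diag_centre\<^esub>"
    by (simp add: central_quotient(3,4) d sl2_z_simps(2))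
  assume "y \<in> carrier (G Mod diag_centre)"
  then obtain X Y where "y = q X Y" "det X = 1" "det Y = 1" using central_quotient(2) by blast
  then show "q sl2_z (mat 1) \<otimes>\<^bsub>G Mod diag_centre\<^esub> y = y \<otimes>\<^bsub>G Mod diag_centre\<^esub> q sl2_z (mat 1)"
    by (simp add: central_quotient(3) d sl2_z_simps(1))
qed

end

context ct_completion
begin

text \<open>The quotient has exactly one non-trivial central element, so the images of \<open>z\<close> from \<open>i\<close> and from \<open>j\<close> coincide
  there, whichever of the two central products occurs in the definition of the amalgam.\<close>

lemma nontrivial_refines:
  assumes nt: "\<not> trivial_group C"
  shows "rel_refines (sim_amalgam I A) (sim0 I E)"
proof (rule sim_amalgam_refinesI)
  fix i j assume ij: "i \<in> I" "j \<in> I" "i \<noteq> j" and z: "(sl2_z :: 'k^2^2) \<noteq> mat 1"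
    and iso: "egrp A i j \<cong> (SL2 \<times>\<times> SL2 :: (('k^2^2) \<times> ('k^2^2)) monoid) Mod diag_centre"
  let ?Q = "(SL2 \<times>\<times> SL2 :: (('k^2^2) \<times> ('k^2^2)) monoid) Mod diag_centre"
  let ?q = "diag_centre #>\<^bsub>SL2 \<times>\<times> SL2\<^esub> (sl2_z, mat 1 :: 'k^2^2)"
  note cq = central_quotient[OF z refl refl] and centre = central_quotient_centre[OF z refl refl]
    and invol = central_quotient_involution[OF z refl refl]
  obtain \<theta> where \<theta>: "\<theta> \<in> iso (egrp A i j) ?Q" using iso by (auto simp: is_iso_def)
  interpret E: group "egrp A i j" by (rule egrp_group[OF ij])
  interpret \<theta>: group_hom "egrp A i j" ?Q \<theta>
    using \<theta> cq(1) by (simp add: group_hom_def group_hom_axioms_def iso_def E.is_group)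
  have \<theta>s: "\<theta> ` carrier (egrp A i j) = carrier ?Q" and \<theta>i: "inj_on \<theta> (carrier (egrp A i j))"
    using \<theta> by (auto simp: iso_def bij_betw_def)
  have ne: "{i, j} \<notin> E"
  proof
    assume e: "{i, j} \<in> E"
    note p = psi3_hom[OF e]
    interpret p: group_hom SL3 "egrp A i j" "psi3 i j"
      using p SL_group by (simp add: group_hom_def group_hom_axioms_def E.is_group)
    have "?q \<in> \<theta> ` psi3 i j ` carrier SL3" using invol(1) \<theta>s p(2) by simp
    then obtain B where B: "det B = 1" "\<theta> (psi3 i j B) = ?q" by (auto simp: SL_simps)
    have eq: "X = Y" if "det X = 1" "det Y = 1" "\<theta> (psi3 i j X) = \<theta> (psi3 i j Y)" for X Y
    proof -
      have c: "psi3 i j X = psi3 i j Y"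
        by (rule inj_onD[OF \<theta>i that(3)]) (use p.hom_closed that in \<open>simp_all add: SL_simps\<close>)
      have "psi3 i j (X ** matrix_inv Y) = psi3 i j (Y ** matrix_inv Y)"
        using p.hom_mult[of X "matrix_inv Y"] p.hom_mult[of Y "matrix_inv Y"] that c by (simp add: SL_simps matrix_inv_SL)
      also have "\<dots> = \<one>\<^bsub>egrp A i j\<^esub>" using p.hom_one that by (simp add: SL_simps matrix_inv_SL)
      finally have "X ** matrix_inv Y = mat 1"
        using psi3_inj[OF e, of "X ** matrix_inv Y"] that by (simp add: det_mul matrix_inv_SL)
      then have "X ** matrix_inv Y ** Y = Y" by simp
      then show "X = Y" using matrix_inv_SL(2)[OF that(2)] by (simp add: matrix_mul_assoc[symmetric])
    qed
    have m: "\<theta> (psi3 i j (X ** Y)) = \<theta> (psi3 i j X) \<otimes>\<^bsub>?Q\<^esub> \<theta> (psi3 i j Y)" if "det X = 1" "det Y = 1" for X Y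
      using p.hom_mult[of X Y] p.hom_closed[of X] p.hom_closed[of Y] that by (simp add: SL_simps)
    have Q: "\<theta> (psi3 i j X) \<in> carrier ?Q" if "det X = 1" for X
      using p.hom_closed[of X] that by (simp add: SL_simps)
    have o: "\<theta> (psi3 i j (mat 1)) = \<one>\<^bsub>?Q\<^esub>" using p.hom_one by (simp add: SL_simps)
    \<comment> \<open>The composite of \<open>psi3 i j\<close> and \<open>\<theta>\<close> is
      injective, so B inherits from its image that it is central with square 1.\<close>
    have "B = mat 1"
    proof (rule SL3_no_central_involution[OF B(1)])
      have "\<theta> (psi3 i j (B ** B)) = \<theta> (psi3 i j (mat 1))"
        unfolding m[OF B(1) B(1)] B(2) o by (rule invol(3))
      then show "B ** B = mat 1" by (rule eq[rotated 2]) (simp_all add: det_mul B)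
      fix X :: "'k^3^3" assume X: "det X = 1"
      show "B ** X = X ** B" by (rule eq) (simp_all add: det_mul B X m invol(4)[OF Q])
    qed
    then show False using B(2) o invol(2) by simp
  qed
  have \<theta>z: "\<theta> u = ?q"
    if u: "u \<in> carrier (egrp A i j)" "u \<noteq> \<one>\<^bsub>egrp A i j\<^esub>"
      "\<And>y. y \<in> carrier (egrp A i j) \<Longrightarrow> u \<otimes>\<^bsub>egrp A i j\<^esub> y = y \<otimes>\<^bsub>egrp A i j\<^esub> u" for u
  proof (rule centre)
    show "\<theta> u \<in> carrier ?Q" using u by simp
    show "\<theta> u \<noteq> \<one>\<^bsub>?Q\<^esub>"
      using inj_onD[OF \<theta>i, of u "\<one>\<^bsub>egrp A i j\<^esub>"] u \<theta>.hom_one by auto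
    fix y assume "y \<in> carrier ?Q"
    then obtain y' where "y' \<in> carrier (egrp A i j)" "y = \<theta> y'" using \<theta>s by blast
    then show "\<theta> u \<otimes>\<^bsub>?Q\<^esub> y = y \<otimes>\<^bsub>?Q\<^esub> \<theta> u" using u(1) u(3)[of y'] \<theta>.hom_mult by metis
  qed
  have ji: "j \<in> I" "i \<in> I" "j \<noteq> i" "{j, i} \<notin> E" using ij ne by (auto simp: insert_commute)
  note c = conn_mult[OF ij]
  have "\<theta> (conn A i j sl2_z) = ?q"
    by (rule \<theta>z[OF c(1)[OF sl2_z_det] conn_z_neq[OF ij z] nonedge_central[OF ij ne]])
  moreover have "\<theta> (conn A j i sl2_z) = ?q"
    using conn_z_neq[OF ji(1-3) z] nonedge_central[OF ji] 
    by (intro \<theta>z[OF c(3)[OF sl2_z_det]]) (simp_all add: egrp_sym[OF ij])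
  ultimately have "conn A i j sl2_z = conn A j i sl2_z"
    by (intro inj_onD[OF \<theta>i]) (simp_all add: c sl2_z_det)
  then have gz: "gm i sl2_z = gm j sl2_z"
    using \<beta>(3,4)[OF ij sl2_z_det] by (simp add: gm_def \<phi>_z ij)
  have "{i, k} \<in> E \<longleftrightarrow> {j, k} \<in> E" for k
    using neighbors_sub[OF nt ij ne gz z] neighbors_sub[OF nt ji gz[symmetric] z] by blast
  then have "neighbors E i = neighbors E j" by (simp add: neighbors_def)
  moreover have "neighbors E i \<noteq> {}" using neighbor[OF ij(1)] by (auto simp: neighbors_def)
  ultimately show "(i, j) \<in> sim0 I E" using ij ne by (simp add: sim0_def)
qed

end

section \<open>The Kac-Moody completion\<close>

lemma hom_commuting_product:
  assumes "group H" "a \<in> hom G H" "b \<in> hom G' H"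
    and c: "\<And>x y. x \<in> carrier G \<Longrightarrow> y \<in> carrier G' \<Longrightarrow> a x \<otimes>\<^bsub>H\<^esub> b y = b y \<otimes>\<^bsub>H\<^esub> a x"
  shows "(\<lambda>(x, y). a x \<otimes>\<^bsub>H\<^esub> b y) \<in> hom (G \<times>\<times> G') H"
proof (rule homI)
  interpret group H by (rule assms(1))
  note cl = hom_in_carrier[OF assms(2)] hom_in_carrier[OF assms(3)]
  fix p p' assume "p \<in> carrier (G \<times>\<times> G')" "p' \<in> carrier (G \<times>\<times> G')"
  then obtain x y x' y' where p: "p = (x, y)" "p' = (x', y')"
    and xy: "x \<in> carrier G" "x' \<in> carrier G" "y \<in> carrier G'" "y' \<in> carrier G'" by auto
  show "(case p of (x, y) \<Rightarrow> a x \<otimes>\<^bsub>H\<^esub> b y) \<in> carrier H" using xy cl by (simp add: p)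
  have "a x \<otimes>\<^bsub>H\<^esub> a x' \<otimes>\<^bsub>H\<^esub> (b y \<otimes>\<^bsub>H\<^esub> b y') = a x \<otimes>\<^bsub>H\<^esub> (a x' \<otimes>\<^bsub>H\<^esub> b y) \<otimes>\<^bsub>H\<^esub> b y'"
    using xy cl by (simp add: m_assoc)
  also have "\<dots> = a x \<otimes>\<^bsub>H\<^esub> b y \<otimes>\<^bsub>H\<^esub> (a x' \<otimes>\<^bsub>H\<^esub> b y')"
    unfolding c[OF xy(2,3)] using xy cl by (simp add: m_assoc)
  finally show "(case p \<otimes>\<^bsub>G \<times>\<times> G'\<^esub> p' of (x, y) \<Rightarrow> a x \<otimes>\<^bsub>H\<^esub> b y) =
      (case p of (x, y) \<Rightarrow> a x \<otimes>\<^bsub>H\<^esub> b y) \<otimes>\<^bsub>H\<^esub> (case p' of (x, y) \<Rightarrow> a x \<otimes>\<^bsub>H\<^esub> b y)"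
    using xy hom_mult[OF assms(2)] hom_mult[OF assms(3)] by (simp add: p)
qed

locale ct_rep = ct_graph I E T \<omega> A \<phi> \<psi> + twisted_rep I E T \<omega> e f
  for I E T and \<omega> :: "nat set \<Rightarrow> 'k::field twist" and A :: "('k^2^2, 'g) amalgam" and \<phi> \<psi>
    and e f :: "nat \<times> 'k twist \<Rightarrow> 'r::real_algebra" +
  assumes refines: "rel_refines (sim_amalgam I A) (sim0 I E)"
begin

abbreviation "aut \<equiv> LA gens :: ((('r \<Rightarrow> 'k) \<Rightarrow> 'k) \<Rightarrow> (('r \<Rightarrow> 'k) \<Rightarrow> 'k)) monoid"

lemma aut_group: "group aut" by (rule LA_group)

lemma gam_hom: "i \<in> I \<Longrightarrow> gam i \<in> hom SL2 aut"
  by (rule homI) (simp_all add: SL_simps gam_LA gam_mult LA_simps(2,3))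

lemma gam_one: "i \<in> I \<Longrightarrow> gam i (mat 1) = id"
  using hom_one[OF gam_hom SL_group aut_group] by (simp add: SL_simps LA_simps(2,3))

lemma del_hom: "{i, j} \<in> E \<Longrightarrow> i < j \<Longrightarrow> del i j \<in> hom SL3 aut"
  by (rule homI) (simp_all add: SL_simps del_LA del_mult LA_simps(2,3))

lemma del_one: "{i, j} \<in> E \<Longrightarrow> i < j \<Longrightarrow> del i j (mat 1) = id"
  using hom_one[OF del_hom SL_group aut_group] by (simp add: SL_simps LA_simps(2,3))

lemma vertex_rep:
  assumes "i \<in> I"
  shows "\<exists>a\<in>hom SL2 aut. \<forall>X. det X = 1 \<longrightarrow> a (\<phi> i X) = gam i X"
proof -
  have "\<exists>a\<in>hom SL2 aut. \<forall>X\<in>carrier SL2. a (\<phi> i X) = gam i X"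
    by (rule hom_factor[OF SL_group SL_group aut_group \<phi>_hom[OF assms] gam_hom[OF assms]])
      (use \<phi>_inj[OF assms] gam_one[OF assms] in \<open>auto simp: SL_simps LA_simps(2,3)\<close>)
  then show ?thesis by (simp add: Ball_def SL_simps)
qed

lemma edge_rep:
  assumes e: "{i, j} \<in> E" "i < j"
  shows "\<exists>q\<in>hom (egrp A i j) aut. \<forall>X. det X = 1 \<longrightarrow>
    q (conn A i j (\<phi> i X)) = gam i X \<and> q (conn A j i (\<phi> j X)) = gam j X"
proof -
  have ij: "i \<in> I" "j \<in> I" "i \<noteq> j" using edge[OF e(1)] by auto
  obtain q where q: "q \<in> hom (egrp A i j) aut" "\<forall>B\<in>carrier SL3. q (psi3 i j B) = del i j B"
    using hom_factor[OF SL_group egrp_group[OF ij] aut_group psi3_hom[OF e(1)] del_hom[OF e]]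
      psi3_inj[OF e(1)] del_one[OF e] by (auto simp: SL_simps LA_simps(2,3))
  have "q (conn A i j (\<phi> i X)) = gam i X \<and> q (conn A j i (\<phi> j X)) = gam j X" if X: "det X = 1" for X
    using q(2) X om_tw[OF e(1)] unfolding psi3_block[OF e X, symmetric]
    by (simp add: SL_simps block_det twm_props del_upper[OF e X] del_lower[OF e X])
  then show ?thesis using q(1) by blast
qed

lemma nonedge_rep:
  assumes ij: "i \<in> I" "j \<in> I" "i \<noteq> j" and ne: "{i, j} \<notin> E"
  shows "\<exists>q\<in>hom (egrp A i j) aut. \<forall>X. det X = 1 \<longrightarrow>
    q (conn A i j (\<phi> i X)) = gam i X \<and> q (conn A j i (\<phi> j X)) = gam j X"
proof -
  let ?p = "\<lambda>(X, Y). conn A i j (\<phi> i X) \<otimes>\<^bsub>egrp A i j\<^esub> conn A j i (\<phi> j Y)"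
  let ?h = "\<lambda>(X, Y). gam i X \<otimes>\<^bsub>aut\<^esub> gam j Y"
  obtain N \<eta> where N: "N \<in> {{(mat 1, mat 1)}, diag_centre}" and \<eta>: "\<eta> \<in> iso ((SL2 \<times>\<times> SL2) Mod N) (egrp A i j)"
    and ker: "\<And>x y. det x = 1 \<Longrightarrow> det y = 1 \<Longrightarrow> conn A i j x \<otimes>\<^bsub>egrp A i j\<^esub> conn A j i y = \<one>\<^bsub>egrp A i j\<^esub> \<longleftrightarrow> (x, y) \<in> N"
    and nor: "N \<lhd> SL2 \<times>\<times> SL2"
    by (rule nonedge[OF ij ne]) (rule that, assumption+)
  interpret H: group "egrp A i j" by (rule egrp_group[OF ij])
  note ji = ij(2,1) ij(3)[symmetric]
  have hom_c: "(\<lambda>X. conn A i j (\<phi> i X)) \<in> hom SL2 (egrp A i j)" "(\<lambda>X. conn A j i (\<phi> j X)) \<in> hom SL2 (egrp A i j)"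
    using hom_compose[OF \<phi>_hom(1)[OF ij(1)] conn_hom[OF ij]] hom_compose[OF \<phi>_hom(1)[OF ij(2)] conn_hom[OF ji]]
    by (simp_all add: comp_def egrp_sym[OF ij])
  have p_hom: "?p \<in> hom (SL2 \<times>\<times> SL2) (egrp A i j)"
    by (rule hom_commuting_product[OF H.is_group hom_c])
      (use nonedge_commute[OF ij ne] \<phi>_mult ij in \<open>simp add: SL_simps\<close>)
  have h_hom: "?h \<in> hom (SL2 \<times>\<times> SL2) aut"
    by (rule hom_commuting_product[OF aut_group gam_hom[OF ij(1)] gam_hom[OF ij(2)]])
      (use gam_commute[OF ij ne] in \<open>simp add: SL_simps LA_simps(2,3)\<close>)
  have p_sur: "?p ` carrier (SL2 \<times>\<times> SL2) = carrier (egrp A i j)"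
  proof
    show "?p ` carrier (SL2 \<times>\<times> SL2) \<subseteq> carrier (egrp A i j)" using hom_carrier[OF p_hom] .
    show "carrier (egrp A i j) \<subseteq> ?p ` carrier (SL2 \<times>\<times> SL2)"
    proof
      fix y assume "y \<in> carrier (egrp A i j)"
      then obtain u v where uv: "det u = 1" "det v = 1" "y = conn A i j u \<otimes>\<^bsub>egrp A i j\<^esub> conn A j i v"
        by (rule nonedge_prod[OF ij ne])
      then have "u \<in> \<phi> i ` carrier SL2" "v \<in> \<phi> j ` carrier SL2"
        using \<phi>_hom(2) ij by (simp_all add: SL_simps)
      then obtain X Y where "X \<in> carrier SL2" "Y \<in> carrier SL2" "u = \<phi> i X" "v = \<phi> j Y" by blast
      then show "y \<in> ?p ` carrier (SL2 \<times>\<times> SL2)" using uv(3) by (intro image_eqI[of _ _ "(X, Y)"]) simp_all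
    qed
  qed
  \<comment> \<open>The only nontrivial element of N that could obstruct the factorisation is (z,
    z). In characteristic 2 it is trivial and \<open>sim_amalgam\<close> relates no distinct
    vertices, hence the separate case; otherwise the refinement hypothesis gives i and j the same
    neighbours.\<close>
  have z_prod: "gam i sl2_z \<circ> gam j sl2_z = id" if "N = diag_centre"
  proof (cases "(sl2_z :: 'k^2^2) = mat 1")
    case True
    then show ?thesis using gam_one ij by simp
  next
    case False
    interpret Q: group "(SL2 \<times>\<times> SL2) Mod N" by (rule normal.factorgroup_is_group[OF nor])
    have "egrp A i j \<cong> (SL2 \<times>\<times> SL2 :: (('k^2^2) \<times> ('k^2^2)) monoid) Mod diag_centre"
      using Q.iso_sym[OF is_isoI[OF \<eta>]] that by simp
    then have "(i, j) \<in> sim_amalgam I A"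
      using ij False unfolding sim_amalgam_def by (auto intro!: r_into_equivclp)
    then have "neighbors E i = neighbors E j"
      using refines ij(3) by (auto simp: rel_refines_def sim0_def)
    then have "gam i sl2_z \<circ> gam j sl2_z = gam i (sl2_z ** sl2_z)"
      using gam_mult[OF ij(1) sl2_z_det sl2_z_det] gam_z_eq[OF ij(1,2)] by simp
    then show ?thesis using gam_one ij by (simp add: sl2_z_simps(2))
  qed
  have kernel: "?h s = \<one>\<^bsub>aut\<^esub>" if s: "s \<in> carrier (SL2 \<times>\<times> SL2)" "?p s = \<one>\<^bsub>egrp A i j\<^esub>" for s
  proof -
    obtain X Y where XY: "s = (X, Y)" "det X = 1" "det Y = 1" using s(1) by (auto simp: SL_simps)
    then have "(\<phi> i X, \<phi> j Y) \<in> N" using ker[of "\<phi> i X" "\<phi> j Y"] s(2) \<phi>_mult(2) ij by simp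
    then have "\<phi> i X = mat 1 \<and> \<phi> j Y = mat 1 \<or> N = diag_centre \<and> \<phi> i X = sl2_z \<and> \<phi> j Y = sl2_z"
      using N by (auto simp: diag_centre_eq)
    then show ?thesis
    proof (elim disjE conjE)
      assume "\<phi> i X = mat 1" "\<phi> j Y = mat 1"
      then have "X = mat 1" "Y = mat 1" using \<phi>_inj XY ij by blast+
      then show ?thesis using gam_one ij by (simp add: XY LA_simps(2,3))
    next
      assume "N = diag_centre" and XYz: "\<phi> i X = sl2_z" "\<phi> j Y = sl2_z"
      have "X = sl2_z" "Y = sl2_z"
        using \<phi>_cancel[OF ij(1) XY(2) sl2_z_det] \<phi>_cancel[OF ij(2) XY(3) sl2_z_det] XYz \<phi>_z ij by simp_all
      then show ?thesis using z_prod[OF \<open>N = diag_centre\<close>] by (simp add: XY LA_simps(2,3))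
    qed
  qed
  have "\<exists>q\<in>hom (egrp A i j) aut. \<forall>s\<in>carrier (SL2 \<times>\<times> SL2). q (?p s) = ?h s"
    by (rule hom_factor[OF DirProd_group[OF SL_group SL_group] H.is_group aut_group p_hom p_sur h_hom kernel])
  then obtain q where q: "q \<in> hom (egrp A i j) aut"
    "\<And>X Y. det X = 1 \<Longrightarrow> det Y = 1 \<Longrightarrow> q (conn A i j (\<phi> i X) \<otimes>\<^bsub>egrp A i j\<^esub> conn A j i (\<phi> j Y)) = gam i X \<circ> gam j Y"
    by (auto simp: SL_simps LA_simps(2,3))
  have "q (conn A i j (\<phi> i X)) = gam i X \<and> q (conn A j i (\<phi> j X)) = gam j X" if X: "det X = 1" for X
  proof -
    have d: "det (mat 1 :: 'k^2^2) = 1" by simp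
    note o = conn_one[OF ij] conn_one[OF ji] \<phi>_mult(3)[OF ij(1)] \<phi>_mult(3)[OF ij(2)] gam_one[OF ij(1)] gam_one[OF ij(2)]
    show ?thesis
      using q(2)[OF X d] q(2)[OF d X] conn_mult(1,3)[OF ij] \<phi>_mult(2) ij X by (simp add: o egrp_sym[OF ij])
  qed
  then show ?thesis using q(1) by blast
qed

lemma completion:
  assumes nz: "\<And>x y. cov x y \<Longrightarrow> \<exists>\<phi>\<in>dual gens. \<phi> (br (e x) (e y)) \<noteq> (0 :: 'k)"
  shows "\<exists>D :: ((('r \<Rightarrow> 'k) \<Rightarrow> 'k) \<Rightarrow> (('r \<Rightarrow> 'k) \<Rightarrow> 'k)) monoid. \<exists>\<alpha> \<beta>. is_completion I A D \<alpha> \<beta> \<and> \<not> trivial_group D"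
proof -
  obtain \<alpha> where \<alpha>: "\<And>i. i \<in> I \<Longrightarrow> \<alpha> i \<in> hom SL2 aut" "\<And>i X. i \<in> I \<Longrightarrow> det X = 1 \<Longrightarrow> \<alpha> i (\<phi> i X) = gam i X"
    using vertex_rep by metis
  have "\<exists>q\<in>hom (egrp A i j) aut. \<forall>X. det X = 1 \<longrightarrow>
    q (conn A i j (\<phi> i X)) = gam i X \<and> q (conn A j i (\<phi> j X)) = gam j X" if "i \<in> I" "j \<in> I" "i < j" for i j
    using that by (cases "{i, j} \<in> E") (intro edge_rep nonedge_rep; simp)+
  then obtain q where q: "\<And>i j. i \<in> I \<Longrightarrow> j \<in> I \<Longrightarrow> i < j \<Longrightarrow> q i j \<in> hom (egrp A i j) aut \<and> (\<forall>X. det X = 1 \<longrightarrow>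
    q i j (conn A i j (\<phi> i X)) = gam i X \<and> q i j (conn A j i (\<phi> j X)) = gam j X)"
    by metis
  \<comment> \<open>Choosing the map for the ordered pair makes \<open>\<beta>\<close> symmetric in
    i and j by definition, while \<open>egrp_sym\<close> identifies the two source groups.\<close>
  define \<beta> where "\<beta> i j = q (min i j) (max i j)" for i j
  obtain i where i: "i \<in> I" using card3 by fastforce
  then obtain l where l: "{i, l} \<in> E" using neighbor by blast
  have d: "det (M2 1 1 0 1 :: 'k^2^2) = 1" by (simp add: M2_det)
  have "\<exists>D. is_completion I A D \<alpha> \<beta> \<and> \<not> trivial_group D"
  proof (rule completion_generated[OF aut_group])
    show "\<alpha> i \<in> hom (vgrp A i) aut" if "i \<in> I" for i using \<alpha>(1) that by (simp add: vgrp)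
    show "\<beta> i j \<in> hom (egrp A i j) aut" if ij: "i \<in> I" "j \<in> I" "i \<noteq> j" for i j
      using q[of i j] q[of j i] ij egrp_sym[OF ij] by (cases "i < j") (auto simp: \<beta>_def min_def max_def)
    show "\<beta> i j x = \<beta> j i x" for i j x by (simp add: \<beta>_def min.commute max.commute)
    fix i j x assume ij: "i \<in> I" "j \<in> I" "i \<noteq> j" and "x \<in> carrier (vgrp A i)"
    then have "x \<in> \<phi> i ` carrier SL2" using \<phi>_hom(2) by (simp add: vgrp)
    then obtain X where X: "x = \<phi> i X" "det X = 1" by (auto simp: SL_simps)
    show "\<beta> i j (conn A i j x) = \<alpha> i x"
      using q[of i j] q[of j i] ij X \<alpha>(2) by (cases "i < j") (auto simp: \<beta>_def min_def max_def)
  next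
    show "i \<in> I" by (rule i)
    show "\<phi> i (M2 1 1 0 1) \<in> carrier (vgrp A i)" using \<phi>_mult(2)[OF i d] i by (simp add: vgrp SL_simps)
    show "\<alpha> i (\<phi> i (M2 1 1 0 1)) \<noteq> \<one>\<^bsub>aut\<^esub>"
      using gam_nontriv[OF l nz] \<alpha>(2)[OF i d] by (simp add: LA_simps(2,3))
  qed
  then show ?thesis by blast
qed

end

context ct_graph
begin

lemma refines_nontrivial:
  assumes "rel_refines (sim_amalgam I A) (sim0 I E)"
  shows "\<exists>(C :: ('k^2^2, 'g) amalgam_word set monoid) \<alpha> \<beta>. is_universal_completion I A C \<alpha> \<beta> \<and> \<not> trivial_group C"
proof -
  obtain e f :: "nat \<times> 'k twist \<Rightarrow> (nat \<times> 'k twist) wop" and \<Phi> where s: "serre cov e f"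
    and \<Phi>: "\<And>u v. linear (\<Phi> u v :: (nat \<times> 'k twist) wop \<Rightarrow> real)" "\<And>u v. cov u v \<Longrightarrow> \<Phi> u v (br (e u) (e v)) = 1"
      "\<And>u v y. y \<in> lieZ (range e \<union> range f) \<Longrightarrow> \<Phi> u v y \<in> \<int>"
    using serre_model[of cov, OF cov_sym cov_irrefl] by metis
  interpret serre cov e f by (rule s)
  interpret kac_moody cov e f by unfold_locales (use cov_tri cov_outer in blast)+
  interpret ct_rep I E T \<omega> A \<phi> \<psi> e f by unfold_locales (rule assms)
  have "\<exists>\<phi>\<in>dual gens. \<phi> (br (e x) (e y)) \<noteq> (0 :: 'k)" if "cov x y" for x y
  \<comment> \<open>The floor merely extracts the integer, as \<open>\<Phi> x y\<close> is integral
    on the Lie ring; hence its composition with the map from the integers to k is additive there.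
    The value 1 stays nonzero in k.\<close>
  proof (intro bexI[of _ "\<lambda>u. of_int \<lfloor>\<Phi> x y u\<rfloor>"])
    show "of_int \<lfloor>\<Phi> x y (br (e x) (e y))\<rfloor> \<noteq> (0 :: 'k)" using \<Phi>(2)[OF that] by simp
    have "(of_int \<lfloor>\<Phi> x y (u - v)\<rfloor> :: 'k) = of_int \<lfloor>\<Phi> x y u\<rfloor> - of_int \<lfloor>\<Phi> x y v\<rfloor>"
      if "u \<in> lieZ gens" "v \<in> lieZ gens" for u v
    proof -
      obtain a b where "\<Phi> x y u = of_int a" "\<Phi> x y v = of_int b" using \<Phi>(3) \<open>u \<in> lieZ gens\<close> \<open>v \<in> lieZ gens\<close> by (metis Ints_cases)
      moreover have "\<Phi> x y (u - v) = \<Phi> x y u - \<Phi> x y v" using \<Phi>(1) by (rule linear_diff)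
      ultimately have "\<lfloor>\<Phi> x y (u - v)\<rfloor> = \<lfloor>\<Phi> x y u\<rfloor> - \<lfloor>\<Phi> x y v\<rfloor>" by simp
      then show ?thesis by simp
    qed
    then show "(\<lambda>u. of_int \<lfloor>\<Phi> x y u\<rfloor> :: 'k) \<in> dual gens" by (simp add: dual_def)
  qed
  then obtain D :: "((((nat \<times> 'k twist) wop \<Rightarrow> 'k) \<Rightarrow> 'k) \<Rightarrow> (((nat \<times> 'k twist) wop \<Rightarrow> 'k) \<Rightarrow> 'k)) monoid" and \<alpha> \<beta>
    where "is_completion I A D \<alpha> \<beta>" "\<not> trivial_group D" using completion by blast
  then show ?thesis by (rule nontrivial_universal_iff[OF amalg])
qed

end

theorem theorem1:
  fixes I :: "nat set" and E T :: "nat set set"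
    and \<omega> :: "nat set \<Rightarrow> 'k::field twist"
    and A :: "('k^2^2, 'g) amalgam"
  assumes "infinite (UNIV :: 'k set) \<or> 4 \<le> card (UNIV :: 'k set)"
    and "finite_simple_graph I E" and "3 \<le> card I"
    and "connected_graph I E" and "triangle_free E"
    and "0 \<in> I" and "spanning_tree I E T" and "labels_increase_from 0 T"
    and "\<forall>e \<in> E - T. \<omega> e \<in> twist_set"
    and "CT_amalgam I E A" and "property_D I E A" and "of_type I E T \<omega> A"
  shows "(\<exists>(C :: ('k^2^2, 'g) amalgam_word set monoid) \<alpha> \<beta>.
            is_universal_completion I A C \<alpha> \<beta> \<and> \<not> trivial_group C)
         \<longleftrightarrow> rel_refines (sim_amalgam I A) (sim0 I E)"
proof -
  interpret twisted_graph I E T \<omega> by (unfold_locales) (rule assms)+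
  obtain \<phi> \<psi> where epi: "amalgam_epi I (standard_amalgam E T \<omega>) A \<phi> \<psi>"
    using assms(12) by (auto simp: of_type_def)
  interpret ct_graph I E T \<omega> A \<phi> \<psi> by unfold_locales (rule assms(10) epi)+
  show ?thesis
  proof
    assume "\<exists>(C :: ('k^2^2, 'g) amalgam_word set monoid) \<alpha> \<beta>. is_universal_completion I A C \<alpha> \<beta> \<and> \<not> trivial_group C"
    then obtain C :: "('k^2^2, 'g) amalgam_word set monoid" and \<alpha> \<beta>
      where C: "is_completion I A C \<alpha> \<beta>" "\<not> trivial_group C"
      unfolding is_universal_completion_def by blast
    interpret ct_completion I E T \<omega> A \<phi> \<psi> C \<alpha> \<beta> by unfold_locales (rule C(1))
    show "rel_refines (sim_amalgam I A) (sim0 I E)" by (rule nontrivial_refines[OF C(2)])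
  next
    assume "rel_refines (sim_amalgam I A) (sim0 I E)"
    then show "\<exists>(C :: ('k^2^2, 'g) amalgam_word set monoid) \<alpha> \<beta>. is_universal_completion I A C \<alpha> \<beta> \<and> \<not> trivial_group C"
      by (rule refines_nontrivial)
  qed
qed

end
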